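(* Let $M_1$ and $M_2$ be (loopless) matroids on groundsets $E_1$ and $E_2$, respectively. Let $N$ be their common restriction, i.e. a matroid on the groundset $T=E_1\cap E_2$ such that $M_1|_T=N=M_2|_T$. Let $\pi_1\colon B(M_1)\to B(N)$ and $\pi_2\colon B(M_2)\to B(N)$ be the projections induced by the inclusions $T\hookrightarrow E_1$ and $T\hookrightarrow E_2$. Let $X=B(M_1)\times_{\pi_1,B(N),\pi_2}B(M_2)$ be the tropical fibre product of $B(M_1)$ and $B(M_2)$ over $B(N)$. Then: (1) $X$ is a tropical fan of degree $1$; (2) if there exists a proper amalgam $M$ of $M_1$ and $M_2$ along $N$, then the map $B(M)\to B(M_1)\times B(M_2)$ induced by $E_1\sqcup E_2\to E_1\cup E_2$ is an isomorphism onto $X$; (3) if all weights of $X$ are positive, then the proper amalgam $M$ of $M_1$ and $M_2$ along $N$ exists. (Hence the tropical fibre product equals the Bergman fan of the proper amalgam if the proper amalgam exists, and has cones with negative weights otherwise.)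
   Context: Matroids. All matroids are loopless, on finite groundsets. A matroid $M$ on $E$ is given by its lattice of flats $\mathcal F(M)\subset 2^E$; $\mathrm{rk}_M$ is the rank function on subsets of $E$; $F'\gtrdot F$ means $F'$ covers $F$. The restriction $M|_T$ has flats $F\cap T$, $F\in\mathcal F(M)$. The direct sum $M_1\oplus M_2$ on $E_1\sqcup E_2$ has flats $F_1\sqcup F_2$ with $F_i\in\mathcal F(M_i)$. Amalgams. An amalgam of $M_1$ and $M_2$ along $N$ is a matroid $M$ on $E_1\cup E_2$ with $M|_{E_1}=M_1$ and $M|_{E_2}=M_2$. It is proper if for every $F\in\mathcal F(M)$, $\mathrm{rk}_M(F)=\mathrm{rk}_{M_1}(F\cap E_1)+\mathrm{rk}_{M_2}(F\cap E_2)-\mathrm{rk}_N(F\cap T)$. The proper amalgam is unique if it exists. Tropical fans. A $k$-dimensional tropical fan in $\mathbb R^n=\mathbb Z^n\otimes\mathbb R$ is a finite collection of $k$-dimensional rational cones $\sigma$ (with their faces) with integer weights $\omega(\sigma)$ such that at each $(k-1)$-dimensional face $\tau$ the balancing condition $\sum_{\sigma\supset\tau}\omega(\sigma)u_{\sigma/\tau}=0$ in $\mathbb R^n/V_\tau$ holds, where $V_\rho$ is the span of $\rho$ and $u_{\sigma/\tau}$ is the primitive generator of $(V_\sigma\cap\mathbb Z^n)/(V_\tau\cap\mathbb Z^n)$ pointing inside $\sigma$. A tropical cycle is a class of tropical fans up to common refinement; cones of weight $0$ are discarded. The product $X\times Y$ has support $|X|\times|Y|$ and weights the products of the weights. Bergman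 fans. $e_F\in\mathbb R^E$ is the characteristic vector of $F\subset E$. The (affine) Bergman fan $B(M)\subset\mathbb R^E$ has maximal cones $\langle e_{F_1},\dots,e_{F_{r-1}},e_E\rangle$ and $\langle e_{F_1},\dots,e_{F_{r-1}},-e_E\rangle$ for all maximal flags of flats $\varnothing=F_0\lessdot F_1\lessdot\dots\lessdot F_r=E$, all weights being $1$. As tropical cycles, $B(M_1\oplus M_2)=B(M_1)\times B(M_2)$. A map of groundsets $E\to E'$ induces the dual linear map $\mathbb R^{E'}\to\mathbb R^{E}$ by composition of functions; e.g. $\pi_i$ is the coordinate restriction $\mathbb R^{E_i}\to\mathbb R^T$. Divisors. A rational function $\phi$ on a tropical fan is a continuous function on its support, linear on each cone; it is also assumed that $\phi(-e_E)=-\phi(e_E)$, so $\phi$ on fans whose cones are generated by $e_F$'s and $-e_E$ is determined by the values $\phi(e_F)$. The Weil divisor $\phi\cdot X$ of $\phi$ on a $k$-dimensional fan $X$ is the $(k-1)$-dimensional tropical fan with weights $\omega_{\phi\cdot X}(\tau)=\sum_{\sigma\supset\tau}\omega_X(\sigma)\phi(v_{\sigma/\tau})-\phi\bigl(\sum_{\sigma\supset\tau}\omega_X(\sigma)v_{\sigma/\tau}\bigr)$ on $(k-1)$-dimensional cones $\tau$, where $v_{\sigma/\tau}$ represents $u_{\sigma/\tau}$. The pullback of $\phi$ along a morphism $\pi$ is $\pi^*(\phi)=\phi\circ\pi$. Degree. Let $\alpha$ be the rational function with $\alpha(e_E)=-1$ and $\alpha(e_F)=0$ for all other rays $e_F$.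 The degree of a $k$-dimensional affine tropical fan $X$ is the weight of the cone $\langle e_E\rangle$ in $\alpha^{k-1}\cdot X$ ($\alpha$ applied $k-1$ times); for $X\subset B(M_1)\times B(M_2)$ one takes $E=E_1\sqcup E_2$. Tropical fibre product. Let $r=\mathrm{rk}\,N$. For $1\le i\le r$ let $\phi_i$ be the rational function on $B(N)\times B(N)=B(N\oplus N)$ given on rays $e_F$, $F=F_1\sqcup F_2$, by $\phi_i(e_F)=0$ if $\mathrm{rk}_N(F_1\cup F_2)+r-i\ge \mathrm{rk}_N(F_1)+\mathrm{rk}_N(F_2)$, and $\phi_i(e_F)=-1$ otherwise (these satisfy $\phi_1\cdots\phi_r\cdot (B(N)\times B(N))=\Delta$, the diagonal). With $\pi=\pi_1\times\pi_2$, the tropical fibre product is $B(M_1)\times_{\pi_1,B(N),\pi_2}B(M_2)=\pi^*(\phi_1)\cdots\pi^*(\phi_r)\cdot(B(M_1)\times B(M_2))$, where the divisors are taken on the flag subdivision $B(M_1\oplus M_2)$ of $B(M_1)\times B(M_2)$. *)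

theory Defs
  imports "HOL-Analysis.Analysis"
begin

section \<open>Matroids given by their lattices of flats\<close>

datatype 'a flat_system = Flat_System (ground: "'a set") (flats: "'a set set")

definition covers :: "'a flat_system \<Rightarrow> 'a set \<Rightarrow> 'a set \<Rightarrow> bool" where
  "covers M F G \<longleftrightarrow>
     F \<in> flats M \<and> G \<in> flats M \<and> F \<subset> G \<and> (\<forall>H\<in>flats M. \<not> (F \<subset> H \<and> H \<subset> G))"

definition loopless_matroid :: "'a flat_system \<Rightarrow> bool" where
  "loopless_matroid M \<longleftrightarrow>
     finite (ground M) \<and> flats M \<subseteq> Pow (ground M) \<and>
     ground M \<in> flats M \<and>
     (\<forall>F\<in>flats M. \<forall>G\<in>flats M. F \<inter> G \<in> flats M) \<and>
     (\<forall>F\<in>flats M. \<forall>x\<in>ground M - F. \<exists>!G. covers M F G \<and> x \<in> G) \<and>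
     {} \<in> flats M"

definition flat_closure :: "'a flat_system \<Rightarrow> 'a set \<Rightarrow> 'a set" where
  "flat_closure M S = \<Inter> {F \<in> flats M. S \<subseteq> F}"

text \<open>The rank of a set is the height of its closure in the lattice of flats, i.e. the
  largest number of flats in a chain strictly below the closure.\<close>

definition mrank :: "'a flat_system \<Rightarrow> 'a set \<Rightarrow> nat" where
  "mrank M S = Max {card C |C. C \<subseteq> flats M \<and> (\<forall>F\<in>C. F \<subset> flat_closure M S) \<and>
                               (\<forall>F\<in>C. \<forall>G\<in>C. F \<subseteq> G \<or> G \<subseteq> F)}"

definition restriction :: "'a flat_system \<Rightarrow> 'a set \<Rightarrow> 'a flat_system" where
  "restriction M T = Flat_System T ((\<lambda>F. F \<inter> T) ` flats M)"

definition direct_sum :: "'a flat_system \<Rightarrow> 'b flat_system \<Rightarrow> ('a + 'b) flat_system" where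
  "direct_sum M1 M2 = Flat_System (ground M1 <+> ground M2)
     {F1 <+> F2 |F1 F2. F1 \<in> flats M1 \<and> F2 \<in> flats M2}"

definition amalgam :: "'a flat_system \<Rightarrow> 'a flat_system \<Rightarrow> 'a flat_system \<Rightarrow> bool" where
  "amalgam M1 M2 M \<longleftrightarrow>
     loopless_matroid M \<and> ground M = ground M1 \<union> ground M2 \<and>
     restriction M (ground M1) = M1 \<and> restriction M (ground M2) = M2"

definition proper_amalgam ::
    "'a flat_system \<Rightarrow> 'a flat_system \<Rightarrow> 'a flat_system \<Rightarrow> 'a flat_system \<Rightarrow> bool" where
  "proper_amalgam M1 M2 N M \<longleftrightarrow>
     amalgam M1 M2 M \<and>
     (\<forall>F\<in>flats M. int (mrank M F) =
        int (mrank M1 (F \<inter> ground M1)) + int (mrank M2 (F \<inter> ground M2))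
          - int (mrank N (F \<inter> ground N)))"

section \<open>Tropical fans\<close>

text \<open>For a groundset \<open>E\<close> inside a finite type \<open>'n\<close>, the space \<open>\<real>\<^sup>E\<close> is regarded as the coordinate
  subspace of \<open>real ^ 'n\<close> of vectors vanishing outside \<open>E\<close>.

  A pure weighted fan is represented by its weight function on sets of vectors; its maximal
  cones are the sets of nonzero weight, so cones of weight 0 are discarded automatically.
  Weights are real numbers at this level; integrality is part of the notion of a tropical fan.\<close>

type_synonym 'n wfan = "(real ^ 'n) set \<Rightarrow> real"

definition int_lattice :: "(real ^ 'n) set" where
  "int_lattice = {x. \<forall>i. x $ i \<in> \<int>}"

definition fan_cones :: "'n wfan \<Rightarrow> (real ^ 'n) set set" where
  "fan_cones X = {\<sigma>. X \<sigma> \<noteq> 0}"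

definition fan_support :: "'n wfan \<Rightarrow> (real ^ 'n) set" where
  "fan_support X = \<Union> (fan_cones X)"

definition rational_cone :: "(real ^ 'n::finite) set \<Rightarrow> bool" where
  "rational_cone \<sigma> \<longleftrightarrow> (\<exists>S. finite S \<and> S \<subseteq> int_lattice \<and> \<sigma> = convex_cone hull S)"

text \<open>\<open>v\<close> represents the primitive generator of
  \<open>(V\<^sub>\<sigma> \<inter> \<int>\<^sup>n) / (V\<^sub>\<tau> \<inter> \<int>\<^sup>n)\<close> pointing inside \<open>\<sigma>\<close>.\<close>

definition represents_normal ::
    "(real ^ 'n::finite) set \<Rightarrow> (real ^ 'n) set \<Rightarrow> real ^ 'n \<Rightarrow> bool" where
  "represents_normal \<sigma> \<tau> v \<longleftrightarrow>
     v \<in> span \<sigma> \<inter> int_lattice \<and>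
     (\<forall>w\<in>span \<sigma> \<inter> int_lattice. \<exists>m::int. w - of_int m *\<^sub>R v \<in> span \<tau>) \<and>
     (\<exists>x\<in>\<sigma>. v - x \<in> span \<tau>)"

definition normal_vector ::
    "(real ^ 'n::finite) set \<Rightarrow> (real ^ 'n) set \<Rightarrow> real ^ 'n" where
  "normal_vector \<sigma> \<tau> = (SOME v. represents_normal \<sigma> \<tau> v)"

definition cones_around :: "'n::finite wfan \<Rightarrow> (real ^ 'n) set \<Rightarrow> (real ^ 'n) set set" where
  "cones_around X \<tau> = {\<sigma> \<in> fan_cones X. \<tau> facet_of \<sigma>}"

definition balanced_at :: "'n::finite wfan \<Rightarrow> (real ^ 'n) set \<Rightarrow> bool" where
  "balanced_at X \<tau> \<longleftrightarrow> (\<Sum>\<sigma>\<in>cones_around X \<tau>. X \<sigma> *\<^sub>R normal_vector \<sigma> \<tau>) \<in> span \<tau>"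

definition tropical_fan :: "nat \<Rightarrow> 'n::finite wfan \<Rightarrow> bool" where
  "tropical_fan k X \<longleftrightarrow>
     finite (fan_cones X) \<and>
     (\<forall>\<sigma>\<in>fan_cones X. rational_cone \<sigma> \<and> dim \<sigma> = k \<and> X \<sigma> \<in> \<int>) \<and>
     (\<forall>\<sigma>\<in>fan_cones X. \<forall>\<sigma>'\<in>fan_cones X. (\<sigma> \<inter> \<sigma>') face_of \<sigma> \<and> (\<sigma> \<inter> \<sigma>') face_of \<sigma>') \<and>
     (\<forall>\<tau>. cones_around X \<tau> \<noteq> {} \<longrightarrow> balanced_at X \<tau>)"

section \<open>Morphisms and products\<close>

definition integral_linear :: "(real ^ 'm \<Rightarrow> real ^ 'n) \<Rightarrow> bool" where
  "integral_linear f \<longleftrightarrow> linear f \<and> f ` int_lattice \<subseteq> int_lattice"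

definition tropical_morphism ::
    "(real ^ 'm \<Rightarrow> real ^ 'n) \<Rightarrow> 'm wfan \<Rightarrow> 'n wfan \<Rightarrow> bool" where
  "tropical_morphism f X Y \<longleftrightarrow> integral_linear f \<and> f ` fan_support X \<subseteq> fan_support Y"

definition refinement :: "nat \<Rightarrow> 'n::finite wfan \<Rightarrow> 'n wfan \<Rightarrow> bool" where
  "refinement k X' X \<longleftrightarrow>
     tropical_fan k X' \<and> fan_support X' = fan_support X \<and>
     (\<forall>\<sigma>'\<in>fan_cones X'. \<exists>\<sigma>\<in>fan_cones X. \<sigma>' \<subseteq> \<sigma> \<and> X' \<sigma>' = X \<sigma>)"

text \<open>Isomorphism of \<open>k\<close>-dimensional tropical cycles: mutually inverse morphisms that identify
  suitable refinements of the two fans together with their weights.\<close>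

definition tropical_isomorphism ::
    "nat \<Rightarrow> (real ^ 'm::finite \<Rightarrow> real ^ 'n::finite) \<Rightarrow> 'm wfan \<Rightarrow> 'n wfan \<Rightarrow> bool" where
  "tropical_isomorphism k f X Y \<longleftrightarrow>
     tropical_morphism f X Y \<and>
     (\<exists>g. tropical_morphism g Y X \<and>
          (\<forall>x\<in>fan_support X. g (f x) = x) \<and> (\<forall>y\<in>fan_support Y. f (g y) = y)) \<and>
     (\<exists>X' Y'. refinement k X' X \<and> refinement k Y' Y \<and>
          bij_betw ((`) f) (fan_cones X') (fan_cones Y') \<and>
          (\<forall>\<sigma>\<in>fan_cones X'. Y' (f ` \<sigma>) = X' \<sigma>))"

definition join_vec :: "real ^ 'm::finite \<Rightarrow> real ^ 'n::finite \<Rightarrow> real ^ ('m + 'n)" where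
  "join_vec x y = (\<chi> i. case i of Inl a \<Rightarrow> x $ a | Inr b \<Rightarrow> y $ b)"

definition left_vec :: "real ^ ('m::finite + 'n::finite) \<Rightarrow> real ^ 'm" where
  "left_vec z = (\<chi> a. z $ Inl a)"

definition right_vec :: "real ^ ('m::finite + 'n::finite) \<Rightarrow> real ^ 'n" where
  "right_vec z = (\<chi> b. z $ Inr b)"

definition product_map ::
    "(real ^ 'm::finite \<Rightarrow> real ^ 'k::finite) \<Rightarrow> (real ^ 'n::finite \<Rightarrow> real ^ 'l::finite) \<Rightarrow>
     real ^ ('m + 'n) \<Rightarrow> real ^ ('k + 'l)" where
  "product_map f g z = join_vec (f (left_vec z)) (g (right_vec z))"

definition product_fan :: "'m::finite wfan \<Rightarrow> 'n::finite wfan \<Rightarrow> ('m + 'n) wfan" where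
  "product_fan X Y \<rho> =
     (if \<exists>\<sigma>\<in>fan_cones X. \<exists>\<tau>\<in>fan_cones Y. \<rho> = {join_vec x y |x y. x \<in> \<sigma> \<and> y \<in> \<tau>}
      then X (left_vec ` \<rho>) * Y (right_vec ` \<rho>) else 0)"

text \<open>The linear map \<open>\<real>\<^sup>B \<rightarrow> \<real>\<^sup>A\<close> dual to a map of groundsets \<open>h : A \<rightarrow> B\<close>.\<close>

definition induced_map :: "'m set \<Rightarrow> ('m \<Rightarrow> 'n) \<Rightarrow> real ^ 'n \<Rightarrow> real ^ 'm" where
  "induced_map A h y = (\<chi> i. if i \<in> A then y $ h i else 0)"

section \<open>Bergman fans\<close>

definition char_vec :: "'n set \<Rightarrow> real ^ 'n" where
  "char_vec F = (\<chi> i. if i \<in> F then 1 else 0)"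

definition maximal_flag :: "'a flat_system \<Rightarrow> (nat \<Rightarrow> 'a set) \<Rightarrow> bool" where
  "maximal_flag M F \<longleftrightarrow>
     F 0 = {} \<and> F (mrank M (ground M)) = ground M \<and>
     (\<forall>i<mrank M (ground M). covers M (F i) (F (Suc i)))"

definition flag_cone :: "'n::finite flat_system \<Rightarrow> (nat \<Rightarrow> 'n set) \<Rightarrow> real \<Rightarrow> (real ^ 'n) set" where
  "flag_cone M F s = convex_cone hull
     (insert (s *\<^sub>R char_vec (ground M)) ((\<lambda>i. char_vec (F i)) ` {1..<mrank M (ground M)}))"

definition bergman_fan :: "'n::finite flat_system \<Rightarrow> 'n wfan" where
  "bergman_fan M \<sigma> =
     (if \<exists>F. maximal_flag M F \<and> (\<sigma> = flag_cone M F 1 \<or> \<sigma> = flag_cone M F (-1)) then 1 else 0)"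

section \<open>Rational functions and divisors\<close>

definition rational_function ::
    "'n::finite set \<Rightarrow> 'n wfan \<Rightarrow> (real ^ 'n \<Rightarrow> real) \<Rightarrow> bool" where
  "rational_function E X \<phi> \<longleftrightarrow>
     continuous_on (fan_support X) \<phi> \<and>
     (\<forall>\<sigma>\<in>fan_cones X. \<exists>f. linear f \<and> (\<forall>x\<in>\<sigma>. \<phi> x = f x)) \<and>
     \<phi> (- char_vec E) = - \<phi> (char_vec E)"

text \<open>The rational function on \<open>B(M)\<close> with prescribed values on the rays \<open>e\<^sub>F\<close>; it is
  determined on the support of \<open>B(M)\<close>, and unspecified elsewhere.\<close>

definition ray_function ::
    "'n::finite flat_system \<Rightarrow> ('n set \<Rightarrow> real) \<Rightarrow> real ^ 'n \<Rightarrow> real" where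
  "ray_function M f = (SOME \<phi>. rational_function (ground M) (bergman_fan M) \<phi> \<and>
     (\<forall>F\<in>flats M - {{}}. \<phi> (char_vec F) = f F))"

text \<open>The representatives of the normal vectors and their weighted sum lie in the spans of the
  cones, not necessarily in the cones; there the function is evaluated by its linear
  extension, which is unique on the span.\<close>

definition linear_extension ::
    "(real ^ 'n \<Rightarrow> real) \<Rightarrow> (real ^ 'n) set \<Rightarrow> real ^ 'n \<Rightarrow> real" where
  "linear_extension \<phi> \<sigma> = (SOME f. linear f \<and> (\<forall>x\<in>\<sigma>. f x = \<phi> x))"

definition divisor :: "(real ^ 'n::finite \<Rightarrow> real) \<Rightarrow> 'n wfan \<Rightarrow> 'n wfan" where
  "divisor \<phi> X \<tau> =
     (if cones_around X \<tau> \<noteq> {} then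
        (\<Sum>\<sigma>\<in>cones_around X \<tau>. X \<sigma> * linear_extension \<phi> \<sigma> (normal_vector \<sigma> \<tau>))
          - linear_extension \<phi> \<tau> (\<Sum>\<sigma>\<in>cones_around X \<tau>. X \<sigma> *\<^sub>R normal_vector \<sigma> \<tau>)
      else 0)"

text \<open>Degree of a \<open>k\<close>-dimensional fan subordinate to the flag subdivision \<open>B(M)\<close>. For \<open>k = 0\<close>
  (only possible on an empty groundset) this is the weight of the origin.\<close>

definition degree_function :: "'n::finite flat_system \<Rightarrow> real ^ 'n \<Rightarrow> real" where
  "degree_function M = ray_function M (\<lambda>F. if F = ground M then - 1 else 0)"

definition fan_degree :: "'n::finite flat_system \<Rightarrow> nat \<Rightarrow> 'n wfan \<Rightarrow> real" where
  "fan_degree M k X =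
     (divisor (degree_function M) ^^ (k - 1)) X (convex_cone hull {char_vec (ground M)})"

section \<open>The tropical fibre product\<close>

definition diagonal_function ::
    "'a::finite flat_system \<Rightarrow> nat \<Rightarrow> real ^ ('a + 'a) \<Rightarrow> real" where
  "diagonal_function N i = ray_function (direct_sum N N)
     (\<lambda>F. let F1 = Inl -` F; F2 = Inr -` F in
        if int (mrank N (F1 \<union> F2)) + int (mrank N (ground N)) - int i
             \<ge> int (mrank N F1) + int (mrank N F2)
        then 0 else - 1)"

definition tropical_fibre_product ::
    "'a::finite flat_system \<Rightarrow> 'a flat_system \<Rightarrow> 'a flat_system \<Rightarrow>
     (real ^ 'a \<Rightarrow> real ^ 'a) \<Rightarrow> (real ^ 'a \<Rightarrow> real ^ 'a) \<Rightarrow> ('a + 'a) wfan" where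
  "tropical_fibre_product M1 M2 N \<pi>1 \<pi>2 =
     foldr (\<lambda>i. divisor (diagonal_function N i \<circ> product_map \<pi>1 \<pi>2))
       [1..<Suc (mrank N (ground N))] (bergman_fan (direct_sum M1 M2))"

end

theory Submission
  imports Defs
begin

text \<open>A fan whose cones are spanned by chains of subsets of \<open>E\<close> together with \<open>\<plusminus>e\<^sub>E\<close> is a weight on
  chains; balancing, the divisors of functions with values \<open>0\<close> and \<open>-1\<close> on the rays, and the degree
  become finite sums over the sets refining a chain.

  Each \<open>\<phi>\<^sub>i\<close> only sees the nullity \<open>d F\<close> of the pair of flats of \<open>N\<close> cut out by a flat \<open>F\<close> of
  \<open>P = M\<^sub>1 \<oplus> M\<^sub>2\<close>. A chain that survives all \<open>r\<close> divisors consists of flats with equal traces on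
  both copies of \<open>T\<close>, and a flat \<open>F\<close> occupies position \<open>rk\<^sub>P F - d F\<close> in it. Chains that climb
  along the diagonal flats have weight 1, which gives the degree.

  If \<open>M\<close> is a proper amalgam, its flats, doubled on \<open>T\<close>, form a matroid quotient \<open>Q\<close> of \<open>P\<close>. The
  Higgs lifts between \<open>P\<close> and \<open>Q\<close> are elementary quotients of each other, and the divisors by
  \<open>\<phi>\<^sub>r, \<dots>, \<phi>\<^sub>1\<close> pass through them one by one, up to commuting the divisors.

  Conversely, let all weights be positive. Together with degree 1 this makes the next member of a
  chain through a given element unique, and balancing allows chains to be exchanged; hence the
  sets occurring in the fan are the flats of a matroid of rank function \<open>rk\<^sub>P - d\<close>, which is the
  proper amalgam.\<close>

section \<open>Ranked lattices of flats\<close>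

text \<open>The obstacle is that the fans between \<open>B(P)\<close> and \<open>X\<close> are not
  known to be effective, so single intermediate weights are out of reach in general. What can be
  controlled is the support. A divisor is evaluated with a coordinate \<open>j\<close> lying in
  exactly those chain members where the function is \<open>-1\<close>; a refining set
  \<open>G\<close> then contributes only if \<open>j \<in> G\<close> and \<open>G \<in> U\<close>
  disagree. The rank count, the equality of traces and all the single-term sums rest on this
  disagreement, together with the freedom to choose \<open>j\<close>. The functions are given by
  up-sets because \<open>d\<close> is monotone. Divisors of up-sets commute, which matters because
  the fibre product uses the thresholds \<open>d > 0\<close>, \<open>d > 1\<close>, ... in this
  order, whereas the descent from \<open>P\<close> to \<open>Q\<close> consumes them from
  \<open>r - 1\<close> down to \<open>0\<close>. Every lattice that has to be recognised as a
  matroid (the sum, the doubled amalgam, the lifts, the reconstructed amalgam) is presented by a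
  candidate rank function and a least one-element extension. This yields the axioms and identifies
  the rank at once, without checking intersections or covers each time.\<close>

locale ranked_flats =
  fixes E :: "'a set" and L :: "'a set set" and rk :: "'a set \<Rightarrow> nat"
  assumes finite_ground: "finite E"
    and flats_ground: "L \<subseteq> Pow E"
    and empty_flat: "{} \<in> L"
    and ground_flat: "E \<in> L"
    and rk_empty: "rk {} = 0"
    and rk_strict: "\<And>F G. F \<in> L \<Longrightarrow> G \<in> L \<Longrightarrow> F \<subset> G \<Longrightarrow> rk F < rk G"
    and extend: "\<And>F x. F \<in> L \<Longrightarrow> x \<in> E - F \<Longrightarrow>
      \<exists>G\<in>L. F \<subseteq> G \<and> x \<in> G \<and> rk G = Suc (rk F) \<and> (\<forall>H\<in>L. F \<subseteq> H \<and> x \<in> H \<longrightarrow> G \<subseteq> H)"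
begin

lemma finite_flats: "finite L"
  using finite_ground flats_ground by (meson finite_Pow_iff finite_subset)

lemma rk_mono: "F \<in> L \<Longrightarrow> G \<in> L \<Longrightarrow> F \<subseteq> G \<Longrightarrow> rk F \<le> rk G"
  using rk_strict by (metis less_or_eq_imp_le order_neq_le_trans)

lemma eq_of_rk_le: "F \<in> L \<Longrightarrow> G \<in> L \<Longrightarrow> F \<subseteq> G \<Longrightarrow> rk G \<le> rk F \<Longrightarrow> F = G"
  using rk_strict by (metis leD psubsetI)

lemma rk_inj_on_chain:
  assumes "C \<subseteq> L" "\<forall>F\<in>C. \<forall>G\<in>C. F \<subseteq> G \<or> G \<subseteq> F"
  shows "inj_on rk C"
  unfolding inj_on_def using assms eq_of_rk_le by (metis le_refl subsetD)

text \<open>Take a flat of maximal rank inside \<open>F \<inter> G\<close>. A missing element would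
  extend it, and the minimality in \<open>extend\<close> keeps the extension inside both
  \<open>F\<close> and \<open>G\<close>, against maximality.\<close>

lemma inter_flat:
  assumes "F \<in> L" "G \<in> L"
  shows "F \<inter> G \<in> L"
proof -
  let ?A = "{H \<in> L. H \<subseteq> F \<inter> G}"
  have fin: "finite ?A" using finite_flats by simp
  have ne: "?A \<noteq> {}" using empty_flat by auto
  have "Max (rk ` ?A) \<in> rk ` ?A" using Max_in[of "rk ` ?A"] fin ne by blast
  then obtain H where H0: "H \<in> ?A" "rk H = Max (rk ` ?A)" by auto
  have "\<forall>K\<in>?A. rk K \<le> rk H" using Max_ge[of "rk ` ?A"] fin H0(2) by simp
  note H = H0(1) this
  have "H = F \<inter> G"
  proof (rule ccontr)
    assume "H \<noteq> F \<inter> G"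
    then obtain x where x: "x \<in> F \<inter> G" "x \<notin> H" using H(1) by blast
    moreover have "x \<in> E" using x assms flats_ground by blast
    ultimately obtain K where K: "K \<in> L" "H \<subseteq> K" "x \<in> K" "rk K = Suc (rk H)"
      "\<forall>H'\<in>L. H \<subseteq> H' \<and> x \<in> H' \<longrightarrow> K \<subseteq> H'"
      using extend[of H x] H(1) by auto
    have "K \<subseteq> F \<inter> G" using K(5) assms x H(1) by auto
    then show False using H(2) K by fastforce
  qed
  then show ?thesis using H by auto
qed

text \<open>The number \<open>m\<close> witnesses a gap of at least two ranks; extending
  \<open>F\<close> by one element of \<open>H\<close> climbs a single rank and therefore stays
  strictly below \<open>H\<close>.\<close>

lemma chain_insert:
  assumes "F \<in> L" "H \<in> L" "F \<subset> H" "rk F < m" "m < rk H"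
  shows "\<exists>G\<in>L. F \<subset> G \<and> G \<subset> H"
proof -
  obtain x where x: "x \<in> H" "x \<notin> F" using assms by blast
  have "x \<in> E - F" using x assms flats_ground by blast
  then obtain K where K: "K \<in> L" "F \<subseteq> K" "x \<in> K" "rk K = Suc (rk F)"
      "\<forall>H'\<in>L. F \<subseteq> H' \<and> x \<in> H' \<longrightarrow> K \<subseteq> H'"
    using extend[of F x] assms by auto
  have "K \<subseteq> H" using K(5) assms x by auto
  moreover have "K \<noteq> H" using K(4) assms by auto
  ultimately show ?thesis using K x by blast
qed

text \<open>A chain that is maximal under inclusion hits every rank: at a missed rank, its
  neighbours below and above leave a gap that \<open>chain_insert\<close> fills. The given chain
  \<open>K\<close> is carried along so that partial chains can be completed.\<close>

lemma maximal_chain: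
  assumes F: "F \<in> L" and K: "K \<subseteq> {G \<in> L. G \<subset> F}" "\<forall>A\<in>K. \<forall>B\<in>K. A \<subseteq> B \<or> B \<subseteq> A"
  shows "\<exists>C. K \<subseteq> C \<and> C \<subseteq> {G \<in> L. G \<subset> F} \<and> (\<forall>A\<in>C. \<forall>B\<in>C. A \<subseteq> B \<or> B \<subseteq> A) \<and> rk ` C = {..<rk F}"
proof -
  let ?P = "\<lambda>C. K \<subseteq> C \<and> C \<subseteq> {G \<in> L. G \<subset> F} \<and> (\<forall>A\<in>C. \<forall>B\<in>C. A \<subseteq> B \<or> B \<subseteq> A)"
  have fin: "finite {G \<in> L. G \<subset> F}" using finite_flats by simp
  have finP: "finite {C. ?P C}"
    by (rule finite_subset[of _ "Pow {G \<in> L. G \<subset> F}"]) (use fin in auto)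
  define PP where "PP = {C. ?P C}"
  have "K \<in> PP" unfolding PP_def using K by auto
  from finite_has_maximal2[OF finP[folded PP_def] this] obtain C where
    C0: "C \<in> PP" "\<forall>D\<in>PP. C \<le> D \<longrightarrow> C = D" by metis
  have C: "?P C" using C0(1) unfolding PP_def by (rule CollectD)
  have Cmax: "D = C" if "?P D" "C \<subseteq> D" for D
  proof -
    have "D \<in> PP" unfolding PP_def using that(1) by (rule CollectI)
    then show ?thesis using C0(2) that(2) by metis
  qed
  have CL: "C \<subseteq> L" and CF: "\<And>A. A \<in> C \<Longrightarrow> A \<subset> F" and Cch: "\<And>A B. A \<in> C \<Longrightarrow> B \<in> C \<Longrightarrow> A \<subseteq> B \<or> B \<subseteq> A"
    and KC: "K \<subseteq> C" using C by auto
  have finC: "finite C" by (rule finite_subset[OF CL finite_flats])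
  have "m \<in> rk ` C" if m: "m < rk F" for m
  proof (rule ccontr)
    assume nm: "m \<notin> rk ` C"
    \<comment> \<open>\<open>F\<close> is added so that an upper neighbour always exists; below, the
      empty flat steps in when \<open>?lo\<close> is empty.\<close>
    let ?lo = "{A \<in> C. rk A < m}" and ?hi = "insert F {A \<in> C. rk A > m}"
    define A where "A = \<Union> ?lo"
    have A: "A = {} \<or> A \<in> ?lo"
    proof (cases "?lo = {}")
      case False
      have "subset.chain ?lo ?lo" unfolding subset_chain_def using Cch by auto
      then have "\<Union> ?lo \<in> ?lo" using finC by (intro Union_in_chain[OF _ False]) simp_all
      then show ?thesis unfolding A_def by (rule disjI2)
    next
      case True
      then have "A = {}" unfolding A_def by (metis Union_empty)
      then show ?thesis by blast
    qed
    define B where "B = \<Inter> ?hi"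
    have "subset.chain ?hi ?hi" unfolding subset_chain_def using Cch CF by (auto simp: psubset_imp_subset)
    then have B: "B \<in> ?hi" unfolding B_def using finC by (intro Inter_in_chain) simp_all
    show False
    proof (cases "m = 0")
      case True
      have "{} \<notin> C" using nm True rk_empty by force
      moreover have "F \<noteq> {}" using m rk_empty by auto
      then have "?P (insert {} C)" using C empty_flat by auto
      then have "insert {} C = C" by (rule Cmax) auto
      ultimately show False by blast
    next
      case False
      have AL: "A \<in> L" "rk A < m" using A CL False empty_flat rk_empty by auto
      have BL: "B \<in> L" "m < rk B" using B CL F m by auto
      have AB: "A \<subset> B"
      proof -
        have "A \<subseteq> B \<or> B \<subseteq> A" using A B Cch[of A B] CF[of A] by auto
        then show ?thesis using rk_mono[OF BL(1) AL(1)] AL BL by fastforce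
      qed
      obtain G where G: "G \<in> L" "A \<subset> G" "G \<subset> B"
        using chain_insert[OF AL(1) BL(1) AB AL(2) BL(2)] by blast
      have cmp: "D \<subseteq> A \<or> B \<subseteq> D" if "D \<in> C" for D
      proof -
        have "rk D \<noteq> m" using nm that by auto
        then have "D \<in> ?lo \<or> D \<in> ?hi" using that by auto
        then show ?thesis unfolding A_def B_def by (meson Inf_lower Sup_upper)
      qed
      have "?P (insert G C)"
      proof (intro conjI ballI)
        show "K \<subseteq> insert G C" using C by auto
        have "B \<subseteq> F" using B CF by auto
        then show "insert G C \<subseteq> {G \<in> L. G \<subset> F}" using C G by auto
        fix X Y assume XY: "X \<in> insert G C" "Y \<in> insert G C"
        have c: "X \<subseteq> G \<or> G \<subseteq> X" if "X \<in> C" for X using cmp[OF that] G by blast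
        have "X \<subseteq> Y \<or> Y \<subseteq> X" if "X \<in> C" "Y \<in> C" using C that by blast
        then show "X \<subseteq> Y \<or> Y \<subseteq> X" using XY c by blast
      qed
      then have "insert G C = C" by (rule Cmax) auto
      then have "G \<in> C" by blast
      then show False using cmp[of G] G by blast
    qed
  qed
  moreover have "rk ` C \<subseteq> {..<rk F}" using C rk_strict[OF _ F] by auto
  ultimately show ?thesis using C by (intro exI[of _ C]) auto
qed

lemma covers_iff:
  "covers (Flat_System E L) F G \<longleftrightarrow> F \<in> L \<and> G \<in> L \<and> F \<subset> G \<and> rk G = Suc (rk F)"
proof
  assume c: "covers (Flat_System E L) F G"
  then have FG: "F \<in> L" "G \<in> L" "F \<subset> G" and no: "\<And>H. H \<in> L \<Longrightarrow> \<not> (F \<subset> H \<and> H \<subset> G)"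
    unfolding covers_def by auto
  have "\<not> Suc (rk F) < rk G"
    using chain_insert[OF FG, of "Suc (rk F)"] no by auto
  then show "F \<in> L \<and> G \<in> L \<and> F \<subset> G \<and> rk G = Suc (rk F)" using FG rk_strict[OF FG] by auto
next
  assume "F \<in> L \<and> G \<in> L \<and> F \<subset> G \<and> rk G = Suc (rk F)"
  then show "covers (Flat_System E L) F G"
    unfolding covers_def flat_system.sel using rk_strict by (metis Suc_leI leD)
qed

lemma loopless: "loopless_matroid (Flat_System E L)"
proof -
  have "\<exists>!G. covers (Flat_System E L) F G \<and> x \<in> G" if Fx: "F \<in> L" "x \<in> E - F" for F x
  proof -
    obtain K where K: "K \<in> L" "F \<subseteq> K" "x \<in> K" "rk K = Suc (rk F)"
      "\<forall>H'\<in>L. F \<subseteq> H' \<and> x \<in> H' \<longrightarrow> K \<subseteq> H'"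
      using extend[OF Fx] by auto
    show ?thesis
    proof (rule ex1I[of _ K])
      show "covers (Flat_System E L) F K \<and> x \<in> K" unfolding covers_iff using K Fx by auto
      fix G assume G: "covers (Flat_System E L) F G \<and> x \<in> G"
      then have "K \<subseteq> G" using K(5) unfolding covers_iff by auto
      then show "G = K" using eq_of_rk_le[of K G] G K unfolding covers_iff by auto
    qed
  qed
  then show ?thesis unfolding loopless_matroid_def flat_system.sel
    using finite_ground flats_ground empty_flat ground_flat inter_flat by auto
qed

text \<open>The ranks of a chain strictly below \<open>F\<close> are distinct numbers less than
  \<open>rk F\<close>, and a maximal chain attains all of them. This turns any candidate rank
  function of the locale into the rank defined by longest chains.\<close>

lemma mrank_flat:
  assumes F: "F \<in> L"
  shows "mrank (Flat_System E L) F = rk F"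
proof -
  have cl: "flat_closure (Flat_System E L) F = F" using F unfolding flat_closure_def by auto
  let ?S = "{card C |C. C \<subseteq> L \<and> (\<forall>G\<in>C. G \<subset> F) \<and> (\<forall>A\<in>C. \<forall>B\<in>C. A \<subseteq> B \<or> B \<subseteq> A)}"
  have le: "n \<le> rk F" if nS: "n \<in> ?S" for n
  proof -
    obtain C where C: "n = card C" "C \<subseteq> L" "\<forall>G\<in>C. G \<subset> F" "\<forall>A\<in>C. \<forall>B\<in>C. A \<subseteq> B \<or> B \<subseteq> A"
      using CollectD[OF nS] by force
    have "rk ` C \<subseteq> {..<rk F}" using C rk_strict[OF _ F] by auto
    then have "card (rk ` C) \<le> rk F" by (metis card_lessThan card_mono finite_lessThan)
    then show ?thesis using card_image[OF rk_inj_on_chain[OF C(2,4)]] C by simp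
  qed
  obtain C where C: "C \<subseteq> {G \<in> L. G \<subset> F}" "\<forall>A\<in>C. \<forall>B\<in>C. A \<subseteq> B \<or> B \<subseteq> A" "rk ` C = {..<rk F}"
    using maximal_chain[OF F, of "{}"] by auto
  have CL: "C \<subseteq> L" and CF: "\<forall>G\<in>C. G \<subset> F" using C(1) by auto
  have "rk F = card C" using card_image[OF rk_inj_on_chain[OF CL C(2)]] C(3) by simp
  then have "rk F \<in> ?S" using CL CF C(2) by (intro CollectI exI[of _ C]) simp
  moreover have "finite ?S" unfolding finite_nat_set_iff_bounded_le by (intro exI[of _ "rk F"] ballI le)
  ultimately have "Max ?S = rk F" using le by (intro Max_eqI)
  then show ?thesis unfolding mrank_def cl flat_system.sel by simp
qed

end

section \<open>Rank and closure in a matroid\<close>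

lemma loopless_matroidD:
  assumes "loopless_matroid M"
  shows "finite (ground M)" "flats M \<subseteq> Pow (ground M)" "ground M \<in> flats M" "{} \<in> flats M"
    "\<And>F G. F \<in> flats M \<Longrightarrow> G \<in> flats M \<Longrightarrow> F \<inter> G \<in> flats M" "finite (flats M)"
  using assms unfolding loopless_matroid_def by (auto intro: finite_subset[of _ "Pow (ground M)"])

lemma flat_closure_subset: "S \<subseteq> F \<Longrightarrow> F \<in> flats M \<Longrightarrow> flat_closure M S \<subseteq> F"
  unfolding flat_closure_def by auto

lemma flat_closure_superset: "S \<subseteq> flat_closure M S"
  unfolding flat_closure_def by auto

lemma flat_closure_flat [simp]: "F \<in> flats M \<Longrightarrow> flat_closure M F = F"
  unfolding flat_closure_def by auto

lemma flat_closure_mono: "S \<subseteq> S' \<Longrightarrow> flat_closure M S \<subseteq> flat_closure M S'"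
  unfolding flat_closure_def by auto

lemma flat_closure_in_flats:
  assumes M: "loopless_matroid M" and S: "S \<subseteq> ground M"
  shows "flat_closure M S \<in> flats M"
proof -
  have int: "finite A \<Longrightarrow> A \<noteq> {} \<Longrightarrow> A \<subseteq> flats M \<Longrightarrow> \<Inter> A \<in> flats M" for A
  proof (induction A rule: finite_ne_induct)
    case (insert x A)
    then show ?case using loopless_matroidD(5)[OF M] by auto
  qed auto
  show ?thesis unfolding flat_closure_def
    by (rule int) (use loopless_matroidD[OF M] S in auto)
qed

text \<open>A flat above \<open>F\<close> through \<open>x\<close> meets the cover in a flat
  strictly above \<open>F\<close>, hence contains the cover.\<close>

lemma cover_minimal:
  assumes M: "loopless_matroid M" and F: "F \<in> flats M" "x \<in> ground M - F"
  shows "\<exists>G. covers M F G \<and> x \<in> G \<and> (\<forall>H\<in>flats M. F \<subseteq> H \<longrightarrow> x \<in> H \<longrightarrow> G \<subseteq> H)"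
proof -
  obtain G where G: "covers M F G" "x \<in> G" using M F unfolding loopless_matroid_def by blast
  moreover have "G \<subseteq> H" if H: "H \<in> flats M" "F \<subseteq> H" "x \<in> H" for H
  proof -
    have "G \<inter> H \<in> flats M" using loopless_matroidD(5)[OF M _ H(1)] G unfolding covers_def by auto
    moreover have "F \<subset> G \<inter> H" using H G F unfolding covers_def by auto
    ultimately have "\<not> G \<inter> H \<subset> G" using G unfolding covers_def by blast
    then show ?thesis by blast
  qed
  ultimately show ?thesis by metis
qed

section \<open>Saturated chains and the Jordan-Dedekind condition\<close>

inductive saturated :: "'a flat_system \<Rightarrow> nat \<Rightarrow> 'a set \<Rightarrow> 'a set \<Rightarrow> bool" for M where
  saturated_refl: "F \<in> flats M \<Longrightarrow> saturated M 0 F F"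
| saturated_step: "covers M F G \<Longrightarrow> saturated M n G H \<Longrightarrow> saturated M (Suc n) F H"

lemma saturated_flats: "saturated M n F G \<Longrightarrow> F \<in> flats M \<and> G \<in> flats M \<and> F \<subseteq> G"
  by (induction rule: saturated.induct) (auto simp: covers_def)

text \<open>The induction joins every member of the chain with the first atom of the saturated chain;
  this shortens the chain by at most one.\<close>

lemma chain_le_saturated:
  assumes M: "loopless_matroid M" and "saturated M n H G"
    and "K \<subseteq> {X \<in> flats M. H \<subseteq> X \<and> X \<subset> G}" "\<forall>A\<in>K. \<forall>B\<in>K. A \<subseteq> B \<or> B \<subseteq> A"
  shows "card K \<le> n"
  using assms(2-)
proof (induction arbitrary: K rule: saturated.induct)
  case (saturated_refl F)
  then have "K = {}" by auto
  then show ?case by simp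
next
  case (saturated_step H A n G K)
  have finK: "finite K" using saturated_step.prems(1) loopless_matroidD(6)[OF M] finite_subset by fastforce
  have A: "A \<in> flats M" "A \<subseteq> G" "G \<in> flats M" using saturated_flats[OF saturated_step.hyps(2)] by auto
  obtain x where x: "x \<in> A" "x \<notin> H" using saturated_step.hyps(1) unfolding covers_def by blast
  have xg: "x \<in> ground M" using x A loopless_matroidD(2)[OF M] by blast
  have minA: "A \<subseteq> X" if "X \<in> flats M" "H \<subseteq> X" "x \<in> X" for X
  proof -
    have "A \<inter> X \<in> flats M" using loopless_matroidD(5)[OF M A(1)] that by auto
    moreover have "H \<subset> A \<inter> X" using saturated_step.hyps(1) that x unfolding covers_def by auto
    ultimately have "\<not> A \<inter> X \<subset> A" using saturated_step.hyps(1) unfolding covers_def by blast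
    then show ?thesis by blast
  qed
  define K0 where "K0 = {X \<in> K. x \<notin> X}"
  define K1 where "K1 = {X \<in> K. x \<in> X}"
  have K: "K = K0 \<union> K1" "K0 \<inter> K1 = {}" unfolding K0_def K1_def by auto
  have finK0: "finite K0" "finite K1" using finK K by auto
  have chain: "X \<subseteq> Y \<or> Y \<subseteq> X" if "X \<in> K" "Y \<in> K" for X Y using saturated_step.prems(2) that by blast
  have KD: "X \<in> flats M" "H \<subseteq> X" "X \<subset> G" if "X \<in> K" for X
    using subsetD[OF saturated_step.prems(1) that] by auto
  have K0D: "X \<in> K" "x \<notin> X" if "X \<in> K0" for X using that unfolding K0_def by auto
  have K1D: "X \<in> K" "x \<in> X" if "X \<in> K1" for X using that unfolding K1_def by auto
  have "\<forall>X\<in>K0. \<exists>Y. covers M X Y \<and> x \<in> Y \<and> (\<forall>H\<in>flats M. X \<subseteq> H \<longrightarrow> x \<in> H \<longrightarrow> Y \<subseteq> H)"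
  proof
    fix X assume X: "X \<in> K0"
    have "X \<in> flats M" "x \<in> ground M - X" using K0D[OF X] KD xg by auto
    from cover_minimal[OF M this] show "\<exists>Y. covers M X Y \<and> x \<in> Y \<and> (\<forall>H\<in>flats M. X \<subseteq> H \<longrightarrow> x \<in> H \<longrightarrow> Y \<subseteq> H)" .
  qed
  then obtain j where j: "\<And>X. X \<in> K0 \<Longrightarrow> covers M X (j X)" "\<And>X. X \<in> K0 \<Longrightarrow> x \<in> j X"
    "\<And>X H. X \<in> K0 \<Longrightarrow> H \<in> flats M \<Longrightarrow> X \<subseteq> H \<Longrightarrow> x \<in> H \<Longrightarrow> j X \<subseteq> H"
    by (metis (no_types) bchoice)
  have jD: "j X \<in> flats M" "X \<subset> j X" and jno: "\<And>H. H \<in> flats M \<Longrightarrow> X \<subset> H \<Longrightarrow> H \<subset> j X \<Longrightarrow> False"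
    if "X \<in> K0" for X using j(1)[OF that] unfolding covers_def by auto
  show ?case
  proof (cases "K0 = {}")
    case True
    then have "K1 = K" using K(1) by simp
    have "K \<subseteq> {X \<in> flats M. A \<subseteq> X \<and> X \<subset> G}"
    proof
      fix X assume X: "X \<in> K"
      then have "x \<in> X" using K1D(2)[of X] \<open>K1 = K\<close> by simp
      then show "X \<in> {X \<in> flats M. A \<subseteq> X \<and> X \<subset> G}" using KD[OF X] minA[of X] by simp
    qed
    from saturated_step.IH[OF this saturated_step.prems(2)] show ?thesis by simp
  next
    case False
    \<comment> \<open>\<open>Z\<close> is the largest member avoiding \<open>x\<close>. It is the
      one that is sacrificed, since its join with \<open>x\<close> may coincide with the next member
      or with \<open>G\<close>.\<close>
    define Z where "Z = \<Union> K0"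
    have "subset.chain K0 K0" unfolding subset_chain_def using chain K0D by auto
    then have Z: "Z \<in> K0" unfolding Z_def by (intro Union_in_chain[OF finK0(1) False])
    have strict: "j X \<subset> Y" if X: "X \<in> K0" "X \<subset> Z" and Y: "Y \<in> flats M" "Z \<subset> Y" "x \<in> Y" for X Y
    proof -
      have "X \<subseteq> Y" using X Y by auto
      then have "j X \<subseteq> Y" by (rule j(3)[OF X(1) Y(1) _ Y(3)])
      moreover have "j X \<noteq> Y" using jno[OF X(1) KD(1)[OF K0D(1)[OF Z]] X(2)] Y(2) by auto
      ultimately show ?thesis by blast
    qed
    have up: "Z \<subset> Y" if "Y \<in> K1" for Y
      using chain[OF K0D(1)[OF Z] K1D(1)[OF that]] K0D(2)[OF Z] K1D(2)[OF that] by auto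
    have below: "X \<subset> Z" if "X \<in> K0 - {Z}" for X using that unfolding Z_def by auto
    let ?J = "j ` (K0 - {Z})"
    have GZ: "Z \<subset> G" "x \<in> G" using KD(3)[OF K0D(1)[OF Z]] x A(2) by auto
    have jk: "j X \<subset> Y" if "X \<in> K0 - {Z}" "Y \<in> K1" for X Y
      using strict[of X Y] that up[OF that(2)] below[OF that(1)] KD(1) K1D[OF that(2)] by auto
    have disj: "?J \<inter> K1 = {}" using jk by auto
    have monoj: "j X \<subseteq> j Y" if "X \<in> K0" "Y \<in> K0" "X \<subseteq> Y" for X Y
      using j(3)[OF that(1) jD(1)[OF that(2)] _ j(2)[OF that(2)]] that(3) jD(2)[OF that(2)] by auto
    have ne: "j X \<noteq> j Y" if "X \<in> K0" "Y \<in> K0" "X \<subset> Y" for X Y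
      using jno[OF that(1) KD(1)[OF K0D(1)[OF that(2)]] that(3)] jD(2)[OF that(2)] by auto
    have inj: "inj_on j (K0 - {Z})"
    proof (rule inj_onI)
      fix X Y assume XY: "X \<in> K0 - {Z}" "Y \<in> K0 - {Z}" "j X = j Y"
      have "X \<subseteq> Y \<or> Y \<subseteq> X" using chain K0D XY by auto
      then show "X = Y" using ne[of X Y] ne[of Y X] XY by auto
    qed
    have sub: "?J \<union> K1 \<subseteq> {X \<in> flats M. A \<subseteq> X \<and> X \<subset> G}"
    proof
      fix X assume "X \<in> ?J \<union> K1"
      then show "X \<in> {X \<in> flats M. A \<subseteq> X \<and> X \<subset> G}"
      proof
        assume "X \<in> ?J"
        then obtain W where W: "W \<in> K0 - {Z}" "X = j W" by blast
        then have W0: "W \<in> K0" by simp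
        have "X \<subset> G" using strict[OF W0 below[OF W(1)] A(3) GZ] W by auto
        moreover have "A \<subseteq> X" using minA[OF jD(1)[OF W0] _ j(2)[OF W0]] jD(2)[OF W0] KD(2)[OF K0D(1)[OF W0]] W
          by auto
        ultimately show ?thesis using jD(1)[OF W0] W by auto
      next
        assume "X \<in> K1"
        then show ?thesis using KD[OF K1D(1)] minA K1D by auto
      qed
    qed
    have ch: "\<forall>X\<in>?J \<union> K1. \<forall>Y\<in>?J \<union> K1. X \<subseteq> Y \<or> Y \<subseteq> X"
    proof -
      have jj: "j X \<subseteq> j Y \<or> j Y \<subseteq> j X" if "X \<in> K0 - {Z}" "Y \<in> K0 - {Z}" for X Y
        using chain[of X Y] monoj[of X Y] monoj[of Y X] that K0D by auto
      have kk: "X \<subseteq> Y \<or> Y \<subseteq> X" if "X \<in> K1" "Y \<in> K1" for X Y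
        using chain that K1D by auto
      show ?thesis
      proof (intro ballI)
        fix X Y assume "X \<in> ?J \<union> K1" "Y \<in> ?J \<union> K1"
        then consider "X \<in> K1" "Y \<in> K1" | W where "W \<in> K0 - {Z}" "X = j W" "Y \<in> K1"
          | W where "W \<in> K0 - {Z}" "Y = j W" "X \<in> K1"
          | W W' where "W \<in> K0 - {Z}" "X = j W" "W' \<in> K0 - {Z}" "Y = j W'" by blast
        then show "X \<subseteq> Y \<or> Y \<subseteq> X"
        proof cases
          case 1 then show ?thesis by (rule kk)
        next
          case 2 then show ?thesis using psubset_imp_subset[OF jk] by simp
        next
          case 3 then show ?thesis using psubset_imp_subset[OF jk] by simp
        next
          case 4 then show ?thesis using jj by simp
        qed
      qed
    qed
    have "card (?J \<union> K1) \<le> n" using saturated_step.IH[OF sub ch] .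
    moreover have "card (?J \<union> K1) = card (K0 - {Z}) + card K1"
      using card_Un_disjoint[OF _ _ disj] finK0 card_image[OF inj] by simp
    moreover have "card K = card K0 + card K1" using K finK0 card_Un_disjoint by metis
    ultimately show ?thesis using Z finK0 by (simp add: card_Diff_singleton)
  qed
qed

lemma saturated_exists:
  assumes M: "loopless_matroid M" and "F \<in> flats M" "G \<in> flats M" "F \<subseteq> G"
  shows "\<exists>n. saturated M n F G"
  using assms(2-)
proof (induction "card (G - F)" arbitrary: F rule: less_induct)
  case less
  show ?case
  proof (cases "F = G")
    case True
    then show ?thesis using saturated_refl less by blast
  next
    case False
    then obtain x where x: "x \<in> G - F" using less by blast
    have "x \<in> ground M - F" using x less loopless_matroidD(2)[OF M] by auto
    from cover_minimal[OF M less.prems(1) this] obtain H where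
      H: "covers M F H" "x \<in> H" "H \<subseteq> G" using less.prems x by blast
    have "G - H \<subset> G - F" using H x unfolding covers_def by auto
    moreover have "finite G" using less.prems loopless_matroidD[OF M] by (meson PowD finite_subset subsetD)
    ultimately have "card (G - H) < card (G - F)" by (simp add: psubset_card_mono)
    then obtain n where "saturated M n H G" using less.hyps[of H] H less.prems unfolding covers_def by auto
    then show ?thesis using saturated_step H by blast
  qed
qed

lemma saturated_snoc: "saturated M n F G \<Longrightarrow> covers M G H \<Longrightarrow> saturated M (Suc n) F H"
proof (induction rule: saturated.induct)
  case (saturated_refl F)
  then show ?case by (metis covers_def saturated.intros)
qed (metis saturated_step)

lemma saturated_chain:
  "saturated M n F G \<Longrightarrow> \<exists>C. card C = n \<and> finite C \<and> C \<subseteq> {X \<in> flats M. F \<subseteq> X \<and> X \<subset> G} \<and>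
     (\<forall>A\<in>C. \<forall>B\<in>C. A \<subseteq> B \<or> B \<subseteq> A)"
proof (induction rule: saturated.induct)
  case (saturated_refl F)
  show ?case by (rule exI[of _ "{}"]) auto
next
  case (saturated_step F G n H)
  then obtain C where C: "card C = n" "finite C" "C \<subseteq> {X \<in> flats M. G \<subseteq> X \<and> X \<subset> H}"
    "\<forall>A\<in>C. \<forall>B\<in>C. A \<subseteq> B \<or> B \<subseteq> A" by (elim exE conjE)
  have GH: "G \<subseteq> H" using saturated_flats[OF saturated_step.hyps(2)] by auto
  have "F \<notin> C" using C saturated_step.hyps(1) unfolding covers_def by auto
  have FG: "F \<in> flats M" "F \<subset> G" using saturated_step.hyps(1) unfolding covers_def by auto
  have CD: "X \<in> flats M" "G \<subseteq> X" "X \<subset> H" if "X \<in> C" for X using subsetD[OF C(3) that] by auto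
  show ?case
  proof (intro exI[of _ "insert F C"] conjI)
    show "card (insert F C) = Suc n" using C \<open>F \<notin> C\<close> by simp
    have "F \<subseteq> X" if "X \<in> C" for X using CD(2)[OF that] FG by auto
    then show "insert F C \<subseteq> {X \<in> flats M. F \<subseteq> X \<and> X \<subset> H}" using CD FG GH by (intro subsetI CollectI) (elim insertE; force)
    have "F \<subseteq> X" if "X \<in> C" for X using CD(2)[OF that] FG by auto
    then show "\<forall>A\<in>insert F C. \<forall>B\<in>insert F C. A \<subseteq> B \<or> B \<subseteq> A" using C(4) by simp
  qed (use C in simp)
qed

lemma mrank_saturated:
  assumes M: "loopless_matroid M" and s: "saturated M n {} F"
  shows "mrank M F = n"
proof -
  have F: "F \<in> flats M" using saturated_flats[OF s] by auto
  let ?S = "{card C |C. C \<subseteq> flats M \<and> (\<forall>G\<in>C. G \<subset> F) \<and> (\<forall>A\<in>C. \<forall>B\<in>C. A \<subseteq> B \<or> B \<subseteq> A)}"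
  have le: "m \<le> n" if m: "m \<in> ?S" for m
  proof -
    obtain C where C: "m = card C" "C \<subseteq> flats M" "\<forall>G\<in>C. G \<subset> F" "\<forall>A\<in>C. \<forall>B\<in>C. A \<subseteq> B \<or> B \<subseteq> A"
      using CollectD[OF m] by force
    have "C \<subseteq> {X \<in> flats M. {} \<subseteq> X \<and> X \<subset> F}" using C by auto
    then show ?thesis using chain_le_saturated[OF M s _ C(4)] C(1) by simp
  qed
  obtain C where C: "card C = n" "C \<subseteq> {X \<in> flats M. {} \<subseteq> X \<and> X \<subset> F}" "\<forall>A\<in>C. \<forall>B\<in>C. A \<subseteq> B \<or> B \<subseteq> A"
    using saturated_chain[OF s] by metis
  then have "n \<in> ?S" by (intro CollectI exI[of _ C]) auto
  moreover have "finite ?S" unfolding finite_nat_set_iff_bounded_le by (intro exI[of _ n] ballI le)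
  ultimately have "Max ?S = n" using le by (intro Max_eqI)
  then show ?thesis unfolding mrank_def using F by simp
qed

text \<open>The converse passage from the axioms to the locale: since all saturated chains from
  \<open>{}\<close> to a flat have the same length, the rank rises by exactly one along each
  cover.\<close>

lemma ranked_flats_mrank:
  assumes M: "loopless_matroid M"
  shows "ranked_flats (ground M) (flats M) (mrank M)"
proof
  have sat: "\<exists>n. saturated M n {} F \<and> mrank M F = n" if "F \<in> flats M" for F
    using saturated_exists[OF M loopless_matroidD(4)[OF M] that] mrank_saturated[OF M] by auto
  show "finite (ground M)" "flats M \<subseteq> Pow (ground M)" "{} \<in> flats M" "ground M \<in> flats M"
    using loopless_matroidD[OF M] by auto
  show "mrank M {} = 0" by (rule mrank_saturated[OF M saturated_refl]) (rule loopless_matroidD(4)[OF M])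
  have cov: "mrank M G = Suc (mrank M F)" if "covers M F G" for F G
    using sat[of F] that mrank_saturated[OF M saturated_snoc] unfolding covers_def by blast
  show "mrank M F < mrank M G" if FG: "F \<in> flats M" "G \<in> flats M" "F \<subset> G" for F G
  proof -
    obtain m where m: "saturated M m F G" using saturated_exists[OF M] FG by blast
    have *: "mrank M F + n = mrank M G" if "saturated M n F G" for n F G
      using that by (induction rule: saturated.induct) (auto dest: cov)
    have "m \<noteq> 0" using m FG by (auto elim: saturated.cases)
    then show ?thesis using *[OF m] by simp
  qed
  fix F x assume F: "F \<in> flats M" "x \<in> ground M - F"
  obtain G where G: "covers M F G" "x \<in> G"
    "\<forall>H\<in>flats M. F \<subseteq> H \<longrightarrow> x \<in> H \<longrightarrow> G \<subseteq> H" using cover_minimal[OF M F] by metis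
  show "\<exists>G\<in>flats M. F \<subseteq> G \<and> x \<in> G \<and> mrank M G = Suc (mrank M F) \<and>
           (\<forall>H\<in>flats M. F \<subseteq> H \<and> x \<in> H \<longrightarrow> G \<subseteq> H)"
    using G(1,2) cov[OF G(1)] G(3) unfolding covers_def by (intro bexI[of _ G]) (simp_all add: psubset_imp_subset)
qed

lemma flat_closure_closure:
  assumes "loopless_matroid M" "S \<subseteq> ground M"
  shows "flat_closure M (flat_closure M S) = flat_closure M S"
  using flat_closure_in_flats[OF assms] by simp

lemma mrank_flat_closure:
  assumes "loopless_matroid M" "S \<subseteq> ground M"
  shows "mrank M (flat_closure M S) = mrank M S"
  unfolding mrank_def flat_closure_closure[OF assms] ..

lemma mrank_empty: "loopless_matroid M \<Longrightarrow> mrank M {} = 0"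
  using ranked_flats.rk_empty[OF ranked_flats_mrank] .

text \<open>The basis of the rank calculus: the inequalities below are proved by adding elements one
  at a time and comparing closures.\<close>

lemma mrank_insert:
  assumes M: "loopless_matroid M" and S: "S \<subseteq> ground M" and x: "x \<in> ground M"
  shows "mrank M (insert x S) = mrank M S + (if x \<in> flat_closure M S then 0 else 1)"
proof (cases "x \<in> flat_closure M S")
  case True
  have "flat_closure M (insert x S) = flat_closure M S"
  proof
    show "flat_closure M (insert x S) \<subseteq> flat_closure M S"
      using True flat_closure_superset[of S M] flat_closure_in_flats[OF M S] by (intro flat_closure_subset) auto
  qed (rule flat_closure_mono, auto)
  then show ?thesis using True unfolding mrank_def by simp
next
  case False
  interpret ranked_flats "ground M" "flats M" "mrank M" by (rule ranked_flats_mrank[OF M])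
  let ?F = "flat_closure M S"
  have F: "?F \<in> flats M" by (rule flat_closure_in_flats[OF M S])
  obtain G where G: "G \<in> flats M" "?F \<subseteq> G" "x \<in> G" "mrank M G = Suc (mrank M ?F)"
     "\<forall>H\<in>flats M. ?F \<subseteq> H \<and> x \<in> H \<longrightarrow> G \<subseteq> H"
    using extend[OF F, of x] x False by auto
  have "flat_closure M (insert x S) = G"
  proof
    show "flat_closure M (insert x S) \<subseteq> G" using G flat_closure_superset[of S M] by (intro flat_closure_subset) auto
    have "?F \<subseteq> flat_closure M (insert x S)" by (rule flat_closure_mono[OF subset_insertI])
    moreover have "x \<in> flat_closure M (insert x S)" using flat_closure_superset[of "insert x S" M] by simp
    ultimately show "G \<subseteq> flat_closure M (insert x S)"
      using G(5) flat_closure_in_flats[OF M, of "insert x S"] S x by simp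
  qed
  then show ?thesis using False G(4) mrank_flat_closure[OF M S] mrank_flat_closure[OF M, of "insert x S"] S x
    by simp
qed

section \<open>Rank inequalities\<close>

lemma finite_subset_ground: "loopless_matroid M \<Longrightarrow> S \<subseteq> ground M \<Longrightarrow> finite S"
  using loopless_matroidD(1) finite_subset by blast

text \<open>The hypothesis makes \<open>Q\<close>, on the groundset of \<open>P\<close>, a quotient
  of \<open>P\<close>. Its closures are larger, so each added element that leaves the rank in
  \<open>P\<close> unchanged also leaves the rank in \<open>Q\<close> unchanged: the difference of
  the two ranks grows with the set.\<close>

lemma mrank_quotient:
  assumes P: "loopless_matroid P" and Q: "loopless_matroid Q"
    and "ground P \<subseteq> ground Q" and quot: "\<And>F. F \<in> flats Q \<Longrightarrow> F \<inter> ground P \<in> flats P"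
    and "S \<subseteq> S'" "S' \<subseteq> ground P"
  shows "mrank Q S' + mrank P S \<le> mrank P S' + mrank Q S"
proof -
  have "finite (S' - S)" using finite_subset_ground[OF P] assms(6) by blast
  have "S \<union> A \<subseteq> ground P \<Longrightarrow> mrank Q (S \<union> A) + mrank P S \<le> mrank P (S \<union> A) + mrank Q S"
    if "finite A" for A using that
  proof (induction A rule: finite_induct)
    case (insert x A)
    have g: "S \<union> A \<subseteq> ground P" "x \<in> ground P" "S \<union> A \<subseteq> ground Q" "x \<in> ground Q"
      using insert.prems assms(3) by auto
    have "flat_closure P (S \<union> A) \<subseteq> flat_closure Q (S \<union> A) \<inter> ground P"
      using flat_closure_superset[of "S \<union> A" Q] g
      by (intro flat_closure_subset quot flat_closure_in_flats[OF Q]) auto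
    then show ?case using insert.IH g mrank_insert[OF P g(1,2)] mrank_insert[OF Q g(3,4)]
      by (auto split: if_splits)
  qed simp
  from this[of "S' - S"] show ?thesis using assms by (simp add: \<open>finite (S' - S)\<close> Un_absorb1)
qed

lemma mrank_mono:
  assumes M: "loopless_matroid M" and S: "S \<subseteq> S'" "S' \<subseteq> ground M"
  shows "mrank M S \<le> mrank M S'"
proof -
  interpret ranked_flats "ground M" "flats M" "mrank M" by (rule ranked_flats_mrank[OF M])
  have "S \<subseteq> ground M" using S by auto
  then have "mrank M (flat_closure M S) \<le> mrank M (flat_closure M S')"
    using S by (intro rk_mono flat_closure_in_flats[OF M] flat_closure_mono)
  then show ?thesis using mrank_flat_closure[OF M] S \<open>S \<subseteq> ground M\<close> by simp
qed

text \<open>Adding the elements of \<open>B\<close> singly to \<open>A\<close> and to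
  \<open>A \<inter> B\<close>, an increase over the larger set forces one over the smaller
  set.\<close>

lemma mrank_submodular:
  assumes M: "loopless_matroid M" and A: "A \<subseteq> ground M" and B: "B \<subseteq> ground M"
  shows "mrank M (A \<union> B) + mrank M (A \<inter> B) \<le> mrank M A + mrank M B"
proof -
  have "C \<subseteq> B \<Longrightarrow> mrank M (A \<union> C) + mrank M (A \<inter> B) \<le> mrank M A + mrank M ((A \<inter> B) \<union> C)"
    if "finite C" for C using that
  proof (induction C rule: finite_induct)
    case (insert x C)
    have g: "A \<union> C \<subseteq> ground M" "x \<in> ground M" "A \<inter> B \<union> C \<subseteq> ground M"
      using insert.prems A B by auto
    have "flat_closure M (A \<inter> B \<union> C) \<subseteq> flat_closure M (A \<union> C)" by (rule flat_closure_mono) auto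
    then show ?case using insert mrank_insert[OF M g(1,2)] mrank_insert[OF M g(3,2)] by (auto split: if_splits)
  qed simp
  from this[of B] show ?thesis using finite_subset_ground[OF M B] by (simp add: Un_absorb1)
qed

section \<open>Restrictions and direct sums\<close>

lemma loopless_restriction:
  assumes M: "loopless_matroid M" and T: "T \<subseteq> ground M"
  shows "ranked_flats T (flats (restriction M T)) (mrank M)"
proof
  interpret ranked_flats "ground M" "flats M" "mrank M" by (rule ranked_flats_mrank[OF M])
  let ?L = "flats (restriction M T)"
  have L: "?L = (\<lambda>F. F \<inter> T) ` flats M" unfolding restriction_def by simp
  show "finite T" using T finite_ground finite_subset by blast
  show "?L \<subseteq> Pow T" unfolding L by auto
  show "{} \<in> ?L" unfolding L using empty_flat by (intro image_eqI[of _ _ "{}"]) auto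
  show "T \<in> ?L" unfolding L using ground_flat T by (intro image_eqI[of _ _ "ground M"]) auto
  show "mrank M {} = 0" by (rule rk_empty)
  \<comment> \<open>A trace is recovered from its closure in \<open>M\<close>; hence distinct nested
    traces have distinct closures and the rank of \<open>M\<close> stays strict on traces.\<close>
  have cl: "flat_closure M F \<inter> T = F" if F: "F \<in> ?L" for F
  proof -
    obtain G where "G \<in> flats M" "F = G \<inter> T" using F unfolding L by auto
    then show ?thesis using flat_closure_subset[of F G M] flat_closure_superset[of F M] by auto
  qed
  have sub: "F \<subseteq> ground M" if "F \<in> ?L" for F using that T unfolding L by auto
  show "mrank M F < mrank M G" if FG: "F \<in> ?L" "G \<in> ?L" "F \<subset> G" for F G
  proof -
    have "flat_closure M F \<noteq> flat_closure M G" using FG cl by (metis psubset_eq)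
    then have "flat_closure M F \<subset> flat_closure M G" using flat_closure_mono[of F G M] FG by blast
    then have "mrank M (flat_closure M F) < mrank M (flat_closure M G)"
      by (intro rk_strict flat_closure_in_flats[OF M] sub FG)
    then show ?thesis using mrank_flat_closure[OF M] sub FG by simp
  qed
  fix F x assume F: "F \<in> ?L" "x \<in> T - F"
  have g: "F \<subseteq> ground M" "x \<in> ground M" using sub F T by auto
  have nx: "x \<notin> flat_closure M F" using cl[OF F(1)] F by auto
  let ?G = "flat_closure M (insert x F)"
  have G: "?G \<in> flats M" using flat_closure_in_flats[OF M] g by simp
  show "\<exists>G\<in>?L. F \<subseteq> G \<and> x \<in> G \<and> mrank M G = Suc (mrank M F) \<and> (\<forall>H\<in>?L. F \<subseteq> H \<and> x \<in> H \<longrightarrow> G \<subseteq> H)"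
  proof (intro bexI[of _ "?G \<inter> T"] conjI ballI impI)
    show "?G \<inter> T \<in> ?L" unfolding L using G by auto
    have sup: "insert x F \<subseteq> ?G \<inter> T" using flat_closure_superset[of "insert x F" M] F unfolding L by auto
    then show "F \<subseteq> ?G \<inter> T" "x \<in> ?G \<inter> T" by auto
    have "mrank M (insert x F) \<le> mrank M (?G \<inter> T)" using sup T by (intro mrank_mono[OF M]) auto
    moreover have "mrank M (?G \<inter> T) \<le> mrank M ?G" using G flats_ground by (intro mrank_mono[OF M]) auto
    moreover have "mrank M ?G = mrank M (insert x F)" using mrank_flat_closure[OF M] g by simp
    ultimately show "mrank M (?G \<inter> T) = Suc (mrank M F)" using mrank_insert[OF M g] nx by simp
    fix H assume H: "H \<in> ?L" "F \<subseteq> H \<and> x \<in> H"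
    then have "?G \<subseteq> flat_closure M H" by (intro flat_closure_mono) auto
    then show "?G \<inter> T \<subseteq> H" using cl[OF H(1)] by auto
  qed
qed

lemma restriction_ground [simp]: "ground (restriction M T) = T"
  unfolding restriction_def by simp

lemma restriction_flat_iff:
  "flats (restriction M T) = (\<lambda>F. F \<inter> T) ` flats M"
  unfolding restriction_def by simp

lemma mrank_restriction:
  assumes M: "loopless_matroid M" and T: "T \<subseteq> ground M" and S: "S \<subseteq> T"
  shows "mrank (restriction M T) S = mrank M S"
proof -
  interpret R: ranked_flats T "flats (restriction M T)" "mrank M" by (rule loopless_restriction[OF M T])
  have R: "Flat_System T (flats (restriction M T)) = restriction M T" unfolding restriction_def by simp
  have lR: "loopless_matroid (restriction M T)" using R.loopless R by simp
  let ?c = "flat_closure (restriction M T) S"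
  have c: "?c \<in> flats (restriction M T)" using flat_closure_in_flats[OF lR] S by simp
  have "mrank (restriction M T) S = mrank (restriction M T) ?c" using mrank_flat_closure[OF lR] S by simp
  also have "\<dots> = mrank M ?c" using R.mrank_flat[OF c] R by simp
  also have "\<dots> = mrank M S"
  proof (rule antisym)
    have SM: "S \<subseteq> ground M" using S T by auto
    have "?c \<subseteq> flat_closure M S \<inter> T"
      using flat_closure_in_flats[OF M SM] flat_closure_superset[of S M] S
      by (intro flat_closure_subset) (auto simp: restriction_flat_iff)
    then have "mrank M ?c \<le> mrank M (flat_closure M S)"
      using flat_closure_in_flats[OF M SM] loopless_matroidD(2)[OF M] by (intro mrank_mono[OF M]) auto
    then show "mrank M ?c \<le> mrank M S" using mrank_flat_closure[OF M SM] by simp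
    show "mrank M S \<le> mrank M ?c" using flat_closure_superset[of S] c T
      by (intro mrank_mono[OF M]) (auto simp: restriction_flat_iff)
  qed
  finally show ?thesis .
qed

lemma ranked_flats_direct_sum:
  assumes M1: "loopless_matroid M1" and M2: "loopless_matroid M2"
  shows "ranked_flats (ground M1 <+> ground M2) (flats (direct_sum M1 M2))
    (\<lambda>F. mrank M1 (Inl -` F) + mrank M2 (Inr -` F))"
proof
  interpret R1: ranked_flats "ground M1" "flats M1" "mrank M1" by (rule ranked_flats_mrank[OF M1])
  interpret R2: ranked_flats "ground M2" "flats M2" "mrank M2" by (rule ranked_flats_mrank[OF M2])
  let ?L = "flats (direct_sum M1 M2)"
  have vi: "Inl -` (A <+> B) = A" "Inr -` (A <+> B) = B" for A :: "'a set" and B :: "'b set" by auto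
  have L: "?L = {F1 <+> F2 |F1 F2. F1 \<in> flats M1 \<and> F2 \<in> flats M2}" unfolding direct_sum_def by simp
  show "finite (ground M1 <+> ground M2)" using R1.finite_ground R2.finite_ground by simp
  show "?L \<subseteq> Pow (ground M1 <+> ground M2)" unfolding L using R1.flats_ground R2.flats_ground by blast
  have "{} = {} <+> {}" by blast
  then show "{} \<in> ?L" unfolding L using R1.empty_flat R2.empty_flat by blast
  show "ground M1 <+> ground M2 \<in> ?L" unfolding L using R1.ground_flat R2.ground_flat by blast
  show "mrank M1 (Inl -` {}) + mrank M2 (Inr -` {}) = 0" using R1.rk_empty R2.rk_empty by simp
  show "mrank M1 (Inl -` F) + mrank M2 (Inr -` F) < mrank M1 (Inl -` G) + mrank M2 (Inr -` G)"
    if FG: "F \<in> ?L" "G \<in> ?L" "F \<subset> G" for F G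
  proof -
    obtain F1 F2 G1 G2 where e: "F = F1 <+> F2" "G = G1 <+> G2" "F1 \<in> flats M1" "F2 \<in> flats M2"
      "G1 \<in> flats M1" "G2 \<in> flats M2" using FG unfolding L by blast
    have s: "F1 \<subseteq> G1" "F2 \<subseteq> G2" using FG(3) e by auto
    then have le: "mrank M1 F1 \<le> mrank M1 G1" "mrank M2 F2 \<le> mrank M2 G2" using R1.rk_mono R2.rk_mono e by auto
    have "F1 \<subset> G1 \<or> F2 \<subset> G2" using s FG(3) e by auto
    then have "mrank M1 F1 < mrank M1 G1 \<or> mrank M2 F2 < mrank M2 G2"
      using R1.rk_strict R2.rk_strict e by auto
    then show ?thesis using le e vi by auto
  qed
  fix F x assume F: "F \<in> ?L" "x \<in> (ground M1 <+> ground M2) - F"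
  then obtain F1 F2 where e: "F = F1 <+> F2" "F1 \<in> flats M1" "F2 \<in> flats M2" unfolding L by blast
  have HL: "\<exists>H1 H2. H = H1 <+> H2 \<and> H1 \<in> flats M1 \<and> H2 \<in> flats M2" if "H \<in> ?L" for H
    using that unfolding L by blast
  show "\<exists>G\<in>?L. F \<subseteq> G \<and> x \<in> G \<and>
        mrank M1 (Inl -` G) + mrank M2 (Inr -` G) = Suc (mrank M1 (Inl -` F) + mrank M2 (Inr -` F)) \<and>
        (\<forall>H\<in>?L. F \<subseteq> H \<and> x \<in> H \<longrightarrow> G \<subseteq> H)"
  proof (cases x)
    case (Inl a)
    then have "a \<in> ground M1 - F1" using F e by auto
    from R1.extend[OF e(2) this] obtain G1 where G: "G1 \<in> flats M1" "F1 \<subseteq> G1" "a \<in> G1"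
      "mrank M1 G1 = Suc (mrank M1 F1)" "\<forall>H\<in>flats M1. F1 \<subseteq> H \<and> a \<in> H \<longrightarrow> G1 \<subseteq> H" by auto
    show ?thesis
    proof (intro bexI[of _ "G1 <+> F2"] conjI ballI impI)
      show "G1 <+> F2 \<in> ?L" unfolding L using G e by blast
      fix H assume H: "H \<in> ?L" "F \<subseteq> H \<and> x \<in> H"
      obtain H1 H2 where h: "H = H1 <+> H2" "H1 \<in> flats M1" "H2 \<in> flats M2" using HL[OF H(1)] by blast
      then have "F1 \<subseteq> H1" "a \<in> H1" "F2 \<subseteq> H2" using H e Inl by auto
      then show "G1 <+> F2 \<subseteq> H" using G h by auto
    qed (use G e Inl in \<open>auto simp: vi\<close>)
  next
    case (Inr a)
    then have "a \<in> ground M2 - F2" using F e by auto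
    from R2.extend[OF e(3) this] obtain G2 where G: "G2 \<in> flats M2" "F2 \<subseteq> G2" "a \<in> G2"
      "mrank M2 G2 = Suc (mrank M2 F2)" "\<forall>H\<in>flats M2. F2 \<subseteq> H \<and> a \<in> H \<longrightarrow> G2 \<subseteq> H" by auto
    show ?thesis
    proof (intro bexI[of _ "F1 <+> G2"] conjI ballI impI)
      show "F1 <+> G2 \<in> ?L" unfolding L using G e by blast
      fix H assume H: "H \<in> ?L" "F \<subseteq> H \<and> x \<in> H"
      obtain H1 H2 where h: "H = H1 <+> H2" "H1 \<in> flats M1" "H2 \<in> flats M2" using HL[OF H(1)] by blast
      then have "F2 \<subseteq> H2" "a \<in> H2" "F1 \<subseteq> H1" using H e Inr by auto
      then show "F1 <+> G2 \<subseteq> H" using G h by auto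
    qed (use G e Inr in \<open>auto simp: vi\<close>)
  qed
qed

lemma direct_sum_ground [simp]: "ground (direct_sum M1 M2) = ground M1 <+> ground M2"
  unfolding direct_sum_def by simp

lemma vimage_Plus [simp]: "Inl -` (A <+> B) = A" "Inr -` (A <+> B) = B"
  by auto

lemma Plus_vimage: "(Inl -` F) <+> (Inr -` F) = F"
proof (rule set_eqI)
  show "x \<in> (Inl -` F) <+> (Inr -` F) \<longleftrightarrow> x \<in> F" for x by (cases x) auto
qed

lemma direct_sum_flat_iff:
  "F \<in> flats (direct_sum M1 M2) \<longleftrightarrow> Inl -` F \<in> flats M1 \<and> Inr -` F \<in> flats M2"
proof
  assume "F \<in> flats (direct_sum M1 M2)"
  then show "Inl -` F \<in> flats M1 \<and> Inr -` F \<in> flats M2" unfolding direct_sum_def by auto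
next
  assume "Inl -` F \<in> flats M1 \<and> Inr -` F \<in> flats M2"
  then show "F \<in> flats (direct_sum M1 M2)" unfolding direct_sum_def flat_system.sel
    using Plus_vimage[of F] by (intro CollectI exI[of _ "Inl -` F"] exI[of _ "Inr -` F"]) simp
qed

lemma
  assumes M1: "loopless_matroid M1" and M2: "loopless_matroid M2"
  shows loopless_direct_sum: "loopless_matroid (direct_sum M1 M2)"
    and mrank_direct_sum: "F \<in> flats (direct_sum M1 M2) \<Longrightarrow>
      mrank (direct_sum M1 M2) F = mrank M1 (Inl -` F) + mrank M2 (Inr -` F)"
proof -
  interpret ranked_flats "ground M1 <+> ground M2" "flats (direct_sum M1 M2)"
    "\<lambda>F. mrank M1 (Inl -` F) + mrank M2 (Inr -` F)" by (rule ranked_flats_direct_sum[OF M1 M2])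
  have e: "Flat_System (ground M1 <+> ground M2) (flats (direct_sum M1 M2)) = direct_sum M1 M2"
    unfolding direct_sum_def by simp
  show "loopless_matroid (direct_sum M1 M2)" using loopless e by simp
  show "F \<in> flats (direct_sum M1 M2) \<Longrightarrow> mrank (direct_sum M1 M2) F = mrank M1 (Inl -` F) + mrank M2 (Inr -` F)"
    using mrank_flat e by simp
qed

section \<open>Weights on chains of subsets\<close>

text \<open>The empty set gives no ray, and the direction of \<open>e_E\<close> is kept apart as the
  sign \<open>s\<close> of a cone; both are therefore excluded from chains.\<close>

definition proper_chain :: "'n set \<Rightarrow> 'n set set \<Rightarrow> bool" where
  "proper_chain E C \<longleftrightarrow> (\<forall>F\<in>C. F \<noteq> {} \<and> F \<subset> E) \<and> (\<forall>F\<in>C. \<forall>G\<in>C. F \<subseteq> G \<or> G \<subseteq> F)"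

text \<open>\<open>k\<close> is the dimension of the cones; the \<open>Suc\<close> accounts for the
  additional generator \<open>e_E\<close> or \<open>-e_E\<close>.\<close>

definition chain_weight :: "'n set \<Rightarrow> nat \<Rightarrow> ('n set set \<Rightarrow> real) \<Rightarrow> bool" where
  "chain_weight E k \<omega> \<longleftrightarrow> (\<forall>C. \<omega> C \<noteq> 0 \<longrightarrow> proper_chain E C \<and> Suc (card C) = k)"

text \<open>The vector \<open>\<Sum>\<^sub>G \<omega>(D \<union> {G}) e\<^sub>G\<close>, whose membership in the span of \<open>D\<close> and \<open>e\<^sub>E\<close> is the
  balancing condition at \<open>D\<close>.\<close>

definition chain_vec :: "('n::finite set set \<Rightarrow> real) \<Rightarrow> 'n set set \<Rightarrow> 'n \<Rightarrow> real" where
  "chain_vec \<omega> D i = (\<Sum>G\<in>- D. \<omega> (insert G D) * of_bool (i \<in> G))"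

text \<open>For a vector supported on \<open>E\<close>, membership in the span of a chain and
  \<open>e_E\<close> means being constant on the blocks into which the chain divides
  \<open>E\<close>. The coordinate form avoids spans in the whole calculus of divisors.\<close>

definition chain_balanced :: "'n::finite set \<Rightarrow> ('n set set \<Rightarrow> real) \<Rightarrow> bool" where
  "chain_balanced E \<omega> \<longleftrightarrow>
     (\<forall>D. \<forall>i\<in>E. \<forall>j\<in>E. (\<forall>H\<in>D. i \<in> H \<longleftrightarrow> j \<in> H) \<longrightarrow> chain_vec \<omega> D i = chain_vec \<omega> D j)"

text \<open>The closure property and the two boundary conditions are what makes the associated
  function linear on every cone, equal to minus one coordinate; see
  \<open>split_exists\<close>.\<close>

definition up_set :: "'n set \<Rightarrow> 'n set set \<Rightarrow> bool" where
  "up_set E U \<longleftrightarrow> (\<forall>F G. F \<in> U \<longrightarrow> F \<subseteq> G \<longrightarrow> G \<in> U) \<and> E \<in> U \<and> {} \<notin> U"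

text \<open>The divisor of the piecewise linear function with value \<open>-1\<close> on the rays in the up-set \<open>U\<close>
  and \<open>0\<close> on the other rays: on the cone of a chain it is minus the coordinate \<open>j\<close> for any
  \<open>j\<close> which lies in exactly those members of the chain that belong to \<open>U\<close>.\<close>

definition chain_divisor ::
    "'n::finite set \<Rightarrow> 'n set set \<Rightarrow> ('n set set \<Rightarrow> real) \<Rightarrow> 'n set set \<Rightarrow> real" where
  "chain_divisor E U \<omega> D =
     chain_vec \<omega> D (SOME j. j \<in> E \<and> (\<forall>H\<in>insert E D. j \<in> H \<longleftrightarrow> H \<in> U))
       - (\<Sum>G\<in>- D. \<omega> (insert G D) * of_bool (G \<in> U))"

lemma proper_chain_subset: "proper_chain E D \<Longrightarrow> C \<subseteq> D \<Longrightarrow> proper_chain E C"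
  unfolding proper_chain_def by (meson subsetD)

lemma proper_chainD:
  assumes "proper_chain E C" "F \<in> C"
  shows "F \<noteq> {}" "F \<subset> E" "\<And>G. G \<in> C \<Longrightarrow> F \<subseteq> G \<or> G \<subseteq> F"
  using assms unfolding proper_chain_def by auto

lemma proper_chain_insert:
  "proper_chain E (insert G D) \<longleftrightarrow> proper_chain E D \<and> G \<noteq> {} \<and> G \<subset> E \<and> (\<forall>H\<in>D. H \<subseteq> G \<or> G \<subseteq> H)"
  unfolding proper_chain_def by (simp add: ball_conj_distrib conj_ac disj_commute)

lemma chain_weightD:
  assumes "chain_weight E k \<omega>" "\<omega> C \<noteq> 0"
  shows "proper_chain E C" "Suc (card C) = k"
  using assms unfolding chain_weight_def by simp_all

lemma chain_balancedD:
  assumes "chain_balanced E \<omega>" "i \<in> E" "j \<in> E" "\<And>H. H \<in> D \<Longrightarrow> i \<in> H \<longleftrightarrow> j \<in> H"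
  shows "chain_vec \<omega> D i = chain_vec \<omega> D j"
proof -
  have "\<forall>i\<in>E. \<forall>j\<in>E. (\<forall>H\<in>D. i \<in> H \<longleftrightarrow> j \<in> H) \<longrightarrow> chain_vec \<omega> D i = chain_vec \<omega> D j"
    using assms(1) unfolding chain_balanced_def by (rule spec)
  then show ?thesis using assms(2-4) by metis
qed

lemma up_setD:
  assumes "up_set E U"
  shows "F \<in> U \<Longrightarrow> F \<subseteq> G \<Longrightarrow> G \<in> U" "E \<in> U" "{} \<notin> U"
  using assms unfolding up_set_def by auto

section \<open>Evaluating divisors with adapted coordinates\<close>

lemma Union_chain_mem:
  fixes A :: "'n::finite set set"
  assumes "\<And>F G. F \<in> A \<Longrightarrow> G \<in> A \<Longrightarrow> F \<subseteq> G \<or> G \<subseteq> F" "A \<noteq> {}"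
  shows "\<Union> A \<in> A" "\<Inter> A \<in> A"
proof -
  have "subset.chain A A" unfolding subset_chain_def using assms(1) by auto
  then show "\<Union> A \<in> A" "\<Inter> A \<in> A"
    using Union_in_chain[of A A] Inter_in_chain[of A A] assms(2) by auto
qed

text \<open>The largest member outside \<open>U\<close> lies strictly below the smallest member
  inside \<open>U\<close>, and any element of the difference serves. \<open>{}\<close> and
  \<open>E\<close> supply these two sets when the chain does not.\<close>

lemma split_exists:
  fixes E :: "'n::finite set"
  assumes D: "proper_chain E D" and U: "up_set E U"
  shows "\<exists>j\<in>E. \<forall>H\<in>insert E D. j \<in> H \<longleftrightarrow> H \<in> U"
proof -
  define A where "A = {H \<in> D. H \<notin> U}"
  define B where "B = insert E {H \<in> D. H \<in> U}"
  have cmp: "F \<subseteq> G \<or> G \<subseteq> F" if "F \<in> insert E D" "G \<in> insert E D" for F G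
    using that proper_chainD[OF D] by blast
  have nA: "\<Union> A \<notin> U"
  proof (cases "A = {}")
    case True
    then show ?thesis using up_setD(3)[OF U] by simp
  next
    case False
    have "\<Union> A \<in> A" using Union_chain_mem(1)[OF _ False] cmp unfolding A_def by simp
    then show ?thesis unfolding A_def by auto
  qed
  have "\<Inter> B \<in> B" by (rule Union_chain_mem(2)) (use cmp in \<open>auto simp: B_def\<close>)
  then have BU: "\<Inter> B \<in> U" unfolding B_def using up_setD(2)[OF U] by auto
  have "H \<subseteq> G" if "H \<in> A" "G \<in> B" for H G
  proof -
    have "H \<notin> U" "G \<in> U" "H \<subseteq> G \<or> G \<subseteq> H"
      using that up_setD(2)[OF U] cmp unfolding A_def B_def by auto
    then show ?thesis using up_setD(1)[OF U, of G H] by auto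
  qed
  then have "\<Union> A \<subseteq> \<Inter> B" by auto
  moreover have "\<Union> A \<noteq> \<Inter> B" using nA BU by auto
  ultimately obtain j where j: "j \<in> \<Inter> B" "j \<notin> \<Union> A" by blast
  show ?thesis
  proof (intro bexI[of _ j] ballI)
    show "j \<in> E" using j unfolding B_def by auto
    fix H assume "H \<in> insert E D"
    then have "H \<in> A \<or> H \<in> B" "H \<in> A \<longleftrightarrow> H \<notin> U \<and> H \<in> D" "H \<in> B \<longrightarrow> H \<in> U"
      using up_setD(2)[OF U] unfolding A_def B_def by auto
    then show "j \<in> H \<longleftrightarrow> H \<in> U" using j by auto
  qed
qed

text \<open>Balancing makes the choice of the coordinate immaterial, so that \<open>j\<close> can be
  adapted to each argument. In this form only those sets contribute for which
  \<open>j \<in> G\<close> and \<open>G \<in> U\<close> disagree.\<close>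

lemma chain_divisor_eq:
  assumes bal: "chain_balanced E \<omega>" and j: "j \<in> E" "\<And>H. H \<in> insert E D \<Longrightarrow> j \<in> H \<longleftrightarrow> H \<in> U"
  shows "chain_divisor E U \<omega> D = (\<Sum>G\<in>- D. \<omega> (insert G D) * (of_bool (j \<in> G) - of_bool (G \<in> U)))"
proof -
  let ?P = "\<lambda>j. j \<in> E \<and> (\<forall>H\<in>insert E D. j \<in> H \<longleftrightarrow> H \<in> U)"
  have P: "?P (Eps ?P)" by (rule someI[of ?P j]) (use j in auto)
  have "chain_vec \<omega> D (Eps ?P) = chain_vec \<omega> D j"
    by (rule chain_balancedD[OF bal]) (use P j in auto)
  then show ?thesis unfolding chain_divisor_def
    by (simp add: chain_vec_def right_diff_distrib sum_subtractf)
qed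

lemma chain_divisor_nonzero:
  assumes bal: "chain_balanced E \<omega>" and j: "j \<in> E" "\<And>H. H \<in> insert E D \<Longrightarrow> j \<in> H \<longleftrightarrow> H \<in> U"
    and nz: "chain_divisor E U \<omega> D \<noteq> 0"
  obtains G where "G \<notin> D" "\<omega> (insert G D) \<noteq> 0" "(j \<in> G) \<noteq> (G \<in> U)"
proof -
  have "(\<Sum>G\<in>- D. \<omega> (insert G D) * (of_bool (j \<in> G) - of_bool (G \<in> U))) \<noteq> 0"
    using nz chain_divisor_eq[OF bal j(1), of D U] j(2) by simp
  then obtain G where "G \<in> - D" "\<omega> (insert G D) * (of_bool (j \<in> G) - of_bool (G \<in> U)) \<noteq> 0"
    by (rule sum.not_neutral_contains_not_neutral)
  then show ?thesis using that[of G] by (cases "j \<in> G"; cases "G \<in> U") auto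
qed

lemma chain_divisor_support:
  assumes "chain_divisor E U \<omega> D \<noteq> 0"
  obtains G where "G \<notin> D" "\<omega> (insert G D) \<noteq> 0"
proof (rule ccontr)
  assume "\<not> thesis"
  then have "\<omega> (insert G D) = 0" if "G \<in> - D" for G using that \<open>\<And>G. \<lbrakk>G \<notin> D; \<omega> (insert G D) \<noteq> 0\<rbrakk> \<Longrightarrow> thesis\<close> by auto
  then have "chain_divisor E U \<omega> D = 0" unfolding chain_divisor_def chain_vec_def by simp
  then show False using assms by simp
qed

lemma chain_weight_divisor:
  assumes "chain_weight E (Suc k) \<omega>"
  shows "chain_weight E k (chain_divisor E U \<omega>)"
  unfolding chain_weight_def
proof (intro allI impI)
  fix D assume "chain_divisor E U \<omega> D \<noteq> 0"
  then obtain G where G: "G \<notin> D" "\<omega> (insert G D) \<noteq> 0" by (rule chain_divisor_support)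
  then show "proper_chain E D \<and> Suc (card D) = k"
    using chain_weightD[OF assms G(2)] by (simp add: proper_chain_insert)
qed

lemma chain_divisor_int:
  assumes "\<And>C. \<omega> C \<in> \<int>"
  shows "chain_divisor E U \<omega> D \<in> \<int>"
  unfolding chain_divisor_def chain_vec_def using assms by (intro Ints_diff Ints_sum Ints_mult) auto

text \<open>On the cone of the chain, the functional \<open>x_a - x_b\<close> is dual to the
  generator \<open>e_F\<close>: it vanishes on \<open>e_E\<close> and on the other members.\<close>

lemma dual_pair:
  fixes E :: "'n::finite set"
  assumes D: "proper_chain E D" and F: "F \<in> D"
  obtains a b where "a \<in> F" "b \<in> E - F"
    "\<And>H. H \<in> insert E D \<Longrightarrow> a \<in> H \<longleftrightarrow> F \<subseteq> H" "\<And>H. H \<in> insert E D \<Longrightarrow> b \<in> H \<longleftrightarrow> F \<subset> H"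
proof -
  have "up_set E {H. F \<subseteq> H}" using proper_chainD[OF D F] unfolding up_set_def by auto
  from split_exists[OF D this] obtain a where a: "a \<in> E" "\<forall>H\<in>insert E D. a \<in> H \<longleftrightarrow> F \<subseteq> H" by auto
  have "up_set E {H. F \<subset> H}" using proper_chainD[OF D F] unfolding up_set_def by auto
  from split_exists[OF D this] obtain b where b: "b \<in> E" "\<forall>H\<in>insert E D. b \<in> H \<longleftrightarrow> F \<subset> H" by auto
  show ?thesis by (rule that[of a b]) (use a b F in auto)
qed

text \<open>At \<open>insert F C\<close> the balanced vector is constant on the blocks of the finer
  chain; compared within a block of \<open>C\<close>, it can only jump across \<open>F\<close>. The
  number \<open>c\<close> is its coefficient at \<open>e_F\<close>. If \<open>insert F C\<close> is
  no chain, all weights vanish and \<open>c = 0\<close> is a consistent choice.\<close>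

lemma coefficient_exists:
  assumes wt: "chain_weight E k \<omega>" and bal: "chain_balanced E \<omega>" and F: "F \<notin> C"
  shows "\<exists>c. (\<forall>i\<in>E. \<forall>j\<in>E. (\<forall>H\<in>C. i \<in> H \<longleftrightarrow> j \<in> H) \<longrightarrow>
      chain_vec \<omega> (insert F C) i - chain_vec \<omega> (insert F C) j = c * (of_bool (i \<in> F) - of_bool (j \<in> F))) \<and>
    (\<not> proper_chain E (insert F C) \<longrightarrow> c = 0)"
proof (cases "proper_chain E (insert F C)")
  case False
  have "\<omega> (insert G (insert F C)) = 0" for G
    using False chain_weightD(1)[OF wt, of "insert G (insert F C)"] unfolding proper_chain_insert[of E G] by auto
  then have "chain_vec \<omega> (insert F C) i = 0" for i unfolding chain_vec_def by simp
  then show ?thesis by (intro exI[of _ 0]) simp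
next
  case True
  let ?v = "chain_vec \<omega> (insert F C)"
  obtain a b where ab: "a \<in> F" "b \<in> E - F"
    "\<And>H. H \<in> insert E (insert F C) \<Longrightarrow> a \<in> H \<longleftrightarrow> F \<subseteq> H" "\<And>H. H \<in> insert E (insert F C) \<Longrightarrow> b \<in> H \<longleftrightarrow> F \<subset> H"
    using dual_pair[OF True insertI1] by metis
  have FE: "F \<subset> E" using proper_chainD(2)[OF True insertI1] .
  have main: "?v i = ?v a" "?v j = ?v b"
    if ij: "i \<in> E" "j \<in> E" "\<forall>H\<in>C. i \<in> H \<longleftrightarrow> j \<in> H" "i \<in> F" "j \<notin> F" for i j
  proof -
    have H: "H \<subset> F \<or> F \<subset> H" if "H \<in> C" for H
      using that proper_chainD(3)[OF True insertI1, of H] F by auto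
    have "i \<in> H \<longleftrightarrow> F \<subseteq> H" "j \<in> H \<longleftrightarrow> F \<subset> H" if "H \<in> C" for H
      using H[OF that] ij that by auto
    then have same: "i \<in> H \<longleftrightarrow> a \<in> H" "j \<in> H \<longleftrightarrow> b \<in> H" if "H \<in> insert F C" for H
      using that ab ij by auto
    have "a \<in> E" "b \<in> E" using ab FE by auto
    then show "?v i = ?v a" "?v j = ?v b" using same by (intro chain_balancedD[OF bal] ij; simp)+
  qed
  show ?thesis
  proof (intro exI[of _ "?v a - ?v b"] conjI ballI impI)
    fix i j assume ij: "i \<in> E" "j \<in> E" "\<forall>H\<in>C. i \<in> H \<longleftrightarrow> j \<in> H"
    show "?v i - ?v j = (?v a - ?v b) * (of_bool (i \<in> F) - of_bool (j \<in> F))"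
    proof (cases "i \<in> F \<longleftrightarrow> j \<in> F")
      case True
      then have "?v i = ?v j" using ij by (intro chain_balancedD[OF bal]) auto
      then show ?thesis using True by simp
    next
      case False
      then show ?thesis using main[of i j] main[of j i] ij by (cases "i \<in> F") auto
    qed
  qed (use True in simp)
qed

lemma coefficients:
  assumes wt: "chain_weight E k \<omega>" and bal: "chain_balanced E \<omega>"
  obtains c where "\<And>F i j. F \<notin> C \<Longrightarrow> i \<in> E \<Longrightarrow> j \<in> E \<Longrightarrow> \<forall>H\<in>C. i \<in> H \<longleftrightarrow> j \<in> H \<Longrightarrow>
      chain_vec \<omega> (insert F C) i - chain_vec \<omega> (insert F C) j = c F * (of_bool (i \<in> F) - of_bool (j \<in> F))"
    "\<And>F. F \<notin> C \<Longrightarrow> \<not> proper_chain E (insert F C) \<Longrightarrow> c F = 0"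
proof -
  have "\<forall>F. \<exists>c. F \<notin> C \<longrightarrow> (\<forall>i\<in>E. \<forall>j\<in>E. (\<forall>H\<in>C. i \<in> H \<longleftrightarrow> j \<in> H) \<longrightarrow>
      chain_vec \<omega> (insert F C) i - chain_vec \<omega> (insert F C) j = c * (of_bool (i \<in> F) - of_bool (j \<in> F))) \<and>
    (\<not> proper_chain E (insert F C) \<longrightarrow> c = 0)"
    using coefficient_exists[OF wt bal] by simp
  then obtain c where "\<forall>F. F \<notin> C \<longrightarrow> (\<forall>i\<in>E. \<forall>j\<in>E. (\<forall>H\<in>C. i \<in> H \<longleftrightarrow> j \<in> H) \<longrightarrow>
      chain_vec \<omega> (insert F C) i - chain_vec \<omega> (insert F C) j = c F * (of_bool (i \<in> F) - of_bool (j \<in> F))) \<and>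
    (\<not> proper_chain E (insert F C) \<longrightarrow> c F = 0)" by (rule choice[THEN exE])
  then show ?thesis by (intro that[of c]) simp_all
qed

text \<open>The point is that \<open>j\<close> is adapted to \<open>C\<close> only, so one
  coordinate serves for all \<open>F\<close> at once. Passing to a coordinate adapted to
  \<open>insert F C\<close> costs the correction by \<open>c\<close>.\<close>

lemma chain_divisor_insert:
  assumes wt: "chain_weight E k \<omega>" and bal: "chain_balanced E \<omega>" and U: "up_set E U"
    and j: "j \<in> E" "\<And>H. H \<in> insert E C \<Longrightarrow> j \<in> H \<longleftrightarrow> H \<in> U" and F: "F \<notin> C"
    and c: "\<And>i j. i \<in> E \<Longrightarrow> j \<in> E \<Longrightarrow> \<forall>H\<in>C. i \<in> H \<longleftrightarrow> j \<in> H \<Longrightarrow>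
      chain_vec \<omega> (insert F C) i - chain_vec \<omega> (insert F C) j = c * (of_bool (i \<in> F) - of_bool (j \<in> F))"
    and c0: "\<not> proper_chain E (insert F C) \<Longrightarrow> c = 0"
  shows "chain_divisor E U \<omega> (insert F C) =
    (\<Sum>G\<in>- insert F C. \<omega> (insert G (insert F C)) * (of_bool (j \<in> G) - of_bool (G \<in> U)))
      - (of_bool (j \<in> F) - of_bool (F \<in> U)) * c"
proof (cases "proper_chain E (insert F C)")
  case False
  have "\<omega> (insert G (insert F C)) = 0" for G
    using False chain_weightD(1)[OF wt, of "insert G (insert F C)"] unfolding proper_chain_insert[of E G] by auto
  then show ?thesis using c0[OF False] unfolding chain_divisor_def chain_vec_def by simp
next
  case True
  obtain i where i: "i \<in> E" "\<forall>H\<in>insert E (insert F C). i \<in> H \<longleftrightarrow> H \<in> U"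
    using split_exists[OF True U] by blast
  have "chain_vec \<omega> (insert F C) i - chain_vec \<omega> (insert F C) j = c * (of_bool (i \<in> F) - of_bool (j \<in> F))"
    by (rule c) (use i j in auto)
  moreover have "(i \<in> F) = (F \<in> U)" using i by auto
  ultimately have *: "chain_vec \<omega> (insert F C) i = chain_vec \<omega> (insert F C) j - (of_bool (j \<in> F) - of_bool (F \<in> U)) * c"
    by (simp add: algebra_simps)
  have "chain_divisor E U \<omega> (insert F C) = chain_vec \<omega> (insert F C) i
     - (\<Sum>G\<in>- insert F C. \<omega> (insert G (insert F C)) * of_bool (G \<in> U))"
    using chain_divisor_eq[OF bal i(1), of "insert F C" U] i(2)
    by (simp add: chain_vec_def right_diff_distrib sum_subtractf)
  then show ?thesis unfolding * by (simp add: chain_vec_def right_diff_distrib sum_subtractf)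
qed

text \<open>Both sides run over the ordered pairs of distinct sets outside \<open>C\<close>.\<close>

lemma sum_swap_insert:
  fixes h :: "'n::finite set \<Rightarrow> 'n set \<Rightarrow> real"
  shows "(\<Sum>F\<in>- C. \<Sum>G\<in>- insert F C. h F G) = (\<Sum>G\<in>- C. \<Sum>F\<in>- insert G C. h F G)"
proof -
  have *: "(\<Sum>G\<in>- insert F C. g G) = (\<Sum>G\<in>- C. if G = F then 0 else g G)" for F and g :: "'n set \<Rightarrow> real"
    by (rule sum.mono_neutral_cong_left) auto
  show ?thesis unfolding * by (subst sum.swap) (simp add: eq_commute cong: if_cong)
qed

text \<open>With one coordinate adapted to \<open>C\<close>, the difference of two coordinates of
  the balancing vector becomes a double sum over pairs \<open>F\<close>, \<open>G\<close> minus the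
  corrections. After exchanging the sums, the inner sum is governed by balancing of
  \<open>\<omega>\<close> at \<open>insert G C\<close> and reproduces exactly the
  corrections.\<close>

lemma chain_balanced_divisor:
  assumes wt: "chain_weight E k \<omega>" and bal: "chain_balanced E \<omega>" and U: "up_set E U"
  shows "chain_balanced E (chain_divisor E U \<omega>)"
  unfolding chain_balanced_def
proof (intro allI ballI impI)
  fix C i i' assume ii: "i \<in> E" "i' \<in> E" "\<forall>H\<in>C. i \<in> H \<longleftrightarrow> i' \<in> H"
  let ?w = "chain_divisor E U \<omega>"
  show "chain_vec ?w C i = chain_vec ?w C i'"
  proof (cases "proper_chain E C")
    case False
    have "?w (insert F C) = 0" for F
    proof (rule ccontr)
      assume "?w (insert F C) \<noteq> 0"
      then obtain G where "\<omega> (insert G (insert F C)) \<noteq> 0" by (rule chain_divisor_support)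
      from chain_weightD(1)[OF wt this] show False using False unfolding proper_chain_insert by simp
    qed
    then show ?thesis unfolding chain_vec_def by simp
  next
    case True
    obtain j where j: "j \<in> E" "\<forall>H\<in>insert E C. j \<in> H \<longleftrightarrow> H \<in> U" using split_exists[OF True U] by blast
    obtain c where c: "\<And>F i j. F \<notin> C \<Longrightarrow> i \<in> E \<Longrightarrow> j \<in> E \<Longrightarrow> \<forall>H\<in>C. i \<in> H \<longleftrightarrow> j \<in> H \<Longrightarrow>
        chain_vec \<omega> (insert F C) i - chain_vec \<omega> (insert F C) j = c F * (of_bool (i \<in> F) - of_bool (j \<in> F))"
      "\<And>F. F \<notin> C \<Longrightarrow> \<not> proper_chain E (insert F C) \<Longrightarrow> c F = 0"
      using coefficients[OF wt bal, of C] by metis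
    define \<psi> where "\<psi> G = (of_bool (j \<in> G) - of_bool (G \<in> U) :: real)" for G
    define \<delta> where "\<delta> G = (of_bool (i \<in> G) - of_bool (i' \<in> G) :: real)" for G
    have w: "?w (insert F C) = (\<Sum>G\<in>- insert F C. \<omega> (insert G (insert F C)) * \<psi> G) - \<psi> F * c F" if "F \<in> - C" for F
      unfolding \<psi>_def by (rule chain_divisor_insert[OF wt bal U j(1)]) (use j c that in auto)
    have "chain_vec ?w C i - chain_vec ?w C i' = (\<Sum>F\<in>- C. ?w (insert F C) * \<delta> F)"
      unfolding chain_vec_def \<delta>_def by (simp add: right_diff_distrib sum_subtractf)
    also have "\<dots> = (\<Sum>F\<in>- C. \<Sum>G\<in>- insert F C. \<omega> (insert G (insert F C)) * \<psi> G * \<delta> F) - (\<Sum>F\<in>- C. \<psi> F * c F * \<delta> F)"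
      by (simp add: w left_diff_distrib sum_subtractf sum_distrib_right)
    also have "(\<Sum>F\<in>- C. \<Sum>G\<in>- insert F C. \<omega> (insert G (insert F C)) * \<psi> G * \<delta> F)
        = (\<Sum>G\<in>- C. \<Sum>F\<in>- insert G C. \<omega> (insert G (insert F C)) * \<psi> G * \<delta> F)"
      by (rule sum_swap_insert)
    also have "\<dots> = (\<Sum>G\<in>- C. \<psi> G * (\<Sum>F\<in>- insert G C. \<omega> (insert F (insert G C)) * \<delta> F))"
      by (simp add: sum_distrib_left insert_commute mult_ac)
    also have "\<dots> = (\<Sum>G\<in>- C. \<psi> G * (chain_vec \<omega> (insert G C) i - chain_vec \<omega> (insert G C) i'))"
      unfolding chain_vec_def \<delta>_def by (simp add: right_diff_distrib sum_subtractf)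
    also have "\<dots> = (\<Sum>G\<in>- C. \<psi> G * c G * \<delta> G)"
      by (rule sum.cong) (use c(1)[OF _ ii] in \<open>auto simp: \<delta>_def\<close>)
    finally show ?thesis by simp
  qed
qed

text \<open>Expanded in the same way, the iterated divisor is a sum over pairs weighted by
  \<open>\<phi>\<close> of one set and \<open>\<psi>\<close> of the other, minus the sum of
  \<open>\<phi> F * c F * \<psi> F\<close>. The numbers \<open>c\<close> depend on
  \<open>\<omega>\<close> alone, so the expression is symmetric in the two up-sets.\<close>

lemma chain_divisor_commute:
  assumes wt: "chain_weight E (Suc k) \<omega>" and bal: "chain_balanced E \<omega>" and U: "up_set E U" and V: "up_set E V"
  shows "chain_divisor E U (chain_divisor E V \<omega>) = chain_divisor E V (chain_divisor E U \<omega>)"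
proof
  fix C
  show "chain_divisor E U (chain_divisor E V \<omega>) C = chain_divisor E V (chain_divisor E U \<omega>) C"
  proof (cases "proper_chain E C")
    case False
    have "chain_divisor E U' (chain_divisor E V' \<omega>) C = 0" for U' V'
      using chain_weightD(1)[OF chain_weight_divisor[OF chain_weight_divisor], of E "k - 1" \<omega> U' V' C]
        False wt chain_divisor_support[of E U' "chain_divisor E V' \<omega>" C]
        chain_weightD(1)[OF chain_weight_divisor[OF wt], of V'] by (metis proper_chain_subset subset_insertI)
    then show ?thesis by simp
  next
    case True
    obtain i where i: "i \<in> E" "\<forall>H\<in>insert E C. i \<in> H \<longleftrightarrow> H \<in> U" using split_exists[OF True U] by blast
    obtain j where j: "j \<in> E" "\<forall>H\<in>insert E C. j \<in> H \<longleftrightarrow> H \<in> V" using split_exists[OF True V] by blast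
    obtain c where c: "\<And>F i j. F \<notin> C \<Longrightarrow> i \<in> E \<Longrightarrow> j \<in> E \<Longrightarrow> \<forall>H\<in>C. i \<in> H \<longleftrightarrow> j \<in> H \<Longrightarrow>
        chain_vec \<omega> (insert F C) i - chain_vec \<omega> (insert F C) j = c F * (of_bool (i \<in> F) - of_bool (j \<in> F))"
      "\<And>F. F \<notin> C \<Longrightarrow> \<not> proper_chain E (insert F C) \<Longrightarrow> c F = 0"
      using coefficients[OF wt bal, of C] by metis
    define \<phi> where "\<phi> G = (of_bool (i \<in> G) - of_bool (G \<in> U) :: real)" for G
    define \<psi> where "\<psi> G = (of_bool (j \<in> G) - of_bool (G \<in> V) :: real)" for G
    have u: "chain_divisor E U \<omega> (insert F C) = (\<Sum>G\<in>- insert F C. \<omega> (insert G (insert F C)) * \<phi> G) - \<phi> F * c F" if "F \<in> - C" for F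
      unfolding \<phi>_def by (rule chain_divisor_insert[OF wt bal U i(1)]) (use i c that in auto)
    have v: "chain_divisor E V \<omega> (insert F C) = (\<Sum>G\<in>- insert F C. \<omega> (insert G (insert F C)) * \<psi> G) - \<psi> F * c F" if "F \<in> - C" for F
      unfolding \<psi>_def by (rule chain_divisor_insert[OF wt bal V j(1)]) (use j c that in auto)
    have "chain_divisor E U (chain_divisor E V \<omega>) C = (\<Sum>F\<in>- C. chain_divisor E V \<omega> (insert F C) * \<phi> F)"
      unfolding \<phi>_def by (rule chain_divisor_eq[OF chain_balanced_divisor[OF wt bal V] i(1)]) (use i in auto)
    also have "\<dots> = (\<Sum>F\<in>- C. \<Sum>G\<in>- insert F C. \<omega> (insert G (insert F C)) * \<psi> G * \<phi> F) - (\<Sum>F\<in>- C. \<psi> F * c F * \<phi> F)"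
      by (simp add: v left_diff_distrib sum_subtractf sum_distrib_right)
    also have "(\<Sum>F\<in>- C. \<Sum>G\<in>- insert F C. \<omega> (insert G (insert F C)) * \<psi> G * \<phi> F)
      = (\<Sum>G\<in>- C. \<Sum>F\<in>- insert G C. \<omega> (insert G (insert F C)) * \<psi> G * \<phi> F)"
      by (rule sum_swap_insert)
    also have "\<dots> = (\<Sum>G\<in>- C. \<Sum>F\<in>- insert G C. \<omega> (insert F (insert G C)) * \<phi> F * \<psi> G)"
      by (simp add: insert_commute mult_ac)
    also have "(\<Sum>F\<in>- C. \<psi> F * c F * \<phi> F) = (\<Sum>F\<in>- C. \<phi> F * c F * \<psi> F)"
      by (simp add: mult_ac)
    also have "(\<Sum>G\<in>- C. \<Sum>F\<in>- insert G C. \<omega> (insert F (insert G C)) * \<phi> F * \<psi> G) - (\<Sum>F\<in>- C. \<phi> F * c F * \<psi> F)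
       = (\<Sum>F\<in>- C. chain_divisor E U \<omega> (insert F C) * \<psi> F)"
      by (simp add: u left_diff_distrib sum_subtractf sum_distrib_right)
    also have "\<dots> = chain_divisor E V (chain_divisor E U \<omega>) C"
      unfolding \<psi>_def by (rule chain_divisor_eq[symmetric, OF chain_balanced_divisor[OF wt bal U] j(1)]) (use j in auto)
    finally show ?thesis .
  qed
qed

section \<open>Complete flags of a ranked lattice\<close>

definition flag_weight :: "'n set \<Rightarrow> 'n set set \<Rightarrow> nat \<Rightarrow> 'n set set \<Rightarrow> real" where
  "flag_weight E L r C = of_bool (proper_chain E C \<and> C \<subseteq> L \<and> Suc (card C) = r)"

lemma flag_weight_chain_weight: "chain_weight E r (flag_weight E L r)"
  unfolding chain_weight_def flag_weight_def by auto

context ranked_flats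
begin

lemma rk_proper_chain:
  assumes "proper_chain E C" "C \<subseteq> L"
  shows "rk ` C \<subseteq> {1..<rk E}" "inj_on rk C"
proof -
  show "rk ` C \<subseteq> {1..<rk E}"
  proof
    fix m assume "m \<in> rk ` C"
    then obtain F where F: "F \<in> C" "m = rk F" by auto
    have "rk {} < rk F" "rk F < rk E"
      using assms F proper_chainD[OF assms(1) F(1)] empty_flat ground_flat by (auto intro!: rk_strict)
    then show "m \<in> {1..<rk E}" using F by auto
  qed
  show "inj_on rk C" by (rule rk_inj_on_chain[OF assms(2)]) (use assms(1) in \<open>auto simp: proper_chain_def\<close>)
qed

lemma chain_subset_of_rk:
  assumes "proper_chain E C" "C \<subseteq> L" "F \<in> insert {} (insert E C)" "G \<in> insert {} (insert E C)" "rk F \<le> rk G"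
  shows "F \<subseteq> G"
proof -
  have "F \<in> L" "G \<in> L" using assms empty_flat ground_flat by auto
  moreover have "F \<subseteq> G \<or> G \<subseteq> F" using assms proper_chainD[OF assms(1)] by blast
  ultimately show ?thesis using eq_of_rk_le[of G F] assms(5) by auto
qed

text \<open>A chain one short of a flag misses a single rank \<open>m\<close>; \<open>A\<close> and
  \<open>B\<close> are its neighbours of ranks \<open>m - 1\<close> and \<open>m + 1\<close>, with
  \<open>{}\<close> and \<open>E\<close> allowed, and the refinements are the flats strictly between
  them.\<close>

lemma chain_gap:
  assumes D: "proper_chain E D" "D \<subseteq> L" "Suc (Suc (card D)) = rk E"
  obtains A B where "A \<in> insert {} D" "B \<in> insert E D" "A \<subset> B" "rk B = Suc (Suc (rk A))" "A \<in> L" "B \<in> L"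
    "\<And>H. H \<in> D \<Longrightarrow> H \<subseteq> A \<or> B \<subseteq> H"
    "\<And>G. G \<in> L \<Longrightarrow> G \<notin> D \<Longrightarrow> proper_chain E (insert G D) \<Longrightarrow> A \<subset> G \<and> G \<subset> B"
    "\<And>G. G \<in> L \<Longrightarrow> A \<subset> G \<Longrightarrow> G \<subset> B \<Longrightarrow> G \<notin> D \<and> proper_chain E (insert G D)"
proof -
  note r = rk_proper_chain[OF D(1,2)]
  have "card (rk ` D) = rk E - 2" using card_image[OF r(2)] D(3) by simp
  then have "card ({1..<rk E} - rk ` D) = 1"
    using r(1) D(3) by (subst card_Diff_subset) (auto intro: finite_subset)
  then obtain m where m: "{1..<rk E} - rk ` D = {m}" by (auto simp: card_1_singleton_iff)
  have m1: "1 \<le> m" "m < rk E" "m \<notin> rk ` D" using m by auto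
  have img: "n \<in> rk ` D" if "1 \<le> n" "n < rk E" "n \<noteq> m" for n using that m by auto
  obtain A where A: "A \<in> insert {} D" "rk A = m - 1"
  proof (cases "m = 1")
    case True
    then show ?thesis using that[of "{}"] rk_empty by simp
  next
    case False
    then have "m - 1 \<in> rk ` D" using img[of "m - 1"] m1 by auto
    then obtain H where "m - 1 = rk H" "H \<in> D" by (rule imageE)
    then show ?thesis using that[of H] by simp
  qed
  obtain B where B: "B \<in> insert E D" "rk B = Suc m"
  proof (cases "Suc m = rk E")
    case True
    then show ?thesis using that[of E] by simp
  next
    case False
    then have "Suc m \<in> rk ` D" using img[of "Suc m"] m1 by auto
    then obtain H where "Suc m = rk H" "H \<in> D" by (rule imageE)
    then show ?thesis using that[of H] by simp
  qed
  have AL: "A \<in> L" "B \<in> L" using A B D(2) empty_flat ground_flat by auto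
  have AB: "A \<subset> B"
  proof -
    have "A \<subseteq> B" by (rule chain_subset_of_rk[OF D(1,2)]) (use A B in auto)
    moreover have "A \<noteq> B" using A B by auto
    ultimately show ?thesis by blast
  qed
  have rkH: "H \<subseteq> A \<or> B \<subseteq> H" if "H \<in> D" for H
  proof -
    have "rk H \<noteq> m" using m1 that by auto
    then have "rk H \<le> rk A \<or> rk B \<le> rk H" using A B by auto
    then show ?thesis using chain_subset_of_rk[OF D(1,2), of H A] chain_subset_of_rk[OF D(1,2), of B H] A B that by auto
  qed
  show ?thesis
  proof (rule that[OF A(1) B(1) AB _ AL rkH])
    show "rk B = Suc (Suc (rk A))" using A B m1 by simp
    fix G assume G: "G \<in> L" "G \<notin> D" "proper_chain E (insert G D)"
    have GD: "insert G D \<subseteq> L" using G D by auto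
    note r' = rk_proper_chain[OF G(3) GD]
    have "rk G \<in> {1..<rk E}" using r'(1) by auto
    moreover have "rk G \<notin> rk ` D" using r'(2) G(2) unfolding inj_on_def by blast
    ultimately have "rk G = m" using m by auto
    then show "A \<subset> G \<and> G \<subset> B"
      using chain_subset_of_rk[OF G(3) GD, of A G] chain_subset_of_rk[OF G(3) GD, of G B] A B m1
      by (cases "A = G"; cases "G = B") auto
  next
    fix G assume G: "G \<in> L" "A \<subset> G" "G \<subset> B"
    have "G \<notin> D" using rkH[of G] G by auto
    moreover have "G \<subset> E" using G AL flats_ground by auto
    moreover have "H \<subseteq> G \<or> G \<subseteq> H" if "H \<in> D" for H using rkH[OF that] G by auto
    moreover have "G \<noteq> {}" using G by auto
    ultimately show "G \<notin> D \<and> proper_chain E (insert G D)"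
      unfolding proper_chain_insert using D(1) by simp
  qed
qed

lemma flag_extension:
  assumes K: "proper_chain E K" "K \<subseteq> L" and ne: "E \<noteq> {}"
  obtains C where "K \<subseteq> C" "proper_chain E C" "C \<subseteq> L" "Suc (card C) = rk E"
proof -
  have "insert {} K \<subseteq> {G \<in> L. G \<subset> E}" using K ne empty_flat unfolding proper_chain_def by auto
  moreover have "\<forall>A\<in>insert {} K. \<forall>B\<in>insert {} K. A \<subseteq> B \<or> B \<subseteq> A" using K unfolding proper_chain_def by auto
  ultimately have "\<exists>C. insert {} K \<subseteq> C \<and> C \<subseteq> {G \<in> L. G \<subset> E} \<and> (\<forall>A\<in>C. \<forall>B\<in>C. A \<subseteq> B \<or> B \<subseteq> A) \<and> rk ` C = {..<rk E}"
    by (rule maximal_chain[OF ground_flat])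
  then obtain C where C: "insert {} K \<subseteq> C" "C \<subseteq> {G \<in> L. G \<subset> E}" "\<forall>A\<in>C. \<forall>B\<in>C. A \<subseteq> B \<or> B \<subseteq> A"
    "rk ` C = {..<rk E}" by (elim exE conjE)
  have CL: "C \<subseteq> L" using C(2) by auto
  have "card C = rk E" using card_image[OF rk_inj_on_chain[OF CL C(3)]] C(4) by simp
  moreover have "finite C" using CL finite_flats finite_subset by blast
  ultimately have "Suc (card (C - {{}})) = rk E" using C(1) card_Suc_Diff1[of C "{}"] by simp
  moreover have "proper_chain E (C - {{}})" using C(2,3) unfolding proper_chain_def by auto
  moreover have "K \<subseteq> C - {{}}" using C(1) K unfolding proper_chain_def by auto
  ultimately show ?thesis using that[of "C - {{}}"] CL by auto
qed

lemma unique_extension: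
  assumes "A \<in> L" "i \<in> E - A"
  obtains G where "G \<in> L" "A \<subset> G" "i \<in> G" "rk G = Suc (rk A)" "\<And>H. H \<in> L \<Longrightarrow> A \<subseteq> H \<Longrightarrow> i \<in> H \<Longrightarrow> G \<subseteq> H"
    "\<And>H. H \<in> L \<Longrightarrow> A \<subseteq> H \<Longrightarrow> i \<in> H \<Longrightarrow> rk H = Suc (rk A) \<Longrightarrow> H = G"
proof -
  obtain G where G: "G \<in> L" "A \<subseteq> G" "i \<in> G" "rk G = Suc (rk A)" "\<forall>H\<in>L. A \<subseteq> H \<and> i \<in> H \<longrightarrow> G \<subseteq> H"
    using extend[OF assms] by auto
  show ?thesis
  proof (rule that[OF G(1) _ G(3,4)])
    show "A \<subset> G" using G assms by auto
    show "G \<subseteq> H" if "H \<in> L" "A \<subseteq> H" "i \<in> H" for H using G(5) that by auto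
    show "H = G" if "H \<in> L" "A \<subseteq> H" "i \<in> H" "rk H = Suc (rk A)" for H
      using eq_of_rk_le[OF G(1) that(1)] G(4,5) that by auto
  qed
qed

end

text \<open>In a gap of length two from \<open>A\<close> to \<open>B\<close>, the flats strictly
  between partition \<open>B - A\<close>. So each coordinate there is counted once, while on
  \<open>A\<close> and outside \<open>B\<close> the count is constant anyway.\<close>

lemma flag_weight_balanced:
  fixes E :: "'n::finite set"
  assumes "ranked_flats E L rk"
  shows "chain_balanced E (flag_weight E L (rk E))"
  unfolding chain_balanced_def
proof (intro allI ballI impI)
  interpret ranked_flats E L rk by fact
  let ?w = "flag_weight E L (rk E)"
  fix D i j assume ij: "i \<in> E" "j \<in> E" "\<forall>H\<in>D. (i \<in> H) = (j \<in> H)"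
  show "chain_vec ?w D i = chain_vec ?w D j"
  proof (cases "proper_chain E D \<and> D \<subseteq> L \<and> Suc (Suc (card D)) = rk E")
    case False
    then have "?w (insert G D) = 0" if "G \<in> - D" for G
      using that unfolding flag_weight_def by (auto simp: proper_chain_insert)
    then show ?thesis unfolding chain_vec_def by simp
  next
    case True
    then have D: "proper_chain E D" "D \<subseteq> L" "Suc (Suc (card D)) = rk E" by auto
    obtain A B where AB: "A \<in> insert {} D" "B \<in> insert E D" "A \<subset> B" "rk B = Suc (Suc (rk A))" "A \<in> L" "B \<in> L"
      "\<And>G. G \<in> L \<Longrightarrow> G \<notin> D \<Longrightarrow> proper_chain E (insert G D) \<Longrightarrow> A \<subset> G \<and> G \<subset> B"
      "\<And>G. G \<in> L \<Longrightarrow> A \<subset> G \<Longrightarrow> G \<subset> B \<Longrightarrow> G \<notin> D \<and> proper_chain E (insert G D)"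
      by (rule chain_gap[OF D]) (rule that; assumption)
    have w: "?w (insert G D) = of_bool (G \<in> L \<and> A \<subset> G \<and> G \<subset> B)" if "G \<in> - D" for G
    proof -
      have "Suc (card (insert G D)) = rk E" using that D by simp
      then have "?w (insert G D) = of_bool (proper_chain E (insert G D) \<and> G \<in> L)"
        unfolding flag_weight_def using D by auto
      then show ?thesis using AB(7,8)[of G] that by (auto simp del: of_bool_eq_iff)
    qed
    have A: "i \<in> A \<longleftrightarrow> j \<in> A" "i \<in> B \<longleftrightarrow> j \<in> B" using AB ij by auto
    have vec: "chain_vec ?w D i = (\<Sum>G\<in>- D. of_bool (G \<in> L \<and> A \<subset> G \<and> G \<subset> B \<and> i \<in> G))" for i
      unfolding chain_vec_def by (rule sum.cong) (auto simp: w)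
    have one: "chain_vec ?w D i = 1" if i: "i \<in> B" "i \<notin> A" for i
    proof -
      have iE: "i \<in> E - A" using i AB(6) flats_ground by auto
      obtain G where G: "G \<in> L" "A \<subset> G" "i \<in> G" "rk G = Suc (rk A)" "\<And>H. H \<in> L \<Longrightarrow> A \<subseteq> H \<Longrightarrow> i \<in> H \<Longrightarrow> G \<subseteq> H"
        "\<And>H. H \<in> L \<Longrightarrow> A \<subseteq> H \<Longrightarrow> i \<in> H \<Longrightarrow> rk H = Suc (rk A) \<Longrightarrow> H = G"
        by (rule unique_extension[OF AB(5) iE]) (rule that; assumption)
      have "G \<subseteq> B" by (rule G(5)[OF AB(6) psubset_imp_subset[OF AB(3)] i(1)])
      moreover have "G \<noteq> B" using AB(4) G(4) by auto
      ultimately have GB: "G \<subset> B" by (rule psubsetI)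
      have eq: "H \<in> L \<and> A \<subset> H \<and> H \<subset> B \<and> i \<in> H \<longleftrightarrow> H = G" for H
      proof
        assume H: "H \<in> L \<and> A \<subset> H \<and> H \<subset> B \<and> i \<in> H"
        then have "rk A < rk H" "rk H < rk B" using rk_strict[of A H] rk_strict[of H B] AB(5,6) by simp_all
        then have "rk H = Suc (rk A)" using AB(4) by simp
        then show "H = G" using H by (intro G(6)) (simp_all add: psubset_imp_subset)
      qed (use G(1-3) GB in simp)
      have "G \<notin> D" using AB(8)[OF G(1,2) GB] by auto
      then show ?thesis unfolding vec eq by (simp add: of_bool_def sum.delta)
    qed
    show ?thesis
    proof (cases "i \<in> B \<and> i \<notin> A")
      case True
      then show ?thesis using one A by simp
    next
      case False
      then have "H \<in> L \<and> A \<subset> H \<and> H \<subset> B \<and> i \<in> H \<longleftrightarrow> H \<in> L \<and> A \<subset> H \<and> H \<subset> B \<and> j \<in> H" for H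
        using A by auto
      then show ?thesis unfolding vec by simp
    qed
  qed
qed

section \<open>Unimodular simplicial cones\<close>

text \<open>The integral dual functionals express that \<open>B\<close> is part of a lattice basis,
  in the form in which it is used: faces are their zero sets, and primitive normal vectors are read
  off from their values.\<close>

definition unimodular :: "(real ^ 'n) set \<Rightarrow> bool" where
  "unimodular B \<longleftrightarrow> finite B \<and> B \<subseteq> int_lattice \<and>
     (\<forall>b\<in>B. \<exists>f::real ^ 'n \<Rightarrow> real. linear f \<and> f b = 1 \<and> (\<forall>b'\<in>B - {b}. f b' = 0) \<and>
        (\<forall>w\<in>int_lattice. f w \<in> \<int>))"

lemma convex_cone_sum:
  fixes f :: "'i \<Rightarrow> 'a::real_vector"
  assumes S: "convex_cone S" and "\<And>i. i \<in> I \<Longrightarrow> f i \<in> S"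
  shows "sum f I \<in> S"
  using assms(2) convex_cone_contains_0[OF S]
  by (induction I rule: infinite_finite_induct) (auto intro: convex_cone_add[OF S])

lemma convex_cone_hull_explicit:
  assumes fin: "finite B"
  shows "x \<in> convex_cone hull B \<longleftrightarrow> (\<exists>c. (\<forall>b\<in>B. (0::real) \<le> c b) \<and> x = (\<Sum>b\<in>B. c b *\<^sub>R b))"
proof
  let ?S = "{x. \<exists>c. (\<forall>b\<in>B. (0::real) \<le> c b) \<and> x = (\<Sum>b\<in>B. c b *\<^sub>R b)}"
  have "convex_cone ?S" unfolding convex_cone_iff
  proof (intro conjI ballI allI impI)
    show "0 \<in> ?S" by (intro CollectI exI[of _ "\<lambda>_. 0"]) simp
    fix x assume "x \<in> ?S"
    then obtain c where c: "\<forall>b\<in>B. 0 \<le> c b" "x = (\<Sum>b\<in>B. c b *\<^sub>R b)" by blast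
    show "a *\<^sub>R x \<in> ?S" if "0 \<le> a" for a
      using c that by (intro CollectI exI[of _ "\<lambda>b. a * c b"]) (simp add: scaleR_sum_right)
    fix y assume "y \<in> ?S"
    then obtain d where d: "\<forall>b\<in>B. 0 \<le> d b" "y = (\<Sum>b\<in>B. d b *\<^sub>R b)" by blast
    show "x + y \<in> ?S"
      using c d by (intro CollectI exI[of _ "\<lambda>b. c b + d b"]) (simp add: scaleR_left_distrib sum.distrib)
  qed
  moreover have "B \<subseteq> ?S"
  proof
    fix b assume b: "b \<in> B"
    have "b = (\<Sum>b'\<in>B. (if b' = b then 1 else 0) *\<^sub>R b')"
      using b fin by (simp add: if_distrib[of "\<lambda>c. c *\<^sub>R _"] cong: if_cong)
    then show "b \<in> ?S" by (intro CollectI exI[of _ "\<lambda>b'. if b' = b then 1 else 0"]) simp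
  qed
  ultimately have "convex_cone hull B \<subseteq> ?S" by (intro hull_minimal)
  then show "\<exists>c. (\<forall>b\<in>B. 0 \<le> c b) \<and> x = (\<Sum>b\<in>B. c b *\<^sub>R b)" if "x \<in> convex_cone hull B"
    using that by blast
next
  assume "\<exists>c. (\<forall>b\<in>B. (0::real) \<le> c b) \<and> x = (\<Sum>b\<in>B. c b *\<^sub>R b)"
  then obtain c where c: "\<forall>b\<in>B. (0::real) \<le> c b" "x = (\<Sum>b\<in>B. c b *\<^sub>R b)" by blast
  show "x \<in> convex_cone hull B" unfolding c(2)
    by (rule convex_cone_sum[OF convex_cone_convex_cone_hull])
       (use c(1) in \<open>auto intro: convex_cone_hull_mul hull_inc\<close>)
qed

lemma span_convex_cone_hull: "span (convex_cone hull B) = span (B :: 'a::real_vector set)"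
proof
  have "convex_cone hull B \<subseteq> span B" by (intro hull_minimal span_superset convex_cone_span)
  then show "span (convex_cone hull B) \<subseteq> span B" by (simp add: span_minimal)
  show "span B \<subseteq> span (convex_cone hull B)" by (rule span_mono[OF hull_subset])
qed

lemma unimodular_subset:
  assumes "unimodular B" "A \<subseteq> B"
  shows "unimodular A"
  unfolding unimodular_def
proof (intro conjI ballI)
  show "finite A" "A \<subseteq> int_lattice" using assms finite_subset unfolding unimodular_def by auto
  fix b assume b: "b \<in> A"
  then obtain f :: "real ^ 'a \<Rightarrow> real" where "linear f" "f b = 1" "\<forall>b'\<in>B - {b}. f b' = 0" "\<forall>w\<in>int_lattice. f w \<in> \<int>"
    using assms unfolding unimodular_def by blast
  then show "\<exists>f::real ^ 'a \<Rightarrow> real. linear f \<and> f b = 1 \<and> (\<forall>b'\<in>A - {b}. f b' = 0) \<and> (\<forall>w\<in>int_lattice. f w \<in> \<int>)"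
    using assms(2) by (intro exI[of _ f]) auto
qed

lemma unimodular_dual:
  fixes B :: "(real ^ 'n) set"
  assumes "unimodular B" "b \<in> B"
  obtains f :: "real ^ 'n \<Rightarrow> real" where "linear f" "f b = 1" "\<And>x. x \<in> span (B - {b}) \<Longrightarrow> f x = 0"
    "\<And>w. w \<in> int_lattice \<Longrightarrow> f w \<in> \<int>" "\<And>w. w \<in> span B \<Longrightarrow> w - f w *\<^sub>R b \<in> span (B - {b})"
proof -
  obtain f :: "real ^ 'n \<Rightarrow> real" where f: "linear f" "f b = 1" "\<forall>b'\<in>B - {b}. f b' = 0" "\<forall>w\<in>int_lattice. f w \<in> \<int>"
    using assms unfolding unimodular_def by blast
  have 0: "f x = 0" if "x \<in> span (B - {b})" for x
    by (rule linear_eq_0_on_span[OF f(1) _ that]) (use f(3) in auto)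
  show ?thesis
  proof (rule that[OF f(1,2) 0])
    show "f w \<in> \<int>" if "w \<in> int_lattice" for w using f(4) that by auto
    fix w assume w: "w \<in> span B"
    have "B = insert b (B - {b})" using assms(2) by auto
    then obtain k where k: "w - k *\<^sub>R b \<in> span (B - {b})" using w span_breakdown_eq by metis
    have "f (w - k *\<^sub>R b) = f w - k * f b" using f(1) by (simp add: linear_diff linear_scale)
    then have "f w = k" using 0[OF k] f(2) by simp
    then show "w - f w *\<^sub>R b \<in> span (B - {b})" using k by simp
  qed simp
qed

lemma unimodular_independent: "unimodular B \<Longrightarrow> independent B"
proof
  assume B: "unimodular B" and "dependent B"
  then obtain b where b: "b \<in> B" "b \<in> span (B - {b})" unfolding dependent_def by blast
  show False by (rule unimodular_dual[OF B b(1)]) (use b(2) in force)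
qed

lemma unimodular_dim:
  fixes B :: "(real ^ 'n::finite) set"
  assumes "unimodular B"
  shows "dim (convex_cone hull B) = card B"
proof -
  have "dim (convex_cone hull B) = dim (span (convex_cone hull B))" by simp
  also have "\<dots> = dim (span B)" by (simp only: span_convex_cone_hull)
  also have "\<dots> = card B" using unimodular_independent[OF assms] by (simp add: dim_eq_card_independent)
  finally show ?thesis .
qed

lemma unimodular_aff_dim:
  fixes B :: "(real ^ 'n::finite) set"
  assumes "unimodular B"
  shows "aff_dim (convex_cone hull B) = int (card B)"
proof -
  have "0 \<in> affine hull (convex_cone hull B)" by (rule hull_inc[OF convex_cone_hull_contains_0])
  then show ?thesis using unimodular_dim[OF assms] by (simp add: aff_dim_zero)
qed

text \<open>The functional dual to \<open>b\<close> is nonnegative on the cone and vanishes exactly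
  on the subcone without \<open>b\<close>, which is therefore a face; generators are then removed
  one after another.\<close>

lemma unimodular_subcone_face:
  fixes B :: "(real ^ 'n::finite) set"
  assumes B: "unimodular B" and A: "A \<subseteq> B"
  shows "(convex_cone hull A) face_of (convex_cone hull B)"
proof -
  have finB: "finite B" using B unfolding unimodular_def by auto
  have one: "(convex_cone hull (D - {b})) face_of (convex_cone hull D)" if D: "unimodular D" "b \<in> D"
    for D :: "(real ^ 'n) set" and b
    unfolding face_of_def
  proof (intro conjI ballI impI)
    have finD: "finite D" using D unfolding unimodular_def by auto
    show "convex_cone hull (D - {b}) \<subseteq> convex_cone hull D" by (rule hull_mono) auto
    show "convex (convex_cone hull (D - {b}))" by (rule convex_convex_cone_hull)
    obtain f :: "real ^ 'n \<Rightarrow> real" where f: "linear f" "f b = 1" "\<And>x. x \<in> span (D - {b}) \<Longrightarrow> f x = 0"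
      using unimodular_dual[OF D] by metis
    have vanish: "f x = 0" if "x \<in> convex_cone hull (D - {b})" for x
      by (rule f(3)) (use span_base[OF that] in \<open>simp only: span_convex_cone_hull\<close>)
    have rep: "0 \<le> f x \<and> (f x = 0 \<longrightarrow> x \<in> convex_cone hull (D - {b}))" if xD: "x \<in> convex_cone hull D" for x
    proof -
      obtain c where c: "\<forall>b\<in>D. (0::real) \<le> c b" "x = (\<Sum>b\<in>D. c b *\<^sub>R b)"
        using convex_cone_hull_explicit[OF finD, THEN iffD1, OF xD] by (elim exE conjE)
      have x: "x = c b *\<^sub>R b + (\<Sum>d\<in>D - {b}. c d *\<^sub>R d)"
        unfolding c(2) using finD D(2) by (rule sum.remove)
      have y: "(\<Sum>d\<in>D - {b}. c d *\<^sub>R d) \<in> convex_cone hull (D - {b})"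
      proof (rule convex_cone_sum[OF convex_cone_convex_cone_hull])
        fix d assume "d \<in> D - {b}"
        then show "c d *\<^sub>R d \<in> convex_cone hull (D - {b})"
          using c(1) by (intro convex_cone_hull_mul hull_inc) simp_all
      qed
      have "f (\<Sum>d\<in>D - {b}. c d *\<^sub>R d) = 0" by (rule vanish[OF y])
      then have fx: "f x = c b" unfolding x using f(1,2) by (simp add: linear_add linear_scale)
      show ?thesis
      proof
        show "0 \<le> f x" unfolding fx using c(1) D(2) by simp
        show "f x = 0 \<longrightarrow> x \<in> convex_cone hull (D - {b})"
        proof
          assume "f x = 0"
          then have "x = (\<Sum>d\<in>D - {b}. c d *\<^sub>R d)" using x fx by simp
          then show "x \<in> convex_cone hull (D - {b})" using y by (simp only:)
        qed
      qed
    qed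
    fix p q x assume p: "p \<in> convex_cone hull D" and q: "q \<in> convex_cone hull D"
      and x: "x \<in> convex_cone hull (D - {b})" "x \<in> open_segment p q"
    obtain u where u: "0 < u" "u < 1" "x = (1 - u) *\<^sub>R p + u *\<^sub>R q" using x(2) by (auto simp: in_segment)
    have "f x = (1 - u) * f p + u * f q" unfolding u(3) using f(1) by (simp add: linear_add linear_scale)
    moreover have "f x = 0" by (rule vanish[OF x(1)])
    moreover have "0 \<le> (1 - u) * f p" "0 \<le> u * f q" using u rep[OF p] rep[OF q] by auto
    ultimately have "(1 - u) * f p = 0" "u * f q = 0" by linarith+
    then have "f p = 0" "f q = 0" using u by auto
    then show "p \<in> convex_cone hull (D - {b})" "q \<in> convex_cone hull (D - {b})" using rep[OF p] rep[OF q] by blast+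
  qed
  have "finite X \<Longrightarrow> X \<subseteq> B \<Longrightarrow> (convex_cone hull (B - X)) face_of (convex_cone hull B)" for X
  proof (induction X rule: finite_induct)
    case empty
    then show ?case by (simp add: face_of_refl convex_convex_cone_hull)
  next
    case (insert x X)
    have "(convex_cone hull (B - X - {x})) face_of (convex_cone hull (B - X))"
      using insert unimodular_subset[OF B] by (intro one) auto
    then have "(convex_cone hull (B - X - {x})) face_of (convex_cone hull B)"
      using insert face_of_trans by blast
    moreover have "B - X - {x} = B - insert x X" by auto
    ultimately show ?case by simp
  qed
  from this[of "B - A"] show ?thesis using finB A by (simp add: double_diff)
qed

text \<open>If a point of the face has a positive coefficient at \<open>b\<close>, it is a sum of a
  multiple of \<open>b\<close> and a point of the cone; the face property puts both summands, and
  hence \<open>b\<close>, into the face.\<close>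

lemma unimodular_face:
  fixes B :: "(real ^ 'n::finite) set"
  assumes B: "unimodular B" and T: "T face_of (convex_cone hull B)" "T \<noteq> {}"
  shows "T = convex_cone hull (B \<inter> T)"
proof
  have finB: "finite B" using B unfolding unimodular_def by auto
  have con: "conic T" by (rule face_of_conic[OF conic_convex_cone_hull T(1)])
  have "convex T" using T(1) unfolding face_of_def by auto
  then have cc: "convex_cone T" unfolding convex_cone_def using con T(2) by simp
  show "convex_cone hull (B \<inter> T) \<subseteq> T" by (intro hull_minimal cc) auto
  have face: "p \<in> T \<and> q \<in> T" if "p \<in> convex_cone hull B" "q \<in> convex_cone hull B" "x \<in> T" "x \<in> open_segment p q" for p q x
    using T(1) that unfolding face_of_def by blast
  show "T \<subseteq> convex_cone hull (B \<inter> T)"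
  proof
    fix x assume x: "x \<in> T"
    then have "x \<in> convex_cone hull B" using T(1) unfolding face_of_def by auto
    then obtain c where c: "\<forall>b\<in>B. (0::real) \<le> c b" "x = (\<Sum>b\<in>B. c b *\<^sub>R b)"
      unfolding convex_cone_hull_explicit[OF finB] by blast
    have bT: "b \<in> T" if b: "b \<in> B" "0 < c b" for b
    proof -
      define z where "z = c b *\<^sub>R b"
      define y where "y = (\<Sum>d\<in>B - {b}. c d *\<^sub>R d)"
      have xyz: "x = z + y" unfolding z_def y_def c(2) using finB b(1) by (rule sum.remove)
      have y: "y \<in> convex_cone hull B" unfolding y_def
        by (rule convex_cone_sum[OF convex_cone_convex_cone_hull])
           (use c(1) in \<open>auto intro: convex_cone_hull_mul hull_inc\<close>)
      have z: "z \<in> convex_cone hull B" unfolding z_def using b by (intro convex_cone_hull_mul hull_inc) auto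
      have "z \<in> T"
      proof (cases "y = z")
        case True
        then have "z = (1/2) *\<^sub>R x" unfolding xyz by (simp add: scaleR_2[symmetric])
        then show ?thesis using convex_cone_scaleR[OF cc _ x, of "1/2"] by simp
      next
        case False
        \<comment> \<open>Doubling both summands makes \<open>x\<close> an interior point of a
          segment, which is the form in which faces are defined; coinciding summands were settled
          before.\<close>
        have "x = midpoint (2 *\<^sub>R y) (2 *\<^sub>R z)" unfolding xyz midpoint_def
          by (simp add: scaleR_right_distrib add.commute)
        moreover have "2 *\<^sub>R y \<noteq> 2 *\<^sub>R z" using False by simp
        ultimately have "x \<in> open_segment (2 *\<^sub>R y) (2 *\<^sub>R z)" by (metis midpoint_in_open_segment)
        moreover have "2 *\<^sub>R y \<in> convex_cone hull B" "2 *\<^sub>R z \<in> convex_cone hull B"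
          using y z by (simp_all add: convex_cone_hull_mul)
        ultimately have "2 *\<^sub>R z \<in> T" using face[OF _ _ x] by blast
        from convex_cone_scaleR[OF cc _ this, of "1/2"] show ?thesis by simp
      qed
      from convex_cone_scaleR[OF cc _ this, of "1 / c b"] show ?thesis using b unfolding z_def by simp
    qed
    have "x = (\<Sum>b\<in>B \<inter> T. c b *\<^sub>R b)" unfolding c(2)
    proof (rule sum.mono_neutral_right[OF finB])
      show "\<forall>i\<in>B - B \<inter> T. c i *\<^sub>R i = 0" using bT c(1) by (metis DiffE IntI less_eq_real_def scaleR_zero_left)
    qed auto
    then show "x \<in> convex_cone hull (B \<inter> T)"
      using c(1) finB by (subst convex_cone_hull_explicit) auto
  qed
qed

lemma unimodular_facet_iff:
  fixes B :: "(real ^ 'n::finite) set"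
  assumes B: "unimodular B"
  shows "T facet_of (convex_cone hull B) \<longleftrightarrow> (\<exists>b\<in>B. T = convex_cone hull (B - {b}))"
proof
  have finB: "finite B" using B unfolding unimodular_def by auto
  assume T: "T facet_of (convex_cone hull B)"
  then have T': "T face_of (convex_cone hull B)" "T \<noteq> {}" "aff_dim T = aff_dim (convex_cone hull B) - 1"
    unfolding facet_of_def by auto
  have e: "T = convex_cone hull (B \<inter> T)" by (rule unimodular_face[OF B T'(1,2)])
  have "int (card (B \<inter> T)) = int (card B) - 1"
    using T'(3) e unimodular_aff_dim[OF B] unimodular_aff_dim[OF unimodular_subset[OF B], of "B \<inter> T"] by simp
  then have "card (B - B \<inter> T) = 1" using finB by (subst card_Diff_subset) auto
  then obtain b where b: "B - B \<inter> T = {b}" by (auto simp: card_1_singleton_iff)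
  then have "b \<in> B" "B \<inter> T = B - {b}" by auto
  then show "\<exists>b\<in>B. T = convex_cone hull (B - {b})" using e by auto
next
  have finB: "finite B" using B unfolding unimodular_def by auto
  assume "\<exists>b\<in>B. T = convex_cone hull (B - {b})"
  then obtain b where b: "b \<in> B" "T = convex_cone hull (B - {b})" by blast
  have "aff_dim T = int (card (B - {b}))"
    unfolding b(2) by (rule unimodular_aff_dim[OF unimodular_subset[OF B]]) auto
  moreover have "Suc (card (B - {b})) = card B" by (rule card_Suc_Diff1[OF finB b(1)])
  ultimately have "aff_dim T = aff_dim (convex_cone hull B) - 1"
    unfolding unimodular_aff_dim[OF B] by linarith
  moreover have "T face_of (convex_cone hull B)" unfolding b(2) by (rule unimodular_subcone_face[OF B]) auto
  ultimately show "T facet_of (convex_cone hull B)" unfolding facet_of_def b(2)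
    using convex_cone_hull_nonempty by simp
qed

text \<open>\<open>normal_vector\<close> is an arbitrary choice, so it is known only modulo the span
  of the facet. \<open>b\<close> itself is a representative; for any other representative
  \<open>v\<close>, integrality makes the dual value \<open>f v\<close> a unit, and pointing into
  the cone makes it \<open>1\<close>.\<close>

lemma unimodular_normal_vector:
  fixes B :: "(real ^ 'n::finite) set"
  assumes B: "unimodular B" and b: "b \<in> B"
  shows "normal_vector (convex_cone hull B) (convex_cone hull (B - {b})) - b \<in> span (B - {b})"
proof -
  let ?\<sigma> = "convex_cone hull B" and ?\<tau> = "convex_cone hull (B - {b})"
  have finB: "finite B" using B unfolding unimodular_def by auto
  obtain f :: "real ^ 'n \<Rightarrow> real" where f: "linear f" "f b = 1" "\<And>x. x \<in> span (B - {b}) \<Longrightarrow> f x = 0"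
    "\<And>w. w \<in> int_lattice \<Longrightarrow> f w \<in> \<int>" "\<And>w. w \<in> span B \<Longrightarrow> w - f w *\<^sub>R b \<in> span (B - {b})"
    using unimodular_dual[OF B b] by metis
  have bl: "b \<in> int_lattice" using B b unfolding unimodular_def by auto
  have "represents_normal ?\<sigma> ?\<tau> b" unfolding represents_normal_def span_convex_cone_hull
  proof (intro conjI ballI)
    show "b \<in> span B \<inter> int_lattice" using b bl span_base by auto
    show "\<exists>x\<in>?\<sigma>. b - x \<in> span (B - {b})" using b by (intro bexI[of _ b]) (auto simp: span_zero hull_inc)
    fix w assume w: "w \<in> span B \<inter> int_lattice"
    then have "f w \<in> \<int>" using f(4) by blast
    then obtain m where "f w = of_int m" by (auto elim: Ints_cases)
    then show "\<exists>m. w - of_int m *\<^sub>R b \<in> span (B - {b})" using f(5)[of w] w by (intro exI[of _ m]) simp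
  qed
  then have "represents_normal ?\<sigma> ?\<tau> (normal_vector ?\<sigma> ?\<tau>)" unfolding normal_vector_def by (rule someI)
  then obtain v where v: "v = normal_vector ?\<sigma> ?\<tau>" "represents_normal ?\<sigma> ?\<tau> v" by simp
  have v2: "v \<in> span B" "v \<in> int_lattice" "\<And>w. w \<in> span B \<Longrightarrow> w \<in> int_lattice \<Longrightarrow> \<exists>m::int. w - of_int m *\<^sub>R v \<in> span (B - {b})"
    "\<exists>x\<in>?\<sigma>. v - x \<in> span (B - {b})"
    using v(2) unfolding represents_normal_def span_convex_cone_hull by auto
  obtain m :: int where "b - of_int m *\<^sub>R v \<in> span (B - {b})" using v2(3)[of b] b bl span_base by blast
  from f(3)[OF this] have m: "of_int m * f v = 1" using f(1,2) by (simp add: linear_diff linear_scale)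
  obtain n :: int where n: "f v = of_int n" using f(4)[OF v2(2)] by (auto elim: Ints_cases)
  have "m * n = 1" using m n by (metis of_int_eq_1_iff of_int_mult)
  obtain x where x: "x \<in> ?\<sigma>" "v - x \<in> span (B - {b})" using v2(4) by blast
  have "f v = f x" using f(3)[OF x(2)] f(1) by (simp add: linear_diff)
  moreover have "0 \<le> f x"
  proof -
    obtain c where c: "\<forall>b\<in>B. (0::real) \<le> c b" "x = (\<Sum>b\<in>B. c b *\<^sub>R b)"
      using x(1) unfolding convex_cone_hull_explicit[OF finB] by blast
    have "f x = (\<Sum>b\<in>B. c b * f b)" unfolding c(2) using f(1) by (simp add: linear_sum linear_scale)
    also have "\<dots> \<ge> 0"
    proof (rule sum_nonneg)
      fix b' assume b': "b' \<in> B"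
      have "f b' = (if b' = b then 1 else 0)" using f(2,3) b' by (auto intro: span_base)
      then show "0 \<le> c b' * f b'" using c(1) b' by auto
    qed
    finally show ?thesis .
  qed
  ultimately have "n \<ge> 0" using n by simp
  then have "n = 1" using \<open>m * n = 1\<close> by (metis pos_zmult_eq_1_iff zmult_eq_1_iff mult.commute not_one_le_zero neg_0_le_iff_le)
  then show ?thesis using f(5)[OF v2(1)] n v(1) by simp
qed

lemma linear_extension_eq:
  assumes L: "linear L" "\<And>x. x \<in> \<sigma> \<Longrightarrow> \<phi> x = L x" and v: "v \<in> span \<sigma>"
  shows "linear_extension \<phi> \<sigma> v = L v"
proof -
  have "linear (linear_extension \<phi> \<sigma>) \<and> (\<forall>x\<in>\<sigma>. linear_extension \<phi> \<sigma> x = \<phi> x)"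
    unfolding linear_extension_def by (rule someI[of _ L]) (use L in auto)
  then show ?thesis using linear_eq_on_span[OF _ L(1) _ v, of "linear_extension \<phi> \<sigma>"] L(2) by auto
qed

lemma linear_vec_nth: "linear (\<lambda>x::real ^ 'n. x $ i)"
  by (rule bounded_linear.linear[OF bounded_linear_vec_nth])

section \<open>Cones spanned by chains of subsets\<close>

text \<open>The value \<open>s = 0\<close> stands for the cone without a multiple of
  \<open>e_E\<close>, the common facet of the cones with \<open>s = 1\<close> and
  \<open>s = -1\<close>.\<close>

definition chain_gens :: "'n set \<Rightarrow> 'n set set \<Rightarrow> real \<Rightarrow> (real ^ 'n) set" where
  "chain_gens E C s = char_vec ` C \<union> (if s = 0 then {} else {s *\<^sub>R char_vec E})"

definition chain_cone :: "'n::finite set \<Rightarrow> 'n set set \<Rightarrow> real \<Rightarrow> (real ^ 'n) set" where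
  "chain_cone E C s = convex_cone hull chain_gens E C s"

lemma char_vec_nth [simp]: "char_vec F $ i = of_bool (i \<in> F)"
  unfolding char_vec_def by simp

lemma char_vec_inj: "char_vec F = char_vec G \<longleftrightarrow> F = G"
  by (auto simp: vec_eq_iff of_bool_def split: if_splits)

lemma char_vec_lattice: "char_vec F \<in> int_lattice"
  unfolding int_lattice_def by (simp add: of_bool_def)

lemma inj_char_vec: "inj_on char_vec C"
  unfolding inj_on_def by (simp add: char_vec_inj)

lemma scaled_ground_notin:
  assumes "proper_chain E C" "E \<noteq> {}" "s \<in> {-1, 1}"
  shows "s *\<^sub>R char_vec E \<notin> char_vec ` C"
proof
  assume "s *\<^sub>R char_vec E \<in> char_vec ` C"
  then obtain F where F: "F \<in> C" "s *\<^sub>R char_vec E = char_vec F" by auto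
  obtain i where i: "i \<in> E - F" using proper_chainD(2)[OF assms(1) F(1)] by blast
  have "(s *\<^sub>R char_vec E) $ i = char_vec F $ i" using F(2) by simp
  then show False using i assms(3) by auto
qed

lemma top_element:
  fixes E :: "'n::finite set"
  assumes "proper_chain E C" "E \<noteq> {}"
  obtains i where "i \<in> E" "\<And>H. H \<in> C \<Longrightarrow> i \<notin> H"
proof -
  have "up_set E {F. E \<subseteq> F}" using assms(2) unfolding up_set_def by auto
  from split_exists[OF assms(1) this] obtain j where j: "j \<in> E" "\<forall>H\<in>insert E C. j \<in> H \<longleftrightarrow> E \<subseteq> H" by auto
  show ?thesis by (rule that[OF j(1)]) (use j proper_chainD(2)[OF assms(1)] in auto)
qed

text \<open>The dual functionals are coordinate differences from \<open>dual_pair\<close> for the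
  members of the chain, and \<open>s\<close> times a coordinate outside all members for
  \<open>s *\<^sub>R char_vec E\<close>.\<close>

lemma chain_gens_unimodular:
  fixes E :: "'n::finite set"
  assumes C: "proper_chain E C" and E: "E \<noteq> {}" and s: "s \<in> {-1, 0, 1}"
  shows "unimodular (chain_gens E C s)"
  unfolding unimodular_def
proof (intro conjI ballI)
  show "finite (chain_gens E C s)" unfolding chain_gens_def by simp
  have "s *\<^sub>R char_vec E \<in> int_lattice" using s unfolding int_lattice_def by (auto simp: of_bool_def)
  then show "chain_gens E C s \<subseteq> int_lattice" unfolding chain_gens_def using char_vec_lattice by auto
  fix b assume b: "b \<in> chain_gens E C s"
  show "\<exists>f::real ^ 'n \<Rightarrow> real. linear f \<and> f b = 1 \<and> (\<forall>b'\<in>chain_gens E C s - {b}. f b' = 0) \<and> (\<forall>w\<in>int_lattice. f w \<in> \<int>)"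
  proof (cases "b \<in> char_vec ` C")
    case True
    then obtain F where F: "F \<in> C" "b = char_vec F" by auto
    obtain a d where ad: "a \<in> F" "d \<in> E - F"
      "\<And>H. H \<in> insert E C \<Longrightarrow> a \<in> H \<longleftrightarrow> F \<subseteq> H" "\<And>H. H \<in> insert E C \<Longrightarrow> d \<in> H \<longleftrightarrow> F \<subset> H"
      using dual_pair[OF C F(1)] by metis
    let ?f = "\<lambda>x::real ^ 'n. x $ a - x $ d"
    have aE: "a \<in> E" using ad proper_chainD(2)[OF C F(1)] by auto
    have "?f b' = 0" if b': "b' \<in> chain_gens E C s - {b}" for b'
    proof (cases "b' \<in> char_vec ` C")
      case True
      then obtain H where H: "H \<in> C" "b' = char_vec H" by auto
      then have "H \<noteq> F" using b' F by auto
      then have "a \<in> H \<longleftrightarrow> d \<in> H" using ad(3)[of H] ad(4)[of H] H by auto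
      then show ?thesis using H by simp
    next
      case False
      then have "b' = s *\<^sub>R char_vec E" using b' unfolding chain_gens_def by (auto split: if_splits)
      then show ?thesis using aE ad by simp
    qed
    moreover have "linear ?f" by (intro linear_compose_sub linear_vec_nth)
    moreover have "?f b = 1" using F ad by simp
    moreover have "\<forall>w\<in>int_lattice. ?f w \<in> \<int>" unfolding int_lattice_def by auto
    ultimately show ?thesis by (intro exI[of _ ?f]) simp
  next
    case False
    then have bs: "s \<noteq> 0" "b = s *\<^sub>R char_vec E" using b unfolding chain_gens_def by (auto split: if_splits)
    obtain i where i: "i \<in> E" "\<And>H. H \<in> C \<Longrightarrow> i \<notin> H" using top_element[OF C E] by metis
    let ?f = "\<lambda>x::real ^ 'n. s * x $ i"
    have "linear (\<lambda>x::real ^ 'n. s *\<^sub>R (x $ i))" by (intro linear_compose_scale_right linear_vec_nth)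
    then have "linear ?f" by simp
    moreover have "?f b = 1" using bs i s by auto
    moreover have "\<forall>b'\<in>chain_gens E C s - {b}. ?f b' = 0" using i(2) bs unfolding chain_gens_def by auto
    moreover have "\<forall>w\<in>int_lattice. ?f w \<in> \<int>" using s unfolding int_lattice_def by auto
    ultimately show ?thesis by (intro exI[of _ ?f]) simp
  qed
qed

lemma card_chain_gens:
  fixes E :: "'n::finite set"
  assumes "proper_chain E C" "E \<noteq> {}" "s \<in> {-1, 0, 1}"
  shows "card (chain_gens E C s) = card C + of_bool (s \<noteq> 0)"
  using scaled_ground_notin[OF assms(1,2), of s] assms(3) card_image[OF inj_char_vec, of C]
  unfolding chain_gens_def by auto

lemma chain_cone_explicit:
  fixes E :: "'n::finite set"
  assumes "proper_chain E C" "E \<noteq> {}" "s \<in> {-1, 0, 1}"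
  shows "x \<in> chain_cone E C s \<longleftrightarrow>
    (\<exists>c m. (\<forall>F\<in>C. (0::real) \<le> c F) \<and> 0 \<le> m \<and> x = (\<Sum>F\<in>C. c F *\<^sub>R char_vec F) + (m * s) *\<^sub>R char_vec E)"
proof
  have fin: "finite (chain_gens E C s)" unfolding chain_gens_def by simp
  assume "x \<in> chain_cone E C s"
  then obtain c where c: "\<forall>b\<in>chain_gens E C s. (0::real) \<le> c b" "x = (\<Sum>b\<in>chain_gens E C s. c b *\<^sub>R b)"
    unfolding chain_cone_def convex_cone_hull_explicit[OF fin] by blast
  have im: "(\<Sum>b\<in>char_vec ` C. c b *\<^sub>R b) = (\<Sum>F\<in>C. c (char_vec F) *\<^sub>R char_vec F)"
    by (simp add: sum.reindex[OF inj_char_vec])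
  show "\<exists>c m. (\<forall>F\<in>C. (0::real) \<le> c F) \<and> 0 \<le> m \<and> x = (\<Sum>F\<in>C. c F *\<^sub>R char_vec F) + (m * s) *\<^sub>R char_vec E"
  proof (cases "s = 0")
    case True
    then have "chain_gens E C s = char_vec ` C" unfolding chain_gens_def by simp
    then show ?thesis using c im True by (intro exI[of _ "\<lambda>F. c (char_vec F)"] exI[of _ 0]) simp
  next
    case False
    then have g: "chain_gens E C s = insert (s *\<^sub>R char_vec E) (char_vec ` C)" unfolding chain_gens_def by auto
    have "s *\<^sub>R char_vec E \<notin> char_vec ` C" by (rule scaled_ground_notin) (use assms False in auto)
    then show ?thesis using c im unfolding g
      by (intro exI[of _ "\<lambda>F. c (char_vec F)"] exI[of _ "c (s *\<^sub>R char_vec E)"]) (simp add: add.commute)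
  qed
next
  assume "\<exists>c m. (\<forall>F\<in>C. (0::real) \<le> c F) \<and> 0 \<le> m \<and> x = (\<Sum>F\<in>C. c F *\<^sub>R char_vec F) + (m * s) *\<^sub>R char_vec E"
  then obtain c m where c: "\<forall>F\<in>C. (0::real) \<le> c F" "0 \<le> m" "x = (\<Sum>F\<in>C. c F *\<^sub>R char_vec F) + (m * s) *\<^sub>R char_vec E"
    by blast
  have 1: "(\<Sum>F\<in>C. c F *\<^sub>R char_vec F) \<in> chain_cone E C s" unfolding chain_cone_def
  proof (rule convex_cone_sum[OF convex_cone_convex_cone_hull])
    fix F assume "F \<in> C"
    then show "c F *\<^sub>R char_vec F \<in> convex_cone hull chain_gens E C s"
      using c(1) by (intro convex_cone_hull_mul hull_inc) (auto simp: chain_gens_def)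
  qed
  have "(m * s) *\<^sub>R char_vec E \<in> chain_cone E C s"
  proof (cases "s = 0")
    case True
    then show ?thesis unfolding chain_cone_def by (simp add: convex_cone_hull_contains_0)
  next
    case False
    then have "s *\<^sub>R char_vec E \<in> chain_cone E C s" unfolding chain_cone_def chain_gens_def by (intro hull_inc) auto
    then have "m *\<^sub>R (s *\<^sub>R char_vec E) \<in> chain_cone E C s"
      using convex_cone_hull_mul[OF _ c(2)] unfolding chain_cone_def by blast
    then show ?thesis by (simp only: scaleR_scaleR)
  qed
  then show "x \<in> chain_cone E C s" unfolding c(3) using 1 unfolding chain_cone_def by (intro convex_cone_hull_add)
qed

section \<open>Recovering the chain from a point of its cone\<close>

lemma chain_cone_coord:
  fixes c :: "'n::finite set \<Rightarrow> real"
  shows "((\<Sum>F\<in>C. c F *\<^sub>R char_vec F) + m *\<^sub>R char_vec E) $ i = (\<Sum>F\<in>C. c F * of_bool (i \<in> F)) + m * of_bool (i \<in> E)"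
  by simp

text \<open>All members containing \<open>a\<close> contain \<open>F\<close>, so the coordinate
  \<open>a\<close> is minimal on \<open>F\<close>; outside \<open>F\<close> the positive coefficient
  of \<open>F\<close> itself is lost. Hence the coordinate at \<open>a\<close> is the threshold that
  cuts out \<open>F\<close>.\<close>

lemma superlevel_of_chain:
  fixes E :: "'n::finite set"
  assumes C: "proper_chain E C" and c: "\<And>F. F \<in> C \<Longrightarrow> 0 \<le> c F" and F: "F \<in> C" "0 < c F"
    and x: "x = (\<Sum>F\<in>C. c F *\<^sub>R char_vec F) + m *\<^sub>R char_vec E"
  shows "\<exists>l. F = {i \<in> E. l \<le> x $ i}"
proof -
  obtain a where a: "a \<in> F" "\<And>H. H \<in> insert E C \<Longrightarrow> a \<in> H \<longleftrightarrow> F \<subseteq> H" using dual_pair[OF C F(1)] by metis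
  have FE: "F \<subset> E" using proper_chainD(2)[OF C F(1)] .
  have up: "x $ a \<le> x $ i" if i: "i \<in> F" for i
  proof -
    have "(\<Sum>H\<in>C. c H * of_bool (a \<in> H)) \<le> (\<Sum>H\<in>C. c H * of_bool (i \<in> H))"
      by (rule sum_mono) (use a(2) i c in auto)
    then show ?thesis unfolding x chain_cone_coord using i a(1) FE by auto
  qed
  have down: "x $ i < x $ a" if i: "i \<in> E - F" for i
  proof -
    have "(\<Sum>H\<in>C. c H * of_bool (i \<in> H)) < (\<Sum>H\<in>C. c H * of_bool (a \<in> H))"
    proof (rule sum_strict_mono_ex1)
      have "i \<in> H \<Longrightarrow> F \<subseteq> H" if "H \<in> C" for H using proper_chainD(3)[OF C F(1) that] i by auto
      then show "\<forall>H\<in>C. c H * of_bool (i \<in> H) \<le> c H * of_bool (a \<in> H)" using a(2) c by auto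
      show "\<exists>H\<in>C. c H * of_bool (i \<in> H) < c H * of_bool (a \<in> H)" using F a i by (intro bexI[of _ F]) auto
    qed simp
    then show ?thesis unfolding x chain_cone_coord using i a(1) FE by auto
  qed
  have "F = {i \<in> E. x $ a \<le> x $ i}" using up down FE by (auto simp: not_less[symmetric])
  then show ?thesis by blast
qed

text \<open>If no member contained \<open>i\<close> and omitted \<open>j\<close>, then
  \<open>i\<close> would not have the larger coordinate. So members separate every element of
  \<open>F\<close> from every element outside, and the union of the members inside \<open>F\<close>
  is \<open>F\<close>.\<close>

lemma chain_of_superlevel:
  fixes E :: "'n::finite set"
  assumes C: "proper_chain E C" and c: "\<And>F. F \<in> C \<Longrightarrow> 0 \<le> c F"
    and x: "x = (\<Sum>F\<in>C. c F *\<^sub>R char_vec F) + m *\<^sub>R char_vec E"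
    and F: "F = {i \<in> E. l \<le> x $ i}" "F \<noteq> {}" "F \<subset> E"
  shows "F \<in> C"
proof -
  have sep: "\<exists>H\<in>C. i \<in> H \<and> j \<notin> H" if ij: "i \<in> F" "j \<in> E - F" for i j
  proof (rule ccontr)
    assume "\<not> (\<exists>H\<in>C. i \<in> H \<and> j \<notin> H)"
    then have "(\<Sum>H\<in>C. c H * of_bool (i \<in> H)) \<le> (\<Sum>H\<in>C. c H * of_bool (j \<in> H))"
      by (intro sum_mono) (use c in auto)
    then have "x $ i \<le> x $ j" unfolding x chain_cone_coord using ij F(3) by auto
    then show False using ij unfolding F(1) by auto
  qed
  define A where "A = {H \<in> C. H \<subseteq> F}"
  have "i \<in> \<Union> A" if i: "i \<in> F" for i
  proof (rule ccontr)
    assume n: "i \<notin> \<Union> A"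
    define B where "B = {H \<in> C. i \<in> H}"
    obtain j where "j \<in> E - F" using F(3) by auto
    then have "B \<noteq> {}" using sep[OF i] unfolding B_def by auto
    then have "\<Inter> B \<in> B" using Union_chain_mem(2)[of B] proper_chainD(3)[OF C] unfolding B_def by auto
    then have "\<not> \<Inter> B \<subseteq> F" "\<Inter> B \<subseteq> E" using n proper_chainD(2)[OF C] unfolding A_def B_def by auto
    then obtain j where j: "j \<in> \<Inter> B" "j \<in> E - F" by auto
    then show False using sep[OF i j(2)] unfolding B_def by auto
  qed
  then have "\<Union> A = F" unfolding A_def by auto
  moreover have "A \<noteq> {}" using calculation F(2) by auto
  ultimately have "F \<in> A" using Union_chain_mem(1)[of A] proper_chainD(3)[OF C] unfolding A_def by auto
  then show ?thesis unfolding A_def by auto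
qed

text \<open>Some element of \<open>E\<close> lies in no member; the minimal coordinate therefore
  reveals the coefficient of \<open>e_E\<close> and with it the sign of the cone.\<close>

lemma chain_cone_min:
  fixes E :: "'n::finite set"
  assumes C: "proper_chain E C" "E \<noteq> {}" and c: "\<And>F. F \<in> C \<Longrightarrow> 0 \<le> c F"
    and x: "x = (\<Sum>F\<in>C. c F *\<^sub>R char_vec F) + m *\<^sub>R char_vec E"
  shows "\<forall>i\<in>E. m \<le> x $ i" "\<exists>i\<in>E. x $ i = m"
proof -
  have "0 \<le> (\<Sum>F\<in>C. c F * of_bool (i \<in> F))" for i using c by (intro sum_nonneg) auto
  then show "\<forall>i\<in>E. m \<le> x $ i" unfolding x chain_cone_coord by auto
  obtain i where "i \<in> E" "\<And>H. H \<in> C \<Longrightarrow> i \<notin> H" using top_element[OF C] by metis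
  then show "\<exists>i\<in>E. x $ i = m" unfolding x chain_cone_coord by (intro bexI[of _ i]) auto
qed

text \<open>Members with positive coefficient are superlevel sets and the coefficient at
  \<open>e_E\<close> is the minimal coordinate. Both depend on the point only, so a common point
  uses common generators only.\<close>

lemma chain_cone_inter:
  fixes E :: "'n::finite set"
  assumes C: "proper_chain E C" and C': "proper_chain E C'" and E: "E \<noteq> {}" and s: "s \<in> {-1, 0, 1}" "s' \<in> {-1, 0, 1}"
  shows "chain_cone E C s \<inter> chain_cone E C' s' = chain_cone E (C \<inter> C') (if s = s' then s else 0)"
proof
  show "chain_cone E (C \<inter> C') (if s = s' then s else 0) \<subseteq> chain_cone E C s \<inter> chain_cone E C' s'"
    unfolding chain_cone_def by (intro Int_greatest hull_mono) (auto simp: chain_gens_def)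
  show "chain_cone E C s \<inter> chain_cone E C' s' \<subseteq> chain_cone E (C \<inter> C') (if s = s' then s else 0)"
  proof
    fix x assume x: "x \<in> chain_cone E C s \<inter> chain_cone E C' s'"
    obtain c m where c: "\<forall>F\<in>C. (0::real) \<le> c F" "0 \<le> m" "x = (\<Sum>F\<in>C. c F *\<^sub>R char_vec F) + (m * s) *\<^sub>R char_vec E"
      using x chain_cone_explicit[OF C E s(1)] by auto
    obtain d n where d: "\<forall>F\<in>C'. (0::real) \<le> d F" "0 \<le> n" "x = (\<Sum>F\<in>C'. d F *\<^sub>R char_vec F) + (n * s') *\<^sub>R char_vec E"
      using x chain_cone_explicit[OF C' E s(2)] by auto
    have "m * s = n * s'"
      using chain_cone_min[OF C E _ c(3)] chain_cone_min[OF C' E _ d(3)] c(1) d(1) by (metis order.antisym)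
    have z: "c F = 0" if F: "F \<in> C - C'" for F
    proof (rule ccontr)
      assume "c F \<noteq> 0"
      then have "0 < c F" using c(1) F by (simp add: less_le)
      then obtain l where l: "F = {i \<in> E. l \<le> x $ i}" using superlevel_of_chain[OF C _ _ _ c(3), of F] c(1) F by auto
      have "F \<in> C'" by (rule chain_of_superlevel[OF C' _ d(3) l]) (use d(1) proper_chainD[OF C] F in auto)
      then show False using F by auto
    qed
    have sum: "(\<Sum>F\<in>C. c F *\<^sub>R char_vec F) = (\<Sum>F\<in>C \<inter> C'. c F *\<^sub>R char_vec F)"
      by (rule sum.mono_neutral_right) (use z in auto)
    show "x \<in> chain_cone E (C \<inter> C') (if s = s' then s else 0)"
    proof (subst chain_cone_explicit[OF proper_chain_subset[OF C] E])
      have "m * s = m * (if s = s' then s else 0)"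
      proof (cases "s = s'")
        case False
        then have "m * s = 0" using \<open>m * s = n * s'\<close> s c(2) d(2) by (auto simp: add_nonneg_eq_0_iff)
        then show ?thesis using False by simp
      qed simp
      then show "\<exists>c m'. (\<forall>F\<in>C \<inter> C'. 0 \<le> c F) \<and> 0 \<le> m' \<and>
          x = (\<Sum>F\<in>C \<inter> C'. c F *\<^sub>R char_vec F) + (m' * (if s = s' then s else 0)) *\<^sub>R char_vec E"
        using c sum by (intro exI[of _ c] exI[of _ m]) simp
    qed (use s in auto)
  qed
qed

lemma chain_cone_dim:
  fixes E :: "'n::finite set"
  assumes "proper_chain E C" "E \<noteq> {}" "s \<in> {-1, 0, 1}"
  shows "dim (chain_cone E C s) = card C + of_bool (s \<noteq> 0)"
  unfolding chain_cone_def unimodular_dim[OF chain_gens_unimodular[OF assms]] card_chain_gens[OF assms] ..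

text \<open>Equal cones equal their intersection, and counting dimensions leaves no generator
  outside the common ones.\<close>

lemma chain_cone_inj:
  fixes E :: "'n::finite set"
  assumes C: "proper_chain E C" and C': "proper_chain E C'" and E: "E \<noteq> {}" and s: "s \<in> {-1, 0, 1}" "s' \<in> {-1, 0, 1}"
    and eq: "chain_cone E C s = chain_cone E C' s'"
  shows "C = C' \<and> s = s'"
proof -
  have *: "D \<subseteq> D' \<and> (t = 0 \<or> t = t')"
    if "proper_chain E D" "proper_chain E D'" "t \<in> {-1, 0, 1}" "t' \<in> {-1, 0, 1}" "chain_cone E D t = chain_cone E D' t'" for D D' t t'
  proof -
    have "chain_cone E D t = chain_cone E (D \<inter> D') (if t = t' then t else 0)"
      using chain_cone_inter[OF that(1,2) E that(3,4)] that(5) by simp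
    then have "card D + of_bool (t \<noteq> 0) = card (D \<inter> D') + of_bool ((if t = t' then t else 0) \<noteq> 0)"
      using chain_cone_dim[OF that(1) E that(3)]
        chain_cone_dim[OF proper_chain_subset[OF that(1), of "D \<inter> D'"] E, of "if t = t' then t else 0"] that(3) by auto
    moreover have "card (D \<inter> D') \<le> card D" by (intro card_mono) auto
    ultimately have "card (D \<inter> D') = card D" "t = 0 \<or> t = t'" by (cases "t = 0"; cases "t = t'"; simp)+
    moreover from this have "D \<inter> D' = D" by (intro card_subset_eq) auto
    ultimately show ?thesis by auto
  qed
  show ?thesis using *[OF C C' s eq] *[OF C' C s(2,1) eq[symmetric]] by auto
qed

lemma chain_cone_facet:
  fixes E :: "'n::finite set"
  assumes C: "proper_chain E C" "E \<noteq> {}" and s: "s \<in> {-1, 1}"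
  shows "T facet_of chain_cone E C s \<longleftrightarrow> T = chain_cone E C 0 \<or> (\<exists>F\<in>C. T = chain_cone E (C - {F}) s)"
proof -
  have s': "s \<in> {-1, 0, 1}" using s by auto
  have n: "s *\<^sub>R char_vec E \<notin> char_vec ` C" by (rule scaled_ground_notin[OF C s])
  have 1: "chain_gens E C s - {s *\<^sub>R char_vec E} = chain_gens E C 0" using n s unfolding chain_gens_def by auto
  have 2: "chain_gens E C s - {char_vec F} = chain_gens E (C - {F}) s" if "F \<in> C" for F
    using n that unfolding chain_gens_def by (auto simp: char_vec_inj)
  have g: "chain_gens E C s = insert (s *\<^sub>R char_vec E) (char_vec ` C)" using s unfolding chain_gens_def by auto
  have "T facet_of chain_cone E C s \<longleftrightarrow> (\<exists>b\<in>chain_gens E C s. T = convex_cone hull (chain_gens E C s - {b}))"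
    unfolding chain_cone_def by (rule unimodular_facet_iff[OF chain_gens_unimodular[OF C s']])
  also have "\<dots> \<longleftrightarrow> T = convex_cone hull (chain_gens E C s - {s *\<^sub>R char_vec E}) \<or>
      (\<exists>F\<in>C. T = convex_cone hull (chain_gens E C s - {char_vec F}))" unfolding g by simp
  also have "\<dots> \<longleftrightarrow> T = chain_cone E C 0 \<or> (\<exists>F\<in>C. T = chain_cone E (C - {F}) s)"
    unfolding chain_cone_def 1 using 2 by simp
  finally show ?thesis .
qed

lemma chain_cone_normal:
  fixes E :: "'n::finite set"
  assumes C: "proper_chain E (insert G D)" "E \<noteq> {}" "G \<notin> D" and s: "s \<in> {-1, 1}"
  shows "normal_vector (chain_cone E (insert G D) s) (chain_cone E D s) - char_vec G \<in> span (chain_cone E D s)"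
proof -
  have s': "s \<in> {-1, 0, 1}" using s by auto
  have n: "s *\<^sub>R char_vec E \<notin> char_vec ` insert G D" by (rule scaled_ground_notin[OF C(1,2) s])
  have 2: "chain_gens E (insert G D) s - {char_vec G} = chain_gens E D s"
    using n C(3) unfolding chain_gens_def by (auto simp: char_vec_inj)
  have "char_vec G \<in> chain_gens E (insert G D) s" unfolding chain_gens_def by simp
  from unimodular_normal_vector[OF chain_gens_unimodular[OF C(1,2) s'] this]
  show ?thesis unfolding 2 chain_cone_def span_convex_cone_hull .
qed

lemma chain_cone_normal_ground:
  fixes E :: "'n::finite set"
  assumes C: "proper_chain E C" "E \<noteq> {}" and s: "s \<in> {-1, 1}"
  shows "normal_vector (chain_cone E C s) (chain_cone E C 0) - s *\<^sub>R char_vec E \<in> span (chain_cone E C 0)"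
proof -
  have s': "s \<in> {-1, 0, 1}" using s by auto
  have n: "s *\<^sub>R char_vec E \<notin> char_vec ` C" by (rule scaled_ground_notin[OF C s])
  have 1: "chain_gens E C s - {s *\<^sub>R char_vec E} = chain_gens E C 0" using n s unfolding chain_gens_def by auto
  have "s *\<^sub>R char_vec E \<in> chain_gens E C s" using s unfolding chain_gens_def by auto
  from unimodular_normal_vector[OF chain_gens_unimodular[OF C s'] this]
  show ?thesis unfolding 1 chain_cone_def span_convex_cone_hull .
qed

text \<open>Subtracting \<open>e_F\<close> times the jump of the vector across \<open>F\<close>
  leaves a vector constant on the coarser blocks of the chain without \<open>F\<close>.\<close>

lemma block_constant_in_span:
  fixes E :: "'n::finite set" and x :: "real ^ 'n"
  assumes D: "proper_chain E D" and out: "\<And>i. i \<notin> E \<Longrightarrow> x $ i = 0"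
    and blocks: "\<And>i j. i \<in> E \<Longrightarrow> j \<in> E \<Longrightarrow> \<forall>H\<in>D. i \<in> H \<longleftrightarrow> j \<in> H \<Longrightarrow> x $ i = x $ j"
  shows "x \<in> span (char_vec ` insert E D)"
proof -
  have "finite D" by simp
  then show ?thesis using assms
  proof (induction D arbitrary: x rule: finite_induct)
    case empty
    show ?case
    proof (cases "E = {}")
      case True
      then have "x = 0" using empty.prems by (simp add: vec_eq_iff)
      then show ?thesis by (simp add: span_zero)
    next
      case False
      then obtain j where j: "j \<in> E" by auto
      have "x = (x $ j) *\<^sub>R char_vec E"
        using empty.prems(2) empty.prems(3)[OF _ j] by (auto simp: vec_eq_iff)
      then show ?thesis by (metis image_eqI insertI1 span_base span_scale)
    qed
  next
    case (insert F D)
    obtain a b where ab: "a \<in> F" "b \<in> E - F"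
      "\<And>H. H \<in> insert E (insert F D) \<Longrightarrow> a \<in> H \<longleftrightarrow> F \<subseteq> H" "\<And>H. H \<in> insert E (insert F D) \<Longrightarrow> b \<in> H \<longleftrightarrow> F \<subset> H"
      using dual_pair[OF insert.prems(1) insertI1] by metis
    have FE: "F \<subset> E" using proper_chainD(2)[OF insert.prems(1) insertI1] .
    define y where "y = x - (x $ a - x $ b) *\<^sub>R char_vec F"
    have cross: "x $ i = x $ a \<and> x $ j = x $ b"
      if ij: "i \<in> E" "j \<in> E" "\<forall>H\<in>D. i \<in> H \<longleftrightarrow> j \<in> H" "i \<in> F" "j \<notin> F" for i j
    proof -
      have H: "H \<subset> F \<or> F \<subset> H" if "H \<in> D" for H
        using that proper_chainD(3)[OF insert.prems(1) insertI1, of H] insert.hyps by auto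
      have "i \<in> H \<longleftrightarrow> F \<subseteq> H" "j \<in> H \<longleftrightarrow> F \<subset> H" if "H \<in> D" for H
        using H[OF that] ij that by auto
      then have same: "i \<in> H \<longleftrightarrow> a \<in> H" "j \<in> H \<longleftrightarrow> b \<in> H" if "H \<in> insert F D" for H
        using that ab ij by auto
      have "a \<in> E" "b \<in> E" using ab FE by auto
      then show ?thesis using same ij by (intro conjI insert.prems(3)) auto
    qed
    have "y \<in> span (char_vec ` insert E D)"
    proof (rule insert.IH)
      show "proper_chain E D" by (rule proper_chain_subset[OF insert.prems(1)]) auto
      show "y $ i = 0" if "i \<notin> E" for i using that insert.prems(2) FE unfolding y_def by auto
      fix i j assume ij: "i \<in> E" "j \<in> E" "\<forall>H\<in>D. i \<in> H \<longleftrightarrow> j \<in> H"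
      show "y $ i = y $ j"
      proof (cases "i \<in> F \<longleftrightarrow> j \<in> F")
        case True
        then have "x $ i = x $ j" using ij by (intro insert.prems(3)) auto
        then show ?thesis using True unfolding y_def by simp
      next
        case False
        then show ?thesis using cross[of i j] cross[of j i] ij unfolding y_def by (cases "i \<in> F") auto
      qed
    qed
    then have "y \<in> span (char_vec ` insert E (insert F D))" by (rule subsetD[OF span_mono, rotated]) auto
    moreover have "(x $ a - x $ b) *\<^sub>R char_vec F \<in> span (char_vec ` insert E (insert F D))"
      by (intro span_scale span_base) auto
    ultimately have "y + (x $ a - x $ b) *\<^sub>R char_vec F \<in> span (char_vec ` insert E (insert F D))" by (rule span_add)
    then show ?case unfolding y_def by simp
  qed
qed

section \<open>Fans of chain weights\<close>

text \<open>Both cones \<open>s = 1\<close> and \<open>s = -1\<close> of a chain carry the same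
  weight, as in the affine Bergman fan. The description by \<open>THE\<close> is sound for nonempty
  \<open>E\<close> by \<open>chain_cone_inj\<close>.\<close>

definition fan_of :: "'n::finite set \<Rightarrow> ('n set set \<Rightarrow> real) \<Rightarrow> 'n wfan" where
  "fan_of E \<omega> \<sigma> = (if \<exists>C s. proper_chain E C \<and> s \<in> {-1, 1} \<and> \<sigma> = chain_cone E C s
     then \<omega> (THE C. \<exists>s\<in>{-1, 1}. proper_chain E C \<and> \<sigma> = chain_cone E C s) else 0)"

lemma fan_of_cone:
  fixes E :: "'n::finite set"
  assumes E: "E \<noteq> {}" and C: "proper_chain E C" and s: "s \<in> {-1, 1}"
  shows "fan_of E \<omega> (chain_cone E C s) = \<omega> C"
proof -
  have "(THE C'. \<exists>t\<in>{-1, 1}. proper_chain E C' \<and> chain_cone E C s = chain_cone E C' t) = C"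
  proof (rule the_equality)
    show "\<exists>t\<in>{-1, 1}. proper_chain E C \<and> chain_cone E C s = chain_cone E C t" using C s by blast
    fix C' assume "\<exists>t\<in>{-1, 1}. proper_chain E C' \<and> chain_cone E C s = chain_cone E C' t"
    then obtain t where t: "t \<in> {-1, 1}" "proper_chain E C'" "chain_cone E C s = chain_cone E C' t" by blast
    show "C' = C" using chain_cone_inj[OF C t(2) E _ _ t(3)] s t(1) by auto
  qed
  then show ?thesis unfolding fan_of_def using C s by auto
qed

lemma fan_of_nonzero:
  fixes E :: "'n::finite set"
  assumes E: "E \<noteq> {}" and wt: "chain_weight E k \<omega>"
  shows "fan_of E \<omega> \<sigma> \<noteq> 0 \<longleftrightarrow> (\<exists>C s. s \<in> {-1, 1} \<and> \<omega> C \<noteq> 0 \<and> \<sigma> = chain_cone E C s)"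
proof
  assume nz: "fan_of E \<omega> \<sigma> \<noteq> 0"
  then obtain C s where C: "proper_chain E C" "s \<in> {-1, 1}" "\<sigma> = chain_cone E C s"
    unfolding fan_of_def by (auto split: if_splits)
  then show "\<exists>C s. s \<in> {-1, 1} \<and> \<omega> C \<noteq> 0 \<and> \<sigma> = chain_cone E C s"
    using nz fan_of_cone[OF E C(1,2), of \<omega>] by metis
next
  assume "\<exists>C s. s \<in> {-1, 1} \<and> \<omega> C \<noteq> 0 \<and> \<sigma> = chain_cone E C s"
  then obtain C s where C: "s \<in> {-1, 1}" "\<omega> C \<noteq> 0" "\<sigma> = chain_cone E C s" by blast
  then show "fan_of E \<omega> \<sigma> \<noteq> 0" using fan_of_cone[OF E chain_weightD(1)[OF wt C(2)] C(1), of \<omega>] by simp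
qed

section \<open>Facets, stars and balancing\<close>

lemma fan_cones_fan_of:
  fixes E :: "'n::finite set"
  assumes E: "E \<noteq> {}" and wt: "chain_weight E k \<omega>"
  shows "fan_cones (fan_of E \<omega>) = {chain_cone E C s |C s. s \<in> {-1, 1} \<and> \<omega> C \<noteq> 0}"
  unfolding fan_cones_def using fan_of_nonzero[OF E wt] by auto

lemma cones_around_side:
  fixes E :: "'n::finite set"
  assumes E: "E \<noteq> {}" and wt: "chain_weight E k \<omega>" and D: "proper_chain E D" and s: "s \<in> {-1, 1}"
  shows "cones_around (fan_of E \<omega>) (chain_cone E D s) =
    (\<lambda>G. chain_cone E (insert G D) s) ` {G. G \<notin> D \<and> \<omega> (insert G D) \<noteq> 0}"
proof (intro equalityI subsetI)
  fix \<sigma> assume "\<sigma> \<in> cones_around (fan_of E \<omega>) (chain_cone E D s)"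
  then obtain C t where C: "t \<in> {-1, 1}" "\<omega> C \<noteq> 0" "\<sigma> = chain_cone E C t" and f: "chain_cone E D s facet_of \<sigma>"
    unfolding cones_around_def fan_cones_fan_of[OF E wt] by blast
  have Cp: "proper_chain E C" by (rule chain_weightD(1)[OF wt C(2)])
  consider "chain_cone E D s = chain_cone E C 0" | F where "F \<in> C" "chain_cone E D s = chain_cone E (C - {F}) t"
    using f unfolding C(3) chain_cone_facet[OF Cp E C(1)] by blast
  then show "\<sigma> \<in> (\<lambda>G. chain_cone E (insert G D) s) ` {G. G \<notin> D \<and> \<omega> (insert G D) \<noteq> 0}"
  proof cases
    case 1
    have "s = 0" using chain_cone_inj[OF D Cp E _ _ 1] s by auto
    then show ?thesis using s by auto
  next
    case 2
    have "D = C - {F} \<and> s = t"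
      using chain_cone_inj[OF D proper_chain_subset[OF Cp, of "C - {F}"] E _ _ 2(2)] s C(1) by auto
    then have "insert F D = C" "F \<notin> D" "s = t" using 2(1) by auto
    then show ?thesis using C(2,3) by (intro image_eqI[of _ _ F]) auto
  qed
next
  fix \<sigma> assume "\<sigma> \<in> (\<lambda>G. chain_cone E (insert G D) s) ` {G. G \<notin> D \<and> \<omega> (insert G D) \<noteq> 0}"
  then obtain G where G: "G \<notin> D" "\<omega> (insert G D) \<noteq> 0" "\<sigma> = chain_cone E (insert G D) s" by auto
  have Cp: "proper_chain E (insert G D)" by (rule chain_weightD(1)[OF wt G(2)])
  have "D = insert G D - {G}" using G(1) by auto
  then have "chain_cone E D s facet_of \<sigma>" unfolding G(3) chain_cone_facet[OF Cp E s] by (metis insertI1)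
  then show "\<sigma> \<in> cones_around (fan_of E \<omega>) (chain_cone E D s)"
    unfolding cones_around_def fan_cones_fan_of[OF E wt] using G s by blast
qed

lemma cones_around_zero:
  fixes E :: "'n::finite set"
  assumes E: "E \<noteq> {}" and wt: "chain_weight E k \<omega>" and C: "proper_chain E C"
  shows "cones_around (fan_of E \<omega>) (chain_cone E C 0) =
    (if \<omega> C = 0 then {} else {chain_cone E C 1, chain_cone E C (-1)})"
proof (intro equalityI subsetI)
  fix \<sigma> assume "\<sigma> \<in> cones_around (fan_of E \<omega>) (chain_cone E C 0)"
  then obtain C' t where C': "t \<in> {-1, 1}" "\<omega> C' \<noteq> 0" "\<sigma> = chain_cone E C' t" and f: "chain_cone E C 0 facet_of \<sigma>"
    unfolding cones_around_def fan_cones_fan_of[OF E wt] by blast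
  have Cp: "proper_chain E C'" by (rule chain_weightD(1)[OF wt C'(2)])
  consider "chain_cone E C 0 = chain_cone E C' 0" | F where "F \<in> C'" "chain_cone E C 0 = chain_cone E (C' - {F}) t"
    using f unfolding C'(3) chain_cone_facet[OF Cp E C'(1)] by blast
  then show "\<sigma> \<in> (if \<omega> C = 0 then {} else {chain_cone E C 1, chain_cone E C (-1)})"
  proof cases
    case 1
    have "C = C'" using chain_cone_inj[OF C Cp E _ _ 1] by auto
    then show ?thesis using C' by auto
  next
    case 2
    have "0 = t" using chain_cone_inj[OF C proper_chain_subset[OF Cp, of "C' - {F}"] E _ _ 2(2)] C'(1) by auto
    then show ?thesis using C'(1) by auto
  qed
next
  fix \<sigma> assume a: "\<sigma> \<in> (if \<omega> C = 0 then {} else {chain_cone E C 1, chain_cone E C (-1)})"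
  then have w: "\<omega> C \<noteq> 0" by (auto split: if_splits)
  obtain s where s: "s \<in> {-1, 1}" "\<sigma> = chain_cone E C s" using a w by auto
  have "chain_cone E C 0 facet_of \<sigma>" unfolding s(2) chain_cone_facet[OF C E s(1)] by simp
  then show "\<sigma> \<in> cones_around (fan_of E \<omega>) (chain_cone E C 0)"
    unfolding cones_around_def fan_cones_fan_of[OF E wt] using s w by blast
qed

text \<open>Codimension one occurs in two ways: a chain member is dropped and the sign kept, or the
  multiple of \<open>e_E\<close> is dropped, in which case only the two opposite cones of the same
  chain meet.\<close>

lemma cones_around_cases:
  fixes E :: "'n::finite set"
  assumes E: "E \<noteq> {}" and wt: "chain_weight E k \<omega>" and ne: "cones_around (fan_of E \<omega>) \<tau> \<noteq> {}"
  obtains (side) D s where "proper_chain E D" "s \<in> {-1, 1}" "\<tau> = chain_cone E D s"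
    | (zero) C where "proper_chain E C" "\<tau> = chain_cone E C 0"
proof -
  obtain C t where C: "t \<in> {-1, 1}" "\<omega> C \<noteq> 0" and f: "\<tau> facet_of chain_cone E C t"
    using ne unfolding cones_around_def fan_cones_fan_of[OF E wt] by blast
  have Cp: "proper_chain E C" by (rule chain_weightD(1)[OF wt C(2)])
  consider "\<tau> = chain_cone E C 0" | F where "F \<in> C" "\<tau> = chain_cone E (C - {F}) t"
    using f unfolding chain_cone_facet[OF Cp E C(1)] by blast
  then show ?thesis
  proof cases
    case 1 then show ?thesis using zero Cp by blast
  next
    case 2 then show ?thesis using side[OF proper_chain_subset[OF Cp, of "C - {F}"] C(1)] by auto
  qed
qed

lemma span_chain_cone:
  assumes "s \<in> {-1, 1}"
  shows "span (chain_cone E D s) = span (char_vec ` insert E D)"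
  unfolding chain_cone_def span_convex_cone_hull
proof (rule span_eq[THEN iffD2], intro conjI)
  have g: "chain_gens E D s = insert (s *\<^sub>R char_vec E) (char_vec ` D)" using assms unfolding chain_gens_def by auto
  show "chain_gens E D s \<subseteq> span (char_vec ` insert E D)" unfolding g by (auto intro: span_base span_scale)
  have "s *\<^sub>R s *\<^sub>R char_vec E \<in> span (chain_gens E D s)" unfolding g by (intro span_scale span_base) simp
  moreover have "s * s = 1" using assms by auto
  ultimately have "char_vec E \<in> span (chain_gens E D s)" by simp
  then show "char_vec ` insert E D \<subseteq> span (chain_gens E D s)" unfolding g by (auto intro: span_base)
qed

lemma balanced_vector_in_span:
  fixes E :: "'n::finite set"
  assumes wt: "chain_weight E k \<omega>" and bal: "chain_balanced E \<omega>" and D: "proper_chain E D"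
  shows "(\<Sum>G\<in>- D. \<omega> (insert G D) *\<^sub>R char_vec G) \<in> span (char_vec ` insert E D)"
proof (rule block_constant_in_span[OF D])
  have v: "(\<Sum>G\<in>- D. \<omega> (insert G D) *\<^sub>R char_vec G) $ i = chain_vec \<omega> D i" for i
    unfolding chain_vec_def by simp
  show "(\<Sum>G\<in>- D. \<omega> (insert G D) *\<^sub>R char_vec G) $ i = 0" if "i \<notin> E" for i
  proof -
    have "\<omega> (insert G D) * of_bool (i \<in> G) = 0" for G
      using chain_weightD(1)[OF wt, of "insert G D"] that by (auto simp: proper_chain_insert)
    then show ?thesis unfolding v chain_vec_def by (intro sum.neutral) simp
  qed
  show "(\<Sum>G\<in>- D. \<omega> (insert G D) *\<^sub>R char_vec G) $ i = (\<Sum>G\<in>- D. \<omega> (insert G D) *\<^sub>R char_vec G) $ j"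
    if "i \<in> E" "j \<in> E" "\<forall>H\<in>D. i \<in> H \<longleftrightarrow> j \<in> H" for i j
    unfolding v using that by (intro chain_balancedD[OF bal]) auto
qed

lemma sum_cones_around_side:
  fixes E :: "'n::finite set" and h :: "(real ^ 'n) set \<Rightarrow> 'v::real_vector"
  assumes E: "E \<noteq> {}" and wt: "chain_weight E k \<omega>" and D: "proper_chain E D" and s: "s \<in> {-1, 1}"
  shows "(\<Sum>\<sigma>\<in>cones_around (fan_of E \<omega>) (chain_cone E D s). fan_of E \<omega> \<sigma> *\<^sub>R h \<sigma>) =
    (\<Sum>G\<in>- D. \<omega> (insert G D) *\<^sub>R h (chain_cone E (insert G D) s))"
proof -
  let ?A = "{G. G \<notin> D \<and> \<omega> (insert G D) \<noteq> 0}"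
  have Cp: "proper_chain E (insert G D)" if "G \<in> ?A" for G using that chain_weightD(1)[OF wt] by auto
  have inj: "inj_on (\<lambda>G. chain_cone E (insert G D) s) ?A"
  proof (rule inj_onI)
    fix G H assume GH: "G \<in> ?A" "H \<in> ?A" "chain_cone E (insert G D) s = chain_cone E (insert H D) s"
    have "insert G D = insert H D" using chain_cone_inj[OF Cp[OF GH(1)] Cp[OF GH(2)] E _ _ GH(3)] s by auto
    then show "G = H" using GH by auto
  qed
  have "(\<Sum>\<sigma>\<in>cones_around (fan_of E \<omega>) (chain_cone E D s). fan_of E \<omega> \<sigma> *\<^sub>R h \<sigma>)
    = (\<Sum>G\<in>?A. fan_of E \<omega> (chain_cone E (insert G D) s) *\<^sub>R h (chain_cone E (insert G D) s))"
    unfolding cones_around_side[OF assms] sum.reindex[OF inj] by simp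
  also have "\<dots> = (\<Sum>G\<in>?A. \<omega> (insert G D) *\<^sub>R h (chain_cone E (insert G D) s))"
    by (rule sum.cong) (use fan_of_cone[OF E Cp s] in auto)
  also have "\<dots> = (\<Sum>G\<in>- D. \<omega> (insert G D) *\<^sub>R h (chain_cone E (insert G D) s))"
    by (rule sum.mono_neutral_left) auto
  finally show ?thesis .
qed

lemma side_normal:
  fixes E :: "'n::finite set"
  assumes E: "E \<noteq> {}" and wt: "chain_weight E k \<omega>" and s: "s \<in> {-1, 1}" and G: "G \<notin> D" "\<omega> (insert G D) \<noteq> 0"
  shows "normal_vector (chain_cone E (insert G D) s) (chain_cone E D s) - char_vec G \<in> span (chain_cone E D s)"
  by (rule chain_cone_normal[OF chain_weightD(1)[OF wt G(2)] E G(1) s])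

lemma side_sum_in_span:
  fixes E :: "'n::finite set"
  assumes E: "E \<noteq> {}" and wt: "chain_weight E k \<omega>" and bal: "chain_balanced E \<omega>"
    and D: "proper_chain E D" and s: "s \<in> {-1, 1}"
  shows "(\<Sum>G\<in>- D. \<omega> (insert G D) *\<^sub>R normal_vector (chain_cone E (insert G D) s) (chain_cone E D s))
    \<in> span (chain_cone E D s)"
proof -
  let ?n = "\<lambda>G. normal_vector (chain_cone E (insert G D) s) (chain_cone E D s)"
  have "(\<Sum>G\<in>- D. \<omega> (insert G D) *\<^sub>R (?n G - char_vec G)) \<in> span (chain_cone E D s)"
  proof (rule span_sum)
    fix G assume "G \<in> - D"
    then show "\<omega> (insert G D) *\<^sub>R (?n G - char_vec G) \<in> span (chain_cone E D s)"
      using side_normal[OF E wt s, of G D] by (cases "\<omega> (insert G D) = 0") (auto intro: span_scale span_zero)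
  qed
  moreover have "(\<Sum>G\<in>- D. \<omega> (insert G D) *\<^sub>R char_vec G) \<in> span (chain_cone E D s)"
    unfolding span_chain_cone[OF s] by (rule balanced_vector_in_span[OF wt bal D])
  ultimately have "(\<Sum>G\<in>- D. \<omega> (insert G D) *\<^sub>R (?n G - char_vec G)) + (\<Sum>G\<in>- D. \<omega> (insert G D) *\<^sub>R char_vec G)
    \<in> span (chain_cone E D s)" by (rule span_add)
  then show ?thesis by (simp add: sum.distrib[symmetric] scaleR_right_distrib[symmetric])
qed

lemma zero_sum_in_span:
  fixes E :: "'n::finite set"
  assumes E: "E \<noteq> {}" and C: "proper_chain E C"
  shows "w *\<^sub>R normal_vector (chain_cone E C 1) (chain_cone E C 0) +
    w *\<^sub>R normal_vector (chain_cone E C (-1)) (chain_cone E C 0) \<in> span (chain_cone E C 0)"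
proof -
  let ?p = "normal_vector (chain_cone E C 1) (chain_cone E C 0)" and ?m = "normal_vector (chain_cone E C (-1)) (chain_cone E C 0)"
  have "?p - 1 *\<^sub>R char_vec E \<in> span (chain_cone E C 0)" "?m - (-1) *\<^sub>R char_vec E \<in> span (chain_cone E C 0)"
    by (rule chain_cone_normal_ground[OF C E]; simp)+
  then have "(?p - 1 *\<^sub>R char_vec E) + (?m - (-1) *\<^sub>R char_vec E) \<in> span (chain_cone E C 0)" by (rule span_add)
  then have "?p + ?m \<in> span (chain_cone E C 0)" by simp
  then have "w *\<^sub>R (?p + ?m) \<in> span (chain_cone E C 0)" by (rule span_scale)
  then show ?thesis by (simp add: scaleR_right_distrib)
qed

lemma chain_cone_pm_neq:
  fixes E :: "'n::finite set"
  assumes "E \<noteq> {}" "proper_chain E C"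
  shows "chain_cone E C 1 \<noteq> chain_cone E C (-1)"
  using chain_cone_inj[OF assms(2,2,1), of 1 "-1"] by auto

text \<open>At a facet missing a chain member, balancing is \<open>chain_balanced\<close>, since the
  normal vectors differ from the \<open>e_G\<close> by vectors in the span of the facet. At the
  other facets the generators \<open>e_E\<close> and \<open>-e_E\<close> cancel.\<close>

lemma tropical_fan_fan_of:
  fixes E :: "'n::finite set"
  assumes E: "E \<noteq> {}" and wt: "chain_weight E k \<omega>" and bal: "chain_balanced E \<omega>" and int: "\<And>C. \<omega> C \<in> \<int>"
  shows "tropical_fan k (fan_of E \<omega>)"
  unfolding tropical_fan_def
proof (intro conjI ballI allI impI)
  let ?X = "fan_of E \<omega>"
  note cones = fan_cones_fan_of[OF E wt]
  have "fan_cones ?X \<subseteq> (\<lambda>(C, s). chain_cone E C s) ` (UNIV \<times> {-1, 1})" unfolding cones by auto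
  then show "finite (fan_cones ?X)" by (rule finite_subset) simp
  fix \<sigma> assume "\<sigma> \<in> fan_cones ?X"
  then obtain C s where C: "s \<in> {-1, 1}" "\<omega> C \<noteq> 0" "\<sigma> = chain_cone E C s" unfolding cones by blast
  have Cp: "proper_chain E C" "Suc (card C) = k" using chain_weightD[OF wt C(2)] by auto
  have s0: "s \<in> {-1, 0, 1}" "s \<noteq> 0" using C(1) by auto
  have uni: "unimodular (chain_gens E C s)" by (rule chain_gens_unimodular[OF Cp(1) E s0(1)])
  show "rational_cone \<sigma>" unfolding rational_cone_def C(3) chain_cone_def
    using uni unfolding unimodular_def by blast
  show "dim \<sigma> = k" unfolding C(3) chain_cone_dim[OF Cp(1) E s0(1)] using Cp(2) s0 by simp
  show "?X \<sigma> \<in> \<int>" unfolding C(3) fan_of_cone[OF E Cp(1) C(1)] by (rule int)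
  fix \<sigma>' assume "\<sigma>' \<in> fan_cones ?X"
  then obtain C' s' where C': "s' \<in> {-1, 1}" "\<omega> C' \<noteq> 0" "\<sigma>' = chain_cone E C' s'" unfolding cones by blast
  have Cp': "proper_chain E C'" using chain_weightD[OF wt C'(2)] by auto
  have s0': "s' \<in> {-1, 0, 1}" "s' \<noteq> 0" using C'(1) by auto
  have uni': "unimodular (chain_gens E C' s')" by (rule chain_gens_unimodular[OF Cp' E s0'(1)])
  have I: "\<sigma> \<inter> \<sigma>' = chain_cone E (C \<inter> C') (if s = s' then s else 0)"
    unfolding C(3) C'(3) by (rule chain_cone_inter[OF Cp(1) Cp' E s0(1) s0'(1)])
  show "(\<sigma> \<inter> \<sigma>') face_of \<sigma>" unfolding I unfolding C(3) chain_cone_def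
    by (rule unimodular_subcone_face[OF uni]) (auto simp: chain_gens_def)
  show "(\<sigma> \<inter> \<sigma>') face_of \<sigma>'" unfolding I unfolding C'(3) chain_cone_def
    by (rule unimodular_subcone_face[OF uni']) (auto simp: chain_gens_def)
next
  fix \<tau> assume ne: "cones_around (fan_of E \<omega>) \<tau> \<noteq> {}"
  then show "balanced_at (fan_of E \<omega>) \<tau>"
  proof (cases rule: cones_around_cases[OF E wt ne])
    case (1 D s)
    show ?thesis unfolding balanced_at_def 1(3) sum_cones_around_side[OF E wt 1(1,2)]
      by (rule side_sum_in_span[OF E wt bal 1(1,2)])
  next
    case (2 C)
    have w: "\<omega> C \<noteq> 0" using ne unfolding 2(2) cones_around_zero[OF E wt 2(1)] by (auto split: if_splits)
    then have a: "cones_around (fan_of E \<omega>) \<tau> = {chain_cone E C 1, chain_cone E C (-1)}"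
      unfolding 2(2) cones_around_zero[OF E wt 2(1)] by simp
    show ?thesis unfolding balanced_at_def a
      using zero_sum_in_span[OF E 2(1), of "\<omega> C"] chain_cone_pm_neq[OF E 2(1)]
        fan_of_cone[OF E 2(1), of 1 \<omega>] fan_of_cone[OF E 2(1), of "-1" \<omega>] unfolding 2(2) by simp
  qed
qed

text \<open>The interface between actual functions and up-sets: on both cones of the chain,
  \<open>\<phi>\<close> is the same linear form. Nothing is asked of \<open>\<phi>\<close> away from
  these cones.\<close>

definition step_on :: "'n::finite set \<Rightarrow> (real ^ 'n \<Rightarrow> real) \<Rightarrow> 'n set set \<Rightarrow> 'n set set \<Rightarrow> bool" where
  "step_on E \<phi> U C \<longleftrightarrow> (\<exists>j\<in>E. (\<forall>H\<in>insert E C. j \<in> H \<longleftrightarrow> H \<in> U) \<and>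
     (\<forall>s\<in>{-1, 1}. \<forall>x\<in>chain_cone E C s. \<phi> x = - x $ j))"

lemma linear_minus_nth: "linear (\<lambda>x::real ^ 'n. - x $ i)"
  using linear_vec_nth[of i] by (rule linear_compose_neg)

lemma chain_cone_mono: "D \<subseteq> C \<Longrightarrow> chain_cone E D s \<subseteq> chain_cone E C s"
  unfolding chain_cone_def by (intro hull_mono) (auto simp: chain_gens_def)

lemma chain_cone_zero_subset: "chain_cone E C 0 \<subseteq> chain_cone E C s"
  unfolding chain_cone_def by (intro hull_mono) (auto simp: chain_gens_def)

text \<open>After subtracting the linear form of the facet, a neighbouring cone contributes only the
  value at \<open>e_G\<close>; the unknown parts of the chosen normal vectors lie in the span of the
  facet and cancel. Across a facet without \<open>e_E\<close> the function is linear, so that no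
  weight arises there.\<close>

lemma divisor_fan_of:
  fixes E :: "'n::finite set"
  assumes E: "E \<noteq> {}" and wt: "chain_weight E k \<omega>" and bal: "chain_balanced E \<omega>"
    and step: "\<And>C. \<omega> C \<noteq> 0 \<Longrightarrow> step_on E \<phi> U C"
  shows "divisor \<phi> (fan_of E \<omega>) = fan_of E (chain_divisor E U \<omega>)"
proof
  fix \<tau>
  let ?X = "fan_of E \<omega>"
  consider (side) D s where "proper_chain E D" "s \<in> {-1, 1}" "\<tau> = chain_cone E D s"
    | (other) "\<not> (\<exists>D s. proper_chain E D \<and> s \<in> {-1, 1} \<and> \<tau> = chain_cone E D s)" by blast
  then show "divisor \<phi> ?X \<tau> = fan_of E (chain_divisor E U \<omega>) \<tau>"
  proof cases
    case side
    show ?thesis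
    proof (cases "cones_around ?X \<tau> = {}")
      case True
      have "chain_divisor E U \<omega> D = 0"
      proof (rule ccontr)
        assume "chain_divisor E U \<omega> D \<noteq> 0"
        then obtain G where "G \<notin> D" "\<omega> (insert G D) \<noteq> 0" by (rule chain_divisor_support)
        then show False using True unfolding side(3) cones_around_side[OF E wt side(1,2)] by auto
      qed
      then show ?thesis using True fan_of_cone[OF E side(1,2)] unfolding side(3) divisor_def by simp
    next
      case False
      then obtain G0 where G0: "G0 \<notin> D" "\<omega> (insert G0 D) \<noteq> 0"
        unfolding side(3) cones_around_side[OF E wt side(1,2)] by auto
      obtain j where j: "j \<in> E" "\<forall>H\<in>insert E (insert G0 D). j \<in> H \<longleftrightarrow> H \<in> U"
        "\<forall>s\<in>{-1, 1}. \<forall>x\<in>chain_cone E (insert G0 D) s. \<phi> x = - x $ j"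
        using step[OF G0(2)] unfolding step_on_def by blast
      have \<phi>\<tau>: "\<phi> x = - x $ j" if "x \<in> \<tau>" for x
        using j(3) side(2) that chain_cone_mono[of D "insert G0 D" E s] unfolding side(3) by blast
      let ?n = "\<lambda>G. normal_vector (chain_cone E (insert G D) s) \<tau>"
      have ext\<tau>: "linear_extension \<phi> \<tau> v = - v $ j" if "v \<in> span \<tau>" for v
        by (rule linear_extension_eq[OF linear_minus_nth \<phi>\<tau> that])
      have ext: "\<omega> (insert G D) * linear_extension \<phi> (chain_cone E (insert G D) s) (?n G) =
          \<omega> (insert G D) * (- of_bool (G \<in> U) - (?n G - char_vec G) $ j)" if G: "G \<in> - D" for G
      proof (cases "\<omega> (insert G D) = 0")
        case False
        let ?\<sigma> = "chain_cone E (insert G D) s"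
        obtain i where i: "i \<in> E" "\<forall>H\<in>insert E (insert G D). i \<in> H \<longleftrightarrow> H \<in> U"
          "\<forall>s\<in>{-1, 1}. \<forall>x\<in>chain_cone E (insert G D) s. \<phi> x = - x $ i"
          using step[OF False] unfolding step_on_def by blast
        have \<phi>\<sigma>: "\<phi> x = - x $ i" if "x \<in> ?\<sigma>" for x using i(3) side(2) that by blast
        have n: "?n G - char_vec G \<in> span \<tau>" using side_normal[OF E wt side(2) _ False] G unfolding side(3) by auto
        have sub: "\<tau> \<subseteq> ?\<sigma>" unfolding side(3) by (rule chain_cone_mono) auto
        have cG: "char_vec G \<in> span ?\<sigma>" unfolding span_chain_cone[OF side(2)] by (intro span_base) auto
        have "?n G - char_vec G \<in> span ?\<sigma>" using n span_mono[OF sub] by blast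
        then have "?n G \<in> span ?\<sigma>" using span_add[OF _ cG] by fastforce
        then have "linear_extension \<phi> ?\<sigma> (?n G) = - ?n G $ i"
          using linear_extension_eq[OF linear_minus_nth \<phi>\<sigma>] by blast
        \<comment> \<open>The coordinates \<open>i\<close> and \<open>j\<close> may differ, but both
          represent \<open>\<phi>\<close> on the facet and hence agree on its span.\<close>
        moreover have "- (?n G - char_vec G) $ i = - (?n G - char_vec G) $ j"
        proof (rule linear_eq_on_span[OF linear_minus_nth linear_minus_nth _ n])
          show "- x $ i = - x $ j" if "x \<in> \<tau>" for x using \<phi>\<sigma> \<phi>\<tau> that sub by force
        qed
        moreover have "?n G $ i = (?n G - char_vec G) $ i + of_bool (i \<in> G)" by simp
        moreover have "(i \<in> G) = (G \<in> U)" using i(2) by auto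
        ultimately have "linear_extension \<phi> ?\<sigma> (?n G) = - of_bool (G \<in> U) - (?n G - char_vec G) $ j"
          by (simp only:)
        then show ?thesis by (simp only:)
      qed simp
      have "divisor \<phi> ?X \<tau> = (\<Sum>\<sigma>\<in>cones_around ?X \<tau>. ?X \<sigma> *\<^sub>R linear_extension \<phi> \<sigma> (normal_vector \<sigma> \<tau>))
          - linear_extension \<phi> \<tau> (\<Sum>\<sigma>\<in>cones_around ?X \<tau>. ?X \<sigma> *\<^sub>R normal_vector \<sigma> \<tau>)"
        using False unfolding divisor_def by simp
      also have "(\<Sum>\<sigma>\<in>cones_around ?X \<tau>. ?X \<sigma> *\<^sub>R linear_extension \<phi> \<sigma> (normal_vector \<sigma> \<tau>)) =
          (\<Sum>G\<in>- D. \<omega> (insert G D) * linear_extension \<phi> (chain_cone E (insert G D) s) (?n G))"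
        unfolding side(3) sum_cones_around_side[OF E wt side(1,2)] by simp
      also have "\<dots> = (\<Sum>G\<in>- D. \<omega> (insert G D) * (- of_bool (G \<in> U) - (?n G - char_vec G) $ j))"
        by (rule sum.cong[OF refl ext])
      also have "(\<Sum>\<sigma>\<in>cones_around ?X \<tau>. ?X \<sigma> *\<^sub>R normal_vector \<sigma> \<tau>) = (\<Sum>G\<in>- D. \<omega> (insert G D) *\<^sub>R ?n G)"
        unfolding side(3) sum_cones_around_side[OF E wt side(1,2)] ..
      also have "linear_extension \<phi> \<tau> \<dots> = - (\<Sum>G\<in>- D. \<omega> (insert G D) *\<^sub>R ?n G) $ j"
        using side_sum_in_span[OF E wt bal side(1,2)] unfolding side(3)[symmetric] by (rule ext\<tau>)
      also have "(\<Sum>G\<in>- D. \<omega> (insert G D) * (- of_bool (G \<in> U) - (?n G - char_vec G) $ j)) - \<dots> =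
          (\<Sum>G\<in>- D. \<omega> (insert G D) * (of_bool (j \<in> G) - of_bool (G \<in> U)))"
        by (simp add: sum.distrib[symmetric] sum_negf[symmetric] algebra_simps)
      also have "\<dots> = chain_divisor E U \<omega> D"
        by (rule chain_divisor_eq[symmetric, OF bal j(1)]) (use j(2) in auto)
      finally show ?thesis using fan_of_cone[OF E side(1,2)] unfolding side(3) by simp
    qed
  next
    case other
    then have r: "fan_of E (chain_divisor E U \<omega>) \<tau> = 0" unfolding fan_of_def by auto
    show ?thesis
    proof (cases "cones_around ?X \<tau> = {}")
      case True
      then show ?thesis using r unfolding divisor_def by simp
    next
      case False
      obtain C where C: "proper_chain E C" "\<tau> = chain_cone E C 0"
        using other by (cases rule: cones_around_cases[OF E wt False]) auto
      have w: "\<omega> C \<noteq> 0" using False unfolding C(2) cones_around_zero[OF E wt C(1)] by (auto split: if_splits)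
      then have a: "cones_around ?X \<tau> = {chain_cone E C 1, chain_cone E C (-1)}"
        unfolding C(2) cones_around_zero[OF E wt C(1)] by simp
      obtain j where j: "\<forall>s\<in>{-1, 1}. \<forall>x\<in>chain_cone E C s. \<phi> x = - x $ j"
        using step[OF w] unfolding step_on_def by blast
      let ?n = "\<lambda>s. normal_vector (chain_cone E C s) \<tau>"
      have \<tau>s: "\<tau> \<subseteq> chain_cone E C s" for s unfolding C(2) by (rule chain_cone_zero_subset)
      have ext: "linear_extension \<phi> (chain_cone E C s) (?n s) = - ?n s $ j" if s: "s \<in> {-1, 1}" for s
      proof (rule linear_extension_eq[OF linear_minus_nth])
        show "\<phi> x = - x $ j" if "x \<in> chain_cone E C s" for x using j s that by blast
        have "?n s - s *\<^sub>R char_vec E \<in> span (chain_cone E C s)"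
          using chain_cone_normal_ground[OF C(1) E s] span_mono[OF \<tau>s[of s]] unfolding C(2) by blast
        moreover have "s *\<^sub>R char_vec E \<in> span (chain_cone E C s)"
          unfolding span_chain_cone[OF s] by (intro span_scale span_base) auto
        ultimately show "?n s \<in> span (chain_cone E C s)" using span_add by fastforce
      qed
      have "linear_extension \<phi> \<tau> (\<omega> C *\<^sub>R ?n 1 + \<omega> C *\<^sub>R ?n (-1)) = - (\<omega> C *\<^sub>R ?n 1 + \<omega> C *\<^sub>R ?n (-1)) $ j"
      proof (rule linear_extension_eq[OF linear_minus_nth])
        show "\<phi> x = - x $ j" if "x \<in> \<tau>" for x using j that \<tau>s[of 1] by blast
        show "\<omega> C *\<^sub>R ?n 1 + \<omega> C *\<^sub>R ?n (-1) \<in> span \<tau>" unfolding C(2) by (rule zero_sum_in_span[OF E C(1)])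
      qed
      then have "divisor \<phi> ?X \<tau> = 0" using ext[of 1] ext[of "-1"] chain_cone_pm_neq[OF E C(1)]
        fan_of_cone[OF E C(1), of 1 \<omega>] fan_of_cone[OF E C(1), of "-1" \<omega>] unfolding divisor_def a by simp
      then show ?thesis using r by simp
    qed
  qed
qed

section \<open>Bergman fans and step functions\<close>

lemma flag_cone_eq:
  assumes "s \<in> {-1, 1}"
  shows "flag_cone M F s = chain_cone (ground M) (F ` {1..<mrank M (ground M)}) s"
  using assms unfolding flag_cone_def chain_cone_def chain_gens_def by (auto simp: image_image)

lemma maximal_flag_rank:
  assumes M: "loopless_matroid M" and F: "maximal_flag M F" and i: "i \<le> mrank M (ground M)"
  shows "F i \<in> flats M \<and> mrank M (F i) = i"
  using i
proof (induction i)
  case 0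
  then show ?case using F loopless_matroidD(4)[OF M] mrank_empty[OF M] unfolding maximal_flag_def by simp
next
  case (Suc i)
  interpret ranked_flats "ground M" "flats M" "mrank M" by (rule ranked_flats_mrank[OF M])
  have "covers M (F i) (F (Suc i))" using F Suc.prems unfolding maximal_flag_def by auto
  then have "covers (Flat_System (ground M) (flats M)) (F i) (F (Suc i))" by simp
  then show ?case using Suc unfolding covers_iff by auto
qed

lemma maximal_flag_chain:
  assumes M: "loopless_matroid M" and F: "maximal_flag M F" and E: "ground M \<noteq> {}"
  defines "C \<equiv> F ` {1..<mrank M (ground M)}"
  shows "proper_chain (ground M) C \<and> C \<subseteq> flats M \<and> Suc (card C) = mrank M (ground M)"
proof -
  interpret ranked_flats "ground M" "flats M" "mrank M" by (rule ranked_flats_mrank[OF M])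
  let ?r = "mrank M (ground M)"
  note r = maximal_flag_rank[OF M F]
  have "{} \<subset> ground M" using E by blast
  then have r0: "0 < ?r" using rk_strict[OF empty_flat ground_flat] by simp
  have step: "F i \<subseteq> F (Suc i)" if "i < ?r" for i using F that unfolding maximal_flag_def covers_def by auto
  have mono: "F i \<subseteq> F j" if "i \<le> j" "j \<le> ?r" for i j
    using that by (induction j rule: dec_induct) (use step in \<open>auto simp: subset_iff\<close>)
  have inj: "inj_on F {1..<?r}"
  proof (rule inj_onI)
    fix i j assume ij: "i \<in> {1..<?r}" "j \<in> {1..<?r}" "F i = F j"
    have "mrank M (F i) = i" "mrank M (F j) = j" using r[of i] r[of j] ij(1,2) by simp_all
    then show "i = j" using ij(3) by metis
  qed
  have "G \<noteq> {} \<and> G \<subset> ground M" if G: "G \<in> C" for G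
  proof -
    obtain i where i: "i \<in> {1..<?r}" "G = F i" using G unfolding C_def by auto
    then have "G \<in> flats M" "mrank M G = i" using r[of i] by auto
    then show ?thesis using i flats_ground rk_empty by auto
  qed
  moreover have "A \<subseteq> B \<or> B \<subseteq> A" if AB: "A \<in> C" "B \<in> C" for A B
  proof -
    obtain i j where ij: "i \<in> {1..<?r}" "A = F i" "j \<in> {1..<?r}" "B = F j" using AB unfolding C_def by auto
    then show ?thesis using mono[of i j] mono[of j i] by (cases "i \<le> j") auto
  qed
  moreover have "C \<subseteq> flats M" unfolding C_def using r by auto
  moreover have "Suc (card C) = ?r" unfolding C_def using card_image[OF inj] r0 by simp
  ultimately show ?thesis unfolding proper_chain_def by blast
qed

lemma chain_maximal_flag:
  assumes M: "loopless_matroid M" and E: "ground M \<noteq> {}"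
    and C: "proper_chain (ground M) C" "C \<subseteq> flats M" "Suc (card C) = mrank M (ground M)"
  obtains F where "maximal_flag M F" "C = F ` {1..<mrank M (ground M)}"
proof -
  interpret ranked_flats "ground M" "flats M" "mrank M" by (rule ranked_flats_mrank[OF M])
  let ?r = "mrank M (ground M)"
  note rC = rk_proper_chain[OF C(1,2)]
  have img: "mrank M ` C = {1..<?r}"
    by (rule card_subset_eq) (use rC C(3) card_image[OF rC(2)] in auto)
  have "\<forall>i. \<exists>G. i \<in> {1..<?r} \<longrightarrow> G \<in> C \<and> mrank M G = i" using img by (metis imageE)
  then obtain h where h: "\<forall>i. i \<in> {1..<?r} \<longrightarrow> h i \<in> C \<and> mrank M (h i) = i" by (rule choice[THEN exE])
  define F where "F i = (if i = 0 then {} else if i < ?r then h i else ground M)" for i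
  have F: "F i \<in> insert {} (insert (ground M) C)" "mrank M (F i) = i" if "i \<le> ?r" for i
    using that h rk_empty unfolding F_def by auto
  have "C = F ` {1..<?r}"
  proof (intro equalityI subsetI)
    fix G assume G: "G \<in> C"
    then have g: "mrank M G \<in> {1..<?r}" using rC(1) by auto
    then have "h (mrank M G) = G" using h G rC(2) unfolding inj_on_def by blast
    then show "G \<in> F ` {1..<?r}" using g unfolding F_def by (intro image_eqI[of _ _ "mrank M G"]) auto
  qed (use h in \<open>auto simp: F_def\<close>)
  moreover have "maximal_flag M F" unfolding maximal_flag_def
  proof (intro conjI allI impI)
    show "F 0 = {}" unfolding F_def by simp
    have "{} \<subset> ground M" using E by blast
    then show "F ?r = ground M" using rk_strict[OF empty_flat ground_flat] unfolding F_def by simp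
    fix i assume i: "i < ?r"
    have mem: "F i \<in> insert {} (insert (ground M) C)" "F (Suc i) \<in> insert {} (insert (ground M) C)"
      "mrank M (F i) = i" "mrank M (F (Suc i)) = Suc i" using F[of i] F[of "Suc i"] i by auto
    have "F i \<subseteq> F (Suc i)" using chain_subset_of_rk[OF C(1,2) mem(1,2)] mem(3,4) by simp
    moreover have "F i \<noteq> F (Suc i)"
    proof
      assume "F i = F (Suc i)"
      then have "mrank M (F i) = mrank M (F (Suc i))" by (rule arg_cong)
      then show False unfolding mem(3,4) by simp
    qed
    moreover have "H \<in> flats M" if "H \<in> insert {} (insert (ground M) C)" for H
      using that C(2) empty_flat ground_flat by auto
    then have "F i \<in> flats M" "F (Suc i) \<in> flats M" using mem(1,2) by metis+
    ultimately have "covers (Flat_System (ground M) (flats M)) (F i) (F (Suc i))"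
      unfolding covers_iff mem(3,4) by blast
    then show "covers M (F i) (F (Suc i))" by simp
  qed
  ultimately show ?thesis using that by blast
qed

definition flag_weight_of :: "'n flat_system \<Rightarrow> 'n set set \<Rightarrow> real" where
  "flag_weight_of M = flag_weight (ground M) (flats M) (mrank M (ground M))"

lemma bergman_fan_eq:
  fixes M :: "'n::finite flat_system"
  assumes M: "loopless_matroid M" and E: "ground M \<noteq> {}"
  shows "bergman_fan M = fan_of (ground M) (flag_weight_of M)"
proof
  fix \<sigma>
  note wt = flag_weight_chain_weight[of "ground M" "mrank M (ground M)" "flats M", folded flag_weight_of_def]
  have iff: "(\<exists>F. maximal_flag M F \<and> (\<sigma> = flag_cone M F 1 \<or> \<sigma> = flag_cone M F (-1))) \<longleftrightarrow>
      (\<exists>C s. s \<in> {-1, 1} \<and> flag_weight_of M C \<noteq> 0 \<and> \<sigma> = chain_cone (ground M) C s)"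
  proof
    assume "\<exists>F. maximal_flag M F \<and> (\<sigma> = flag_cone M F 1 \<or> \<sigma> = flag_cone M F (-1))"
    then obtain F s where F: "maximal_flag M F" "s \<in> {-1, 1}" "\<sigma> = flag_cone M F s" by auto
    then show "\<exists>C s. s \<in> {-1, 1} \<and> flag_weight_of M C \<noteq> 0 \<and> \<sigma> = chain_cone (ground M) C s"
      using maximal_flag_chain[OF M F(1) E] flag_cone_eq[OF F(2)]
      unfolding flag_weight_of_def flag_weight_def by (intro exI[of _ "F ` {1..<mrank M (ground M)}"] exI[of _ s]) auto
  next
    assume "\<exists>C s. s \<in> {-1, 1} \<and> flag_weight_of M C \<noteq> 0 \<and> \<sigma> = chain_cone (ground M) C s"
    then obtain C s where C: "s \<in> {-1, 1}" "flag_weight_of M C \<noteq> 0" "\<sigma> = chain_cone (ground M) C s" by blast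
    then have "proper_chain (ground M) C \<and> C \<subseteq> flats M \<and> Suc (card C) = mrank M (ground M)"
      unfolding flag_weight_of_def flag_weight_def by (auto split: if_splits)
    then obtain F where F: "maximal_flag M F" "C = F ` {1..<mrank M (ground M)}"
      using chain_maximal_flag[OF M E] by metis
    have "\<sigma> = flag_cone M F s" unfolding C(3) F(2) by (rule flag_cone_eq[OF C(1), symmetric])
    then show "\<exists>F. maximal_flag M F \<and> (\<sigma> = flag_cone M F 1 \<or> \<sigma> = flag_cone M F (-1))" using F(1) C(1) by auto
  qed
  show "bergman_fan M \<sigma> = fan_of (ground M) (flag_weight_of M) \<sigma>"
  proof (cases "\<exists>C s. s \<in> {-1, 1} \<and> flag_weight_of M C \<noteq> 0 \<and> \<sigma> = chain_cone (ground M) C s")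
    case True
    then obtain C s where C: "s \<in> {-1, 1}" "flag_weight_of M C \<noteq> 0" "\<sigma> = chain_cone (ground M) C s" by blast
    have "fan_of (ground M) (flag_weight_of M) \<sigma> = flag_weight_of M C"
      unfolding C(3) by (rule fan_of_cone[OF E chain_weightD(1)[OF wt C(2)] C(1)])
    also have "\<dots> = 1" using C(2) unfolding flag_weight_of_def flag_weight_def by (auto split: if_splits)
    finally show ?thesis using True iff unfolding bergman_fan_def by simp
  next
    case False
    then show ?thesis using iff fan_of_nonzero[OF E wt] unfolding bergman_fan_def by auto
  qed
qed

lemma flag_weight_of_props:
  fixes M :: "'n::finite flat_system"
  assumes M: "loopless_matroid M"
  shows "chain_weight (ground M) (mrank M (ground M)) (flag_weight_of M)"
    "chain_balanced (ground M) (flag_weight_of M)" "flag_weight_of M C \<in> \<int>"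
  using flag_weight_chain_weight flag_weight_balanced[OF ranked_flats_mrank[OF M]]
  unfolding flag_weight_of_def by (auto simp: flag_weight_def of_bool_def)

text \<open>For a proper chain on nonempty \<open>E\<close> this is the union of its two cones.
  Under a restriction of coordinates a chain member can turn into the full groundset, so the sign of
  the image is not determined by that of the cone.\<close>

definition chain_line :: "'n::finite set \<Rightarrow> 'n set set \<Rightarrow> (real ^ 'n) set" where
  "chain_line E C = {x. \<exists>c m. (\<forall>F\<in>C. 0 \<le> c F) \<and> x = (\<Sum>F\<in>C. c F *\<^sub>R char_vec F) + m *\<^sub>R char_vec E}"

lemma chain_line_cases:
  fixes E :: "'n::finite set"
  assumes "proper_chain E C" "E \<noteq> {}" "x \<in> chain_line E C"
  obtains s where "s \<in> {-1, 1}" "x \<in> chain_cone E C s"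
proof -
  obtain c m where c: "\<forall>F\<in>C. 0 \<le> c F" "x = (\<Sum>F\<in>C. c F *\<^sub>R char_vec F) + m *\<^sub>R char_vec E"
    using assms(3) unfolding chain_line_def by blast
  define s :: real where "s = (if 0 \<le> m then 1 else -1)"
  have s: "s \<in> {-1, 1}" "s \<in> {-1, 0, 1}" "m = \<bar>m\<bar> * s" unfolding s_def by auto
  have "x \<in> chain_cone E C s" unfolding chain_cone_explicit[OF assms(1,2) s(2)]
    using c s(3) by (intro exI[of _ c] exI[of _ "\<bar>m\<bar>"]) auto
  then show ?thesis using that s(1) by blast
qed

lemma chain_line_cone: "convex_cone (chain_line E C)"
  unfolding convex_cone_iff
proof (intro conjI ballI allI impI)
  show "0 \<in> chain_line E C" unfolding chain_line_def by (intro CollectI exI[of _ "\<lambda>_. 0"] exI[of _ 0]) simp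
  fix x assume "x \<in> chain_line E C"
  then obtain c m where c: "\<forall>F\<in>C. 0 \<le> c F" "x = (\<Sum>F\<in>C. c F *\<^sub>R char_vec F) + m *\<^sub>R char_vec E"
    unfolding chain_line_def by blast
  show "a *\<^sub>R x \<in> chain_line E C" if "0 \<le> a" for a unfolding chain_line_def
    using c that by (intro CollectI exI[of _ "\<lambda>F. a * c F"] exI[of _ "a * m"]) (simp add: scaleR_right_distrib scaleR_sum_right)
  fix y assume "y \<in> chain_line E C"
  then obtain d n where d: "\<forall>F\<in>C. 0 \<le> d F" "y = (\<Sum>F\<in>C. d F *\<^sub>R char_vec F) + n *\<^sub>R char_vec E"
    unfolding chain_line_def by blast
  show "x + y \<in> chain_line E C" unfolding chain_line_def
    using c d by (intro CollectI exI[of _ "\<lambda>F. c F + d F"] exI[of _ "m + n"]) (simp add: scaleR_left_distrib sum.distrib)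
qed

lemma chain_line_gen:
  fixes E :: "'n::finite set"
  assumes "F \<in> C"
  shows "char_vec F \<in> chain_line E C"
proof -
  have "(\<Sum>H\<in>C. (if H = F then 1 else 0) *\<^sub>R char_vec H) = char_vec F"
    using assms by (simp add: if_distrib[of "\<lambda>c. c *\<^sub>R _"] cong: if_cong)
  then show ?thesis unfolding chain_line_def
    by (intro CollectI exI[of _ "\<lambda>H. if H = F then 1 else 0"] exI[of _ 0]) simp
qed

lemma chain_line_ground: "m *\<^sub>R char_vec E \<in> chain_line E C"
  unfolding chain_line_def by (intro CollectI exI[of _ "\<lambda>_. 0"] exI[of _ m]) simp

lemma linear_chain_cone_into:
  fixes E :: "'n::finite set" and f :: "real ^ 'n \<Rightarrow> 'b::real_vector"
  assumes f: "linear f" and S: "convex_cone S" and gens: "\<And>F. F \<in> C \<Longrightarrow> f (char_vec F) \<in> S" "\<And>m. f (m *\<^sub>R char_vec E) \<in> S"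
    and x: "x \<in> chain_cone E C s"
  shows "f x \<in> S"
proof -
  have "f ` chain_cone E C s = convex_cone hull (f ` chain_gens E C s)"
    unfolding chain_cone_def by (rule convex_cone_hull_linear_image[OF f, symmetric])
  moreover have "f ` chain_gens E C s \<subseteq> S" unfolding chain_gens_def using gens by auto
  then have "convex_cone hull (f ` chain_gens E C s) \<subseteq> S" using S by (intro hull_minimal)
  ultimately show ?thesis using x by blast
qed

lemma same_block_coord:
  assumes "x \<in> chain_cone E C s" "\<And>H. H \<in> insert E C \<Longrightarrow> i \<in> H \<longleftrightarrow> j \<in> H"
  shows "x $ i = x $ j"
proof -
  have "x \<in> span (chain_gens E C s)" using assms(1) span_base span_convex_cone_hull unfolding chain_cone_def by metis
  then have sp: "x \<in> span (chain_gens E C s)" .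
  have "b $ i = b $ j" if b: "b \<in> chain_gens E C s" for b
  proof -
    obtain H c where "H \<in> insert E C" "b = c *\<^sub>R char_vec H"
    proof (cases "b \<in> char_vec ` C")
      case True
      then obtain H where "H \<in> C" "b = char_vec H" by auto
      then show ?thesis using that[of H 1] by simp
    next
      case False
      then have "b = s *\<^sub>R char_vec E" using b unfolding chain_gens_def by (simp split: if_splits)
      then show ?thesis using that[of E s] by simp
    qed
    then show ?thesis using assms(2)[of H] by simp
  qed
  from linear_eq_on_span[OF linear_vec_nth[of i] linear_vec_nth[of j] this sp] show ?thesis .
qed

text \<open>Every set of \<open>U\<close> has an element outside the members not in
  \<open>U\<close>, whose coordinate is at most \<open>x $ j\<close>; the smallest member in
  \<open>U\<close> attains this bound. One max-min formula thus describes the step function on all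
  cones simultaneously.\<close>

lemma max_min_on_cone:
  fixes E :: "'n::finite set"
  assumes C: "proper_chain E C" and E: "E \<noteq> {}" and s: "s \<in> {-1, 1}" and x: "x \<in> chain_cone E C s"
    and U: "up_set E U" and j: "j \<in> E" "\<And>H. H \<in> insert E C \<Longrightarrow> j \<in> H \<longleftrightarrow> H \<in> U"
    and W: "W = {A \<in> L. A \<in> U}" "insert E C \<subseteq> L" "L \<subseteq> Pow E"
  shows "Max ((\<lambda>A. Min ((\<lambda>i. x $ i) ` A)) ` W) = x $ j"
proof -
  obtain c m where c: "\<forall>F\<in>C. (0::real) \<le> c F" "x = (\<Sum>F\<in>C. c F *\<^sub>R char_vec F) + (m * s) *\<^sub>R char_vec E"
  proof -
    have "s \<in> {-1, 0, 1}" using s by auto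
    from chain_cone_explicit[OF C E this, THEN iffD1, OF x] show ?thesis using that by blast
  qed
  have le: "x $ p \<le> x $ q" if "p \<in> E" "q \<in> E" "\<And>H. H \<in> C \<Longrightarrow> p \<in> H \<Longrightarrow> q \<in> H" for p q
  proof -
    have "(\<Sum>H\<in>C. c H * of_bool (p \<in> H)) \<le> (\<Sum>H\<in>C. c H * of_bool (q \<in> H))"
      by (rule sum_mono) (use that c(1) in auto)
    then show ?thesis unfolding c(2) chain_cone_coord using that by auto
  qed
  have cmp: "F \<subseteq> G \<or> G \<subseteq> F" if "F \<in> insert E C" "G \<in> insert E C" for F G
    using that proper_chainD[OF C] by blast
  define B where "B = {H \<in> insert E C. H \<in> U}"
  have "\<Inter> B \<in> B" by (rule Union_chain_mem(2)) (use cmp up_setD(2)[OF U] in \<open>auto simp: B_def\<close>)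
  then have BW: "\<Inter> B \<in> W" unfolding B_def W(1) using W(2) by auto
  have WE: "A \<subseteq> E" "A \<noteq> {}" if "A \<in> W" for A using that W up_setD(3)[OF U] by auto
  show ?thesis
  proof (rule Max_eqI)
    show "finite ((\<lambda>A. Min (($) x ` A)) ` W)" by simp
    fix y assume "y \<in> (\<lambda>A. Min (($) x ` A)) ` W"
    then obtain A where A: "A \<in> W" "y = Min (($) x ` A)" by auto
    define D where "D = {H \<in> C. H \<notin> U}"
    have "\<Union> D \<notin> U"
    proof (cases "D = {}")
      case True then show ?thesis using up_setD(3)[OF U] by simp
    next
      case False
      have "\<Union> D \<in> D" by (rule Union_chain_mem(1)[OF _ False]) (use cmp in \<open>auto simp: D_def\<close>)
      then show ?thesis unfolding D_def by auto
    qed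
    then have "\<not> A \<subseteq> \<Union> D" using up_setD(1)[OF U, of A "\<Union> D"] A(1) W(1) by auto
    then obtain i where i: "i \<in> A" "i \<notin> \<Union> D" by auto
    have "x $ i \<le> x $ j"
    proof (rule le)
      show "i \<in> E" using i WE[OF A(1)] by auto
      show "j \<in> H" if "H \<in> C" "i \<in> H" for H using i that j(2)[of H] unfolding D_def by auto
    qed (rule j(1))
    moreover have "y \<le> x $ i" unfolding A(2) using i by (intro Min_le) auto
    ultimately show "y \<le> x $ j" by simp
  next
    have jB: "j \<in> \<Inter> B" using j unfolding B_def by auto
    have "Min (($) x ` \<Inter> B) = x $ j"
    proof (rule Min_eqI)
      fix y assume "y \<in> ($) x ` \<Inter> B"
      then obtain i where i: "i \<in> \<Inter> B" "y = x $ i" by auto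
      show "x $ j \<le> y" unfolding i(2)
      proof (rule le)
        show "i \<in> E" using i up_setD(2)[OF U] unfolding B_def by auto
        show "i \<in> H" if "H \<in> C" "j \<in> H" for H using i that j(2)[of H] unfolding B_def by auto
      qed (rule j(1))
    qed (use jB in auto)
    then show "x $ j \<in> (\<lambda>A. Min (($) x ` A)) ` W" using BW by (metis image_eqI)
  qed
qed

section \<open>Functions prescribed on the rays of a Bergman fan\<close>

lemma scaled_ground_in_cone: "s \<in> {-1, 1} \<Longrightarrow> s *\<^sub>R char_vec E \<in> chain_cone E C s"
  unfolding chain_cone_def chain_gens_def by (intro hull_inc) auto

lemma char_vec_in_cone: "F \<in> C \<Longrightarrow> char_vec F \<in> chain_cone E C s"
  unfolding chain_cone_def chain_gens_def by (intro hull_inc) auto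

lemma bergman_cones:
  fixes Q :: "'n::finite flat_system"
  assumes Q: "loopless_matroid Q" and E: "ground Q \<noteq> {}"
  shows "fan_cones (bergman_fan Q) = {chain_cone (ground Q) C s |C s. s \<in> {-1, 1} \<and>
    proper_chain (ground Q) C \<and> C \<subseteq> flats Q \<and> Suc (card C) = mrank Q (ground Q)}"
proof -
  have "flag_weight_of Q C \<noteq> 0 \<longleftrightarrow> proper_chain (ground Q) C \<and> C \<subseteq> flats Q \<and> Suc (card C) = mrank Q (ground Q)" for C
    unfolding flag_weight_of_def flag_weight_def by auto
  then show ?thesis
    unfolding bergman_fan_eq[OF Q E] fan_cones_fan_of[OF E flag_weight_of_props(1)[OF Q]] by simp
qed

text \<open>\<open>ray_function\<close> is a choice, so a function with the prescribed values must
  be exhibited first. The negative of the max-min expression is one; continuity follows from the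
  finite cover by closed cones on which it is linear.\<close>

lemma ray_function_exists:
  fixes Q :: "'n::finite flat_system"
  assumes Q: "loopless_matroid Q" and E: "ground Q \<noteq> {}" and U: "up_set (ground Q) U"
  shows "\<exists>\<phi>. rational_function (ground Q) (bergman_fan Q) \<phi> \<and>
    (\<forall>F\<in>flats Q - {{}}. \<phi> (char_vec F) = - of_bool (F \<in> U))"
proof -
  interpret ranked_flats "ground Q" "flats Q" "mrank Q" by (rule ranked_flats_mrank[OF Q])
  let ?E = "ground Q"
  define W where "W = {A \<in> flats Q. A \<in> U}"
  define \<phi> :: "real ^ 'n \<Rightarrow> real" where "\<phi> x = - Max ((\<lambda>A. Min (($) x ` A)) ` W)" for x
  have val: "\<phi> x = - x $ j" if "proper_chain ?E C" "C \<subseteq> flats Q" "s \<in> {-1, 1}" "x \<in> chain_cone ?E C s"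
      "j \<in> ?E" "\<And>H. H \<in> insert ?E C \<Longrightarrow> j \<in> H \<longleftrightarrow> H \<in> U" for C s x j
    unfolding \<phi>_def using max_min_on_cone[OF that(1) E that(3,4) U that(5,6) W_def] that(2) ground_flat flats_ground by simp
  have cone: "\<exists>j. \<forall>x\<in>chain_cone ?E C s. \<phi> x = - x $ j" if Cs: "proper_chain ?E C" "C \<subseteq> flats Q" "s \<in> {-1, 1}" for C s
  proof -
    obtain j where "j \<in> ?E" "\<forall>H\<in>insert ?E C. j \<in> H \<longleftrightarrow> H \<in> U" using split_exists[OF Cs(1) U] by blast
    then show ?thesis using val[OF Cs] by blast
  qed
  note cones = bergman_cones[OF Q E]
  have "rational_function ?E (bergman_fan Q) \<phi>" unfolding rational_function_def
  proof (intro conjI ballI)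
    have "continuous_on (\<Union>\<sigma>\<in>fan_cones (bergman_fan Q). \<sigma>) \<phi>"
    proof (rule continuous_on_closed_Union)
      have "fan_cones (bergman_fan Q) \<subseteq> (\<lambda>(C, s). chain_cone ?E C s) ` (UNIV \<times> {-1, 1})" unfolding cones by auto
      then show "finite (fan_cones (bergman_fan Q))" by (rule finite_subset) simp
      fix \<sigma> assume "\<sigma> \<in> fan_cones (bergman_fan Q)"
      then obtain C s where C: "\<sigma> = chain_cone ?E C s" "s \<in> {-1, 1}" "proper_chain ?E C" "C \<subseteq> flats Q" unfolding cones by blast
      show "closed \<sigma>" unfolding C(1) chain_cone_def by (rule closed_convex_cone_hull) (simp add: chain_gens_def)
      obtain j where j: "\<forall>x\<in>\<sigma>. \<phi> x = - x $ j" using cone[OF C(3,4,2)] C(1) by blast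
      have "continuous_on \<sigma> (\<lambda>x. - x $ j)" by (intro continuous_intros)
      then show "continuous_on \<sigma> \<phi>" using j by (simp cong: continuous_on_cong)
    qed
    then show "continuous_on (fan_support (bergman_fan Q)) \<phi>" unfolding fan_support_def by simp
    fix \<sigma> assume "\<sigma> \<in> fan_cones (bergman_fan Q)"
    then obtain C s where C: "\<sigma> = chain_cone ?E C s" "s \<in> {-1, 1}" "proper_chain ?E C" "C \<subseteq> flats Q" unfolding cones by blast
    obtain j where "\<forall>x\<in>\<sigma>. \<phi> x = - x $ j" using cone[OF C(3,4,2)] C(1) by blast
    then show "\<exists>f. linear f \<and> (\<forall>x\<in>\<sigma>. \<phi> x = f x)" using linear_minus_nth by blast
  next
    have e: "proper_chain ?E {}" unfolding proper_chain_def by simp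
    obtain j where j: "j \<in> ?E" "\<forall>H\<in>insert ?E {}. j \<in> H \<longleftrightarrow> H \<in> U" using split_exists[OF e U] by blast
    have "\<phi> (s *\<^sub>R char_vec ?E) = - (s *\<^sub>R char_vec ?E) $ j" if "s \<in> {-1, 1}" for s
      using val[OF e _ that scaled_ground_in_cone[OF that] j(1)] j(2) by auto
    from this[of 1] this[of "-1"] show "\<phi> (- char_vec ?E) = - \<phi> (char_vec ?E)" by simp
  qed
  moreover have "\<phi> (char_vec F) = - of_bool (F \<in> U)" if F: "F \<in> flats Q - {{}}" for F
  proof -
    let ?C = "if F = ?E then {} else {F}"
    have p: "proper_chain ?E ?C" "?C \<subseteq> flats Q" using F flats_ground unfolding proper_chain_def by auto
    obtain j where j: "j \<in> ?E" "\<forall>H\<in>insert ?E ?C. j \<in> H \<longleftrightarrow> H \<in> U" using split_exists[OF p(1) U] by blast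
    have "char_vec F \<in> chain_cone ?E ?C 1"
      using scaled_ground_in_cone[of 1 ?E ?C] char_vec_in_cone[of F ?C ?E 1] by (cases "F = ?E") auto
    then have "\<phi> (char_vec F) = - char_vec F $ j" using val[OF p, of 1 _ j] j by auto
    moreover have "j \<in> F \<longleftrightarrow> F \<in> U" using j(2) by (cases "F = ?E") auto
    ultimately show ?thesis by simp
  qed
  ultimately show ?thesis by blast
qed

text \<open>On a maximal cone, linearity and the values on the generators determine the chosen
  function, with the normalisation handling \<open>-e_E\<close>. A partial chain is first completed
  to a flag, and its block containing \<open>j\<close> carries a single coordinate value.\<close>

lemma ray_function_step:
  fixes Q :: "'n::finite flat_system"
  assumes Q: "loopless_matroid Q" and E: "ground Q \<noteq> {}" and U: "up_set (ground Q) U"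
    and f: "\<And>F. F \<in> flats Q \<Longrightarrow> F \<noteq> {} \<Longrightarrow> f F = - of_bool (F \<in> U)"
    and C: "proper_chain (ground Q) C" "C \<subseteq> flats Q" and x: "x \<in> chain_line (ground Q) C"
    and j: "j \<in> ground Q" "\<And>H. H \<in> insert (ground Q) C \<Longrightarrow> j \<in> H \<longleftrightarrow> H \<in> U"
  shows "ray_function Q f x = - x $ j"
proof -
  interpret ranked_flats "ground Q" "flats Q" "mrank Q" by (rule ranked_flats_mrank[OF Q])
  let ?E = "ground Q" and ?\<phi> = "ray_function Q f"
  have ex: "\<exists>\<phi>. rational_function ?E (bergman_fan Q) \<phi> \<and> (\<forall>F\<in>flats Q - {{}}. \<phi> (char_vec F) = f F)"
    using ray_function_exists[OF Q E U] f by simp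
  have "rational_function ?E (bergman_fan Q) ?\<phi> \<and> (\<forall>F\<in>flats Q - {{}}. ?\<phi> (char_vec F) = f F)"
    unfolding ray_function_def by (rule someI_ex[OF ex])
  then have lin: "\<And>\<sigma>. \<sigma> \<in> fan_cones (bergman_fan Q) \<Longrightarrow> \<exists>g. linear g \<and> (\<forall>x\<in>\<sigma>. ?\<phi> x = g x)"
    and neg: "?\<phi> (- char_vec ?E) = - ?\<phi> (char_vec ?E)"
    and val: "\<And>F. F \<in> flats Q \<Longrightarrow> F \<noteq> {} \<Longrightarrow> ?\<phi> (char_vec F) = - of_bool (F \<in> U)"
    unfolding rational_function_def using f by auto
  obtain s where s: "s \<in> {-1, 1}" "x \<in> chain_cone ?E C s" using chain_line_cases[OF C(1) E x] by blast
  obtain B where B: "C \<subseteq> B" "proper_chain ?E B" "B \<subseteq> flats Q" "Suc (card B) = mrank Q ?E"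
    by (rule flag_extension[OF C E])
  have "chain_cone ?E B s \<in> fan_cones (bergman_fan Q)" unfolding bergman_cones[OF Q E] using B s by blast
  then obtain g where g: "linear g" "\<forall>x\<in>chain_cone ?E B s. ?\<phi> x = g x" using lin by blast
  obtain i where i: "i \<in> ?E" "\<forall>H\<in>insert ?E B. i \<in> H \<longleftrightarrow> H \<in> U" using split_exists[OF B(2) U] by blast
  have xB: "x \<in> chain_cone ?E B s" using s(2) chain_cone_mono[OF B(1)] by blast
  have "g y = - y $ i" if y: "y \<in> span (chain_gens ?E B s)" for y
  proof (rule linear_eq_on_span[OF g(1) linear_minus_nth _ y])
    fix b assume b: "b \<in> chain_gens ?E B s"
    show "g b = - b $ i"
    proof (cases "b \<in> char_vec ` B")
      case True
      then obtain F where F: "F \<in> B" "b = char_vec F" by auto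
      have "g b = ?\<phi> b" using g(2) char_vec_in_cone[OF F(1), of ?E s] F(2) by simp
      also have "\<dots> = - of_bool (F \<in> U)" using val F B(3) proper_chainD(1)[OF B(2)] by auto
      finally show ?thesis using i(2) F by simp
    next
      case False
      then have b': "b = s *\<^sub>R char_vec ?E" using b unfolding chain_gens_def by (auto split: if_splits)
      have "g b = ?\<phi> b" using g(2) scaled_ground_in_cone[OF s(1), of ?E B] b' by simp
      also have "\<dots> = s * ?\<phi> (char_vec ?E)" using neg s(1) unfolding b' by auto
      also have "?\<phi> (char_vec ?E) = - 1" using val[OF ground_flat E] up_setD(2)[OF U] by simp
      finally show ?thesis using i unfolding b' by simp
    qed
  qed
  moreover have "x \<in> span (chain_gens ?E B s)"
    using xB span_base span_convex_cone_hull unfolding chain_cone_def by metis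
  ultimately have "?\<phi> x = - x $ i" using g(2) xB by simp
  also have "x $ i = x $ j" by (rule same_block_coord[OF s(2)]) (use i(2) j(2) B(1) in auto)
  finally show ?thesis .
qed

text \<open>Restricting coordinates sends the cone of \<open>C\<close> into the line of cones of the
  chain of traces: empty traces become \<open>0\<close> and full traces join the direction of the
  groundset. A coordinate inside \<open>ground Q\<close> is unchanged by \<open>p\<close> and can be
  used upstairs.\<close>

lemma pullback_step_on:
  fixes Q :: "'m::finite flat_system" and E :: "'m set"
  assumes Q: "loopless_matroid Q" and E: "ground Q \<noteq> {}" "ground Q \<subseteq> E" and U: "up_set (ground Q) U"
    and f: "\<And>F. F \<in> flats Q \<Longrightarrow> F \<noteq> {} \<Longrightarrow> f F = - of_bool (F \<in> U)"
    and p: "linear p" "\<And>x i. p x $ i = (if i \<in> ground Q then x $ i else 0)"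
    and C: "proper_chain E C" "\<And>H. H \<in> C \<Longrightarrow> H \<inter> ground Q \<in> flats Q"
  shows "step_on E (ray_function Q f \<circ> p) {H. H \<inter> ground Q \<in> U} C"
proof -
  interpret ranked_flats "ground Q" "flats Q" "mrank Q" by (rule ranked_flats_mrank[OF Q])
  let ?T = "ground Q"
  define D where "D = (\<lambda>H. H \<inter> ?T) ` C - {{}, ?T}"
  have D: "proper_chain ?T D" unfolding proper_chain_def D_def using proper_chainD(3)[OF C(1)] by blast
  have DL: "D \<subseteq> flats Q" unfolding D_def using C(2) by auto
  obtain j where j: "j \<in> ?T" "\<forall>H\<in>insert ?T D. j \<in> H \<longleftrightarrow> H \<in> U" using split_exists[OF D U] by blast
  have jH: "j \<in> H \<longleftrightarrow> H \<inter> ?T \<in> U" if "H \<in> insert E C" for H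
  proof -
    have "H \<inter> ?T = {} \<or> H \<inter> ?T \<in> insert ?T D"
    proof (cases "H \<in> C")
      case True
      then have "H \<inter> ?T \<in> (\<lambda>H. H \<inter> ?T) ` C" by (rule imageI)
      then show ?thesis unfolding D_def by blast
    next
      case False
      then have "H \<inter> ?T = ?T" using that E(2) by auto
      then show ?thesis by simp
    qed
    moreover have "j \<in> H \<longleftrightarrow> j \<in> H \<inter> ?T" using j(1) by simp
    ultimately show ?thesis using j(2) up_setD(3)[OF U] by (metis empty_iff)
  qed
  have pF: "p (char_vec F) = char_vec (F \<inter> ?T)" for F by (simp add: vec_eq_iff p(2))
  have line: "p x \<in> chain_line ?T D" if "x \<in> chain_cone E C s" for x s
  proof (rule linear_chain_cone_into[OF p(1) chain_line_cone _ _ that])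
    fix m
    have "p (m *\<^sub>R char_vec E) = m *\<^sub>R char_vec ?T" using E(2) by (auto simp: vec_eq_iff p(2))
    then show "p (m *\<^sub>R char_vec E) \<in> chain_line ?T D" using chain_line_ground by metis
  next
    fix F assume F: "F \<in> C"
    consider "F \<inter> ?T = {}" | "F \<inter> ?T = ?T" | "F \<inter> ?T \<in> D" unfolding D_def using F by auto
    then show "p (char_vec F) \<in> chain_line ?T D"
    proof cases
      case 1
      then have "p (char_vec F) = 0 *\<^sub>R char_vec ?T" unfolding pF by (simp add: vec_eq_iff)
      then show ?thesis using chain_line_ground by metis
    next
      case 2
      then show ?thesis unfolding pF using chain_line_ground[of 1 ?T D] by simp
    next
      case 3
      then show ?thesis unfolding pF by (rule chain_line_gen)
    qed
  qed
  show ?thesis unfolding step_on_def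
  proof (intro bexI[of _ j] conjI ballI)
    show "(j \<in> H) = (H \<in> {H. H \<inter> ?T \<in> U})" if "H \<in> insert E C" for H using jH[OF that] by simp
    fix s x assume "x \<in> chain_cone E C s"
    then have "ray_function Q f (p x) = - p x $ j"
      using ray_function_step[OF Q E(1) U f D DL line j(1)] j(2) by blast
    then show "(ray_function Q f \<circ> p) x = - x $ j" using p(2) j(1) by simp
  qed (use j E in auto)
qed

section \<open>The chain weights of the fibre product\<close>

lemma chain_enumeration:
  assumes "finite C" "\<And>F G. F \<in> C \<Longrightarrow> G \<in> C \<Longrightarrow> F \<subseteq> G \<or> G \<subseteq> F"
  shows "\<exists>e::nat \<Rightarrow> 'a set. C = e ` {1..card C} \<and> (\<forall>i j. 1 \<le> i \<longrightarrow> i < j \<longrightarrow> j \<le> card C \<longrightarrow> e i \<subset> e j)"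
  using assms
proof (induction "card C" arbitrary: C)
  case 0
  then show ?case by auto
next
  case (Suc n)
  have "C \<noteq> {}" using Suc.hyps by auto
  then have top: "\<Union> C \<in> C" using Suc.prems Union_in_chain[of C C] by (auto simp: subset_chain_def)
  let ?D = "C - {\<Union> C}"
  have cD: "n = card ?D" using Suc.hyps(2) Suc.prems(1) top by simp
  obtain e where e: "?D = e ` {1..card ?D}" "\<forall>i j. 1 \<le> i \<longrightarrow> i < j \<longrightarrow> j \<le> card ?D \<longrightarrow> e i \<subset> e j"
    using Suc.hyps(1)[OF cD] Suc.prems by (metis DiffD1 finite_Diff)
  define f where "f = e(Suc n := \<Union> C)"
  have "f ` {1..card C} = insert (\<Union> C) (e ` {1..n})"
  proof -
    have "{1..card C} = insert (Suc n) {1..n}" using Suc.hyps(2) by auto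
    then show ?thesis unfolding f_def by auto
  qed
  moreover have "C = insert (\<Union> C) ?D" using top by blast
  ultimately have "C = f ` {1..card C}" using e(1) cD by metis
  moreover have "f i \<subset> f j" if ij: "1 \<le> i" "i < j" "j \<le> card C" for i j
  proof (cases "j = Suc n")
    case True
    have "i \<in> {1..card ?D}" using True ij cD Suc.hyps(2) by simp
    then have "e i \<in> e ` {1..card ?D}" by (rule imageI)
    then have "e i \<in> ?D" using e(1) by simp
    then show ?thesis using True ij unfolding f_def by auto
  next
    case False
    then show ?thesis using e(2) ij cD Suc.hyps(2) unfolding f_def by auto
  qed
  ultimately show ?case by blast
qed

lemma (in ranked_flats) flag_position:
  assumes C: "proper_chain E C" "C \<subseteq> L" "Suc (card C) = rk E" and F: "F \<in> C"
  shows "rk F = card {H \<in> C. H \<subseteq> F}"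
proof -
  note r = rk_proper_chain[OF C(1,2)]
  have img: "rk ` C = {1..<rk E}" by (rule card_subset_eq) (use r C(3) card_image[OF r(2)] in auto)
  have eq: "{H \<in> C. H \<subseteq> F} = {H \<in> C. rk H \<le> rk F}"
  proof (intro Collect_cong conj_cong refl iffI)
    fix H assume H: "H \<in> C"
    show "H \<subseteq> F \<Longrightarrow> rk H \<le> rk F" by (rule rk_mono) (use H F C(2) in auto)
    show "rk H \<le> rk F \<Longrightarrow> H \<subseteq> F" by (rule chain_subset_of_rk[OF C(1,2)]) (use H F in auto)
  qed
  have "rk ` {H \<in> C. rk H \<le> rk F} = {n \<in> rk ` C. n \<le> rk F}" by auto
  also have "\<dots> = {1..rk F}"
  proof -
    have "rk F < rk E" using r(1) F by auto
    then show ?thesis unfolding img by auto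
  qed
  finally have "rk ` {H \<in> C. H \<subseteq> F} = {1..rk F}" unfolding eq .
  moreover have "inj_on rk {H \<in> C. H \<subseteq> F}" using r(2) by (rule inj_on_subset) auto
  ultimately show ?thesis using card_image[of rk "{H \<in> C. H \<subseteq> F}"] by simp
qed

lemma (in ranked_flats) flag_through:
  obtains g where "g 0 = {}" "g (rk E) = E" "\<And>i. i \<le> rk E \<Longrightarrow> g i \<in> L" "\<And>i. i \<le> rk E \<Longrightarrow> rk (g i) = i"
    "\<And>i j. i \<le> j \<Longrightarrow> j \<le> rk E \<Longrightarrow> g i \<subseteq> g j" "x \<in> E \<Longrightarrow> x \<in> g 1"
proof -
  obtain K where K: "K \<subseteq> {G \<in> L. G \<subset> E}" "\<forall>A\<in>K. \<forall>B\<in>K. A \<subseteq> B \<or> B \<subseteq> A"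
    "x \<in> E \<Longrightarrow> rk E \<noteq> 1 \<Longrightarrow> \<exists>G\<in>K. x \<in> G \<and> rk G = 1"
  proof (cases "x \<in> E \<and> rk E \<noteq> 1")
    case True
    obtain G where G: "G \<in> L" "x \<in> G" "rk G = Suc (rk {})" using extend[OF empty_flat, of x] True by auto
    then have "G \<subset> E" using True flats_ground rk_empty by auto
    then show ?thesis using that[of "{G}"] G rk_empty by auto
  next
    case False
    then show ?thesis using that[of "{}"] by auto
  qed
  obtain C where C: "K \<subseteq> C" "C \<subseteq> {G \<in> L. G \<subset> E}" "\<forall>A\<in>C. \<forall>B\<in>C. A \<subseteq> B \<or> B \<subseteq> A" "rk ` C = {..<rk E}"
    using maximal_chain[OF ground_flat K(1,2)] by (elim exE conjE)
  have CL: "C \<subseteq> L" using C(2) by auto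
  note inj = rk_inj_on_chain[OF CL C(3)]
  have "\<forall>i. \<exists>G. i < rk E \<longrightarrow> G \<in> C \<and> rk G = i" using C(4) by (metis imageE lessThan_iff)
  then obtain h where h: "\<forall>i. i < rk E \<longrightarrow> h i \<in> C \<and> rk (h i) = i" by (rule choice[THEN exE])
  define g where "g i = (if i < rk E then h i else E)" for i
  have g: "g i \<in> L" "rk (g i) = i" if "i \<le> rk E" for i
    using that h CL ground_flat unfolding g_def by auto
  show ?thesis
  proof (rule that[of g])
    show "g 0 = {}" using eq_of_rk_le[OF empty_flat g(1)[of 0]] g(2)[of 0] by simp
    show "g (rk E) = E" unfolding g_def by simp
    show "g i \<subseteq> g j" if ij: "i \<le> j" "j \<le> rk E" for i j
    proof (cases "j < rk E")
      case True
      then have "h i \<in> C" "h j \<in> C" "rk (h i) \<le> rk (h j)" using h ij by auto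
      moreover from this have "h i \<subseteq> h j \<or> h j \<subseteq> h i" using C(3) by auto
      ultimately have "h i \<subseteq> h j" using eq_of_rk_le[of "h j" "h i"] CL by auto
      then show ?thesis using True ij unfolding g_def by simp
    next
      case False
      have "g i \<subseteq> E" using g(1)[of i] ij flats_ground by auto
      then show ?thesis using False unfolding g_def by simp
    qed
    assume x: "x \<in> E"
    show "x \<in> g 1"
    proof (cases "1 < rk E")
      case True
      then obtain G where G: "G \<in> K" "x \<in> G" "rk G = 1" using K(3) x by auto
      have "G \<in> C" "h 1 \<in> C" "rk G = rk (h 1)" using G C(1) h True by auto
      then have "G = h 1" using inj_onD[OF inj] by metis
      then show ?thesis using True G unfolding g_def by simp
    qed (use x in \<open>auto simp: g_def\<close>)
  qed (use g in auto)
qed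

section \<open>Iterated divisors of the degree function\<close>

lemma alpha_up_set: "E \<noteq> {} \<Longrightarrow> up_set E {F. E \<subseteq> F}"
  unfolding up_set_def by auto

text \<open>The up-set consists of the sets above \<open>E\<close>, which are no chain members, so
  the subtracted sum vanishes: the divisor adds up the weights of all refinements by a set through
  \<open>j\<close>.\<close>

lemma alpha_divisor:
  fixes E :: "'n::finite set"
  assumes wt: "chain_weight E k \<omega>" and bal: "chain_balanced E \<omega>" and D: "proper_chain E D"
    and j: "j \<in> E" "\<And>H. H \<in> D \<Longrightarrow> j \<notin> H"
  shows "chain_divisor E {F. E \<subseteq> F} \<omega> D = chain_vec \<omega> D j"
proof -
  have "chain_divisor E {F. E \<subseteq> F} \<omega> D = (\<Sum>G\<in>- D. \<omega> (insert G D) * (of_bool (j \<in> G) - of_bool (G \<in> {F. E \<subseteq> F})))"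
    by (rule chain_divisor_eq[OF bal j(1)]) (use j proper_chainD(2)[OF D] in auto)
  also have "\<dots> = chain_vec \<omega> D j" unfolding chain_vec_def
  proof (rule sum.cong[OF refl])
    fix G
    have "\<not> E \<subseteq> G" if "\<omega> (insert G D) \<noteq> 0" using chain_weightD(1)[OF wt that] by (auto simp: proper_chain_insert)
    then show "\<omega> (insert G D) * (of_bool (j \<in> G) - of_bool (G \<in> {F. E \<subseteq> F})) = \<omega> (insert G D) * of_bool (j \<in> G)"
      by (cases "\<omega> (insert G D) = 0") auto
  qed
  finally show ?thesis .
qed

lemma alpha_iterate_props:
  fixes E :: "'n::finite set"
  assumes E: "E \<noteq> {}" and wt: "chain_weight E (k + m) \<omega>" and bal: "chain_balanced E \<omega>"
  shows "chain_weight E k ((chain_divisor E {F. E \<subseteq> F} ^^ m) \<omega>) \<and>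
    chain_balanced E ((chain_divisor E {F. E \<subseteq> F} ^^ m) \<omega>)"
  using wt
proof (induction m arbitrary: k)
  case (Suc m)
  have "chain_weight E (Suc k + m) \<omega>" using Suc.prems by simp
  from Suc.IH[OF this] show ?case
    using chain_weight_divisor[of E k] chain_balanced_divisor[OF _ _ alpha_up_set[OF E]] by auto
qed (use bal in simp)

text \<open>The coordinate used avoids all members of the chain, so the added set lies above all of
  them: these divisors strip chains from the top.\<close>

lemma alpha_iterate_support:
  fixes E :: "'n::finite set"
  assumes E: "E \<noteq> {}" and wt: "chain_weight E (k + m) \<omega>" and bal: "chain_balanced E \<omega>"
    and nz: "(chain_divisor E {F. E \<subseteq> F} ^^ m) \<omega> D \<noteq> 0"
  shows "\<exists>C. \<omega> C \<noteq> 0 \<and> D \<subseteq> C \<and> (\<forall>H\<in>C - D. \<forall>H'\<in>D. H' \<subset> H)"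
  using wt nz
proof (induction m arbitrary: k D)
  case 0
  then show ?case by auto
next
  case (Suc m)
  let ?w = "(chain_divisor E {F. E \<subseteq> F} ^^ m) \<omega>"
  have wt': "chain_weight E (Suc k + m) \<omega>" using Suc.prems(1) by simp
  note props = alpha_iterate_props[OF E wt' bal]
  have nz: "chain_divisor E {F. E \<subseteq> F} ?w D \<noteq> 0" using Suc.prems(2) by simp
  have D: "proper_chain E D" using chain_weightD(1)[OF chain_weight_divisor nz] props by blast
  obtain j where j: "j \<in> E" "\<And>H. H \<in> D \<Longrightarrow> j \<notin> H" using top_element[OF D E] by metis
  have "chain_vec ?w D j \<noteq> 0" using nz alpha_divisor[OF _ _ D j] props by metis
  then obtain G where G: "G \<in> - D" "?w (insert G D) * of_bool (j \<in> G) \<noteq> 0"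
    unfolding chain_vec_def by (rule sum.not_neutral_contains_not_neutral)
  then have G': "?w (insert G D) \<noteq> 0" "j \<in> G" by (auto split: if_splits)
  have p: "proper_chain E (insert G D)" using chain_weightD(1) props G'(1) by blast
  have DG: "H' \<subset> G" if "H' \<in> D" for H' using proper_chainD(3)[OF p insertI1, of H'] that j(2)[OF that] G'(2) by auto
  obtain C where C: "\<omega> C \<noteq> 0" "insert G D \<subseteq> C" "\<forall>H\<in>C - insert G D. \<forall>H'\<in>insert G D. H' \<subset> H"
    using Suc.IH[OF wt' G'(1)] by blast
  have "H' \<subset> H" if "H \<in> C - D" "H' \<in> D" for H H'
    using that C(3) DG by (cases "H = G") auto
  then show ?case using C by blast
qed

text \<open>An empty groundset is excluded because chain weights need the generator
  \<open>e_E\<close>, which then would be zero; \<open>theorem1\<close> treats that case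
  directly.\<close>

locale fibre_data =
  fixes M1 M2 N :: "'a::finite flat_system"
  assumes M1: "loopless_matroid M1" and M2: "loopless_matroid M2" and N: "loopless_matroid N"
    and ground_N: "ground N = ground M1 \<inter> ground M2"
    and res1: "restriction M1 (ground N) = N" and res2: "restriction M2 (ground N) = N"
    and nonempty: "ground M1 <+> ground M2 \<noteq> {}"
begin

abbreviation "T \<equiv> ground N"
abbreviation "E \<equiv> ground M1 <+> ground M2"
abbreviation "P \<equiv> direct_sum M1 M2"
abbreviation "r \<equiv> mrank N T"
abbreviation "R \<equiv> mrank P E"

definition lft :: "('a + 'a) set \<Rightarrow> 'a set" where "lft F = Inl -` F \<inter> T"
definition rgt :: "('a + 'a) set \<Rightarrow> 'a set" where "rgt F = Inr -` F \<inter> T"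

text \<open>The nullity of the pair of flats which \<open>F\<close> cuts out on the two copies of \<open>T\<close>; the function
  \<open>\<phi>\<^sub>i\<close> takes the value \<open>-1\<close> on \<open>e\<^sub>F\<close> exactly if this nullity exceeds \<open>r - i\<close>.\<close>

definition d :: "('a + 'a) set \<Rightarrow> nat" where
  "d F = mrank N (lft F) + mrank N (rgt F) - mrank N (lft F \<union> rgt F)"

text \<open>For \<open>t < r\<close> this is the up-set of
  \<open>diagonal_function N (r - t)\<close> pulled back to \<open>E\<close>.\<close>

definition U :: "nat \<Rightarrow> ('a + 'a) set set" where "U t = {F. t < d F}"

text \<open>The thresholds increase from \<open>0\<close>, since \<open>foldr\<close> applies the
  function with index \<open>r\<close> first.\<close>

primrec W :: "nat \<Rightarrow> ('a + 'a) set set \<Rightarrow> real" where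
  "W 0 = flag_weight_of P"
| "W (Suc s) = chain_divisor E (U s) (W s)"

section \<open>Nullity and the supports of the iterated divisors\<close>

lemma T_sub: "T \<subseteq> ground M1" "T \<subseteq> ground M2" using ground_N by auto

lemma lft_T: "lft F \<subseteq> T" "rgt F \<subseteq> T" unfolding lft_def rgt_def by auto

lemma lft_Plus: "lft (A <+> B) = A \<inter> T" "rgt (A <+> B) = B \<inter> T"
  unfolding lft_def rgt_def by auto

lemma loopless_P: "loopless_matroid P" by (rule loopless_direct_sum[OF M1 M2])

lemma ground_P: "ground P = E" by simp

sublocale P: ranked_flats E "flats P" "mrank P"
  using ranked_flats_mrank[OF loopless_P] by simp

sublocale N: ranked_flats T "flats N" "mrank N" by (rule ranked_flats_mrank[OF N])
sublocale M1: ranked_flats "ground M1" "flats M1" "mrank M1" by (rule ranked_flats_mrank[OF M1])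
sublocale M2: ranked_flats "ground M2" "flats M2" "mrank M2" by (rule ranked_flats_mrank[OF M2])

lemma rk_P: "F \<in> flats P \<Longrightarrow> mrank P F = mrank M1 (Inl -` F) + mrank M2 (Inr -` F)"
  by (rule mrank_direct_sum[OF M1 M2])

lemma mrank_N1: "S \<subseteq> T \<Longrightarrow> mrank M1 S = mrank N S"
  using mrank_restriction[OF M1 T_sub(1)] unfolding res1 by simp

lemma mrank_N2: "S \<subseteq> T \<Longrightarrow> mrank M2 S = mrank N S"
  using mrank_restriction[OF M2 T_sub(2)] unfolding res2 by simp

lemma flat_N1: "F \<in> flats M1 \<Longrightarrow> F \<inter> T \<in> flats N"
  using res1 restriction_flat_iff[of M1 T] by (metis image_eqI)

lemma flat_N2: "F \<in> flats M2 \<Longrightarrow> F \<inter> T \<in> flats N"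
  using res2 restriction_flat_iff[of M2 T] by (metis image_eqI)

lemma closure_T1: "g \<in> flats N \<Longrightarrow> flat_closure M1 g \<inter> T = g"
proof -
  assume g: "g \<in> flats N"
  then obtain F where F: "F \<in> flats M1" "g = F \<inter> T" using res1 restriction_flat_iff[of M1 T] by auto
  then show ?thesis using flat_closure_subset[of g F M1] flat_closure_superset[of g M1] by auto
qed

lemma closure_T2: "g \<in> flats N \<Longrightarrow> flat_closure M2 g \<inter> T = g"
proof -
  assume g: "g \<in> flats N"
  then obtain F where F: "F \<in> flats M2" "g = F \<inter> T" using res2 restriction_flat_iff[of M2 T] by auto
  then show ?thesis using flat_closure_subset[of g F M2] flat_closure_superset[of g M2] by auto
qed

lemma flat_lft: "F \<in> flats P \<Longrightarrow> lft F \<in> flats N" "F \<in> flats P \<Longrightarrow> rgt F \<in> flats N"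
  unfolding lft_def rgt_def direct_sum_flat_iff using flat_N1 flat_N2 by auto

lemma d_eq: "d F + mrank N (lft F \<union> rgt F) = mrank N (lft F) + mrank N (rgt F)"
  using mrank_submodular[OF N lft_T, of F F] unfolding d_def by simp

text \<open>Submodularity in \<open>N\<close> is applied twice, enlarging first the left trace and
  then the right one.\<close>

lemma d_mono: assumes "F \<subseteq> G" shows "d F \<le> d G"
proof -
  have s: "lft F \<subseteq> lft G" "rgt F \<subseteq> rgt G" using assms unfolding lft_def rgt_def by auto
  have g: "lft G \<union> rgt F \<subseteq> T" "lft F \<union> rgt F \<subseteq> T" using lft_T by auto
  have "mrank N (lft G \<union> (lft F \<union> rgt F)) + mrank N (lft G \<inter> (lft F \<union> rgt F)) \<le> mrank N (lft G) + mrank N (lft F \<union> rgt F)"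
    by (rule mrank_submodular[OF N lft_T(1) g(2)])
  moreover have "lft G \<union> (lft F \<union> rgt F) = lft G \<union> rgt F" using s by auto
  moreover have "mrank N (lft F) \<le> mrank N (lft G \<inter> (lft F \<union> rgt F))"
    by (rule mrank_mono[OF N]) (use s g in auto)
  moreover have "mrank N (rgt G \<union> (lft G \<union> rgt F)) + mrank N (rgt G \<inter> (lft G \<union> rgt F)) \<le> mrank N (rgt G) + mrank N (lft G \<union> rgt F)"
    by (rule mrank_submodular[OF N lft_T(2) g(1)])
  moreover have "rgt G \<union> (lft G \<union> rgt F) = lft G \<union> rgt G" using s by auto
  moreover have "mrank N (rgt F) \<le> mrank N (rgt G \<inter> (lft G \<union> rgt F))"
    by (rule mrank_mono[OF N]) (use s g in auto)
  ultimately show ?thesis using d_eq[of F] d_eq[of G] by simp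
qed

lemma d_ground: "d E = r" unfolding d_def lft_Plus using T_sub by (simp add: Int_absorb1)

lemma d_empty: "d {} = 0" unfolding d_def lft_def rgt_def by (simp add: N.rk_empty)

lemma d_le: "F \<subseteq> E \<Longrightarrow> d F \<le> r" using d_mono[of F E] d_ground by simp

lemma up_set_U: "t < r \<Longrightarrow> up_set E (U t)"
  unfolding up_set_def U_def using d_ground d_empty order.strict_trans2[OF _ d_mono] by auto

lemma r_le: "r \<le> mrank M1 (ground M1)" "r \<le> mrank M2 (ground M2)"
  using mrank_mono[OF M1 T_sub(1)] mrank_mono[OF M2 T_sub(2)] mrank_N1[of T] mrank_N2[of T] by auto

lemma R_eq: "R = mrank M1 (ground M1) + mrank M2 (ground M2)"
  using rk_P[OF P.ground_flat] by simp

lemma R_pos: "0 < R"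
proof -
  have "{} \<subset> E" using nonempty by (simp only: psubset_eq) blast
  then show ?thesis using P.rk_strict[OF P.empty_flat P.ground_flat] by simp
qed

lemma r_less: "r < R"
proof (cases "r = 0")
  case True then show ?thesis using R_pos by simp
next
  case False then show ?thesis using r_le R_eq by simp
qed

lemma W_props: "s \<le> r \<Longrightarrow> chain_weight E (R - s) (W s) \<and> chain_balanced E (W s) \<and> (\<forall>C. W s C \<in> \<int>)"
proof (induction s)
  case 0
  then show ?case using flag_weight_of_props[OF loopless_P] by simp
next
  case (Suc s)
  have "R - s = Suc (R - Suc s)" using Suc.prems r_less by simp
  then show ?case using Suc chain_weight_divisor[of E "R - Suc s" "W s"] chain_balanced_divisor[OF _ _ up_set_U]
      chain_divisor_int[of "W s"] by auto
qed

lemma W_flats: "W s C \<noteq> 0 \<Longrightarrow> C \<subseteq> flats P"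
proof (induction s arbitrary: C)
  case 0
  then show ?case by (auto simp: flag_weight_of_def flag_weight_def split: if_splits)
next
  case (Suc s)
  then have "chain_divisor E (U s) (W s) C \<noteq> 0" by simp
  then obtain G where "W s (insert G C) \<noteq> 0" by (rule chain_divisor_support)
  from Suc.IH[OF this] show ?case by simp
qed

lemma W_chain: "s \<le> r \<Longrightarrow> W s C \<noteq> 0 \<Longrightarrow> proper_chain E C \<and> Suc (card C) = R - s"
  using W_props chain_weightD by blast

text \<open>The backward step of all support arguments: a surviving chain stems from a refinement by
  a set on which coordinate and threshold disagree.\<close>

lemma W_step:
  assumes s: "s < r" and nz: "W (Suc s) C \<noteq> 0"
    and j: "j \<in> E" "\<And>H. H \<in> insert E C \<Longrightarrow> j \<in> H \<longleftrightarrow> s < d H"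
  obtains G where "G \<notin> C" "W s (insert G C) \<noteq> 0" "(j \<in> G) \<noteq> (s < d G)" "proper_chain E (insert G C)"
    "insert G C \<subseteq> flats P"
proof -
  have bal: "chain_balanced E (W s)" using W_props s by simp
  have jU: "j \<in> H \<longleftrightarrow> H \<in> U s" if "H \<in> insert E C" for H using j(2)[OF that] unfolding U_def by simp
  obtain G where G: "G \<notin> C" "W s (insert G C) \<noteq> 0" "(j \<in> G) \<noteq> (G \<in> U s)"
    using chain_divisor_nonzero[OF bal j(1) jU] nz by auto
  show ?thesis by (rule that[OF G(1,2)]) (use G(3) W_chain[OF _ G(2)] W_flats[OF G(2)] s in \<open>auto simp: U_def\<close>)
qed

lemma W_split:
  assumes "s < r" "proper_chain E C"
  obtains j where "j \<in> E" "\<And>H. H \<in> insert E C \<Longrightarrow> j \<in> H \<longleftrightarrow> s < d H"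
  using split_exists[OF assms(2) up_set_U[OF assms(1)]] unfolding U_def by auto

text \<open>Undoing the divisor with threshold \<open>s\<close> inserts a set \<open>G\<close>.
  Disagreement and monotonicity of \<open>d\<close> force \<open>G\<close> below \<open>F\<close>
  exactly if \<open>s < d F\<close>, which is exactly when \<open>min (d F) s\<close> grows.\<close>

lemma position:
  assumes "s \<le> r" "W s C \<noteq> 0" "F \<in> C"
  shows "mrank P F = min (d F) s + card {H \<in> C. H \<subseteq> F}"
  using assms
proof (induction s arbitrary: C)
  case 0
  have "proper_chain E C \<and> C \<subseteq> flats P \<and> Suc (card C) = R"
    using 0(2) by (simp add: flag_weight_of_def flag_weight_def split: if_splits)
  then show ?case using P.flag_position[of C F] 0(3) by simp
next
  case (Suc s)
  have s: "s < r" using Suc.prems by simp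
  have C: "proper_chain E C" using W_chain Suc.prems by blast
  obtain j where j: "j \<in> E" "\<And>H. H \<in> insert E C \<Longrightarrow> j \<in> H \<longleftrightarrow> s < d H" using W_split[OF s C] by metis
  obtain G where G: "G \<notin> C" "W s (insert G C) \<noteq> 0" "(j \<in> G) \<noteq> (s < d G)" "proper_chain E (insert G C)"
    using W_step[OF s Suc.prems(2) j] by metis
  have IH: "mrank P F = min (d F) s + card {H \<in> insert G C. H \<subseteq> F}"
    using Suc.IH[OF _ G(2)] Suc.prems by simp
  have jF: "j \<in> F \<longleftrightarrow> s < d F" using j(2) Suc.prems(3) by auto
  show ?case
  proof (cases "G \<subseteq> F")
    case True
    then have "{H \<in> insert G C. H \<subseteq> F} = insert G {H \<in> C. H \<subseteq> F}" by auto
    moreover have "s < d F" using jF G(3) True d_mono[OF True] by auto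
    ultimately show ?thesis using IH G(1) by simp
  next
    case False
    then have "F \<subseteq> G" using proper_chainD(3)[OF G(4) insertI1, of F] Suc.prems(3) by auto
    then have "\<not> s < d F" using jF G(3) d_mono[of F G] by auto
    moreover have "{H \<in> insert G C. H \<subseteq> F} = {H \<in> C. H \<subseteq> F}" using False by auto
    ultimately show ?thesis using IH by simp
  qed
qed

section \<open>Equality of the traces on the two copies of \<open>T\<close>\<close>

definition twins :: "'a + 'a \<Rightarrow> 'a + 'a \<Rightarrow> bool" where
  "twins a b \<longleftrightarrow> (\<exists>t\<in>T. a = Inl t \<and> b = Inr t \<or> a = Inr t \<and> b = Inl t)"

text \<open>Adding the missing twin raises the rank of one trace, whereas the union of the traces
  already contains the element.\<close>

lemma d_less:
  assumes ab: "twins a b" and F: "F \<in> flats P" "a \<in> F" "b \<notin> F" and G: "F \<subseteq> G" "b \<in> G"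
  shows "d F < d G"
proof -
  obtain t where t: "t \<in> T" "a = Inl t \<and> b = Inr t \<or> a = Inr t \<and> b = Inl t" using ab unfolding twins_def by blast
  have ins: "mrank N (insert t S) = Suc (mrank N S)" if "S \<in> flats N" "t \<notin> S" for S
    using mrank_insert[OF N, of S t] that t N.flats_ground by auto
  have "d (insert b F) = Suc (d F)"
  proof (cases "a = Inl t \<and> b = Inr t")
    case True
    have e: "lft (insert b F) = lft F" "rgt (insert b F) = insert t (rgt F)" using True t(1) unfolding lft_def rgt_def by auto
    have tF: "t \<in> lft F" "t \<notin> rgt F" using True F t(1) unfolding lft_def rgt_def by auto
    have "lft F \<union> insert t (rgt F) = lft F \<union> rgt F" using tF by auto
    then show ?thesis using d_eq[of "insert b F"] d_eq[of F] ins[OF flat_lft(2)[OF F(1)] tF(2)] unfolding e by simp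
  next
    case False
    then have b: "a = Inr t" "b = Inl t" using t by auto
    have e: "rgt (insert b F) = rgt F" "lft (insert b F) = insert t (lft F)" using b t(1) unfolding lft_def rgt_def by auto
    have tF: "t \<in> rgt F" "t \<notin> lft F" using b F t(1) unfolding lft_def rgt_def by auto
    have "insert t (lft F) \<union> rgt F = lft F \<union> rgt F" using tF by auto
    then show ?thesis using d_eq[of "insert b F"] d_eq[of F] ins[OF flat_lft(1)[OF F(1)] tF(2)] unfolding e by simp
  qed
  moreover have "d (insert b F) \<le> d G" using G by (intro d_mono) auto
  ultimately show ?thesis by simp
qed

text \<open>If the jump of the \<open>s\<close>-th function lies strictly inside the interval from \<open>F\<close> to \<open>G\<close>, its
  divisor can be computed with the coordinate \<open>b\<close>; then every member of the interval that
  contributes would again violate the statement.\<close>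

lemma no_twin_gap:
  assumes ab: "twins a b" and "s \<le> r" "W s C \<noteq> 0" "F \<in> C" "G \<in> insert E C" "F \<subset> G"
    "\<And>H. H \<in> C \<Longrightarrow> H \<subseteq> F \<or> G \<subseteq> H" "a \<in> F" "b \<notin> F" "b \<in> G" "d G \<le> s"
  shows False
  using assms(2-)
proof (induction s arbitrary: C G)
  case 0
  have "F \<in> flats P" using W_flats[OF 0(2)] 0 by auto
  from d_less[OF ab this 0(7,8) psubset_imp_subset[OF 0(5)] 0(9)] show False using 0(10) by simp
next
  case (Suc s)
  have s: "s < r" using Suc.prems(1) by simp
  have C: "proper_chain E C" using W_chain Suc.prems by blast
  have FL: "F \<in> flats P" using W_flats[OF Suc.prems(2)] Suc.prems(3) by auto
  have dFG: "d F < d G" by (rule d_less[OF ab FL Suc.prems(7,8) psubset_imp_subset[OF Suc.prems(5)] Suc.prems(9)])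
  show False
  proof (cases "d G \<le> s")
    case True
    obtain j where j: "j \<in> E" "\<And>H. H \<in> insert E C \<Longrightarrow> j \<in> H \<longleftrightarrow> s < d H" using W_split[OF s C] by metis
    obtain K where K: "K \<notin> C" "W s (insert K C) \<noteq> 0" "(j \<in> K) \<noteq> (s < d K)" "proper_chain E (insert K C)"
      using W_step[OF s Suc.prems(2) j] by metis
    have GC: "G \<in> C" using Suc.prems(4) True s d_ground by auto
    have "j \<notin> G" using j(2)[of G] GC True by auto
    then have "\<not> K \<subseteq> G" using K(3) d_mono[of K G] True by auto
    then have "G \<subseteq> K" using proper_chainD(3)[OF K(4) insertI1, of G] GC by auto
    then have "H \<subseteq> F \<or> G \<subseteq> H" if "H \<in> insert K C" for H using that Suc.prems(6) by auto
    then show False using Suc.IH[OF _ K(2), of G] Suc.prems True by auto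
  next
    case False
    have bE: "b \<in> E" using Suc.prems(4,9) proper_chainD(2)[OF C] by auto
    have b: "b \<in> H \<longleftrightarrow> s < d H" if H: "H \<in> insert E C" for H
    proof -
      have "G \<subseteq> E" using Suc.prems(4) proper_chainD(2)[OF C] by auto
      then have "H \<subseteq> F \<or> G \<subseteq> H" using H Suc.prems(6) by auto
      then show ?thesis
      proof
        assume "H \<subseteq> F"
        then show ?thesis using d_mono[of H F] dFG False Suc.prems(8,10) by auto
      next
        assume "G \<subseteq> H"
        then show ?thesis using d_mono[of G H] False Suc.prems(9) by auto
      qed
    qed
    obtain K where K: "K \<notin> C" "W s (insert K C) \<noteq> 0" "(b \<in> K) \<noteq> (s < d K)" "proper_chain E (insert K C)"
        "insert K C \<subseteq> flats P"
      using W_step[OF s Suc.prems(2) bE b] by metis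
    have "\<not> K \<subseteq> F" using K(3) d_mono[of K F] dFG False Suc.prems(8,10) by auto
    then have FK: "F \<subset> K" using proper_chainD(3)[OF K(4) insertI1, of F] Suc.prems(3) by auto
    have "\<not> G \<subseteq> K" using K(3) d_mono[of G K] False Suc.prems(9) by auto
    moreover have "G = E \<Longrightarrow> K \<subseteq> G" using proper_chainD(2)[OF K(4) insertI1] by auto
    ultimately have KG: "K \<subseteq> G" using proper_chainD(3)[OF K(4) insertI1, of G] Suc.prems(4) by auto
    show False
    proof (cases "b \<in> K")
      case True
      have "H \<subseteq> F \<or> K \<subseteq> H" if "H \<in> insert K C" for H using that Suc.prems(6) KG by auto
      then show False using Suc.IH[OF _ K(2) _ _ FK _ Suc.prems(7,8) True] Suc.prems(1,3) K(3) True by auto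
    next
      case nb: False
      have "d K < d G" by (rule d_less[OF ab _ _ nb KG Suc.prems(9)]) (use K(5) FK Suc.prems(7) in auto)
      then show False using K(3) nb Suc.prems(10) by auto
    qed
  qed
qed

text \<open>Otherwise the last member containing \<open>a\<close> but not \<open>b\<close> and the
  first set containing \<open>b\<close> enclose a gap as in \<open>no_twin_gap\<close>, where the
  threshold is \<open>r\<close> and no nullity exceeds \<open>r\<close>.\<close>

lemma twins_iff:
  assumes ab: "twins a b" and nz: "W r C \<noteq> 0" and F: "F \<in> C" "a \<in> F"
  shows "b \<in> F"
proof (rule ccontr)
  assume nb: "b \<notin> F"
  have C: "proper_chain E C" using W_chain[OF _ nz] by auto
  have cmp: "H \<subseteq> H' \<or> H' \<subseteq> H" if "H \<in> insert E C" "H' \<in> insert E C" for H H'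
    using that proper_chainD[OF C] by blast
  define A where "A = {H \<in> C. a \<in> H \<and> b \<notin> H}"
  have A: "\<Union> A \<in> A" by (rule Union_chain_mem(1)) (use cmp F nb in \<open>auto simp: A_def\<close>)
  have bE: "b \<in> E" using ab T_sub unfolding twins_def by auto
  define B where "B = {H \<in> insert E C. b \<in> H}"
  have B: "\<Inter> B \<in> B" by (rule Union_chain_mem(2)) (use cmp bE in \<open>auto simp: B_def\<close>)
  have A': "\<Union> A \<in> C" "a \<in> \<Union> A" "b \<notin> \<Union> A" using A unfolding A_def by blast+
  have B': "\<Inter> B \<in> insert E C" "b \<in> \<Inter> B" using B unfolding B_def by blast+
  have AB: "\<Union> A \<subset> \<Inter> B" using cmp[of "\<Union> A" "\<Inter> B"] A' B' by auto
  have gap: "H \<subseteq> \<Union> A \<or> \<Inter> B \<subseteq> H" if H: "H \<in> C" for H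
  proof (cases "b \<in> H")
    case True
    then show ?thesis using H unfolding B_def by auto
  next
    case False
    then show ?thesis using cmp[of H "\<Union> A"] H A' unfolding A_def by blast
  qed
  have "\<Inter> B \<subseteq> E" using B' proper_chainD(2)[OF C] by auto
  then show False using no_twin_gap[OF ab order.refl nz A'(1) B'(1) AB gap A'(2,3) B'(2)] d_le by auto
qed

lemma diagonal:
  assumes "W r C \<noteq> 0" "F \<in> C"
  shows "lft F = rgt F" "d F = mrank N (lft F)"
proof -
  have "t \<in> lft F \<longleftrightarrow> t \<in> rgt F" for t
    using twins_iff[of "Inl t" "Inr t" C F] twins_iff[of "Inr t" "Inl t" C F] assms
    unfolding twins_def lft_def rgt_def by auto
  then show "lft F = rgt F" by auto
  then show "d F = mrank N (lft F)" using d_eq[of F] by simp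
qed

text \<open>For a flat \<open>g\<close> of \<open>N\<close>, the smallest flat of \<open>P\<close>
  that contains \<open>g\<close> in both copies of \<open>T\<close>; its rank is twice that of
  \<open>g\<close> and its nullity equals the rank of \<open>g\<close>.\<close>

definition dia :: "'a set \<Rightarrow> ('a + 'a) set" where
  "dia g = flat_closure M1 g <+> flat_closure M2 g"

section \<open>Diagonal flats and chains of weight 1\<close>

lemma closure_flat:
  assumes "g \<in> flats N"
  shows "flat_closure M1 g \<in> flats M1" "flat_closure M2 g \<in> flats M2"
    "mrank M1 (flat_closure M1 g) = mrank N g" "mrank M2 (flat_closure M2 g) = mrank N g"
proof -
  have g: "g \<subseteq> T" "g \<subseteq> ground M1" "g \<subseteq> ground M2" using assms N.flats_ground T_sub by auto
  show "flat_closure M1 g \<in> flats M1" "flat_closure M2 g \<in> flats M2"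
    using flat_closure_in_flats[OF M1] flat_closure_in_flats[OF M2] g by auto
  show "mrank M1 (flat_closure M1 g) = mrank N g" "mrank M2 (flat_closure M2 g) = mrank N g"
    using mrank_flat_closure[OF M1 g(2)] mrank_flat_closure[OF M2 g(3)] mrank_N1[OF g(1)] mrank_N2[OF g(1)] by auto
qed

lemma closure_pair:
  assumes "g \<in> flats N" "h \<in> flats N"
  defines "F \<equiv> flat_closure M1 g <+> flat_closure M2 h"
  shows "F \<in> flats P" "mrank P F = mrank N g + mrank N h" "lft F = g" "rgt F = h"
proof -
  show FP: "F \<in> flats P" unfolding F_def direct_sum_flat_iff using closure_flat assms by simp
  show "mrank P F = mrank N g + mrank N h" unfolding rk_P[OF FP] unfolding F_def using closure_flat assms by simp
  show "lft F = g" "rgt F = h" unfolding F_def lft_Plus using closure_T1 closure_T2 assms by auto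
qed

lemma dia_props:
  assumes "g \<in> flats N"
  shows "dia g \<in> flats P" "mrank P (dia g) = 2 * mrank N g" "lft (dia g) = g" "rgt (dia g) = g" "d (dia g) = mrank N g"
  using closure_pair[OF assms assms] d_eq[of "dia g"] unfolding dia_def by auto

lemma dia_mono: "g \<subseteq> h \<Longrightarrow> dia g \<subseteq> dia h"
  unfolding dia_def using flat_closure_mono[of g h M1] flat_closure_mono[of g h M2] by auto

lemma dia_subset:
  assumes "F \<in> flats P" "g \<subseteq> lft F" "g \<subseteq> rgt F"
  shows "dia g \<subseteq> F"
proof -
  have "Inl -` F \<in> flats M1" "Inr -` F \<in> flats M2" using assms(1) unfolding direct_sum_flat_iff by auto
  moreover have "g \<subseteq> Inl -` F" "g \<subseteq> Inr -` F" using assms(2,3) unfolding lft_def rgt_def by auto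
  ultimately have "flat_closure M1 g \<subseteq> Inl -` F" "flat_closure M2 g \<subseteq> Inr -` F"
    using flat_closure_subset by metis+
  then show ?thesis unfolding dia_def by auto
qed

text \<open>The chains whose weight after \<open>s\<close> divisors can be computed outright: they climb along the
  diagonal flats of a complete flag of \<open>N\<close> and are maximal above.\<close>

definition canonical :: "(nat \<Rightarrow> 'a set) \<Rightarrow> nat \<Rightarrow> ('a + 'a) set set \<Rightarrow> bool" where
  "canonical g s C \<longleftrightarrow> proper_chain E C \<and> C \<subseteq> flats P \<and> Suc (card C + s) = R \<and>
     (\<forall>i. 1 \<le> i \<longrightarrow> i \<le> s \<longrightarrow> dia (g i) \<in> insert E C) \<and>
     (\<forall>F\<in>C. F \<subset> dia (g s) \<longrightarrow> (\<exists>i. 1 \<le> i \<and> i < s \<and> F = dia (g i)))"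

definition N_flag :: "(nat \<Rightarrow> 'a set) \<Rightarrow> bool" where
  "N_flag g \<longleftrightarrow> g 0 = {} \<and> g r = T \<and> (\<forall>i\<le>r. g i \<in> flats N \<and> mrank N (g i) = i) \<and>
     (\<forall>i j. i \<le> j \<longrightarrow> j \<le> r \<longrightarrow> g i \<subseteq> g j)"

lemma N_flagD:
  assumes "N_flag g"
  shows "g 0 = {}" "g r = T" "i \<le> r \<Longrightarrow> g i \<in> flats N" "i \<le> r \<Longrightarrow> mrank N (g i) = i"
    "i \<le> j \<Longrightarrow> j \<le> r \<Longrightarrow> g i \<subseteq> g j"
  using assms unfolding N_flag_def by auto

lemma N_flag_exists:
  obtains g where "N_flag g" "t \<in> T \<Longrightarrow> t \<in> g 1"
proof -
  obtain g where g: "g 0 = {}" "g r = T" "\<And>i. i \<le> r \<Longrightarrow> g i \<in> flats N" "\<And>i. i \<le> r \<Longrightarrow> mrank N (g i) = i"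
    "\<And>i j. i \<le> j \<Longrightarrow> j \<le> r \<Longrightarrow> g i \<subseteq> g j" "t \<in> T \<Longrightarrow> t \<in> g 1"
    by (rule N.flag_through[of t]) (rule that)
  then have "N_flag g" unfolding N_flag_def by blast
  then show ?thesis using that g(6) by blast
qed

text \<open>The ranks of the two diagonal flats differ by two, so exactly one of the two factors has
  moved up; equality of ranks then determines both factors.\<close>

lemma between_diagonals:
  assumes g: "g \<in> flats N" and h: "h \<in> flats N" and gh: "g \<subseteq> h" "mrank N h = Suc (mrank N g)"
    and G: "G \<in> flats P" "dia g \<subset> G" "G \<subset> dia h"
  shows "G = flat_closure M1 h <+> flat_closure M2 g \<or> G = flat_closure M1 g <+> flat_closure M2 h"
proof -
  let ?A = "Inl -` G" and ?B = "Inr -` G"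
  note cg = closure_flat[OF g] and ch = closure_flat[OF h]
  have fl: "?A \<in> flats M1" "?B \<in> flats M2" using G(1) unfolding direct_sum_flat_iff by auto
  have sub: "flat_closure M1 g \<subseteq> ?A" "flat_closure M2 g \<subseteq> ?B" "?A \<subseteq> flat_closure M1 h" "?B \<subseteq> flat_closure M2 h"
    using G(2,3) unfolding dia_def by auto
  have le: "mrank N g \<le> mrank M1 ?A" "mrank N g \<le> mrank M2 ?B" "mrank M1 ?A \<le> mrank N h" "mrank M2 ?B \<le> mrank N h"
    using M1.rk_mono[OF cg(1) fl(1) sub(1)] M2.rk_mono[OF cg(2) fl(2) sub(2)]
      M1.rk_mono[OF fl(1) ch(1) sub(3)] M2.rk_mono[OF fl(2) ch(2) sub(4)] cg(3,4) ch(3,4) by auto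
  have "mrank P (dia g) < mrank P G" "mrank P G < mrank P (dia h)"
    using P.rk_strict dia_props(1)[OF g] dia_props(1)[OF h] G by auto
  then have "mrank M1 ?A + mrank M2 ?B = Suc (2 * mrank N g)"
    unfolding dia_props(2)[OF g] dia_props(2)[OF h] rk_P[OF G(1)] gh(2) by simp
  then consider "mrank M1 ?A = mrank N h" "mrank M2 ?B = mrank N g" | "mrank M1 ?A = mrank N g" "mrank M2 ?B = mrank N h"
    using le gh(2) by linarith
  then show ?thesis
  proof cases
    case 1
    then have "?A = flat_closure M1 h" "?B = flat_closure M2 g"
      using M1.eq_of_rk_le[OF fl(1) ch(1) sub(3)] M2.eq_of_rk_le[OF cg(2) fl(2) sub(2)] cg(4) ch(3) by auto
    then show ?thesis using Plus_vimage[of G] by simp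
  next
    case 2
    then have "?A = flat_closure M1 g" "?B = flat_closure M2 h"
      using M1.eq_of_rk_le[OF cg(1) fl(1) sub(1)] M2.eq_of_rk_le[OF fl(2) ch(2) sub(4)] cg(3) ch(4) by auto
    then show ?thesis using Plus_vimage[of G] by simp
  qed
qed

text \<open>The coordinate is \<open>Inl x\<close> with \<open>x\<close> new in
  \<open>g (Suc s)\<close>. A contributing set must lie strictly between two consecutive diagonal
  flats. Of the two candidates, the one growing on the right has nullity \<open>s\<close> and misses
  \<open>Inl x\<close>, hence agrees; the one growing on the left has nullity \<open>s\<close> and
  contains \<open>Inl x\<close>, giving the single term 1.\<close>

lemma W_canonical:
  assumes g: "N_flag g" and "s \<le> r" "canonical g s C"
  shows "W s C = 1"
  using assms(2-)
proof (induction s arbitrary: C)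
  case 0
  then show ?case unfolding canonical_def by (simp add: flag_weight_of_def flag_weight_def)
next
  case (Suc s)
  have s: "s < r" "s \<le> r" using Suc.prems(1) by auto
  note gD = N_flagD[OF g]
  have gs: "g s \<in> flats N" "g (Suc s) \<in> flats N" "mrank N (g s) = s" "mrank N (g (Suc s)) = Suc s" "g s \<subseteq> g (Suc s)"
    using gD(3)[of s] gD(3)[of "Suc s"] gD(4)[of s] gD(4)[of "Suc s"] gD(5)[of s "Suc s"] s Suc.prems(1) by auto
  let ?D = "\<lambda>i. dia (g i)"
  have can: "proper_chain E C" "C \<subseteq> flats P" "Suc (card C + Suc s) = R"
    "\<And>i. 1 \<le> i \<Longrightarrow> i \<le> Suc s \<Longrightarrow> ?D i \<in> insert E C"
    "\<And>F. F \<in> C \<Longrightarrow> F \<subset> ?D (Suc s) \<Longrightarrow> \<exists>i. 1 \<le> i \<and> i < Suc s \<and> F = ?D i"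
    using Suc.prems(2) unfolding canonical_def by auto
  have Di: "?D i \<in> flats P" "mrank P (?D i) = 2 * i" "d (?D i) = i" "lft (?D i) = g i" if "i \<le> Suc s" for i
    using dia_props[OF gD(3), of i] gD(4)[of i] that Suc.prems(1) by auto
  have Dss: "?D s \<subset> ?D (Suc s)"
  proof -
    have "?D s \<noteq> ?D (Suc s)" using Di(3)[of s] Di(3)[of "Suc s"] by auto
    then show ?thesis using dia_mono[OF gs(5)] by auto
  qed
  have "g s \<noteq> g (Suc s)" using gs(3,4) by auto
  then obtain x where x: "x \<in> g (Suc s)" "x \<notin> g s" using gs(5) by auto
  have xT: "x \<in> T" using x(1) gs(2) N.flats_ground by auto
  have jin: "Inl x \<in> F \<longleftrightarrow> x \<in> lft F" for F using xT unfolding lft_def by auto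
  have jE: "Inl x \<in> E" using xT T_sub by auto
  have DE: "?D (Suc s) \<in> insert E C" using can(4)[of "Suc s"] by simp
  have cmpD: "H \<subset> ?D (Suc s) \<or> ?D (Suc s) \<subseteq> H" if H: "H \<in> insert E C" for H
  proof -
    have "F \<subseteq> G \<or> G \<subseteq> F" if "F \<in> insert E C" "G \<in> insert E C" for F G
      using that proper_chainD[OF can(1)] by blast
    then show ?thesis using H DE by blast
  qed
  have below: "x \<notin> lft H \<and> d H \<le> s" if "H \<subseteq> ?D s" for H
  proof -
    have "lft H \<subseteq> lft (?D s)" using that unfolding lft_def by auto
    then show ?thesis using Di(3,4)[of s] d_mono[OF that] x(2) by auto
  qed
  have above: "x \<in> lft H \<and> s < d H" if "?D (Suc s) \<subseteq> H" for H
  proof -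
    have "lft (?D (Suc s)) \<subseteq> lft H" using that unfolding lft_def by auto
    then show ?thesis using Di(3,4)[of "Suc s"] d_mono[OF that] x(1) by auto
  qed
  have lowD: "H \<subseteq> ?D s" if H: "H \<in> C" "H \<subset> ?D (Suc s)" for H
  proof -
    obtain i where "i < Suc s" "H = ?D i" using can(5)[OF H] by blast
    then show ?thesis using dia_mono[OF gD(5)[of i s]] s by auto
  qed
  have jU: "Inl x \<in> H \<longleftrightarrow> H \<in> U s" if H: "H \<in> insert E C" for H
  proof (cases "?D (Suc s) \<subseteq> H")
    case True
    then show ?thesis using above jin unfolding U_def by auto
  next
    case False
    then have l: "H \<subset> ?D (Suc s)" using cmpD[OF H] by auto
    have "?D (Suc s) \<subseteq> E" using Di(1)[of "Suc s"] P.flats_ground by auto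
    then have "H \<in> C" using H l by auto
    then have "H \<subseteq> ?D s" using lowD l by auto
    then have "x \<notin> lft H" "\<not> s < d H" using below[of H] by simp_all
    then show ?thesis using jin[of H] unfolding U_def by simp
  qed
  let ?\<psi> = "\<lambda>G. (of_bool (Inl x \<in> G) - of_bool (G \<in> U s) :: real)"
  let ?G = "flat_closure M1 (g (Suc s)) <+> flat_closure M2 (g s)"
  note pG = closure_pair[OF gs(2,1)] and pG' = closure_pair[OF gs(1,2)]
  have un: "g (Suc s) \<union> g s = g (Suc s)" "g s \<union> g (Suc s) = g (Suc s)" using gs(5) by auto
  have dG: "d ?G = s" using d_eq[of ?G] unfolding pG(3,4) un gs(3,4) by simp
  have dG': "d (flat_closure M1 (g s) <+> flat_closure M2 (g (Suc s))) = s"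
    using d_eq[of "flat_closure M1 (g s) <+> flat_closure M2 (g (Suc s))"] unfolding pG'(3,4) un gs(3,4) by simp
  have rkG: "mrank P ?G = Suc (2 * s)" using pG(2) gs by simp
  have G1: "?\<psi> ?G = 1" using jin[of ?G] pG(3) x(1) dG unfolding U_def by simp
  have GD: "?G \<subseteq> ?D (Suc s)" "?D s \<subseteq> ?G"
    unfolding dia_def using flat_closure_mono[OF gs(5), of M1] flat_closure_mono[OF gs(5), of M2] by auto
  have GnC: "?G \<notin> C"
  proof
    assume GC: "?G \<in> C"
    have "?G \<noteq> ?D (Suc s)" using rkG Di(2)[of "Suc s"] by auto
    then obtain i where "i < Suc s" "?G = ?D i" using can(5)[OF GC] GD by auto
    then have "2 * i = Suc (2 * s)" using rkG Di(2)[of i] by auto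
    then show False by presburger
  qed
  have only: "G = ?G" if G: "G \<in> - C" "W s (insert G C) * ?\<psi> G \<noteq> 0" for G
  proof -
    have w: "W s (insert G C) \<noteq> 0" "?\<psi> G \<noteq> 0" using G(2) by auto
    have ch: "proper_chain E (insert G C)" "G \<in> flats P" using W_chain[OF s(2) w(1)] W_flats[OF w(1)] by auto
    have n1: "\<not> ?D (Suc s) \<subseteq> G" using above[of G] w(2) jin unfolding U_def by auto
    have n2: "\<not> G \<subseteq> ?D s" using below[of G] w(2) jin unfolding U_def by auto
    have "G \<subset> E" using proper_chainD(2)[OF ch(1) insertI1] .
    then have up: "G \<subset> ?D (Suc s)" using proper_chainD(3)[OF ch(1) insertI1, of "?D (Suc s)"] DE n1 by auto
    have lo: "?D s \<subset> G"
    proof (cases "s = 0")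
      case True
      have "?D s = {}" using P.eq_of_rk_le[OF P.empty_flat Di(1)[of s]] Di(2)[of s] True by simp
      then show ?thesis using proper_chainD(1)[OF ch(1) insertI1] by auto
    next
      case False
      have "?D s \<in> insert E C" using can(4)[of s] False by simp
      moreover have "?D s \<noteq> E" using Dss Di(1)[of "Suc s"] P.flats_ground by auto
      ultimately have "?D s \<in> C" by auto
      then show ?thesis using proper_chainD(3)[OF ch(1) insertI1, of "?D s"] n2 by auto
    qed
    have "mrank N (g (Suc s)) = Suc (mrank N (g s))" using gs by simp
    from between_diagonals[OF gs(1,2,5) this ch(2) lo up] show ?thesis
    proof
      assume e: "G = flat_closure M1 (g s) <+> flat_closure M2 (g (Suc s))"
      have "?\<psi> G = 0" using jin[of G] x(2) dG' unfolding e pG'(3) U_def by simp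
      then show ?thesis using w(2) by simp
    qed
  qed
  have "canonical g s (insert ?G C)" unfolding canonical_def
  proof (intro conjI allI ballI impI)
    have "H \<subseteq> ?G \<or> ?G \<subseteq> H" if "H \<in> C" for H
      using cmpD[of H] lowD[of H] GD that by auto
    moreover have "?G \<noteq> {}"
    proof
      assume e: "?G = {}"
      show False using rkG P.rk_empty unfolding e by simp
    qed
    moreover have "?G \<noteq> E"
    proof
      assume e: "?G = E"
      have "?D (Suc s) \<subseteq> E" using Di(1)[of "Suc s"] P.flats_ground by auto
      then have "?D (Suc s) = ?G" using GD(1) e by auto
      then show False using rkG Di(2)[of "Suc s"] by auto
    qed
    moreover have "?G \<subseteq> E" using pG(1) P.flats_ground by auto
    ultimately show "proper_chain E (insert ?G C)" unfolding proper_chain_insert using can(1) by auto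
    show "insert ?G C \<subseteq> flats P" using can(2) pG(1) by auto
    show "Suc (card (insert ?G C) + s) = R" using GnC can(3) by simp
    show "?D i \<in> insert E (insert ?G C)" if "1 \<le> i" "i \<le> s" for i using can(4)[of i] that by auto
    fix F assume F: "F \<in> insert ?G C" "F \<subset> ?D s"
    then have FC: "F \<in> C" using GD(2) by auto
    obtain i where i: "1 \<le> i" "i < Suc s" "F = ?D i" using can(5)[OF FC] F(2) Dss by auto
    then have "i \<noteq> s" using F(2) by auto
    then show "\<exists>i. 1 \<le> i \<and> i < s \<and> F = ?D i" using i by (intro exI[of _ i]) auto
  qed
  then have W1: "W s (insert ?G C) = 1" using Suc.IH s by simp
  have "W (Suc s) C = (\<Sum>G\<in>- C. W s (insert G C) * ?\<psi> G)"
    unfolding W.simps by (rule chain_divisor_eq[OF _ jE jU]) (use W_props s in auto)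
  also have "\<dots> = (\<Sum>G\<in>{?G}. W s (insert G C) * ?\<psi> G)"
  proof (rule sum.mono_neutral_right)
    show "\<forall>G\<in>- C - {?G}. W s (insert G C) * ?\<psi> G = 0"
    proof
      fix G assume "G \<in> - C - {?G}"
      then show "W s (insert G C) * ?\<psi> G = 0" using only[of G] by (metis DiffD1 DiffD2 singletonI)
    qed
  qed (use GnC in simp_all)
  also have "\<dots> = 1" using W1 G1 by simp
  finally show ?case .
qed

text \<open>Complete the given sets to a flag of \<open>P\<close> through the top diagonal flat,
  then replace everything below that flat by the diagonal flats of even rank. This drops
  \<open>r\<close> members, as many as there are divisors.\<close>

lemma canonical_exists:
  assumes g: "N_flag g" and K: "proper_chain E K" "K \<subseteq> flats P" "\<And>F. F \<in> K \<Longrightarrow> dia (g r) \<subseteq> F"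
  obtains C where "canonical g r C" "K \<subseteq> C"
proof -
  let ?D = "\<lambda>i. dia (g i)"
  note gD = N_flagD[OF g]
  have Di: "?D i \<in> flats P" "mrank P (?D i) = 2 * i" if "i \<le> r" for i
    using dia_props[OF gD(3), of i] gD(4)[of i] that by auto
  have Dmono: "?D i \<subseteq> ?D j" if "i \<le> j" "j \<le> r" for i j using dia_mono[OF gD(5)] that by auto
  have DE: "?D r \<subseteq> E" using Di(1)[of r] P.flats_ground by auto
  let ?K = "K \<union> ({?D r} - {{}, E})"
  have "proper_chain E ?K"
  proof (cases "?D r \<in> {{}, E}")
    case True
    then have "?K = K" by blast
    then show ?thesis using K(1) by simp
  next
    case False
    then have "?K = insert (?D r) K" by blast
    then show ?thesis using False K(1,3) DE by (simp add: proper_chain_insert psubset_eq)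
  qed
  moreover have "?K \<subseteq> flats P" using K(2) Di(1)[of r] by auto
  ultimately obtain B where B: "?K \<subseteq> B" "proper_chain E B" "B \<subseteq> flats P" "Suc (card B) = R"
    using P.flag_extension[OF _ _ nonempty] by metis
  have DB: "?D r \<in> insert {} (insert E B)" using B(1) by auto
  note rB = P.rk_proper_chain[OF B(2,3)]
  have img: "mrank P ` B = {1..<R}" by (rule card_subset_eq) (use rB B(4) card_image[OF rB(2)] in auto)
  let ?hi = "{F \<in> B. ?D r \<subseteq> F}" and ?lo = "?D ` {1..<r}"
  have hi: "?hi = {F \<in> B. 2 * r \<le> mrank P F}"
  proof (intro Collect_cong conj_cong refl iffI)
    fix F assume F: "F \<in> B"
    show "2 * r \<le> mrank P F" if "?D r \<subseteq> F" using P.rk_mono[OF Di(1)[OF order.refl] _ that] F B(3) Di(2)[of r] by auto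
    show "?D r \<subseteq> F" if "2 * r \<le> mrank P F"
      by (rule P.chain_subset_of_rk[OF B(2,3) DB]) (use F that Di(2)[of r] in auto)
  qed
  have "mrank P ` ?hi = {n \<in> mrank P ` B. 2 * r \<le> n}" unfolding hi by auto
  \<comment> \<open>The maximum with 1 covers \<open>r = 0\<close>: the flat of rank
    \<open>0\<close> is not a chain member.\<close>
  also have "\<dots> = {max 1 (2 * r)..<R}" unfolding img by auto
  finally have "card (mrank P ` ?hi) = R - max 1 (2 * r)" by simp
  moreover have "inj_on (mrank P) ?hi" using rB(2) by (rule inj_on_subset) auto
  ultimately have cardhi: "card ?hi = R - max 1 (2 * r)" by (simp add: card_image)
  have injD: "inj_on ?D {1..<r}"
  proof (rule inj_onI)
    fix i j assume ij: "i \<in> {1..<r}" "j \<in> {1..<r}" "?D i = ?D j"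
    have "mrank P (?D i) = 2 * i" "mrank P (?D j) = 2 * j" using Di(2)[of i] Di(2)[of j] ij(1,2) by simp_all
    then have "2 * i = 2 * j" using ij(3) by metis
    then show "i = j" by simp
  qed
  have Dlt: "?D i \<subset> ?D r" if "i \<in> {1..<r}" for i
  proof -
    have "?D i \<noteq> ?D r" using Di(2)[of i] Di(2)[of r] that by auto
    then show ?thesis using Dmono[of i r] that by auto
  qed
  define C where "C = ?lo \<union> ?hi"
  have disj: "?lo \<inter> ?hi = {}"
  proof (rule ccontr)
    assume "?lo \<inter> ?hi \<noteq> {}"
    then obtain F where "F \<in> ?lo" "F \<in> ?hi" by blast
    then obtain i where i: "i \<in> {1..<r}" "?D r \<subseteq> ?D i" by blast
    from Dlt[OF i(1)] i(2) show False by (metis psubsetD psubsetE)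
  qed
  have R2: "2 * r \<le> R" using r_le R_eq by simp
  have cardC: "card C = (r - 1) + (R - max 1 (2 * r))"
    unfolding C_def using card_Un_disjoint[OF _ _ disj] card_image[OF injD] cardhi by simp
  show ?thesis
  proof (rule that)
    show "K \<subseteq> C" unfolding C_def using K(3) B(1) by auto
    show "canonical g r C" unfolding canonical_def
    proof (intro conjI allI impI ballI)
      have lo: "F \<noteq> {} \<and> F \<subset> E" if F: "F \<in> ?lo" for F
      proof -
        obtain i where i: "i \<in> {1..<r}" "F = ?D i" using F by auto
        then have "mrank P F \<noteq> 0" using Di(2)[of i] by auto
        then show ?thesis using Dlt[OF i(1)] DE i P.rk_empty by auto
      qed
      have hi': "F \<noteq> {} \<and> F \<subset> E" if F: "F \<in> ?hi" for F using F proper_chainD[OF B(2), of F] by auto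
      have c1: "F \<subseteq> G \<or> G \<subseteq> F" if FG: "F \<in> ?lo" "G \<in> ?lo" for F G
      proof -
        obtain i j where ij: "i \<in> {1..<r}" "F = ?D i" "j \<in> {1..<r}" "G = ?D j" using FG by auto
        then show ?thesis using Dmono[of i j] Dmono[of j i] by (cases "i \<le> j") auto
      qed
      have c2: "F \<subseteq> G" if "F \<in> ?lo" "G \<in> ?hi" for F G using that Dlt by blast
      have c3: "F \<subseteq> G \<or> G \<subseteq> F" if "F \<in> ?hi" "G \<in> ?hi" for F G using that proper_chainD(3)[OF B(2), of F G] by auto
      show "proper_chain E C" unfolding proper_chain_def C_def
      proof (intro conjI ballI)
        fix F assume F: "F \<in> ?lo \<union> ?hi"
        then show "F \<noteq> {}" "F \<subset> E" using lo hi' by blast+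
        fix G assume G: "G \<in> ?lo \<union> ?hi"
        show "F \<subseteq> G \<or> G \<subseteq> F" using F G c1[of F G] c2[of F G] c2[of G F] c3[of F G] by blast
      qed
      show "C \<subseteq> flats P" unfolding C_def using B(3) Di(1) by auto
      show "Suc (card C + r) = R" using cardC R2 r_less by (cases "r = 0") auto
      fix i assume i: "1 \<le> i" "i \<le> r"
      show "?D i \<in> insert E C"
      proof (cases "i = r")
        case True
        have "?D r \<noteq> {}" using Di(2)[of r] i True P.rk_empty by auto
        then show ?thesis using True B(1) unfolding C_def by auto
      qed (use i in \<open>auto simp: C_def\<close>)
    next
      fix F assume F: "F \<in> C" "F \<subset> ?D r"
      then have "F \<in> ?lo" unfolding C_def by auto
      then show "\<exists>i. 1 \<le> i \<and> i < r \<and> F = ?D i" by auto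
    qed
  qed
qed

lemma dia_of_canonical:
  assumes g: "N_flag g" and C: "canonical g r C" and i: "1 \<le> i" "i \<le> r" "i < R - r"
  shows "dia (g i) \<in> C"
proof -
  note gD = N_flagD[OF g]
  have "dia (g i) \<in> insert E C" using C i unfolding canonical_def by auto
  moreover have "mrank P (dia (g i)) = 2 * i" using dia_props(2)[OF gD(3), of i] gD(4)[of i] i by simp
  then have "dia (g i) \<noteq> E" using i by auto
  ultimately show ?thesis by auto
qed

text \<open>One canonical chain is followed, and \<open>j\<close> is chosen so that no set other
  than its next member can be added. While positions are at most \<open>r\<close>, \<open>j\<close>
  is a new element of the flag of \<open>N\<close>. A competitor contains the next diagonal flat of
  rank \<open>2 * Suc p\<close>; from \<open>rk = d + Suc p\<close> and
  \<open>2 * d \<le> rk\<close> its rank is at most that. Beyond \<open>r\<close> the nullity is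
  constantly \<open>r\<close>, so a competitor is the unique flat of \<open>P\<close> one rank
  higher through \<open>j\<close>.\<close>

theorem degree_one: "(chain_divisor E {F. E \<subseteq> F} ^^ (R - r - 1)) (W r) {} = 1"
proof -
  let ?k = "R - r"
  have k: "0 < ?k" using r_less by simp
  obtain g where g: "N_flag g" using N_flag_exists by metis
  note gD = N_flagD[OF g]
  have "proper_chain E {}" unfolding proper_chain_def by simp
  then obtain C where C: "canonical g r C" using canonical_exists[OF g, of "{}"] by auto
  have WC: "W r C = 1" by (rule W_canonical[OF g order.refl C])
  then have chC: "proper_chain E C" "Suc (card C) = ?k" "C \<subseteq> flats P"
    using W_chain[of r C] W_flats[of r C] by auto
  obtain e where e: "C = e ` {1..card C}" "\<forall>i j. 1 \<le> i \<longrightarrow> i < j \<longrightarrow> j \<le> card C \<longrightarrow> e i \<subset> e j"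
    using chain_enumeration[of C] proper_chainD(3)[OF chC(1)] by auto
  have eC: "e i \<in> C" if "1 \<le> i" "i \<le> card C" for i using e(1) that by auto
  have e_inj: "inj_on e {1..card C}"
    using e(2) unfolding inj_on_def by (metis atLeastAtMost_iff linorder_neqE_nat psubsetE order.refl)
  have e_sub: "e i \<subseteq> e j \<longleftrightarrow> i \<le> j" if "1 \<le> i" "i \<le> card C" "1 \<le> j" "j \<le> card C" for i j
  proof (cases i j rule: linorder_cases)
    case less then show ?thesis using e(2) that by auto
  next
    case greater then show ?thesis using e(2) that by (metis leD psubsetD psubsetE)
  qed auto
  have pos: "mrank P (e i) = d (e i) + i" if i: "1 \<le> i" "i \<le> card C" for i
  proof -
    have "{H \<in> C. H \<subseteq> e i} = e ` {1..i}"
    proof (intro equalityI subsetI)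
      fix H assume H: "H \<in> {H \<in> C. H \<subseteq> e i}"
      then have "H \<in> e ` {1..card C}" using e(1) by blast
      then obtain h where "h \<in> {1..card C}" "H = e h" by (rule imageE)
      then show "H \<in> e ` {1..i}" using e_sub[of h i] i H by auto
    next
      fix H assume "H \<in> e ` {1..i}"
      then obtain h where "h \<in> {1..i}" "H = e h" by auto
      then show "H \<in> {H \<in> C. H \<subseteq> e i}" using e_sub[of h i] eC[of h] i by auto
    qed
    moreover have "card (e ` {1..i}) = i" using card_image[OF inj_on_subset[OF e_inj]] i by auto
    moreover have "d (e i) \<le> r" using d_le eC[OF i] proper_chainD(2)[OF chC(1)] by auto
    ultimately show ?thesis using position[of r C "e i"] WC eC[OF i] by simp
  qed
  have diag: "e i = dia (g i)" if i: "1 \<le> i" "i \<le> r" "i \<le> card C" for i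
  proof -
    have "dia (g i) \<in> C" by (rule dia_of_canonical[OF g C]) (use i chC(2) in auto)
    then have "dia (g i) \<in> e ` {1..card C}" using e(1) by simp
    then obtain h where h0: "dia (g i) = e h" "h \<in> {1..card C}" by (rule imageE)
    then have h: "1 \<le> h" "h \<le> card C" "dia (g i) = e h" by auto
    have "2 * i = i + h" using pos[OF h(1,2)] dia_props[OF gD(3), of i] gD(4)[of i] i h(3) by simp
    then show ?thesis using h(3) by simp
  qed
  define AL where "AL m = (chain_divisor E {F. E \<subseteq> F} ^^ m) (W r)" for m
  have wt: "chain_weight E ?k (W r)" and bal: "chain_balanced E (W r)" using W_props[of r] by auto
  \<comment> \<open>The lowest \<open>p\<close> members remain after \<open>m\<close> divisors by
    \<open>\<alpha>\<close>; the two numbers always add up to the length of the chain.\<close>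
  have "AL m (e ` {1..p}) = 1" if "m + p = card C" for m p
    using that
  proof (induction m arbitrary: p)
    case 0
    then show ?case using WC e(1) unfolding AL_def by simp
  next
    case (Suc m)
    let ?D = "e ` {1..p}" and ?F = "e (Suc p)"
    have p: "Suc p \<le> card C" "m + Suc p = card C" using Suc.prems by auto
    have insD: "insert ?F ?D = e ` {1..Suc p}" by (simp add: atLeastAtMostSuc_conv)
    have DC: "insert ?F ?D \<subseteq> C" unfolding insD using e(1) p by auto
    have chD: "proper_chain E ?D" using proper_chain_subset[OF chC(1)] DC by blast
    have FnD: "?F \<notin> ?D"
    proof
      assume "?F \<in> ?D"
      then obtain i where "?F = e i" "i \<in> {1..p}" by (rule imageE)
      then show False using inj_onD[OF e_inj, of "Suc p" i] p by simp
    qed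
    have cardD: "card ?D = p" using card_image[OF inj_on_subset[OF e_inj]] p by auto
    have Dlt: "H \<subset> ?F" if H: "H \<in> ?D" for H
    proof -
      obtain i where "H = e i" "i \<in> {1..p}" using H by (rule imageE)
      then show ?thesis using e(2) p by simp
    qed
    have FP: "?F \<in> flats P" "?F \<subset> E" using eC[of "Suc p"] p chC(3) proper_chainD(2)[OF chC(1)] by auto
    have "R - r = Suc (Suc p) + m" using chC(2) p by simp
    then have wtm: "chain_weight E (Suc (Suc p) + m) (W r)" using wt by simp
    note props = alpha_iterate_props[OF nonempty wtm bal, folded AL_def]
    \<comment> \<open>A set that can follow \<open>?D\<close> occupies position \<open>p + 1\<close>
      in a chain of \<open>W r\<close>, so that its nullity fixes its rank.\<close>
    have gen: "mrank P G = d G + Suc p \<and> lft G = rgt G \<and> d G = mrank N (lft G) \<and> G \<in> flats P \<and> (\<forall>H\<in>?D. H \<subseteq> G)"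
      if G: "G \<notin> ?D" "AL m (insert G ?D) \<noteq> 0" "\<exists>j\<in>G. \<forall>H\<in>?D. j \<notin> H" for G
    proof -
      obtain B where B: "W r B \<noteq> 0" "insert G ?D \<subseteq> B" "\<forall>H\<in>B - insert G ?D. \<forall>H'\<in>insert G ?D. H' \<subset> H"
        using alpha_iterate_support[OF nonempty wtm bal, of "insert G ?D"] G(2) unfolding AL_def by blast
      have ch: "proper_chain E B" using W_chain B(1) by auto
      have DG: "H \<subseteq> G" if "H \<in> ?D" for H
        using proper_chainD(3)[OF ch, of G H] B(2) that G(3) by auto
      have "{H \<in> B. H \<subseteq> G} = insert G ?D" using B(2,3) DG by auto
      then have "card {H \<in> B. H \<subseteq> G} = Suc p" using G(1) cardD by simp
      moreover have GB: "G \<in> B" using B(2) by auto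
      moreover have "d G \<le> r" using d_le proper_chainD(2)[OF ch GB] by auto
      ultimately have "mrank P G = d G + Suc p" using position[OF order.refl B(1) GB] by simp
      then show ?thesis using diagonal[OF B(1) GB] W_flats[OF B(1)] GB DG by auto
    qed
    have "\<exists>j\<in>?F. (\<forall>H\<in>?D. j \<notin> H) \<and> (\<forall>G. G \<notin> ?D \<longrightarrow> AL m (insert G ?D) \<noteq> 0 \<longrightarrow> j \<in> G \<longrightarrow> G = ?F)"
    proof (cases "Suc p \<le> r")
      case True
      have F: "?F = dia (g (Suc p))" by (rule diag) (use True p in auto)
      have gp: "g p \<in> flats N" "g (Suc p) \<in> flats N" "mrank N (g p) = p" "mrank N (g (Suc p)) = Suc p" "g p \<subseteq> g (Suc p)"
        using gD(3)[of p] gD(3)[of "Suc p"] gD(4)[of p] gD(4)[of "Suc p"] gD(5)[of p "Suc p"] True by auto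
      have "g p \<noteq> g (Suc p)" using gp(3,4) by auto
      then obtain x where x: "x \<in> g (Suc p)" "x \<notin> g p" using gp(5) by auto
      have xT: "x \<in> T" using x(1) gp(2) N.flats_ground by auto
      have Dp: "H \<subseteq> dia (g p)" if H: "H \<in> ?D" for H
      proof -
        obtain i where i: "i \<in> {1..p}" "H = e i" using H by auto
        then have "H = dia (g i)" using diag[of i] True p by auto
        then show ?thesis using dia_mono[OF gD(5)[of i p]] i True by auto
      qed
      have xD: "Inl x \<notin> H" if H: "H \<in> ?D" for H
      proof -
        have "lft H \<subseteq> lft (dia (g p))" using Dp[OF H] unfolding lft_def by auto
        then have "x \<notin> lft H" using x(2) unfolding dia_props(3)[OF gp(1)] by auto
        then show ?thesis using xT unfolding lft_def by auto
      qed
      have xF: "Inl x \<in> ?F" using x(1) dia_props(3)[OF gp(2)] unfolding F lft_def by auto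
      have "G = ?F" if G: "G \<notin> ?D" "AL m (insert G ?D) \<noteq> 0" "Inl x \<in> G" for G
      proof -
        have GG: "mrank P G = d G + Suc p" "lft G = rgt G" "d G = mrank N (lft G)" "G \<in> flats P" "\<forall>H\<in>?D. H \<subseteq> G"
          using gen[OF G(1,2)] G(3) xD by blast+
        have gpG: "g p \<subseteq> lft G"
        proof (cases "p = 0")
          case True then show ?thesis using gD(1) by simp
        next
          case False
          then have "dia (g p) \<in> ?D" using diag[of p] True p by auto
          then have "lft (dia (g p)) \<subseteq> lft G" using GG(5) unfolding lft_def by auto
          then show ?thesis unfolding dia_props(3)[OF gp(1)] .
        qed
        have lG: "lft G \<in> flats N" by (rule flat_lft(1)[OF GG(4)])
        have int: "lft G \<inter> g (Suc p) \<in> flats N" by (rule N.inter_flat[OF lG gp(2)])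
        have "g p \<subset> lft G \<inter> g (Suc p)" using gpG gp(5) x G(3) xT unfolding lft_def by auto
        then have "p < mrank N (lft G \<inter> g (Suc p))" using N.rk_strict[OF gp(1) int] gp(3) by simp
        then have "lft G \<inter> g (Suc p) = g (Suc p)" using N.eq_of_rk_le[OF int gp(2)] gp(4) by auto
        then have sub: "g (Suc p) \<subseteq> lft G" by auto
        have DG: "dia (lft G) \<subseteq> G" using dia_subset[OF GG(4)] GG(2) by auto
        have "2 * mrank N (lft G) \<le> mrank P G"
          using P.rk_mono[OF dia_props(1)[OF lG] GG(4) DG] dia_props(2)[OF lG] by simp
        then have "mrank P G \<le> 2 * Suc p" using GG(1,3) by simp
        moreover have "?F \<subseteq> G" unfolding F using dia_mono[OF sub] DG by auto
        ultimately show ?thesis using P.eq_of_rk_le[OF FP(1) GG(4)] dia_props(2)[OF gp(2)] gp(4) unfolding F by auto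
      qed
      then show ?thesis using xD xF by blast
    next
      case False
      then have rp: "r \<le> p" by simp
      obtain A where A: "A \<in> insert {} ?D" "\<forall>H\<in>?D. H \<subseteq> A" "mrank P A = d A + p" "A \<in> flats P" "dia (g r) \<subseteq> A"
      proof (cases "p = 0")
        case True
        then have "r = 0" using rp by simp
        then have "dia (g r) = {}" using P.eq_of_rk_le[OF P.empty_flat dia_props(1)[OF gD(3)], of r] dia_props(2)[OF gD(3), of r] gD(4)[of r] P.rk_empty by simp
        then show ?thesis using that[of "{}"] True P.rk_empty P.empty_flat d_empty by simp
      next
        case False
        have "dia (g r) \<subseteq> e p"
        proof (cases "r = 0")
          case True
          then have "dia (g r) = {}" using P.eq_of_rk_le[OF P.empty_flat dia_props(1)[OF gD(3)], of r] dia_props(2)[OF gD(3), of r] gD(4)[of r] P.rk_empty by simp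
          then show ?thesis by simp
        next
          case r0: False
          then have "dia (g r) = e r" using diag[of r] rp p by auto
          then show ?thesis using e_sub[of r p] r0 False rp p by auto
        qed
        moreover have "\<forall>H\<in>?D. H \<subseteq> e p" using e_sub p by auto
        ultimately show ?thesis using that[of "e p"] False pos[of p] p eC[of p] chC(3) by auto
      qed
      have dr: "d H = r" if "dia (g r) \<subseteq> H" "H \<subseteq> E" for H
        using d_mono[OF that(1)] d_le[OF that(2)] dia_props(5)[OF gD(3), of r] gD(4)[of r] by simp
      have AF: "A \<subset> ?F" using A(1) Dlt eC[of "Suc p"] p proper_chainD(1)[OF chC(1)] by auto
      then obtain j where j: "j \<in> ?F" "j \<notin> A" by auto
      have jD: "\<forall>H\<in>?D. j \<notin> H" using j A(2) by auto
      have jE: "j \<in> E - A" using j FP by auto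
      obtain B where B: "\<And>H. H \<in> flats P \<Longrightarrow> A \<subseteq> H \<Longrightarrow> j \<in> H \<Longrightarrow> mrank P H = Suc (mrank P A) \<Longrightarrow> H = B"
        using P.unique_extension[OF A(4) jE] by metis
      have rA: "mrank P A = r + p" using A(3) dr[OF A(5)] A(4) P.flats_ground by auto
      have "?F = B"
      proof (rule B[OF FP(1) _ j(1)])
        show "A \<subseteq> ?F" using AF by auto
        then show "mrank P ?F = Suc (mrank P A)" using pos[of "Suc p"] p dr[of ?F] A(5) FP rA by auto
      qed
      moreover have "G = B" if G: "G \<notin> ?D" "AL m (insert G ?D) \<noteq> 0" "j \<in> G" for G
      proof -
        have GG: "mrank P G = d G + Suc p" "G \<in> flats P" "\<forall>H\<in>?D. H \<subseteq> G"
          using gen[OF G(1,2)] G(3) jD by blast+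
        have AG: "A \<subseteq> G" using A(1) GG(3) by auto
        then have "mrank P G = Suc (mrank P A)" using GG(1) dr[of G] A(5) GG(2) P.flats_ground rA by auto
        then show ?thesis using B[OF GG(2) AG G(3)] by simp
      qed
      ultimately show ?thesis using j(1) jD by blast
    qed
    then obtain j where j: "j \<in> ?F" "\<forall>H\<in>?D. j \<notin> H"
      "\<And>G. G \<notin> ?D \<Longrightarrow> AL m (insert G ?D) \<noteq> 0 \<Longrightarrow> j \<in> G \<Longrightarrow> G = ?F" by blast
    have jE: "j \<in> E" using j(1) FP by auto
    have "AL (Suc m) ?D = chain_divisor E {F. E \<subseteq> F} (AL m) ?D" unfolding AL_def by simp
    also have "\<dots> = chain_vec (AL m) ?D j"
      using alpha_divisor[OF _ _ chD jE] props j(2) by blast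
    also have "\<dots> = (\<Sum>G\<in>{?F}. AL m (insert G ?D) * of_bool (j \<in> G))"
      unfolding chain_vec_def by (rule sum.mono_neutral_right) (use FnD j(3) in auto)
    also have "\<dots> = 1" using Suc.IH[OF p(2)] insD j(1) by simp
    finally show ?case .
  qed
  from this[of "card C" 0] have "AL (card C) {} = 1" by simp
  moreover have "R - r - 1 = card C" using chC(2) by simp
  ultimately show ?thesis unfolding AL_def by simp
qed

end

section \<open>The fibre product of a proper amalgam\<close>

lemma foldr_divisor_props:
  fixes E :: "'n::finite set"
  assumes "chain_weight E (k + length xs) \<omega>" "chain_balanced E \<omega>" "\<And>t. t \<in> set xs \<Longrightarrow> up_set E (V t)"
  shows "chain_weight E k (foldr (\<lambda>t. chain_divisor E (V t)) xs \<omega>) \<and>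
    chain_balanced E (foldr (\<lambda>t. chain_divisor E (V t)) xs \<omega>)"
  using assms
proof (induction xs arbitrary: k)
  case (Cons x xs)
  have "chain_weight E (Suc k + length xs) \<omega>" using Cons.prems(1) by simp
  from Cons.IH[OF this Cons.prems(2)] Cons.prems(3)
  have p: "chain_weight E (Suc k) (foldr (\<lambda>t. chain_divisor E (V t)) xs \<omega>)"
    "chain_balanced E (foldr (\<lambda>t. chain_divisor E (V t)) xs \<omega>)" by simp_all
  have Vx: "up_set E (V x)" using Cons.prems(3) by simp
  show ?case using chain_weight_divisor[OF p(1)] chain_balanced_divisor[OF p Vx] by simp
qed simp

lemma foldr_divisor_move:
  fixes E :: "'n::finite set"
  assumes "chain_weight E (Suc (k + length xs)) \<omega>" "chain_balanced E \<omega>" "\<And>t. t \<in> set xs \<Longrightarrow> up_set E (V t)" "up_set E U"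
  shows "foldr (\<lambda>t. chain_divisor E (V t)) xs (chain_divisor E U \<omega>) = chain_divisor E U (foldr (\<lambda>t. chain_divisor E (V t)) xs \<omega>)"
  using assms
proof (induction xs arbitrary: k)
  case (Cons x xs)
  have w: "chain_weight E (Suc (Suc k + length xs)) \<omega>" "chain_weight E (Suc (Suc k) + length xs) \<omega>" using Cons.prems(1) by simp_all
  let ?h = "foldr (\<lambda>t. chain_divisor E (V t)) xs \<omega>"
  have p: "chain_weight E (Suc (Suc k)) ?h" "chain_balanced E ?h"
    using foldr_divisor_props[OF w(2) Cons.prems(2)] Cons.prems(3) by auto
  have IH: "foldr (\<lambda>t. chain_divisor E (V t)) xs (chain_divisor E U \<omega>) = chain_divisor E U ?h"
    using Cons.IH[OF w(1) Cons.prems(2) _ Cons.prems(4)] Cons.prems(3) by simp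
  have Vx: "up_set E (V x)" using Cons.prems(3) by simp
  show ?case using chain_divisor_commute[OF p(1,2) Vx Cons.prems(4)] IH by simp
qed simp

text \<open>Reversal is the only rearrangement required: the fibre product takes the thresholds
  upwards, the sequence of lifts takes them downwards.\<close>

lemma foldr_divisor_rev:
  fixes E :: "'n::finite set"
  assumes "chain_weight E (k + length xs) \<omega>" "chain_balanced E \<omega>" "\<And>t. t \<in> set xs \<Longrightarrow> up_set E (V t)"
  shows "foldr (\<lambda>t. chain_divisor E (V t)) (rev xs) \<omega> = foldr (\<lambda>t. chain_divisor E (V t)) xs \<omega>"
  using assms
proof (induction xs arbitrary: \<omega>)
  case (Cons x xs)
  have w: "chain_weight E (Suc (k + length xs)) \<omega>" using Cons.prems(1) by simp
  have Vx: "up_set E (V x)" using Cons.prems(3) by simp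
  have "foldr (\<lambda>t. chain_divisor E (V t)) (rev xs) (chain_divisor E (V x) \<omega>) =
      foldr (\<lambda>t. chain_divisor E (V t)) xs (chain_divisor E (V x) \<omega>)"
    using Cons.IH[OF chain_weight_divisor[OF w] chain_balanced_divisor[OF w Cons.prems(2) Vx]] Cons.prems(3) by simp
  also have "\<dots> = chain_divisor E (V x) (foldr (\<lambda>t. chain_divisor E (V t)) xs \<omega>)"
    using foldr_divisor_move[OF w Cons.prems(2) _ Vx] Cons.prems(3) by simp
  finally show ?case by simp
qed simp

context fibre_data
begin

text \<open>\<open>join\<close> identifies the two copies of \<open>T\<close> and
  \<open>split\<close> doubles the elements of \<open>T\<close>. On subsets of \<open>E\<close>,
  \<open>split\<close> undoes \<open>join\<close> exactly for sets with equal traces.\<close>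

definition join :: "('a + 'a) set \<Rightarrow> 'a set" where "join F = Inl -` F \<union> Inr -` F"
definition split :: "'a set \<Rightarrow> ('a + 'a) set" where "split S = (S \<inter> ground M1) <+> (S \<inter> ground M2)"

end

locale amalgam_data = fibre_data M1 M2 N for M1 M2 N :: "'a::finite flat_system" +
  fixes M :: "'a flat_system"
  assumes proper: "proper_amalgam M1 M2 N M"
begin

lemma M: "loopless_matroid M" and ground_M: "ground M = ground M1 \<union> ground M2"
  and M_res: "restriction M (ground M1) = M1" "restriction M (ground M2) = M2"
  and proper_rank: "F \<in> flats M \<Longrightarrow> int (mrank M F) =
        int (mrank M1 (F \<inter> ground M1)) + int (mrank M2 (F \<inter> ground M2)) - int (mrank N (F \<inter> ground N))"
  using proper unfolding proper_amalgam_def amalgam_def by auto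

sublocale M: ranked_flats "ground M" "flats M" "mrank M" by (rule ranked_flats_mrank[OF M])

text \<open>The amalgam with every element of \<open>T\<close> replaced by two parallel copies, so
  that it can be compared with \<open>P\<close> on the same groundset.\<close>

definition Q :: "('a + 'a) flat_system" where "Q = Flat_System E (split ` flats M)"

lemma join_split: "S \<subseteq> ground M \<Longrightarrow> join (split S) = S"
  unfolding join_def split_def ground_M by auto

lemma join_mono: "F \<subseteq> G \<Longrightarrow> join F \<subseteq> join G" unfolding join_def by auto
lemma split_mono: "S \<subseteq> S' \<Longrightarrow> split S \<subseteq> split S'" unfolding split_def by auto

lemma join_ground: "F \<subseteq> E \<Longrightarrow> join F \<subseteq> ground M"
  unfolding join_def ground_M by auto

lemma split_join: "F \<subseteq> E \<Longrightarrow> F \<subseteq> split (join F)"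
proof
  fix x assume "F \<subseteq> E" "x \<in> F"
  then show "x \<in> split (join F)" unfolding split_def join_def by (cases x) auto
qed

lemma ground_Q [simp]: "ground Q = E" unfolding Q_def by simp

lemma flats_Q: "F \<in> flats Q \<longleftrightarrow> (\<exists>S\<in>flats M. F = split S)" unfolding Q_def by auto

lemma Q_ranked: "ranked_flats E (split ` flats M) (\<lambda>F. mrank M (join F))"
proof
  have u: "join (split S) = S" if "S \<in> flats M" for S using join_split that M.flats_ground by auto
  show "finite E" by simp
  show "split ` flats M \<subseteq> Pow E" unfolding split_def by auto
  have "split {} = {}" unfolding split_def by auto
  then show "{} \<in> split ` flats M" using M.empty_flat by (metis image_eqI)
  have "split (ground M) = E" unfolding split_def ground_M by auto
  then show "E \<in> split ` flats M" using M.ground_flat by (metis image_eqI)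
  show "mrank M (join {}) = 0" unfolding join_def using M.rk_empty by simp
  show "mrank M (join F) < mrank M (join G)" if FG: "F \<in> split ` flats M" "G \<in> split ` flats M" "F \<subset> G" for F G
  proof -
    obtain A B where AB: "A \<in> flats M" "F = split A" "B \<in> flats M" "G = split B" using FG by auto
    have "A \<subseteq> B" using join_mono[of F G] FG(3) u AB by auto
    moreover have "A \<noteq> B" using FG(3) AB by auto
    ultimately show ?thesis using M.rk_strict[OF AB(1,3)] u AB by auto
  qed
  fix F x assume F: "F \<in> split ` flats M" "x \<in> E - F"
  then obtain S where S: "S \<in> flats M" "F = split S" by auto
  obtain a where a: "a \<in> ground M - S" "\<And>S'. x \<in> split S' \<longleftrightarrow> a \<in> S'"
  proof (cases x)
    case (Inl a)
    have a: "a \<in> ground M1" using F(2) Inl by auto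
    then have e: "x \<in> split S' \<longleftrightarrow> a \<in> S'" for S' unfolding split_def Inl by auto
    have "a \<in> ground M - S" using a F(2) e[of S] unfolding S(2) ground_M by auto
    then show ?thesis using that e by metis
  next
    case (Inr a)
    have a: "a \<in> ground M2" using F(2) Inr by auto
    then have e: "x \<in> split S' \<longleftrightarrow> a \<in> S'" for S' unfolding split_def Inr by auto
    have "a \<in> ground M - S" using a F(2) e[of S] unfolding S(2) ground_M by auto
    then show ?thesis using that e by metis
  qed
  obtain G where G: "G \<in> flats M" "S \<subseteq> G" "a \<in> G" "mrank M G = Suc (mrank M S)"
     "\<forall>H\<in>flats M. S \<subseteq> H \<and> a \<in> H \<longrightarrow> G \<subseteq> H" using M.extend[OF S(1) a(1)] by auto
  show "\<exists>G\<in>split ` flats M. F \<subseteq> G \<and> x \<in> G \<and> mrank M (join G) = Suc (mrank M (join F)) \<and>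
           (\<forall>H\<in>split ` flats M. F \<subseteq> H \<and> x \<in> H \<longrightarrow> G \<subseteq> H)"
  proof (intro bexI[of _ "split G"] conjI ballI impI)
    show "F \<subseteq> split G" unfolding S(2) by (rule split_mono[OF G(2)])
    show "x \<in> split G" using a(2) G(3) by simp
    show "mrank M (join (split G)) = Suc (mrank M (join F))" using u G S by simp
    fix H assume H: "H \<in> split ` flats M" "F \<subseteq> H \<and> x \<in> H"
    then obtain S' where S': "S' \<in> flats M" "H = split S'" by auto
    have "S \<subseteq> S'" using join_mono[of F H] H(2) u S S' by auto
    moreover have "a \<in> S'" using H(2) a(2) S'(2) by simp
    ultimately have "G \<subseteq> S'" using G(5) S'(1) by auto
    then show "split G \<subseteq> H" unfolding S'(2) by (rule split_mono)
  qed (use G in simp)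
qed

lemma loopless_Q: "loopless_matroid Q"
  unfolding Q_def by (rule ranked_flats.loopless[OF Q_ranked])

sublocale Q: ranked_flats E "flats Q" "mrank Q"
  using ranked_flats_mrank[OF loopless_Q] by simp

lemma rk_Q: "F \<subseteq> E \<Longrightarrow> mrank Q F = mrank M (join F)"
proof -
  assume F: "F \<subseteq> E"
  let ?S = "flat_closure M (join F)"
  have S: "?S \<in> flats M" by (rule flat_closure_in_flats[OF M join_ground[OF F]])
  have "flat_closure Q F = split ?S"
  proof
    show "flat_closure Q F \<subseteq> split ?S"
    proof (rule flat_closure_subset)
      show "F \<subseteq> split ?S" using split_join[OF F] split_mono[OF flat_closure_superset] by blast
      show "split ?S \<in> flats Q" unfolding flats_Q using S by blast
    qed
    have "flat_closure Q F \<in> flats Q" using flat_closure_in_flats[OF loopless_Q] F by simp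
    then obtain S' where S': "S' \<in> flats M" "flat_closure Q F = split S'" unfolding flats_Q by blast
    have "join F \<subseteq> S'"
      using join_mono[OF flat_closure_superset[of F Q]] join_split[of S'] S' M.flats_ground by auto
    then have "?S \<subseteq> S'" using S'(1) by (rule flat_closure_subset)
    then show "split ?S \<subseteq> flat_closure Q F" unfolding S'(2) by (rule split_mono)
  qed
  then have "mrank Q F = mrank Q (split ?S)" using mrank_flat_closure[OF loopless_Q, of F] F by simp
  also have "\<dots> = mrank M (join (split ?S))"
    unfolding Q_def by (rule ranked_flats.mrank_flat[OF Q_ranked]) (use S in simp)
  also have "\<dots> = mrank M ?S" using join_split S M.flats_ground by auto
  also have "\<dots> = mrank M (join F)" by (rule mrank_flat_closure[OF M join_ground[OF F]])
  finally show ?thesis .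
qed

lemma flat_M1: "S \<in> flats M \<Longrightarrow> S \<inter> ground M1 \<in> flats M1"
  using M_res(1) restriction_flat_iff[of M "ground M1"] by (metis image_eqI)

lemma flat_M2: "S \<in> flats M \<Longrightarrow> S \<inter> ground M2 \<in> flats M2"
  using M_res(2) restriction_flat_iff[of M "ground M2"] by (metis image_eqI)

lemma Q_P: "flats Q \<subseteq> flats P"
proof
  fix F assume "F \<in> flats Q"
  then obtain S where "S \<in> flats M" "F = split S" unfolding flats_Q by blast
  then show "F \<in> flats P" unfolding direct_sum_flat_iff split_def using flat_M1 flat_M2 by simp
qed

lemma rank_M_1: "S \<subseteq> ground M1 \<Longrightarrow> mrank M1 S = mrank M S"
  using mrank_restriction[OF M, of "ground M1" S] M_res(1) ground_M by simp

lemma rank_M_2: "S \<subseteq> ground M2 \<Longrightarrow> mrank M2 S = mrank M S"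
  using mrank_restriction[OF M, of "ground M2" S] M_res(2) ground_M by simp

lemma rank_M_N: "S \<subseteq> T \<Longrightarrow> mrank N S = mrank M S"
  using mrank_N1[of S] rank_M_1[of S] T_sub by auto

text \<open>This is where properness enters: on flats of \<open>Q\<close> the rank defect of the
  quotient is the rank of the common trace, which is \<open>d F\<close>.\<close>

lemma Q_nullity: assumes "F \<in> flats Q" shows "mrank P F = mrank Q F + d F"
proof -
  obtain S where S: "S \<in> flats M" "F = split S" using assms unfolding flats_Q by blast
  have SM: "S \<subseteq> ground M" using S(1) M.flats_ground by auto
  have FP: "F \<in> flats P" using assms Q_P by auto
  have "lft F = S \<inter> T" "rgt F = S \<inter> T" unfolding S(2) split_def lft_Plus using T_sub by auto
  then have "d F = mrank N (S \<inter> T)" unfolding d_def by simp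
  moreover have "mrank Q F = mrank M S"
    using rk_Q[of F] FP P.flats_ground join_split[OF SM] unfolding S(2) by auto
  moreover have "mrank P F = mrank M1 (S \<inter> ground M1) + mrank M2 (S \<inter> ground M2)"
    unfolding rk_P[OF FP] unfolding S(2) split_def by simp
  ultimately show ?thesis using proper_rank[OF S(1)] by linarith
qed

text \<open>For other flats of \<open>P\<close> only an inequality is available. It combines three
  instances of submodularity in \<open>M\<close>: each side is glued to the trace of the other, and
  then the two results are glued together.\<close>

lemma P_nullity: assumes F: "F \<in> flats P" shows "mrank Q F + d F \<le> mrank P F"
proof -
  let ?A = "Inl -` F" and ?B = "Inr -` F"
  have AB: "?A \<subseteq> ground M1" "?B \<subseteq> ground M2" using F P.flats_ground by auto
  have FE: "F \<subseteq> E" using F P.flats_ground by auto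
  have g: "?A \<subseteq> ground M" "?B \<subseteq> ground M" "lft F \<union> rgt F \<subseteq> ground M" "?A \<union> rgt F \<subseteq> ground M" "?B \<union> lft F \<subseteq> ground M"
    using AB lft_T[of F] T_sub unfolding ground_M by auto
  have sub: "lft F \<subseteq> ?A" "rgt F \<subseteq> ?B" unfolding lft_def rgt_def by auto
  have "mrank M (?A \<union> (lft F \<union> rgt F)) + mrank M (?A \<inter> (lft F \<union> rgt F)) \<le> mrank M ?A + mrank M (lft F \<union> rgt F)"
    by (rule mrank_submodular[OF M g(1,3)])
  moreover have "?A \<union> (lft F \<union> rgt F) = ?A \<union> rgt F" using sub by auto
  moreover have "mrank M (lft F) \<le> mrank M (?A \<inter> (lft F \<union> rgt F))" by (rule mrank_mono[OF M]) (use sub g in auto)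
  ultimately have 1: "mrank M (?A \<union> rgt F) + mrank M (lft F) \<le> mrank M ?A + mrank M (lft F \<union> rgt F)" by simp
  have "mrank M (?B \<union> (lft F \<union> rgt F)) + mrank M (?B \<inter> (lft F \<union> rgt F)) \<le> mrank M ?B + mrank M (lft F \<union> rgt F)"
    by (rule mrank_submodular[OF M g(2,3)])
  moreover have "?B \<union> (lft F \<union> rgt F) = ?B \<union> lft F" using sub by auto
  moreover have "mrank M (rgt F) \<le> mrank M (?B \<inter> (lft F \<union> rgt F))" by (rule mrank_mono[OF M]) (use sub g in auto)
  ultimately have 2: "mrank M (?B \<union> lft F) + mrank M (rgt F) \<le> mrank M ?B + mrank M (lft F \<union> rgt F)" by simp
  have "mrank M ((?A \<union> rgt F) \<union> (?B \<union> lft F)) + mrank M ((?A \<union> rgt F) \<inter> (?B \<union> lft F)) \<le> mrank M (?A \<union> rgt F) + mrank M (?B \<union> lft F)"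
    by (rule mrank_submodular[OF M g(4,5)])
  moreover have "(?A \<union> rgt F) \<union> (?B \<union> lft F) = join F" using sub unfolding join_def by auto
  moreover have "mrank M (lft F \<union> rgt F) \<le> mrank M ((?A \<union> rgt F) \<inter> (?B \<union> lft F))"
    by (rule mrank_mono[OF M]) (use sub g in auto)
  ultimately have "mrank M (join F) + mrank M (lft F \<union> rgt F) \<le> mrank M (?A \<union> rgt F) + mrank M (?B \<union> lft F)" by simp
  moreover have "mrank N (lft F) = mrank M (lft F)" "mrank N (rgt F) = mrank M (rgt F)"
    "mrank N (lft F \<union> rgt F) = mrank M (lft F \<union> rgt F)" using rank_M_N lft_T by auto
  ultimately show ?thesis using 1 2 d_eq[of F] rk_P[OF F] rk_Q[OF FE] rank_M_1[OF AB(1)] rank_M_2[OF AB(2)] by linarith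
qed

lemma nullity_mono:
  assumes "F \<subseteq> G" "G \<subseteq> E"
  shows "mrank Q G + mrank P F \<le> mrank P G + mrank Q F"
proof (rule mrank_quotient[OF loopless_P loopless_Q])
  fix K assume "K \<in> flats Q"
  then have "K \<subseteq> E" "K \<in> flats P" using Q_P Q.flats_ground by auto
  then show "K \<inter> ground P \<in> flats P" by (simp add: Int_absorb2)
qed (use assms in simp_all)

section \<open>Higgs lifts between \<open>P\<close> and \<open>Q\<close>\<close>

lemma rank_Q_ground: "mrank Q E + r = R"
  using Q_nullity[OF Q.ground_flat] d_ground by simp

text \<open>The flats of the Higgs lifts interpolating between \<open>P\<close> (for \<open>\<tau> = r\<close>) and its quotient \<open>Q\<close>
  (for \<open>\<tau> = 0\<close>). Consecutive lifts differ by an elementary quotient, whose modular cut is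
  visible in the function \<open>d\<close>.\<close>

definition level :: "nat \<Rightarrow> ('a + 'a) set set" where
  "level \<tau> = {F \<in> flats P. mrank P F < mrank Q F + \<tau>} \<union> flats Q"

text \<open>Higgs' formula for the rank of the lift.\<close>

definition level_rank :: "nat \<Rightarrow> ('a + 'a) set \<Rightarrow> nat" where
  "level_rank \<tau> F = min (mrank P F) (mrank Q F + \<tau>)"

lemma level_P: "level \<tau> \<subseteq> flats P" unfolding level_def using Q_P by auto

text \<open>The extension in \<open>P\<close> remains valid while the rank defect stays below
  \<open>\<tau>\<close>. By \<open>nullity_mono\<close> the defect, once at least
  \<open>\<tau>\<close>, stays so on all larger sets; from there on flats are flats of
  \<open>Q\<close> and the closure is taken in \<open>Q\<close>.\<close>

lemma level_ranked: "ranked_flats E (level \<tau>) (level_rank \<tau>)"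
proof
  show "finite E" by simp
  show "level \<tau> \<subseteq> Pow E" using level_P P.flats_ground by blast
  show "{} \<in> level \<tau>" "E \<in> level \<tau>" unfolding level_def using Q.empty_flat Q.ground_flat by auto
  show "level_rank \<tau> {} = 0" unfolding level_rank_def using P.rk_empty by simp
  show "level_rank \<tau> F < level_rank \<tau> G" if FG: "F \<in> level \<tau>" "G \<in> level \<tau>" "F \<subset> G" for F G
  proof -
    have P: "F \<in> flats P" "G \<in> flats P" using FG level_P by auto
    have lt: "mrank P F < mrank P G" using P.rk_strict P FG by auto
    have "mrank Q F \<le> mrank Q G" by (rule mrank_mono[OF loopless_Q]) (use FG P P.flats_ground in auto)
    moreover have "mrank Q F < mrank Q G" if "F \<in> flats Q" "G \<in> flats Q" using Q.rk_strict[OF that FG(3)] .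
    moreover have "mrank P F < mrank Q F + \<tau> \<or> F \<in> flats Q" "mrank P G < mrank Q G + \<tau> \<or> G \<in> flats Q"
      using FG(1,2) unfolding level_def by auto
    ultimately show ?thesis using lt unfolding level_rank_def by (auto simp: min_def)
  qed
  fix F x assume F: "F \<in> level \<tau>" "x \<in> E - F"
  have FP: "F \<in> flats P" "F \<subseteq> E" using F level_P P.flats_ground by auto
  obtain H where H: "H \<in> flats P" "F \<subset> H" "x \<in> H" "mrank P H = Suc (mrank P F)"
     "\<And>K. K \<in> flats P \<Longrightarrow> F \<subseteq> K \<Longrightarrow> x \<in> K \<Longrightarrow> H \<subseteq> K"
    using P.unique_extension[OF FP(1) F(2)] by metis
  have HE: "H \<subseteq> E" using H(1) P.flats_ground by auto
  show "\<exists>G\<in>level \<tau>. F \<subseteq> G \<and> x \<in> G \<and> level_rank \<tau> G = Suc (level_rank \<tau> F) \<and> (\<forall>K\<in>level \<tau>. F \<subseteq> K \<and> x \<in> K \<longrightarrow> G \<subseteq> K)"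
  proof (cases "mrank P F < mrank Q F + \<tau> \<and> mrank P H < mrank Q H + \<tau>")
    case True
    show ?thesis
    proof (intro bexI[of _ H] conjI ballI impI)
      show "H \<in> level \<tau>" unfolding level_def using True H by auto
      show "level_rank \<tau> H = Suc (level_rank \<tau> F)" using True H(4) unfolding level_rank_def by auto
      show "H \<subseteq> K" if "K \<in> level \<tau>" "F \<subseteq> K \<and> x \<in> K" for K using H(5) that level_P by auto
    qed (use H in auto)
  next
    case False
    let ?G = "flat_closure Q (insert x F)"
    have ins: "insert x F \<subseteq> E" using FP(2) F(2) by auto
    have G: "?G \<in> flats Q" using flat_closure_in_flats[OF loopless_Q] ins by simp
    have GP: "?G \<in> flats P" using G Q_P by auto
    have GE: "?G \<subseteq> E" using G Q.flats_ground by auto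
    have sup: "insert x F \<subseteq> ?G" by (rule flat_closure_superset)
    have HG: "H \<subseteq> ?G" using H(5)[OF GP] sup by auto
    have rG: "mrank Q ?G = mrank Q (insert x F)" using mrank_flat_closure[OF loopless_Q] ins by simp
    have "mrank Q (insert x F) \<le> mrank Q H" "mrank Q H \<le> mrank Q ?G"
      using mrank_mono[OF loopless_Q] H HG HE GE by auto
    then have rH: "mrank Q H = mrank Q ?G" using rG by simp
    have key: "mrank Q K + \<tau> \<le> mrank P K" if K: "K \<in> flats P" "F \<subseteq> K" "x \<in> K" for K
    proof -
      have KE: "K \<subseteq> E" using K P.flats_ground by auto
      have "mrank Q K + mrank P F \<le> mrank P K + mrank Q F" by (rule nullity_mono[OF K(2) KE])
      moreover have "mrank Q K + mrank P H \<le> mrank P K + mrank Q H" by (rule nullity_mono[OF H(5)[OF K] KE])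
      ultimately show ?thesis using False by linarith
    qed
    have "level_rank \<tau> ?G = mrank Q ?G + \<tau>" unfolding level_rank_def using key[OF GP] sup by auto
    moreover have "mrank Q ?G + \<tau> = Suc (level_rank \<tau> F)"
    proof (cases "mrank P F < mrank Q F + \<tau>")
      case True
      then have ge: "mrank Q H + \<tau> \<le> mrank P H" using False by auto
      have "mrank Q F \<le> mrank Q H" using mrank_mono[OF loopless_Q] H(2) HE by auto
      then show ?thesis using True ge H(4) rH unfolding level_rank_def by auto
    next
      case nF: False
      then have FQ: "F \<in> flats Q" using F(1) unfolding level_def by auto
      have "mrank Q (insert x F) = Suc (mrank Q F)"
        using mrank_insert[OF loopless_Q, of F x] FP(2) F(2) FQ by simp
      then show ?thesis using rG nF unfolding level_rank_def by auto
    qed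
    moreover have "?G \<subseteq> K" if K: "K \<in> level \<tau>" "F \<subseteq> K \<and> x \<in> K" for K
    proof -
      have "K \<in> flats P" using K level_P by auto
      then have "K \<in> flats Q" using key[of K] K unfolding level_def by auto
      then show ?thesis using K by (intro flat_closure_subset) auto
    qed
    ultimately show ?thesis using G sup by (intro bexI[of _ ?G]) (auto simp: level_def)
  qed
qed

lemma level_rank_ground: "\<tau> \<le> r \<Longrightarrow> level_rank \<tau> E = mrank Q E + \<tau>"
  unfolding level_rank_def using rank_Q_ground by simp

text \<open>No defect exceeds that of \<open>E\<close>, which is \<open>r\<close>. A flat of
  \<open>P\<close> attaining \<open>r\<close> cannot grow under closure in \<open>Q\<close>, because
  its closure would have a larger defect.\<close>

lemma level_top: "level r = flats P"
proof
  show "level r \<subseteq> flats P" by (rule level_P)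
  show "flats P \<subseteq> level r"
  proof
    fix F assume F: "F \<in> flats P"
    have FE: "F \<subseteq> E" using F P.flats_ground by auto
    show "F \<in> level r"
    proof (cases "mrank P F < mrank Q F + r")
      case True then show ?thesis unfolding level_def using F by auto
    next
      case False
      let ?H = "flat_closure Q F"
      have H: "?H \<in> flats Q" using flat_closure_in_flats[OF loopless_Q] FE by simp
      have HE: "?H \<subseteq> E" using H Q.flats_ground by auto
      have "mrank Q ?H = mrank Q F" using mrank_flat_closure[OF loopless_Q] FE by simp
      moreover have "mrank Q E + mrank P ?H \<le> R + mrank Q ?H" by (rule nullity_mono[OF HE order.refl])
      ultimately have "mrank P ?H \<le> mrank P F" using False rank_Q_ground by linarith
      then have "F = ?H" using P.eq_of_rk_le[OF F _ flat_closure_superset] H Q_P by auto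
      then show ?thesis using H unfolding level_def by auto
    qed
  qed
qed

lemma level_bottom: "level 0 = flats Q"
  unfolding level_def using nullity_mono[of "{}"] P.rk_empty Q.rk_empty P.flats_ground P_nullity by force

lemma level_step_sub: "level t \<subseteq> level (Suc t)" unfolding level_def by auto

text \<open>On the flats of the lift \<open>Suc t\<close>, the threshold on \<open>d\<close> selects
  the modular cut of the elementary quotient towards the lift \<open>t\<close>: flats of
  \<open>Q\<close> whose defect exceeds \<open>t\<close>.\<close>

lemma level_cut:
  assumes "H \<in> level (Suc t)"
  shows "t < d H \<longleftrightarrow> H \<in> flats Q \<and> mrank Q H + t < mrank P H"
proof (cases "H \<in> flats Q")
  case True
  then show ?thesis using Q_nullity by simp
next
  case False
  then have "H \<in> flats P" "mrank P H < mrank Q H + Suc t" using assms unfolding level_def by auto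
  then show ?thesis using P_nullity[of H] False by auto
qed

text \<open>A flat \<open>F\<close> lost in the quotient has defect exactly \<open>t\<close>. Taking
  \<open>j\<close> in its \<open>Q\<close>-closure but not in \<open>F\<close>, all flats of the
  lift comparable with \<open>F\<close> contain \<open>j\<close> precisely if they lie in the cut.
  Coordinate and threshold always agree, so every term vanishes.\<close>

lemma divisor_level_zero:
  assumes t: "t < r" and C: "proper_chain E C" "C \<subseteq> level (Suc t)" and F: "F \<in> C" "F \<notin> level t"
  shows "chain_divisor E (U t) (flag_weight E (level (Suc t)) (mrank Q E + Suc t)) C = 0"
proof -
  interpret L: ranked_flats E "level (Suc t)" "level_rank (Suc t)" by (rule level_ranked)
  let ?w = "flag_weight E (level (Suc t)) (mrank Q E + Suc t)"
  have bal: "chain_balanced E ?w"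
    using flag_weight_balanced[OF level_ranked[of "Suc t"]] level_rank_ground[of "Suc t"] t by simp
  have FL: "F \<in> level (Suc t)" using C F by auto
  have FP: "F \<in> flats P" "F \<subseteq> E" using FL level_P P.flats_ground by auto
  have nQ: "F \<notin> flats Q" and null: "mrank P F = mrank Q F + t"
    using FL F(2) FP unfolding level_def by auto
  let ?H = "flat_closure Q F"
  have H: "?H \<in> flats Q" using flat_closure_in_flats[OF loopless_Q] FP by simp
  have HP: "?H \<in> flats P" using H Q_P by auto
  have HL: "?H \<in> level (Suc t)" using H unfolding level_def by auto
  have FH: "F \<subset> ?H" using flat_closure_superset[of F Q] nQ H by auto
  then obtain j where j: "j \<in> ?H" "j \<notin> F" by auto
  have jE: "j \<in> E" using j H Q.flats_ground by auto
  have rH: "mrank Q ?H = mrank Q F" using mrank_flat_closure[OF loopless_Q] FP by simp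
  have PH: "mrank P F < mrank P ?H" by (rule P.rk_strict[OF FP(1) HP FH])
  have lr: "level_rank (Suc t) F = mrank P F" "level_rank (Suc t) ?H = Suc (mrank P F)"
    using null PH rH unfolding level_rank_def by auto
  have cover: "?H \<subseteq> K" if K: "K \<in> level (Suc t)" "F \<subseteq> K" "j \<in> K" for K
  proof -
    have "j \<in> E - F" using j jE by auto
    then show ?thesis
    proof (rule L.unique_extension[OF FL])
      fix G
      assume G: "\<And>K. K \<in> level (Suc t) \<Longrightarrow> F \<subseteq> K \<Longrightarrow> j \<in> K \<Longrightarrow> G \<subseteq> K"
        "\<And>K. K \<in> level (Suc t) \<Longrightarrow> F \<subseteq> K \<Longrightarrow> j \<in> K \<Longrightarrow> level_rank (Suc t) K = Suc (level_rank (Suc t) F) \<Longrightarrow> K = G"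
      have "?H = G" by (rule G(2)[OF HL psubset_imp_subset[OF FH] j(1)]) (simp add: lr)
      then show ?thesis using G(1)[OF K] by simp
    qed
  qed
  have dH: "t < d ?H" using Q_nullity[OF H] rH PH null by simp
  have dF: "d F \<le> t" using P_nullity[OF FP(1)] null by simp
  have key: "j \<in> K \<longleftrightarrow> t < d K" if K: "K \<in> level (Suc t)" "K \<subseteq> F \<or> F \<subseteq> K" for K
  proof (cases "K \<subseteq> F")
    case True
    then show ?thesis using j(2) d_mono[OF True] dF by auto
  next
    case False
    then have FK: "F \<subseteq> K" using K by auto
    show ?thesis
    proof
      assume "j \<in> K"
      then show "t < d K" using d_mono[OF cover[OF K(1) FK]] dH by auto
    next
      assume "t < d K"
      then have "K \<in> flats Q" using level_cut[OF K(1)] by auto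
      then have "?H \<subseteq> K" using FK by (intro flat_closure_subset)
      then show "j \<in> K" using j by auto
    qed
  qed
  have jU: "j \<in> K \<longleftrightarrow> K \<in> U t" if "K \<in> insert E C" for K
  proof -
    have "K \<in> level (Suc t)" using that C(2) L.ground_flat by auto
    moreover have "K \<subseteq> F \<or> F \<subseteq> K" using that proper_chainD(3)[OF C(1) F(1)] FP(2) by auto
    ultimately show ?thesis using key unfolding U_def by simp
  qed
  have "chain_divisor E (U t) ?w C = (\<Sum>G\<in>- C. ?w (insert G C) * (of_bool (j \<in> G) - of_bool (G \<in> U t)))"
    by (rule chain_divisor_eq[OF bal jE jU])
  also have "\<dots> = 0"
  proof (rule sum.neutral, rule ballI)
    fix G assume "G \<in> - C"
    show "?w (insert G C) * (of_bool (j \<in> G) - of_bool (G \<in> U t)) = 0"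
    proof (cases "?w (insert G C) = 0")
      case False
      then have "proper_chain E (insert G C) \<and> insert G C \<subseteq> level (Suc t)" unfolding flag_weight_def by (simp split: if_splits)
      then have "G \<in> level (Suc t)" "G \<subseteq> F \<or> F \<subseteq> G" using F(1) unfolding proper_chain_insert by auto
      then show ?thesis using key unfolding U_def by simp
    qed simp
  qed
  finally show ?thesis .
qed

text \<open>Ranks in the two lifts agree outside the cut and differ by one inside, so a flag of the
  lower lift leaves a gap of two ranks in the upper one, where it enters the cut. Flats strictly
  inside the gap are not in the cut; exactly one of them contains a given
  \<open>j \<in> B - A\<close>.\<close>

lemma divisor_level_one:
  assumes t: "t < r" and C: "proper_chain E C" "C \<subseteq> level t" "Suc (card C) = mrank Q E + t"
  shows "chain_divisor E (U t) (flag_weight E (level (Suc t)) (mrank Q E + Suc t)) C = 1"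
proof -
  interpret L: ranked_flats E "level (Suc t)" "level_rank (Suc t)" by (rule level_ranked)
  interpret L': ranked_flats E "level t" "level_rank t" by (rule level_ranked)
  let ?w = "flag_weight E (level (Suc t)) (mrank Q E + Suc t)"
  have bal: "chain_balanced E ?w"
    using flag_weight_balanced[OF level_ranked[of "Suc t"]] level_rank_ground[of "Suc t"] t by simp
  have CL: "C \<subseteq> level (Suc t)" using C(2) level_step_sub by blast
  have cmp: "F \<subseteq> G \<or> G \<subseteq> F" if "F \<in> insert E C" "G \<in> insert E C" for F G
    using that proper_chainD[OF C(1)] by blast
  define X where "X = {H \<in> C. \<not> t < d H}"
  define A where "A = \<Union> X"
  have A: "A \<in> insert {} C" "\<not> t < d A"
  proof -
    have "A \<in> insert {} C \<and> \<not> t < d A"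
    proof (cases "X = {}")
      case True
      then have "A = {}" unfolding A_def by simp
      then show ?thesis using d_empty by simp
    next
      case False
      have "A \<in> X" unfolding A_def by (rule Union_chain_mem(1)[OF _ False]) (use cmp in \<open>auto simp: X_def\<close>)
      then show ?thesis unfolding X_def by auto
    qed
    then show "A \<in> insert {} C" "\<not> t < d A" by auto
  qed
  define Y where "Y = {H \<in> insert E C. t < d H}"
  define B where "B = \<Inter> Y"
  have "E \<in> Y" unfolding Y_def using t d_ground by simp
  then have "Y \<noteq> {}" by blast
  then have "B \<in> Y" unfolding B_def by (intro Union_chain_mem(2) cmp) (simp_all add: Y_def)
  then have B: "B \<in> insert E C" "t < d B" unfolding Y_def by auto
  have gap: "H \<subseteq> A \<or> B \<subseteq> H" if "H \<in> insert E C" for H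
  proof (cases "t < d H")
    case True then show ?thesis using that unfolding B_def Y_def by auto
  next
    case False
    then have "H \<noteq> E" using t d_ground by auto
    then show ?thesis using that False unfolding A_def X_def by auto
  qed
  have AL': "A \<in> level t" "B \<in> level t" using A B C(2) L'.empty_flat L'.ground_flat by auto
  have AL: "A \<in> level (Suc t)" "B \<in> level (Suc t)" using AL' level_step_sub by auto
  have AB: "A \<subset> B"
  proof -
    have "\<not> B \<subseteq> A" using d_mono[of B A] A(2) B(2) by auto
    then show ?thesis using A(1) cmp[of A B] B(1) by auto
  qed
  have low: "level_rank (Suc t) H = level_rank t H" if "H \<in> level t" "\<not> t < d H" for H
    using that Q_nullity[of H] unfolding level_rank_def level_def by auto
  have high: "H \<in> level t \<and> level_rank (Suc t) H = Suc (level_rank t H)" if "H \<in> level (Suc t)" "t < d H" for H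
    using that level_cut[OF that(1)] unfolding level_rank_def level_def by auto
  have consec: "level_rank t B = Suc (level_rank t A)"
  proof (rule ccontr)
    assume "level_rank t B \<noteq> Suc (level_rank t A)"
    moreover have "level_rank t A < level_rank t B" by (rule L'.rk_strict[OF AL' AB])
    moreover have "level_rank t B \<le> level_rank t E" by (rule L'.rk_mono[OF AL'(2) L'.ground_flat]) (use AL'(2) L'.flats_ground in auto)
    ultimately have m: "Suc (level_rank t A) \<in> {1..<level_rank t E}" "Suc (level_rank t A) < level_rank t B" by auto
    note rC = L'.rk_proper_chain[OF C(1,2)]
    have "level_rank t ` C = {1..<level_rank t E}"
      by (rule card_subset_eq) (use rC C(3) card_image[OF rC(2)] level_rank_ground[of t] t in auto)
    then obtain H where H: "H \<in> C" "level_rank t H = Suc (level_rank t A)" using m(1) by (metis imageE)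
    then have HL: "H \<in> level t" using C(2) by auto
    from gap[of H] H(1) show False using L'.rk_mono[OF HL AL'(1)] L'.rk_mono[OF AL'(2) HL] H(2) m(2) by auto
  qed
  have rk2: "level_rank (Suc t) B = Suc (Suc (level_rank (Suc t) A))"
    using low[OF AL'(1) A(2)] high[OF AL(2) B(2)] consec by simp
  have noK: "\<not> t < d G" if G: "G \<in> level (Suc t)" "A \<subset> G" "G \<subset> B" for G
  proof
    assume "t < d G"
    then have GL: "G \<in> level t" using high[OF G(1)] by auto
    have "level_rank t A < level_rank t G" "level_rank t G < level_rank t B"
      using L'.rk_strict AL' GL G by auto
    then show False using consec by simp
  qed
  obtain j where j: "j \<in> B" "j \<notin> A" using AB by auto
  have jE: "j \<in> E" using j(1) AL'(2) L'.flats_ground by auto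
  have inj: "j \<in> H \<longleftrightarrow> t < d H" if "H \<subseteq> A \<or> B \<subseteq> H" for H
    using that
  proof
    assume "H \<subseteq> A" then show ?thesis using j d_mono[of H A] A(2) by auto
  next
    assume "B \<subseteq> H" then show ?thesis using j d_mono[of B H] B(2) by auto
  qed
  have jU: "j \<in> H \<longleftrightarrow> H \<in> U t" if "H \<in> insert E C" for H using inj[OF gap[OF that]] unfolding U_def by simp
  have "j \<in> E - A" using j jE by auto
  from L.extend[OF AL(1) this] obtain G where
    G0: "G \<in> level (Suc t)" "A \<subseteq> G" "j \<in> G" "level_rank (Suc t) G = Suc (level_rank (Suc t) A)"
      "\<forall>H\<in>level (Suc t). A \<subseteq> H \<and> j \<in> H \<longrightarrow> G \<subseteq> H" by (elim bexE conjE)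
  have AG: "A \<subset> G" using G0(2,3) j(2) by auto
  have Gmin: "G \<subseteq> H" if "H \<in> level (Suc t)" "A \<subseteq> H" "j \<in> H" for H using G0(5) that by simp
  have Gun: "H = G" if "H \<in> level (Suc t)" "A \<subseteq> H" "j \<in> H" "level_rank (Suc t) H = Suc (level_rank (Suc t) A)" for H
    using L.eq_of_rk_le[OF G0(1) that(1)] G0(4,5) that by simp
  note G = G0(1) AG G0(3,4) Gmin Gun
  have GB: "G \<subset> B"
  proof -
    have "G \<subseteq> B" by (rule G(5)[OF AL(2) psubset_imp_subset[OF AB] j(1)])
    moreover have "G \<noteq> B" using rk2 G(4) by auto
    ultimately show ?thesis by auto
  qed
  have GC: "G \<notin> C" using gap[of G] G(2) GB by auto
  have "proper_chain E (insert G C)" unfolding proper_chain_insert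
  proof (intro conjI ballI)
    show "G \<noteq> {}" "G \<subset> E" using G(3) GB AL'(2) L'.flats_ground by auto
    show "H \<subseteq> G \<or> G \<subseteq> H" if "H \<in> C" for H using gap[of H] that G(2) GB by auto
  qed (rule C(1))
  then have wG: "?w (insert G C) = 1" unfolding flag_weight_def using CL G(1) GC C(3) by simp
  have dG: "\<not> t < d G" by (rule noK[OF G(1,2) GB])
  let ?\<psi> = "\<lambda>G. (of_bool (j \<in> G) - of_bool (G \<in> U t) :: real)"
  have only: "K = G" if K: "K \<in> - C" "?w (insert K C) * ?\<psi> K \<noteq> 0" for K
  proof -
    have w: "?w (insert K C) \<noteq> 0" "?\<psi> K \<noteq> 0" using K(2) by auto
    then have ch: "proper_chain E (insert K C)" "K \<in> level (Suc t)" unfolding flag_weight_def by (simp_all split: if_splits)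
    have nK: "\<not> (K \<subseteq> A \<or> B \<subseteq> K)" using inj[of K] w(2) unfolding U_def by auto
    have "A \<subseteq> K" using A(1) nK proper_chainD(3)[OF ch(1) insertI1, of A] by auto
    then have AK: "A \<subset> K" using nK by auto
    have "K \<subset> E" using proper_chainD(2)[OF ch(1) insertI1] .
    then have KB: "K \<subset> B" using B(1) nK proper_chainD(3)[OF ch(1) insertI1, of B] by auto
    have "\<not> t < d K" by (rule noK[OF ch(2) AK KB])
    then have jK: "j \<in> K" using w(2) unfolding U_def by auto
    have "level_rank (Suc t) A < level_rank (Suc t) K" "level_rank (Suc t) K < level_rank (Suc t) B"
      using L.rk_strict AL ch(2) AK KB by auto
    then have "level_rank (Suc t) K = Suc (level_rank (Suc t) A)" using rk2 by simp
    then show ?thesis by (rule G(6)[OF ch(2) psubset_imp_subset[OF AK] jK])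
  qed
  have "chain_divisor E (U t) ?w C = (\<Sum>K\<in>- C. ?w (insert K C) * ?\<psi> K)"
    by (rule chain_divisor_eq[OF bal jE jU])
  also have "\<dots> = (\<Sum>K\<in>{G}. ?w (insert K C) * ?\<psi> K)"
  proof (rule sum.mono_neutral_right)
    show "\<forall>K\<in>- C - {G}. ?w (insert K C) * ?\<psi> K = 0"
    proof
      fix K assume "K \<in> - C - {G}"
      then show "?w (insert K C) * ?\<psi> K = 0" using only[of K] by (metis DiffD1 DiffD2 singletonI)
    qed
  qed (use GC in simp_all)
  also have "\<dots> = 1" using wG G(3) dG unfolding U_def by simp
  finally show ?thesis .
qed

lemma divisor_level:
  assumes t: "t < r"
  shows "chain_divisor E (U t) (flag_weight E (level (Suc t)) (mrank Q E + Suc t)) = flag_weight E (level t) (mrank Q E + t)"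
proof
  fix C
  let ?w = "flag_weight E (level (Suc t)) (mrank Q E + Suc t)"
  show "chain_divisor E (U t) ?w C = flag_weight E (level t) (mrank Q E + t) C"
  proof (cases "proper_chain E C \<and> C \<subseteq> level (Suc t) \<and> Suc (card C) = mrank Q E + t")
    case False
    have "chain_divisor E (U t) ?w C = 0"
    proof (rule ccontr)
      assume "chain_divisor E (U t) ?w C \<noteq> 0"
      then obtain G where G: "G \<notin> C" "?w (insert G C) \<noteq> 0" by (rule chain_divisor_support)
      then have "proper_chain E (insert G C) \<and> insert G C \<subseteq> level (Suc t) \<and> Suc (card (insert G C)) = mrank Q E + Suc t"
        unfolding flag_weight_def by (simp split: if_splits)
      then show False using False G(1) unfolding proper_chain_insert by simp
    qed
    moreover have "flag_weight E (level t) (mrank Q E + t) C = 0"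
      using False level_step_sub[of t] unfolding flag_weight_def by auto
    ultimately show ?thesis by simp
  next
    case True
    then have C: "proper_chain E C" "C \<subseteq> level (Suc t)" "Suc (card C) = mrank Q E + t" by auto
    show ?thesis
    proof (cases "C \<subseteq> level t")
      case sub: True
      then show ?thesis using divisor_level_one[OF t C(1) sub C(3)] C unfolding flag_weight_def by simp
    next
      case False
      then obtain F where "F \<in> C" "F \<notin> level t" by auto
      then show ?thesis using divisor_level_zero[OF t C(1,2)] False unfolding flag_weight_def by simp
    qed
  qed
qed

text \<open>The lifts are descended from \<open>r\<close> to \<open>0\<close>, which computes the
  divisors in reverse order; \<open>foldr_divisor_rev\<close> restores the order of
  \<open>W\<close>.\<close>

theorem W_amalgam: "W r = flag_weight_of Q"
proof -
  let ?f = "\<lambda>t. chain_divisor E (U t)"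
  have fold: "W s = foldr ?f (rev [0..<s]) (W 0)" for s
    by (induction s) simp_all
  have wt: "chain_weight E ((R - r) + length [0..<r]) (W 0)" "chain_balanced E (W 0)"
    using W_props[of 0] r_less by auto
  have "foldr ?f [t..<r] (W 0) = flag_weight E (level t) (mrank Q E + t)" if "t \<le> r" for t
    using that
  proof (induction rule: inc_induct)
    case base
    then show ?case using level_top rank_Q_ground by (simp add: flag_weight_of_def)
  next
    case (step t)
    then show ?case using divisor_level[of t] by (simp add: upt_conv_Cons)
  qed
  from this[of 0] have "foldr ?f [0..<r] (W 0) = flag_weight_of Q"
    using level_bottom by (simp add: flag_weight_of_def)
  moreover have "foldr ?f (rev [0..<r]) (W 0) = foldr ?f [0..<r] (W 0)"
    by (rule foldr_divisor_rev[OF wt]) (use up_set_U in auto)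
  ultimately show ?thesis using fold[of r] by simp
qed

end

section \<open>Effective cycles of degree one\<close>

definition initial :: "'n set set \<Rightarrow> 'n set set \<Rightarrow> bool" where
  "initial D C \<longleftrightarrow> D \<subseteq> C \<and> (\<forall>H\<in>C - D. \<forall>H'\<in>D. H' \<subset> H)"

text \<open>What is retained of the fibre product under nonnegativity: an effective integral cycle
  of degree one in which the position of a set does not depend on the chain, being given by
  \<open>rk\<close>. The matroid structure is extracted from these data alone.\<close>

locale effective_cycle =
  fixes E :: "'n::finite set" and \<omega> :: "'n set set \<Rightarrow> real" and k :: nat and rk :: "'n set \<Rightarrow> nat"
  assumes nonempty: "E \<noteq> {}" and k: "0 < k"
    and weight: "chain_weight E k \<omega>" and balanced: "chain_balanced E \<omega>"
    and int: "\<omega> C \<in> \<int>" and nonneg: "0 \<le> \<omega> C"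
    and degree: "(chain_divisor E {F. E \<subseteq> F} ^^ (k - 1)) \<omega> {} = 1"
    and rk_card: "\<omega> C \<noteq> 0 \<Longrightarrow> F \<in> C \<Longrightarrow> rk F = card {H \<in> C. H \<subseteq> F}"
    and rk_empty: "rk {} = 0" and rk_ground: "rk E = k"
begin

definition V :: "nat \<Rightarrow> 'n set set \<Rightarrow> real" where
  "V m = (chain_divisor E {F. E \<subseteq> F} ^^ m) \<omega>"

section \<open>Weights of initial segments of chains\<close>

lemma V_props: assumes "m < k" shows "chain_weight E (k - m) (V m)" "chain_balanced E (V m)"
  using alpha_iterate_props[OF nonempty, of "k - m" m \<omega>] assms weight balanced unfolding V_def by auto

lemma V_Suc:
  assumes "Suc m < k" "proper_chain E D" "j \<in> E" "\<And>H. H \<in> D \<Longrightarrow> j \<notin> H"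
  shows "V (Suc m) D = (\<Sum>G\<in>- D. V m (insert G D) * of_bool (j \<in> G))"
  using alpha_divisor[OF V_props(1) V_props(2) assms(2-4), of m] assms(1) unfolding V_def chain_vec_def by simp

lemma V_int_nonneg: "m < k \<Longrightarrow> V m D \<in> \<int> \<and> 0 \<le> V m D"
proof (induction m arbitrary: D)
  case 0
  then show ?case using int nonneg unfolding V_def by simp
next
  case (Suc m)
  show ?case
  proof (cases "V (Suc m) D = 0")
    case False
    have D: "proper_chain E D" using chain_weightD(1)[OF V_props(1)[OF Suc.prems] False] .
    obtain j where j: "j \<in> E" "\<And>H. H \<in> D \<Longrightarrow> j \<notin> H" using top_element[OF D nonempty] by metis
    have "0 \<le> V m (insert G D) \<and> V m (insert G D) \<in> \<int>" for G using Suc by simp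
    then have "0 \<le> V m (insert G D) * of_bool (j \<in> G)" "V m (insert G D) * of_bool (j \<in> G) \<in> \<int>" for G
      by (cases "j \<in> G"; simp)+
    then have "(\<Sum>G\<in>- D. V m (insert G D) * of_bool (j \<in> G)) \<in> \<int>" "0 \<le> (\<Sum>G\<in>- D. V m (insert G D) * of_bool (j \<in> G))"
      by (intro Ints_sum sum_nonneg; simp)+
    then show ?thesis using V_Suc[OF Suc.prems D j] by (simp only: conj_absorb simp_thms)
  qed simp
qed

lemma V_ge_one: "m < k \<Longrightarrow> V m D \<noteq> 0 \<Longrightarrow> 1 \<le> V m D"
proof -
  assume "m < k" "V m D \<noteq> 0"
  then obtain n :: int where n: "V m D = of_int n" "0 \<le> n" "n \<noteq> 0"
    using V_int_nonneg[of m D] by (auto elim!: Ints_cases)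
  then have "1 \<le> n" by simp
  then show ?thesis using n(1) by simp
qed

text \<open>A coordinate in the top member but in no lower one bounds the weight of a chain by the
  next divisor at the chain without its top, as no negative terms can cancel. Repeating this ends at
  the empty chain, whose weight is the degree.\<close>

lemma V_le_one: "m < k \<Longrightarrow> Suc (card D) + m = k \<Longrightarrow> V m D \<le> 1"
proof (induction "card D" arbitrary: D m)
  case 0
  then have "D = {}" "m = k - 1" by auto
  then show ?case using degree unfolding V_def by simp
next
  case (Suc p)
  show ?case
  proof (cases "V m D = 0")
    case False
    have D: "proper_chain E D" using chain_weightD(1)[OF V_props(1)[OF Suc.prems(1)] False] .
    have cmp: "F \<subseteq> G \<or> G \<subseteq> F" if "F \<in> D" "G \<in> D" for F G using proper_chainD(3)[OF D that] .
    have "D \<noteq> {}" using Suc.hyps(2) by auto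
    then have G: "\<Union> D \<in> D" using Union_chain_mem(1)[of D] cmp by auto
    let ?D = "D - {\<Union> D}"
    have cD: "p = card ?D" using Suc.hyps(2) G by simp
    have chD: "proper_chain E ?D" by (rule proper_chain_subset[OF D]) auto
    have "\<Union> ?D \<noteq> \<Union> D"
    proof (cases "?D = {}")
      case True
      have "\<Union> ?D = {}" unfolding True by simp
      then show ?thesis using proper_chainD(1)[OF D G] by metis
    next
      case False
      have "\<Union> ?D \<in> ?D" by (rule Union_chain_mem(1)[OF _ False]) (use cmp in auto)
      then show ?thesis by auto
    qed
    then obtain j where j: "j \<in> \<Union> D" "j \<notin> \<Union> ?D" by blast
    have jE: "j \<in> E" using j(1) proper_chainD(2)[OF D G] by auto
    have m: "Suc m < k" "Suc (card ?D) + Suc m = k" using Suc.prems(2) Suc.hyps(2) cD by auto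
    have ins: "insert (\<Union> D) ?D = D" using G by auto
    have "V m D = V m (insert (\<Union> D) ?D) * of_bool (j \<in> \<Union> D)" using j(1) ins by simp
    also have "\<dots> \<le> (\<Sum>G\<in>- ?D. V m (insert G ?D) * of_bool (j \<in> G))"
      by (rule member_le_sum) (use V_int_nonneg[OF Suc.prems(1)] in auto)
    also have "\<dots> = V (Suc m) ?D" by (rule V_Suc[symmetric, OF m(1) chD jE]) (use j(2) in auto)
    also have "\<dots> \<le> 1" by (rule Suc.hyps(1)[OF cD m])
    finally show ?thesis .
  qed simp
qed

text \<open>As the weights are nonnegative integers, an iterated divisor by \<open>\<alpha>\<close> of total weight 1
  leaves room for only one chain.\<close>

lemma V_unique:
  assumes m: "Suc m < k" "Suc (card D) + Suc m = k" and D: "proper_chain E D"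
    and j: "j \<in> E" "\<And>H. H \<in> D \<Longrightarrow> j \<notin> H"
    and G: "j \<in> G" "V m (insert G D) \<noteq> 0" and G': "j \<in> G'" "V m (insert G' D) \<noteq> 0"
  shows "G = G'"
proof (rule ccontr)
  assume ne: "G \<noteq> G'"
  have nD: "G \<notin> D" "G' \<notin> D" using j(2) G(1) G'(1) by auto
  have mk: "m < k" using m by simp
  have "2 \<le> (\<Sum>H\<in>{G, G'}. V m (insert H D) * of_bool (j \<in> H))"
    using ne G G' V_ge_one[OF mk, of "insert G D"] V_ge_one[OF mk, of "insert G' D"] by simp
  also have "\<dots> \<le> (\<Sum>H\<in>- D. V m (insert H D) * of_bool (j \<in> H))"
    by (rule sum_mono2) (use nD V_int_nonneg[OF mk] in auto)
  also have "\<dots> = V (Suc m) D" by (rule V_Suc[symmetric, OF m(1) D j])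
  also have "\<dots> \<le> 1" by (rule V_le_one[OF m])
  finally show False by simp
qed

lemma supp: assumes "\<omega> C \<noteq> 0" shows "proper_chain E C" "Suc (card C) = k"
  using chain_weightD[OF weight assms] by auto

lemma rk_less: assumes "\<omega> C \<noteq> 0" "F \<in> C" "G \<in> C" "F \<subset> G" shows "rk F < rk G"
proof -
  have "{H \<in> C. H \<subseteq> F} \<subset> {H \<in> C. H \<subseteq> G}" using assms by auto
  then show ?thesis unfolding rk_card[OF assms(1,2)] rk_card[OF assms(1,3)] by (intro psubset_card_mono) auto
qed

lemma rk_le_iff: assumes "\<omega> C \<noteq> 0" "F \<in> C" "G \<in> C" shows "rk F \<le> rk G \<longleftrightarrow> F \<subseteq> G"
proof
  assume le: "rk F \<le> rk G"
  show "F \<subseteq> G"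
  proof (rule ccontr)
    assume "\<not> F \<subseteq> G"
    then have "G \<subset> F" using proper_chainD(3)[OF supp(1)[OF assms(1)] assms(2,3)] by auto
    then show False using rk_less[OF assms(1,3,2)] le by simp
  qed
next
  assume "F \<subseteq> G"
  then have "F = G \<or> F \<subset> G" by auto
  then show "rk F \<le> rk G" using less_imp_le[OF rk_less[OF assms]] by (elim disjE) (simp_all only: order.refl)
qed

lemma rk_image: assumes "\<omega> C \<noteq> 0" shows "rk ` C = {1..<k}" "inj_on rk C"
proof -
  show inj: "inj_on rk C" unfolding inj_on_def using rk_le_iff[OF assms] by (metis order.refl subset_antisym)
  have "rk ` C \<subseteq> {1..<k}"
  proof
    fix n assume "n \<in> rk ` C"
    then obtain F where F: "F \<in> C" "n = rk F" by auto
    have "card {F} \<le> card {H \<in> C. H \<subseteq> F}" "card {H \<in> C. H \<subseteq> F} \<le> card C" by (rule card_mono; use F in auto)+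
    then show "n \<in> {1..<k}" using rk_card[OF assms F(1)] F(2) supp(2)[OF assms] by auto
  qed
  then show "rk ` C = {1..<k}" using card_image[OF inj] supp(2)[OF assms] by (intro card_subset_eq) auto
qed

lemma initial_next:
  assumes D: "initial D C" and C: "\<omega> C \<noteq> 0" and ne: "D \<noteq> C"
  obtains G where "G \<in> C - D" "initial (insert G D) C" "\<And>H. H \<in> C - D \<Longrightarrow> G \<subseteq> H" "\<exists>j\<in>G. \<forall>H\<in>D. j \<notin> H"
proof -
  note ch = supp(1)[OF C]
  have "C - D \<noteq> {}" using D ne unfolding initial_def by auto
  then have G: "\<Inter> (C - D) \<in> C - D" using Union_chain_mem(2)[of "C - D"] proper_chainD(3)[OF ch] by auto
  define G where "G = \<Inter> (C - D)"
  note G = G[folded G_def]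
  let ?G = G
  have sub: "?G \<subseteq> H" if "H \<in> C - D" for H using that unfolding G_def by auto
  have DG: "H \<subset> ?G" if "H \<in> D" for H using D G that unfolding initial_def by blast
  have "initial (insert ?G D) C" unfolding initial_def
  proof (intro conjI ballI)
    show "insert ?G D \<subseteq> C" using D G unfolding initial_def by auto
    fix H H' assume H: "H \<in> C - insert ?G D" "H' \<in> insert ?G D"
    then have "?G \<subset> H" using sub[of H] by auto
    then show "H' \<subset> H" using H(2) DG[of H'] by (metis insertE psubset_trans)
  qed
  moreover have "\<exists>j\<in>?G. \<forall>H\<in>D. j \<notin> H"
  proof (cases "D = {}")
    case True
    then show ?thesis using proper_chainD(1)[OF ch, of ?G] G by blast
  next
    case False
    have DC: "D \<subseteq> C" using D unfolding initial_def by auto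
    have "\<Union> D \<in> D" by (rule Union_chain_mem(1)[OF _ False]) (use proper_chainD(3)[OF ch] DC in auto)
    from DG[OF this] show ?thesis by blast
  qed
  ultimately show ?thesis using that G sub by blast
qed

text \<open>Without cancellation, the weight of a supported chain persists on each of its initial
  segments.\<close>

lemma V_initial:
  assumes C: "\<omega> C \<noteq> 0" and D: "initial D C"
  shows "V (k - Suc (card D)) D \<noteq> 0"
  using D
proof (induction "card (C - D)" arbitrary: D rule: less_induct)
  case less
  have DC: "D \<subseteq> C" using less.prems unfolding initial_def by auto
  show ?case
  proof (cases "D = C")
    case True
    then show ?thesis using C supp(2)[OF C] unfolding V_def by simp
  next
    case False
    obtain G where G: "G \<in> C - D" "initial (insert G D) C" "\<exists>j\<in>G. \<forall>H\<in>D. j \<notin> H"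
      using initial_next[OF less.prems C False] by metis
    then obtain j where j: "j \<in> G" "\<forall>H\<in>D. j \<notin> H" by blast
    have "C - insert G D \<subset> C - D" using G(1) by auto
    then have "card (C - insert G D) < card (C - D)" by (intro psubset_card_mono) auto
    from less.hyps[OF this G(2)] have nz: "V (k - Suc (card (insert G D))) (insert G D) \<noteq> 0" .
    have "card (insert G D) \<le> card C" using G(2) unfolding initial_def by (intro card_mono) auto
    then have cd: "Suc (card D) < k" using supp(2)[OF C] G(1) by simp
    define m where "m = k - Suc (card (insert G D))"
    have m: "Suc m < k" "k - Suc (card D) = Suc m" using cd G(1) unfolding m_def by auto
    have chD: "proper_chain E D" using proper_chain_subset[OF supp(1)[OF C] DC] .
    have jE: "j \<in> E" using j(1) G(1) proper_chainD(2)[OF supp(1)[OF C], of G] by auto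
    have mk: "m < k" using m by simp
    have "1 \<le> V m (insert G D) * of_bool (j \<in> G)" using V_ge_one[OF mk] nz j(1) unfolding m_def by simp
    also have "\<dots> \<le> (\<Sum>G\<in>- D. V m (insert G D) * of_bool (j \<in> G))"
      by (rule member_le_sum) (use V_int_nonneg[OF mk] G(1) in auto)
    also have "\<dots> = V (Suc m) D" by (rule V_Suc[symmetric, OF m(1) chD jE]) (use j(2) in auto)
    finally show ?thesis using m(2) by simp
  qed
qed

text \<open>Across all supported chains beginning with \<open>D\<close>, the next member is
  determined by any of its elements outside \<open>D\<close>.\<close>

lemma next_unique:
  assumes C: "\<omega> C \<noteq> 0" "initial D C" "initial (insert G D) C" and C': "\<omega> C' \<noteq> 0" "initial (insert G' D) C'"
    and j: "j \<in> G" "j \<in> G'" "\<And>H. H \<in> D \<Longrightarrow> j \<notin> H"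
  shows "G = G'"
proof -
  have nD: "G \<notin> D" "G' \<notin> D" using j by auto
  have GC: "G \<in> C" "insert G D \<subseteq> C" using C(3) unfolding initial_def by auto
  have jE: "j \<in> E" using j(1) proper_chainD(2)[OF supp(1)[OF C(1)] GC(1)] by auto
  have chD: "proper_chain E D" using proper_chain_subset[OF supp(1)[OF C(1)]] GC(2) by auto
  have "card (insert G D) \<le> card C" using GC(2) by (intro card_mono) auto
  then have cd: "Suc (card D) < k" using supp(2)[OF C(1)] nD by simp
  define m where "m = k - Suc (card (insert G D))"
  have m: "Suc m < k" "Suc (card D) + Suc m = k" "m = k - Suc (card (insert G' D))"
    using cd nD unfolding m_def by auto
  show ?thesis
    by (rule V_unique[OF m(1,2) chD jE j(3,1) _ j(2)])
       (use V_initial[OF C(1,3)] V_initial[OF C'] m(3) in \<open>auto simp: m_def\<close>)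
qed

text \<open>At \<open>C - {F}\<close>, balancing compares the coordinate \<open>j\<close> with a coordinate \<open>a\<close> contained in \<open>F\<close>;
  the contribution of \<open>F\<close> to \<open>a\<close> has to be compensated by a set containing \<open>j\<close> but not \<open>a\<close>.\<close>

lemma exchange:
  assumes C: "\<omega> C \<noteq> 0" and F: "F \<in> C" and j: "j \<in> E" "j \<notin> F" "\<And>H. H \<in> C \<Longrightarrow> F \<subset> H \<Longrightarrow> j \<in> H"
  obtains G where "\<omega> (insert G (C - {F})) \<noteq> 0" "j \<in> G" "\<And>H. H \<in> C \<Longrightarrow> H \<subset> F \<Longrightarrow> H \<subset> G"
proof -
  note ch = supp(1)[OF C]
  let ?D = "C - {F}"
  obtain a where a: "a \<in> F" "\<And>H. H \<in> insert E C \<Longrightarrow> a \<in> H \<longleftrightarrow> F \<subseteq> H" using dual_pair[OF ch F] by metis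
  have aE: "a \<in> E" using a(1) proper_chainD(2)[OF ch F] by auto
  have "a \<in> H \<longleftrightarrow> j \<in> H" if "H \<in> ?D" for H
    using a(2)[of H] j(2) j(3)[of H] proper_chainD(3)[OF ch F, of H] that by auto
  then have bal: "chain_vec \<omega> ?D a = chain_vec \<omega> ?D j" by (rule chain_balancedD[OF balanced aE j(1)])
  have "\<exists>G\<in>- ?D. \<omega> (insert G ?D) * of_bool (a \<in> G) < \<omega> (insert G ?D) * of_bool (j \<in> G)"
  proof (rule ccontr)
    assume "\<not> (\<exists>G\<in>- ?D. \<omega> (insert G ?D) * of_bool (a \<in> G) < \<omega> (insert G ?D) * of_bool (j \<in> G))"
    then have le: "\<forall>G\<in>- ?D. \<omega> (insert G ?D) * of_bool (j \<in> G) \<le> \<omega> (insert G ?D) * of_bool (a \<in> G)" by (simp add: not_less)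
    have "insert F ?D = C" using F by auto
    then have "\<omega> (insert F ?D) * of_bool (j \<in> F) < \<omega> (insert F ?D) * of_bool (a \<in> F)"
      using C nonneg[of C] a(1) j(2) by (simp add: less_le)
    then have "chain_vec \<omega> ?D j < chain_vec \<omega> ?D a" unfolding chain_vec_def
      using le by (intro sum_strict_mono_ex1) auto
    then show False using bal by simp
  qed
  then obtain G where G: "\<omega> (insert G ?D) * of_bool (a \<in> G) < \<omega> (insert G ?D) * of_bool (j \<in> G)" by blast
  then have G': "\<omega> (insert G ?D) \<noteq> 0" "j \<in> G" "a \<notin> G"
    using nonneg[of "insert G ?D"] by (auto simp: of_bool_def split: if_splits)
  have "H \<subset> G" if H: "H \<in> C" "H \<subset> F" for H
  proof -
    have "j \<notin> H" using H(2) j(2) by auto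
    moreover have "G \<subseteq> H \<or> H \<subseteq> G" using proper_chainD(3)[OF supp(1)[OF G'(1)] insertI1, of H] H by auto
    ultimately show ?thesis using G'(2) by auto
  qed
  then show ?thesis using that G' by blast
qed

text \<open>The largest member beyond \<open>D\<close> that misses \<open>j\<close> is exchanged for
  a set through \<open>j\<close>; members through \<open>j\<close> stay and the number of exceptions
  drops.\<close>

lemma push_down:
  assumes "\<omega> C \<noteq> 0" "initial D C" and j: "j \<in> E" "\<And>H. H \<in> D \<Longrightarrow> j \<notin> H"
  shows "\<exists>C'. \<omega> C' \<noteq> 0 \<and> initial D C' \<and> (\<forall>H\<in>C. j \<in> H \<longrightarrow> H \<in> C') \<and> (\<forall>H\<in>C' - D. j \<in> H)"
  using assms(1,2)
proof (induction "card {H \<in> C - D. j \<notin> H}" arbitrary: C rule: less_induct)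
  case less
  note ch = supp(1)[OF less.prems(1)]
  let ?A = "{H \<in> C - D. j \<notin> H}"
  show ?case
  proof (cases "?A = {}")
    case True
    then show ?thesis using less.prems by (intro exI[of _ C]) auto
  next
    case False
    have F: "\<Union> ?A \<in> ?A" by (rule Union_chain_mem(1)[OF _ False]) (use proper_chainD(3)[OF ch] in auto)
    define F where "F = \<Union> ?A"
    have F': "F \<in> C" "F \<notin> D" "j \<notin> F" using F unfolding F_def by blast+
    have DF: "H \<subset> F" if "H \<in> D" for H using less.prems(2) F' that unfolding initial_def by blast
    have up: "j \<in> H" if H: "H \<in> C" "F \<subset> H" for H
    proof (rule ccontr)
      assume nj: "j \<notin> H"
      have "H \<notin> D" using DF[of H] H(2) by auto
      then have "H \<subseteq> F" using H(1) nj unfolding F_def by auto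
      then show False using H(2) by auto
    qed
    obtain G where G: "\<omega> (insert G (C - {F})) \<noteq> 0" "j \<in> G" "\<And>H. H \<in> C \<Longrightarrow> H \<subset> F \<Longrightarrow> H \<subset> G"
      using exchange[OF less.prems(1) F'(1) j(1) F'(3) up] by metis
    let ?C = "insert G (C - {F})"
    have DC: "D \<subseteq> C" using less.prems(2) unfolding initial_def by auto
    have init: "initial D ?C" unfolding initial_def
    proof (intro conjI ballI)
      show "D \<subseteq> ?C" using DC F'(2) by auto
      fix H H' assume H: "H \<in> ?C - D" "H' \<in> D"
      show "H' \<subset> H"
      proof (cases "H = G")
        case True
        then show ?thesis using G(3)[of H'] DF[OF H(2)] DC H(2) by auto
      next
        case False
        then show ?thesis using less.prems(2) H unfolding initial_def by auto
      qed
    qed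
    have sub: "{H \<in> ?C - D. j \<notin> H} \<subseteq> ?A - {F}"
    proof
      fix H assume "H \<in> {H \<in> ?C - D. j \<notin> H}"
      then have "H \<in> ?C" "H \<notin> D" "j \<notin> H" by simp_all
      moreover from this G(2) have "H \<noteq> G" by metis
      ultimately show "H \<in> ?A - {F}" by simp
    qed
    have "card (?A - {F}) < card ?A" by (rule card_Diff1_less[OF finite F[folded F_def]])
    moreover have "card {H \<in> ?C - D. j \<notin> H} \<le> card (?A - {F})" by (rule card_mono[OF finite sub])
    ultimately have "card {H \<in> ?C - D. j \<notin> H} < card ?A" by linarith
    from less.hyps[OF this G(1) init] obtain C' where C': "\<omega> C' \<noteq> 0" "initial D C'"
      "\<forall>H\<in>?C. j \<in> H \<longrightarrow> H \<in> C'" "\<forall>H\<in>C' - D. j \<in> H" by blast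
    have "\<forall>H\<in>C. j \<in> H \<longrightarrow> H \<in> C'" using C'(3) F'(3) by auto
    then show ?thesis using C' by blast
  qed
qed

lemma initial_rank:
  assumes "\<omega> C \<noteq> 0"
  shows "initial {H \<in> C. rk H \<le> p} C"
  unfolding initial_def
proof (intro conjI ballI)
  fix H H' assume H: "H \<in> C - {H \<in> C. rk H \<le> p}" "H' \<in> {H \<in> C. rk H \<le> p}"
  then have "rk H' < rk H" by auto
  then show "H' \<subset> H" using rk_le_iff[OF assms, of H' H] H by auto
qed auto

text \<open>The chain through \<open>H\<close> is pushed down along elements of the successive members of the chain
  through \<open>F\<close>; by uniqueness of the next member it then follows that chain up to \<open>F\<close>.\<close>

lemma graft:
  assumes C: "\<omega> C \<noteq> 0" "H \<in> C" and C': "\<omega> C' \<noteq> 0" "F \<in> C'" and FH: "F \<subseteq> H"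
  shows "\<exists>B. \<omega> B \<noteq> 0 \<and> initial {K \<in> C'. K \<subseteq> F} B \<and> H \<in> B"
proof -
  have "\<exists>B. \<omega> B \<noteq> 0 \<and> initial {K \<in> C'. rk K \<le> p} B \<and> H \<in> B" if "p \<le> rk F" for p
    using that
  proof (induction p)
    case 0
    have "rk K \<noteq> 0" if "K \<in> C'" for K using rk_image(1)[OF C'(1)] imageI[OF that, of rk] by simp
    then have "{K \<in> C'. rk K \<le> 0} = {}" by simp
    then show ?case using C by (intro exI[of _ C]) (auto simp: initial_def)
  next
    case (Suc p)
    let ?D = "{K \<in> C'. rk K \<le> p}"
    obtain B where B: "\<omega> B \<noteq> 0" "initial ?D B" "H \<in> B" using Suc by auto
    have "rk F \<in> {1..<k}" using rk_image(1)[OF C'(1)] C'(2) by auto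
    then have "Suc p \<in> rk ` C'" using rk_image(1)[OF C'(1)] Suc.prems by auto
    then obtain G where G: "Suc p = rk G" "G \<in> C'" by (rule imageE)
    have uniq: "K = G" if "K \<in> C'" "rk K = Suc p" for K
      by (rule inj_onD[OF rk_image(2)[OF C'(1)] _ that(1) G(2)]) (simp only: that(2) G(1)[symmetric])
    have ins: "{K \<in> C'. rk K \<le> Suc p} = insert G ?D"
    proof (intro subset_antisym subsetI)
      show "K \<in> insert G ?D" if "K \<in> {K \<in> C'. rk K \<le> Suc p}" for K
        using that uniq[of K] unfolding le_Suc_eq by blast
      show "K \<in> {K \<in> C'. rk K \<le> Suc p}" if "K \<in> insert G ?D" for K
        using that G by (elim insertE) simp_all
    qed
    have i1: "initial (insert G ?D) C'" using initial_rank[OF C'(1), of "Suc p"] unfolding ins .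
    have GF: "G \<subseteq> F" using rk_le_iff[OF C'(1) G(2) C'(2)] G(1) Suc.prems by simp
    have "G \<notin> ?D" using G(1) by simp
    then have nC: "?D \<noteq> C'" using G(2) by metis
    obtain G' where G': "G' \<in> C' - ?D" "\<And>K. K \<in> C' - ?D \<Longrightarrow> G' \<subseteq> K" "\<exists>j\<in>G'. \<forall>K\<in>?D. j \<notin> K"
      by (rule initial_next[OF initial_rank[OF C'(1)] C'(1) nC]) (rule that; assumption)
    have "G' \<subseteq> G" by (rule G'(2)) (use G in simp)
    then obtain j where j: "j \<in> G" "\<forall>K\<in>?D. j \<notin> K" using G'(3) by blast
    have jE: "j \<in> E" using j(1) G(2) proper_chainD(2)[OF supp(1)[OF C'(1)]] by auto
    obtain B' where B': "\<omega> B' \<noteq> 0" "initial ?D B'" "\<forall>K\<in>B. j \<in> K \<longrightarrow> K \<in> B'" "\<forall>K\<in>B' - ?D. j \<in> K"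
      using push_down[OF B(1,2) jE] j(2) by blast
    have jH: "j \<in> H" using j(1) GF FH by auto
    have HB': "H \<in> B'" using B'(3) B(3) jH by auto
    have "?D \<noteq> B'" using HB' jH j(2) by blast
    obtain K where K: "K \<in> B' - ?D" "initial (insert K ?D) B'"
      by (rule initial_next[OF B'(2,1) \<open>?D \<noteq> B'\<close>]) (rule that; assumption)
    have "K = G"
    proof (rule next_unique[OF B'(1,2) K(2) C'(1) i1])
      show "j \<in> K" by (rule bspec[OF B'(4) K(1)])
      show "j \<in> G" by (rule j(1))
      show "j \<notin> H" if "H \<in> ?D" for H by (rule bspec[OF j(2) that])
    qed
    then show ?case using B'(1) K(2) HB' unfolding ins by (intro exI[of _ B']) simp
  qed
  from this[of "rk F"] obtain B where B: "\<omega> B \<noteq> 0" "initial {K \<in> C'. rk K \<le> rk F} B" "H \<in> B" by auto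
  have "{K \<in> C'. rk K \<le> rk F} = {K \<in> C'. K \<subseteq> F}" using rk_le_iff[OF C'(1) _ C'(2)] by auto
  then show ?thesis using B by auto
qed

section \<open>The lattice of occurring sets\<close>

definition L :: "'n set set" where "L = {{}, E} \<union> \<Union> {C. \<omega> C \<noteq> 0}"

lemma L_cases:
  assumes "F \<in> L"
  obtains "F = {}" | "F = E" | C where "\<omega> C \<noteq> 0" "F \<in> C"
  using assms unfolding L_def by auto

lemma supp_exists: obtains C where "\<omega> C \<noteq> 0"
proof -
  have "V (k - 1) {} \<noteq> 0" using degree unfolding V_def by simp
  moreover have "chain_weight E (1 + (k - 1)) \<omega>" using weight k by simp
  ultimately show ?thesis using alpha_iterate_support[OF nonempty _ balanced, of 1 "k - 1" "{}"] that
    unfolding V_def by auto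
qed

lemma common_chain:
  assumes "F \<in> L" "H \<in> L" "F \<subset> H" "H \<noteq> E"
  obtains C B where "\<omega> C \<noteq> 0" "\<omega> B \<noteq> 0" "initial {K \<in> C. K \<subseteq> F} C" "initial {K \<in> C. K \<subseteq> F} B" "H \<in> B" "F \<in> insert {} C"
proof -
  obtain B0 where B0: "\<omega> B0 \<noteq> 0" "H \<in> B0"
    using L_cases[OF assms(2)] assms(3,4) by (metis not_psubset_empty)
  show ?thesis
  proof (cases "F = {}")
    case True
    have "{K \<in> B0. K \<subseteq> {}} = {}" using proper_chainD(1)[OF supp(1)[OF B0(1)]] by auto
    then show ?thesis using that[of B0 B0] B0 True unfolding initial_def by auto
  next
    case False
    have "H \<subseteq> E" using proper_chainD(2)[OF supp(1)[OF B0(1)] B0(2)] by auto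
    then have "F \<noteq> E" using assms(3) by auto
    then obtain C where C: "\<omega> C \<noteq> 0" "F \<in> C" using L_cases[OF assms(1)] False by metis
    obtain B where "\<omega> B \<noteq> 0" "initial {K \<in> C. K \<subseteq> F} B" "H \<in> B"
      using graft[OF B0 C psubset_imp_subset[OF assms(3)]] by blast
    moreover have "{K \<in> C. K \<subseteq> F} = {K \<in> C. rk K \<le> rk F}" using rk_le_iff[OF C(1) _ C(2)] by auto
    then have "initial {K \<in> C. K \<subseteq> F} C" using initial_rank[OF C(1)] by simp
    ultimately show ?thesis using that[of C B] C by auto
  qed
qed

text \<open>Let \<open>D\<close> be the chain segment up to \<open>F\<close>. The cover of
  \<open>F\<close> through \<open>x\<close> is the next member of a chain that begins with
  \<open>D\<close> and continues through \<open>x\<close> only. \<open>next_unique\<close> makes it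
  independent of that chain, hence contained in every larger flat through \<open>x\<close>. If
  \<open>D\<close> is already a full chain, the cover is \<open>E\<close>.\<close>

theorem ranked: "ranked_flats E L rk"
proof
  show "finite E" by simp
  have LE: "F \<subseteq> E" if "F \<in> L" for F
  proof (rule L_cases[OF that])
    show "F \<subseteq> E" if "\<omega> C \<noteq> 0" "F \<in> C" for C
      by (rule psubset_imp_subset[OF proper_chainD(2)[OF supp(1)[OF that(1)] that(2)]])
  qed simp_all
  then show "L \<subseteq> Pow E" by auto
  show "{} \<in> L" "E \<in> L" unfolding L_def by auto
  show "rk {} = 0" by (rule rk_empty)
  have rkC: "1 \<le> rk F \<and> rk F < k" if "\<omega> C \<noteq> 0" "F \<in> C" for C F using rk_image(1)[OF that(1)] that(2) by force
  show "rk F < rk G" if FG: "F \<in> L" "G \<in> L" "F \<subset> G" for F G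
  proof (cases "G = E")
    case True
    have "F \<noteq> E" using FG(3) True by auto
    show ?thesis using L_cases[OF FG(1)] \<open>F \<noteq> E\<close> rkC k True rk_empty rk_ground by metis
  next
    case False
    obtain C B where CB: "\<omega> C \<noteq> 0" "\<omega> B \<noteq> 0" "initial {K \<in> C. K \<subseteq> F} B" "G \<in> B" "F \<in> insert {} C"
      using common_chain[OF FG False] by metis
    show ?thesis
    proof (cases "F = {}")
      case True
      then show ?thesis using rkC[OF CB(2,4)] rk_empty by auto
    next
      case nF: False
      then have "F \<in> B" using CB(3,5) unfolding initial_def by auto
      then show ?thesis using rk_less[OF CB(2) _ CB(4) FG(3)] by simp
    qed
  qed
  fix F x assume F: "F \<in> L" "x \<in> E - F"
  obtain C where C: "\<omega> C \<noteq> 0" "F \<in> insert {} C"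
  proof (rule L_cases[OF F(1)], goal_cases)
    case 1
    obtain C where "\<omega> C \<noteq> 0" using supp_exists by blast
    then show ?case using 1(1)[of C] 1(2) by auto
  next
    case 2 then show ?case using F(2) by auto
  next
    case (3 C) then show ?case by auto
  qed
  define D where "D = {K \<in> C. K \<subseteq> F}"
  have D: "initial D C \<and> card D = rk F"
  proof (cases "F = {}")
    case True
    then have "D = {}" unfolding D_def using proper_chainD(1)[OF supp(1)[OF C(1)]] by auto
    then show ?thesis using True rk_empty unfolding initial_def by auto
  next
    case False
    then have FC: "F \<in> C" using C by auto
    have "D = {K \<in> C. rk K \<le> rk F}" unfolding D_def using rk_le_iff[OF C(1) _ FC] by auto
    then have "initial D C" by (simp only: initial_rank[OF C(1)])
    moreover have "card D = rk F" unfolding D_def by (rule rk_card[OF C(1) FC, symmetric])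
    ultimately show ?thesis ..
  qed
  have xD: "x \<notin> K" if "K \<in> D" for K using that F(2) unfolding D_def by auto
  have xE: "x \<in> E" using F(2) by auto
  obtain C' where C': "\<omega> C' \<noteq> 0" "initial D C'" "\<forall>K\<in>C' - D. x \<in> K"
    using push_down[OF C(1) conjunct1[OF D] xE xD] by blast
  \<comment> \<open>Grafting puts \<open>H\<close> into a chain beginning with \<open>D\<close>, and
    pushing down makes all later members contain \<open>x\<close> without losing
    \<open>H\<close>.\<close>
  have above: "\<exists>B. \<omega> B \<noteq> 0 \<and> initial D B \<and> H \<in> B - D \<and> (\<forall>K\<in>B - D. x \<in> K)"
    if H: "H \<in> L" "F \<subseteq> H" "x \<in> H" "H \<noteq> E" for H
  proof -
    have FH: "F \<subset> H" using H F(2) by auto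
    have "\<exists>B. \<omega> B \<noteq> 0 \<and> initial D B \<and> H \<in> B"
    proof (cases "F = {}")
      case True
      have "D = {}" unfolding D_def using True proper_chainD(1)[OF supp(1)[OF C(1)]] by auto
      obtain B where "\<omega> B \<noteq> 0" "H \<in> B" using L_cases[OF H(1)] H(3,4) by (metis empty_iff)
      then show ?thesis using \<open>D = {}\<close> unfolding initial_def by auto
    next
      case False
      then have FC: "F \<in> C" using C by auto
      obtain B where "\<omega> B \<noteq> 0" "H \<in> B" using L_cases[OF H(1)] H(3,4) by (metis empty_iff)
      then show ?thesis using graft[OF _ _ C(1) FC H(2)] unfolding D_def by blast
    qed
    then obtain B where B: "\<omega> B \<noteq> 0" "initial D B" "H \<in> B" by blast
    obtain B' where "\<omega> B' \<noteq> 0" "initial D B'" "\<forall>K\<in>B. x \<in> K \<longrightarrow> K \<in> B'" "\<forall>K\<in>B' - D. x \<in> K"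
      using push_down[OF B(1,2) xE xD] by blast
    then show ?thesis using B(3) H(3) xD by blast
  qed
  show "\<exists>G\<in>L. F \<subseteq> G \<and> x \<in> G \<and> rk G = Suc (rk F) \<and> (\<forall>H\<in>L. F \<subseteq> H \<and> x \<in> H \<longrightarrow> G \<subseteq> H)"
  proof (cases "D = C'")
    case True
    have "rk F = card C'" using D True by simp
    then have "rk E = Suc (rk F)" using supp(2)[OF C'(1)] rk_ground by simp
    moreover have "E \<subseteq> H" if H: "H \<in> L" "F \<subseteq> H \<and> x \<in> H" for H
    proof (rule ccontr)
      assume "\<not> E \<subseteq> H"
      then obtain B where B: "\<omega> B \<noteq> 0" "initial D B" "H \<in> B - D" using above[of H] H by blast
      then have "D \<subset> B" unfolding initial_def by auto
      then have "card D < card B" by (intro psubset_card_mono) auto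
      then show False using True supp(2)[OF B(1)] supp(2)[OF C'(1)] by simp
    qed
    ultimately show ?thesis using xE LE[OF F(1)] by (intro bexI[of _ E]) (auto simp: L_def)
  next
    case False
    obtain G where G: "G \<in> C' - D" "initial (insert G D) C'" using initial_next[OF C'(2,1) False] by metis
    have xG: "x \<in> G" using C'(3) G(1) by auto
    have rG: "rk G = Suc (rk F)"
    proof -
      have "{K \<in> C'. K \<subseteq> G} = insert G D"
      proof (intro subset_antisym subsetI)
        fix K assume K: "K \<in> {K \<in> C'. K \<subseteq> G}"
        show "K \<in> insert G D"
        proof (rule ccontr)
          assume "K \<notin> insert G D"
          then have "G \<subset> K" using G(2) K unfolding initial_def by simp
          then show False using K by auto
        qed
      next
        fix K assume "K \<in> insert G D"
        moreover have "K \<subseteq> G" "K \<in> C'" if "K \<in> D" using that C'(2) G(1) unfolding initial_def by auto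
        ultimately show "K \<in> {K \<in> C'. K \<subseteq> G}" using G(1) by auto
      qed
      then show ?thesis using rk_card[OF C'(1), of G] G(1) D by simp
    qed
    have FG: "F \<subseteq> G"
    proof (cases "F = {}")
      case nF: False
      then have "F \<in> D" using C unfolding D_def by auto
      then show ?thesis using G C'(2) unfolding initial_def by blast
    qed simp
    have "G \<subseteq> H" if H: "H \<in> L" "F \<subseteq> H \<and> x \<in> H" for H
    proof (cases "H = E")
      case True
      then show ?thesis using proper_chainD(2)[OF supp(1)[OF C'(1)], of G] G(1) by auto
    next
      case nE: False
      obtain B where B: "\<omega> B \<noteq> 0" "initial D B" "H \<in> B - D" "\<forall>K\<in>B - D. x \<in> K" using above[of H] H nE by blast
      have "D \<noteq> B" using B(3) by auto
      then obtain K where K: "K \<in> B - D" "initial (insert K D) B" "\<And>H. H \<in> B - D \<Longrightarrow> K \<subseteq> H"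
        using initial_next[OF B(2,1)] by metis
      have "K = G" by (rule next_unique[OF B(1,2) K(2) C'(1) G(2) _ xG xD]) (use K(1) B(4) in auto)
      then show ?thesis using K(3)[OF B(3)] by simp
    qed
    moreover have "G \<in> L" using G(1) C'(1) unfolding L_def by auto
    ultimately show ?thesis using xG rG FG by (intro bexI[of _ G]) auto
  qed
qed

end

section \<open>The amalgam of a positive fibre product\<close>

context fibre_data
begin

definition W_flats_set :: "('a + 'a) set set" where
  "W_flats_set = {{}, E} \<union> \<Union> {C. W r C \<noteq> 0}"

lemma W_flats_setD:
  assumes "F \<in> W_flats_set"
  shows "F \<in> flats P" "lft F = rgt F" "d F = mrank N (lft F)" "F \<subseteq> E"
proof -
  show "F \<in> flats P" using assms W_flats P.empty_flat P.ground_flat unfolding W_flats_set_def by auto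
  then show "F \<subseteq> E" using P.flats_ground by auto
  have "lft E = rgt E" unfolding lft_Plus using T_sub by auto
  moreover have "lft {} = rgt {}" unfolding lft_def rgt_def by auto
  ultimately show e: "lft F = rgt F" using assms diagonal(1) unfolding W_flats_set_def by auto
  show "d F = mrank N (lft F)" using d_eq[of F] e by simp
qed

lemma W_ranked:
  assumes nonneg: "\<And>C. 0 \<le> W r C"
  shows "ranked_flats E W_flats_set (\<lambda>F. mrank P F - d F)"
proof -
  have "effective_cycle E (W r) (R - r) (\<lambda>F. mrank P F - d F)"
  proof
    show "E \<noteq> {}" by (rule nonempty)
    show "0 < R - r" using r_less by simp
    show "chain_weight E (R - r) (W r)" "chain_balanced E (W r)" "W r C \<in> \<int>" for C using W_props[of r] by auto
    show "0 \<le> W r C" for C by (rule nonneg)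
    show "(chain_divisor E {F. E \<subseteq> F} ^^ (R - r - 1)) (W r) {} = 1" by (rule degree_one)
    show "mrank P F - d F = card {H \<in> C. H \<subseteq> F}" if C: "W r C \<noteq> 0" "F \<in> C" for C F
    proof -
      have "F \<subseteq> E" using W_flats[OF C(1)] C(2) P.flats_ground by auto
      then show ?thesis using position[OF order.refl C] d_le[of F] by simp
    qed
    show "mrank P {} - d {} = 0" using P.rk_empty by simp
    show "mrank P E - d E = R - r" using d_ground by simp
  qed
  then interpret eff: effective_cycle E "W r" "R - r" "\<lambda>F. mrank P F - d F" .
  show ?thesis using eff.ranked unfolding eff.L_def W_flats_set_def .
qed

text \<open>Such a flat lies in a canonical chain, whose weight is 1. These flats are needed to
  determine the ranks of the groundsets \<open>ground M1\<close> and \<open>ground M2\<close> in the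
  amalgam.\<close>

lemma canonical_flat:
  assumes F: "F \<in> flats P" "dia T \<subseteq> F"
  shows "F \<in> W_flats_set"
proof (cases "F = {} \<or> F = E")
  case True then show ?thesis unfolding W_flats_set_def by auto
next
  case False
  obtain g where g: "N_flag g" using N_flag_exists by metis
  have "proper_chain E {F}" using False F(1) P.flats_ground unfolding proper_chain_def by auto
  then obtain C where C: "canonical g r C" "{F} \<subseteq> C"
    using canonical_exists[OF g, of "{F}"] F N_flagD(2)[OF g] by auto
  have "W r C = 1" by (rule W_canonical[OF g order.refl C(1)])
  then have "W r C \<noteq> 0" by simp
  then have "C \<in> {C. W r C \<noteq> 0}" by (rule CollectI)
  moreover have "F \<in> C" using C(2) by simp
  ultimately show ?thesis unfolding W_flats_set_def by (metis UnI2 UnionI)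
qed

lemma join_parts:
  assumes "F \<in> W_flats_set"
  shows "join F \<inter> ground M1 = Inl -` F" "join F \<inter> ground M2 = Inr -` F" "join F \<inter> T = lft F" "split (join F) = F"
proof -
  have FE: "Inl -` F \<subseteq> ground M1" "Inr -` F \<subseteq> ground M2" using W_flats_setD(4)[OF assms] by auto
  have e: "Inl -` F \<inter> T = Inr -` F \<inter> T" using W_flats_setD(2)[OF assms] unfolding lft_def rgt_def .
  show 1: "join F \<inter> ground M1 = Inl -` F" using FE e ground_N unfolding join_def by blast
  show 2: "join F \<inter> ground M2 = Inr -` F" using FE e ground_N unfolding join_def by blast
  show "join F \<inter> T = lft F" using e unfolding join_def lft_def by blast
  show "split (join F) = F" unfolding split_def 1 2 by (rule Plus_vimage)
qed

text \<open>Gluing the occurring sets along \<open>T\<close> yields the flats, and the rank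
  \<open>rk_P - d\<close> gives properness. By construction flats meet \<open>ground Mi\<close> in
  flats of \<open>Mi\<close>, so the restriction is a quotient of \<open>Mi\<close>; as the ranks
  agree, it is \<open>Mi\<close>.\<close>

lemma amalgam_exists:
  assumes nonneg: "\<And>C. 0 \<le> W r C"
  shows "\<exists>M. proper_amalgam M1 M2 N M"
proof -
  interpret W: ranked_flats E W_flats_set "\<lambda>F. mrank P F - d F" by (rule W_ranked[OF nonneg])
  let ?G = "ground M1 \<union> ground M2" and ?L = "join ` W_flats_set"
  let ?\<rho> = "\<lambda>S. mrank P (split S) - d (split S)"
  have join_mono: "F \<subseteq> G \<Longrightarrow> join F \<subseteq> join G" for F G unfolding join_def by auto
  have split_mono: "S \<subseteq> S' \<Longrightarrow> split S \<subseteq> split S'" for S S' unfolding split_def by auto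
  note sj = join_parts(4)
  interpret M: ranked_flats ?G ?L ?\<rho>
  proof
    show "finite ?G" by simp
    show "?L \<subseteq> Pow ?G" using W_flats_setD(4) unfolding join_def by fastforce
    have "join {} = {}" unfolding join_def by auto
    then show "{} \<in> ?L" using W.empty_flat by (metis image_eqI)
    have "join E = ?G" unfolding join_def by auto
    then show "?G \<in> ?L" using W.ground_flat by (metis image_eqI)
    have "split {} = {}" unfolding split_def by auto
    then show "?\<rho> {} = 0" using P.rk_empty by simp
    show "?\<rho> A < ?\<rho> B" if AB: "A \<in> ?L" "B \<in> ?L" "A \<subset> B" for A B
    proof -
      obtain F H where FH: "F \<in> W_flats_set" "A = join F" "H \<in> W_flats_set" "B = join H" using AB by auto
      have "split A \<subseteq> split B" using split_mono AB(3) by auto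
      then have "F \<subseteq> H" using sj FH by simp
      moreover have "F \<noteq> H" using AB(3) FH by auto
      ultimately show ?thesis using W.rk_strict[OF FH(1,3)] sj FH by auto
    qed
    fix A x assume A: "A \<in> ?L" "x \<in> ?G - A"
    obtain F where F: "F \<in> W_flats_set" "A = join F" using A(1) by auto
    obtain y where y: "y \<in> E" "\<And>H. H \<in> W_flats_set \<Longrightarrow> y \<in> H \<longleftrightarrow> x \<in> join H"
    proof (cases "x \<in> ground M1")
      case True
      have "Inl x \<in> H \<longleftrightarrow> x \<in> join H" if "H \<in> W_flats_set" for H using join_parts(1)[OF that] True by auto
      then show ?thesis using that[of "Inl x"] True by auto
    next
      case False
      then have x2: "x \<in> ground M2" using A(2) by auto
      have "Inr x \<in> H \<longleftrightarrow> x \<in> join H" if "H \<in> W_flats_set" for H using join_parts(2)[OF that] x2 by auto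
      then show ?thesis using that[of "Inr x"] x2 by auto
    qed
    have "y \<in> E - F" using y F A(2) by auto
    from W.extend[OF F(1) this] obtain H where H: "H \<in> W_flats_set" "F \<subseteq> H" "y \<in> H"
      "mrank P H - d H = Suc (mrank P F - d F)" "\<forall>K\<in>W_flats_set. F \<subseteq> K \<and> y \<in> K \<longrightarrow> H \<subseteq> K" by auto
    show "\<exists>B\<in>?L. A \<subseteq> B \<and> x \<in> B \<and> ?\<rho> B = Suc (?\<rho> A) \<and> (\<forall>K\<in>?L. A \<subseteq> K \<and> x \<in> K \<longrightarrow> B \<subseteq> K)"
    proof (intro bexI[of _ "join H"] conjI ballI impI)
      show "A \<subseteq> join H" unfolding F(2) by (rule join_mono[OF H(2)])
      show "x \<in> join H" using y(2)[OF H(1)] H(3) by simp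
      show "?\<rho> (join H) = Suc (?\<rho> A)" using H(4) sj H(1) F by simp
      fix K assume K: "K \<in> ?L" "A \<subseteq> K \<and> x \<in> K"
      then obtain K' where K': "K' \<in> W_flats_set" "K = join K'" by auto
      have "F \<subseteq> K'" using split_mono[of A K] K(2) sj F K' by simp
      moreover have "y \<in> K'" using y(2)[OF K'(1)] K K' by simp
      ultimately show "join H \<subseteq> K" using H(5) K' join_mono by simp
    qed (use H in simp)
  qed
  define M where "M = Flat_System ?G ?L"
  have M: "loopless_matroid M" "ground M = ?G" "flats M = ?L" unfolding M_def using M.loopless by auto
  have rM: "mrank M (join F) = mrank P F - d F" if "F \<in> W_flats_set" for F
    unfolding M_def using M.mrank_flat[of "join F"] that sj by simp
  \<comment> \<open>\<open>Z\<close> is the least occurring set whose join contains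
    \<open>ground Mi\<close>; it supplies the rank of \<open>ground Mi\<close> in \<open>M\<close>.
    For \<open>M1\<close> it is \<open>ground M1 <+> flat_closure M2 T\<close>, and symmetrically
    for \<open>M2\<close>.\<close>
  have restr: "restriction M (ground Mi) = Mi"
    if Mi: "loopless_matroid Mi" "ground Mi \<subseteq> ?G" "\<And>F. F \<in> W_flats_set \<Longrightarrow> join F \<inter> ground Mi \<in> flats Mi"
      "Z \<in> W_flats_set" "ground Mi \<subseteq> join Z" "mrank P Z - d Z = mrank Mi (ground Mi)"
      "\<And>F. F \<in> W_flats_set \<Longrightarrow> ground Mi \<subseteq> join F \<Longrightarrow> Z \<subseteq> F" for Mi Z
  proof -
    interpret Mi: ranked_flats "ground Mi" "flats Mi" "mrank Mi" by (rule ranked_flats_mrank[OF Mi(1)])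
    have gM: "ground Mi \<subseteq> ground M" using Mi(2) M(2) by simp
    have "flat_closure M (ground Mi) = join Z"
    proof
      show "flat_closure M (ground Mi) \<subseteq> join Z" by (rule flat_closure_subset[OF Mi(5)]) (use Mi(4) M(3) in simp)
      have "flat_closure M (ground Mi) \<in> ?L" using flat_closure_in_flats[OF M(1) gM] M(3) by simp
      then obtain F where F: "F \<in> W_flats_set" "flat_closure M (ground Mi) = join F" by auto
      have "ground Mi \<subseteq> join F" using flat_closure_superset[of "ground Mi" M] F(2) by simp
      from join_mono[OF Mi(7)[OF F(1) this]] show "join Z \<subseteq> flat_closure M (ground Mi)" using F(2) by simp
    qed
    then have full: "mrank M (ground Mi) = mrank Mi (ground Mi)"
      using mrank_flat_closure[OF M(1) gM] rM[OF Mi(4)] Mi(6) by simp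
    \<comment> \<open>The defect of \<open>M\<close> relative to \<open>Mi\<close> is monotone and
      vanishes on the empty set and on \<open>ground Mi\<close>, hence in between; a flat of
      \<open>Mi\<close> then cannot acquire new elements of \<open>ground Mi\<close> in its
      closure.\<close>
    have quot: "mrank M S' + mrank Mi S \<le> mrank Mi S' + mrank M S" if "S \<subseteq> S'" "S' \<subseteq> ground Mi" for S S'
      by (rule mrank_quotient[OF Mi(1) M(1) gM _ that]) (use M(3) Mi(3) in auto)
    have "(\<lambda>F. F \<inter> ground Mi) ` flats M = flats Mi"
    proof
      show "(\<lambda>F. F \<inter> ground Mi) ` flats M \<subseteq> flats Mi" using M(3) Mi(3) by auto
      show "flats Mi \<subseteq> (\<lambda>F. F \<inter> ground Mi) ` flats M"
      proof
        fix A assume A: "A \<in> flats Mi"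
        have Ag: "A \<subseteq> ground Mi" "A \<subseteq> ground M" using A Mi.flats_ground gM by auto
        let ?S = "flat_closure M A"
        have S: "?S \<in> flats M" by (rule flat_closure_in_flats[OF M(1) Ag(2)])
        have "?S \<inter> ground Mi \<subseteq> A"
        proof
          fix x assume x: "x \<in> ?S \<inter> ground Mi"
          show "x \<in> A"
          proof (rule ccontr)
            assume nx: "x \<notin> A"
            have xg: "x \<in> ground Mi" "x \<in> ground M" using x gM by auto
            have "mrank M (insert x A) = mrank M A" using mrank_insert[OF M(1) Ag(2) xg(2)] x by simp
            moreover have "mrank Mi (insert x A) = Suc (mrank Mi A)"
              using mrank_insert[OF Mi(1) Ag(1) xg(1)] A nx by simp
            moreover have "mrank M A + mrank Mi {} \<le> mrank Mi A + mrank M {}" by (rule quot) (use Ag in auto)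
            moreover have "mrank M (ground Mi) + mrank Mi (insert x A) \<le> mrank Mi (ground Mi) + mrank M (insert x A)"
              by (rule quot) (use Ag xg in auto)
            ultimately show False using full mrank_empty[OF M(1)] mrank_empty[OF Mi(1)] by linarith
          qed
        qed
        moreover have "A \<subseteq> ?S \<inter> ground Mi" using Ag(1) flat_closure_superset[of A M] by auto
        ultimately have "A = ?S \<inter> ground Mi" by blast
        then show "A \<in> (\<lambda>F. F \<inter> ground Mi) ` flats M" using S by blast
      qed
    qed
    then show ?thesis unfolding restriction_def by simp
  qed
  have dT: "d F = r" if "dia T \<subseteq> F" "F \<subseteq> E" for F
    using d_mono[OF that(1)] d_le[OF that(2)] dia_props(5)[OF N.ground_flat] by simp
  have full: "T \<subseteq> lft F" if F: "F \<in> W_flats_set" "T \<subseteq> join F" for F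
    using join_parts(3)[OF F(1)] F(2) by auto
  have ranks: "mrank M1 (flat_closure M1 T) = r" "mrank M2 (flat_closure M2 T) = r" using closure_flat[OF N.ground_flat] by auto
  have cl: "flat_closure M1 T \<subseteq> ground M1" "flat_closure M2 T \<subseteq> ground M2"
    using closure_flat[OF N.ground_flat] M1.flats_ground M2.flats_ground by auto
  have R1: "restriction M (ground M1) = M1"
  proof (rule restr[OF M1, where Z = "ground M1 <+> flat_closure M2 T"])
    let ?F = "ground M1 <+> flat_closure M2 T"
    have FP: "?F \<in> flats P" unfolding direct_sum_flat_iff using M1.ground_flat closure_flat[OF N.ground_flat] by simp
    have dF: "dia T \<subseteq> ?F" unfolding dia_def using cl by auto
    show FW: "?F \<in> W_flats_set" by (rule canonical_flat[OF FP dF])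
    show "join F \<inter> ground M1 \<in> flats M1" if "F \<in> W_flats_set" for F
      using join_parts(1)[OF that] W_flats_setD(1)[OF that] unfolding direct_sum_flat_iff by simp
    have "?F \<subseteq> E" using cl by auto
    then show "mrank P ?F - d ?F = mrank M1 (ground M1)"
      using rk_P[OF FP] ranks dT[OF dF] by simp
    show "?F \<subseteq> F" if F: "F \<in> W_flats_set" "ground M1 \<subseteq> join F" for F
    proof -
      have "T \<subseteq> lft F" by (rule full[OF F(1)]) (use F(2) T_sub in auto)
      then have "T \<subseteq> Inr -` F" using W_flats_setD(2)[OF F(1)] unfolding rgt_def by auto
      then have "flat_closure M2 T \<subseteq> Inr -` F"
        using W_flats_setD(1)[OF F(1)] unfolding direct_sum_flat_iff by (intro flat_closure_subset) auto
      moreover have "ground M1 \<subseteq> Inl -` F" using join_parts(1)[OF F(1)] F(2) by auto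
      ultimately show ?thesis by auto
    qed
  qed (auto simp: join_def)
  have R2: "restriction M (ground M2) = M2"
  proof (rule restr[OF M2, where Z = "flat_closure M1 T <+> ground M2"])
    let ?F = "flat_closure M1 T <+> ground M2"
    have FP: "?F \<in> flats P" unfolding direct_sum_flat_iff using M2.ground_flat closure_flat[OF N.ground_flat] by simp
    have dF: "dia T \<subseteq> ?F" unfolding dia_def using cl by auto
    show FW: "?F \<in> W_flats_set" by (rule canonical_flat[OF FP dF])
    show "join F \<inter> ground M2 \<in> flats M2" if "F \<in> W_flats_set" for F
      using join_parts(2)[OF that] W_flats_setD(1)[OF that] unfolding direct_sum_flat_iff by simp
    have "?F \<subseteq> E" using cl by auto
    then show "mrank P ?F - d ?F = mrank M2 (ground M2)"
      using rk_P[OF FP] ranks dT[OF dF] by simp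
    show "?F \<subseteq> F" if F: "F \<in> W_flats_set" "ground M2 \<subseteq> join F" for F
    proof -
      have "T \<subseteq> lft F" by (rule full[OF F(1)]) (use F(2) T_sub in auto)
      then have "T \<subseteq> Inl -` F" unfolding lft_def by auto
      then have "flat_closure M1 T \<subseteq> Inl -` F"
        using W_flats_setD(1)[OF F(1)] unfolding direct_sum_flat_iff by (intro flat_closure_subset) auto
      moreover have "ground M2 \<subseteq> Inr -` F" using join_parts(2)[OF F(1)] F(2) by auto
      ultimately show ?thesis by auto
    qed
  qed (auto simp: join_def)
  have "int (mrank M S) = int (mrank M1 (S \<inter> ground M1)) + int (mrank M2 (S \<inter> ground M2)) - int (mrank N (S \<inter> T))"
    if S: "S \<in> flats M" for S
  proof -
    obtain F where F: "F \<in> W_flats_set" "S = join F" using S M(3) by auto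
    have "d F \<le> mrank N (lft F)" using W_flats_setD(3)[OF F(1)] by simp
    moreover have "mrank N (lft F) \<le> mrank P F"
    proof -
      have "mrank N (lft F) = mrank M1 (lft F)" using mrank_N1[OF lft_T(1)] by simp
      also have "\<dots> \<le> mrank M1 (Inl -` F)"
        by (rule mrank_mono[OF M1]) (use W_flats_setD(4)[OF F(1)] in \<open>auto simp: lft_def\<close>)
      finally show ?thesis using rk_P[OF W_flats_setD(1)[OF F(1)]] by simp
    qed
    ultimately show ?thesis
      using rM[OF F(1)] rk_P[OF W_flats_setD(1)[OF F(1)]] join_parts[OF F(1)] W_flats_setD(3)[OF F(1)] unfolding F(2) by simp
  qed
  then have "proper_amalgam M1 M2 N M" unfolding proper_amalgam_def amalgam_def using M R1 R2 by simp
  then show ?thesis by blast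
qed

end

section \<open>The fan of the tropical fibre product\<close>

lemma integral_linear_induced_map: "integral_linear (induced_map A h)"
  unfolding integral_linear_def
proof
  show "linear (induced_map A h)" by (rule linearI) (simp_all add: induced_map_def vec_eq_iff)
  show "induced_map A h ` int_lattice \<subseteq> int_lattice" by (auto simp: induced_map_def int_lattice_def)
qed

lemma product_map_restrict_nth:
  "product_map (induced_map S (\<lambda>t. t)) (induced_map S' (\<lambda>t. t)) z $ i = (if i \<in> S <+> S' then z $ i else 0)"
  by (cases i) (auto simp: product_map_def join_vec_def induced_map_def left_vec_def right_vec_def)

lemma linear_product_map_restrict:
  "linear (product_map (induced_map S (\<lambda>t. t)) (induced_map S' (\<lambda>t. t)))"
  by (rule linearI) (simp_all add: vec_eq_iff product_map_restrict_nth)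

lemma chain_cone_subset_line:
  fixes E :: "'n::finite set"
  assumes "x \<in> chain_cone E C s"
  shows "x \<in> chain_line E C"
  using linear_chain_cone_into[OF linear_ident chain_line_cone chain_line_gen chain_line_ground assms] .

lemma degree_step_on:
  fixes Q :: "'n::finite flat_system"
  assumes Q: "loopless_matroid Q" and E: "ground Q \<noteq> {}" and C: "proper_chain (ground Q) C" "C \<subseteq> flats Q"
  shows "step_on (ground Q) (degree_function Q) {F. ground Q \<subseteq> F} C"
proof -
  interpret ranked_flats "ground Q" "flats Q" "mrank Q" by (rule ranked_flats_mrank[OF Q])
  obtain j where j: "j \<in> ground Q" "\<And>H. H \<in> C \<Longrightarrow> j \<notin> H" using top_element[OF C(1) E] by metis
  have jH: "j \<in> H \<longleftrightarrow> H \<in> {F. ground Q \<subseteq> F}" if "H \<in> insert (ground Q) C" for H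
    using that j by auto
  have "degree_function Q x = - x $ j" if "x \<in> chain_cone (ground Q) C s" for x s
    unfolding degree_function_def
  proof (rule ray_function_step[OF Q E alpha_up_set[OF E] _ C chain_cone_subset_line[OF that] j(1) jH])
    show "(if F = ground Q then - 1 else 0) = (- of_bool (F \<in> {F. ground Q \<subseteq> F}) :: real)" if "F \<in> flats Q" for F
      using that flats_ground by auto
  qed
  then show ?thesis unfolding step_on_def using j(1) jH by blast
qed

lemma degree_iterate:
  fixes Q :: "'n::finite flat_system"
  assumes Q: "loopless_matroid Q" and E: "ground Q \<noteq> {}"
    and wt: "chain_weight (ground Q) (k + m) \<omega>" and bal: "chain_balanced (ground Q) \<omega>"
    and supp: "\<And>C. \<omega> C \<noteq> 0 \<Longrightarrow> C \<subseteq> flats Q"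
  shows "(divisor (degree_function Q) ^^ m) (fan_of (ground Q) \<omega>) =
    fan_of (ground Q) ((chain_divisor (ground Q) {F. ground Q \<subseteq> F} ^^ m) \<omega>)"
  using wt
proof (induction m arbitrary: k)
  case (Suc m)
  have w: "chain_weight (ground Q) (Suc k + m) \<omega>" using Suc.prems by simp
  let ?V = "(chain_divisor (ground Q) {F. ground Q \<subseteq> F} ^^ m) \<omega>"
  have V: "chain_weight (ground Q) (Suc k) ?V" "chain_balanced (ground Q) ?V"
    using alpha_iterate_props[OF E w bal] by simp_all
  have "step_on (ground Q) (degree_function Q) {F. ground Q \<subseteq> F} C" if nz: "?V C \<noteq> 0" for C
  proof (rule degree_step_on[OF Q E chain_weightD(1)[OF V(1) nz]])
    obtain C' where "\<omega> C' \<noteq> 0" "C \<subseteq> C'" using alpha_iterate_support[OF E w bal nz] by metis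
    then show "C \<subseteq> flats Q" using supp by blast
  qed
  from divisor_fan_of[OF E V this] show ?case using Suc.IH[OF w] by simp
qed simp

lemma fan_degree_fan_of:
  fixes Q :: "'n::finite flat_system"
  assumes Q: "loopless_matroid Q" and E: "ground Q \<noteq> {}" and k: "0 < k"
    and wt: "chain_weight (ground Q) k \<omega>" and bal: "chain_balanced (ground Q) \<omega>"
    and supp: "\<And>C. \<omega> C \<noteq> 0 \<Longrightarrow> C \<subseteq> flats Q"
  shows "fan_degree Q k (fan_of (ground Q) \<omega>) = (chain_divisor (ground Q) {F. ground Q \<subseteq> F} ^^ (k - 1)) \<omega> {}"
proof -
  have w: "chain_weight (ground Q) (1 + (k - 1)) \<omega>" using wt k by simp
  have it: "(divisor (degree_function Q) ^^ (k - 1)) (fan_of (ground Q) \<omega>) =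
      fan_of (ground Q) ((chain_divisor (ground Q) {F. ground Q \<subseteq> F} ^^ (k - 1)) \<omega>)"
    by (rule degree_iterate[OF Q E w bal]) (rule supp)
  have "convex_cone hull {char_vec (ground Q)} = chain_cone (ground Q) {} 1"
    unfolding chain_cone_def chain_gens_def by simp
  moreover have "proper_chain (ground Q) {}" unfolding proper_chain_def by simp
  ultimately show ?thesis unfolding fan_degree_def it using fan_of_cone[OF E, of "{}" 1] by (simp del: One_nat_def)
qed

section \<open>The fibre product as the fan of \<open>W r\<close>\<close>

context fibre_data
begin

lemma d_restrict: "d (H \<inter> (T <+> T)) = d H"
proof -
  have "lft (H \<inter> (T <+> T)) = lft H" "rgt (H \<inter> (T <+> T)) = rgt H" unfolding lft_def rgt_def by auto
  then show ?thesis unfolding d_def by simp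
qed

lemma diagonal_step_on:
  assumes s: "s < r" and C: "proper_chain E C" "C \<subseteq> flats P"
  shows "step_on E (diagonal_function N (r - s) \<circ> product_map (induced_map T (\<lambda>t. t)) (induced_map T (\<lambda>t. t))) (U s) C"
proof -
  let ?Q = "direct_sum N N" and ?p = "product_map (induced_map T (\<lambda>t. t)) (induced_map T (\<lambda>t. t))"
  let ?V = "{F. s < d F}"
  define f :: "('a + 'a) set \<Rightarrow> real" where "f = (\<lambda>F. let F1 = Inl -` F; F2 = Inr -` F in
        if int (mrank N (F1 \<union> F2)) + int (mrank N (ground N)) - int (r - s)
             \<ge> int (mrank N F1) + int (mrank N F2)
        then 0 else - 1)"
  have T: "T \<noteq> {}"
  proof
    assume "T = {}"
    then have "r = 0" using N.rk_empty by simp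
    then show False using s by simp
  qed
  have "E \<inter> (T <+> T) = T <+> T" using T_sub by auto
  then have "d (T <+> T) = r" using d_restrict[of E] d_ground by simp
  then have up: "up_set (ground ?Q) ?V"
    unfolding up_set_def using s d_empty order.strict_trans2[OF _ d_mono] by auto
  have f: "f F = - of_bool (F \<in> ?V)" if "F \<in> flats ?Q" for F
  proof -
    have "Inl -` F \<subseteq> T" "Inr -` F \<subseteq> T" using that N.flats_ground unfolding direct_sum_flat_iff by auto
    then have "lft F = Inl -` F" "rgt F = Inr -` F" unfolding lft_def rgt_def by auto
    then show ?thesis using d_eq[of F] s unfolding f_def Let_def by (simp add: of_nat_diff)
  qed
  have "step_on E (ray_function ?Q f \<circ> ?p) {H. H \<inter> ground ?Q \<in> ?V} C"
  proof (rule pullback_step_on[OF loopless_direct_sum[OF N N] _ _ up f linear_product_map_restrict _ C(1)])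
    show "ground ?Q \<noteq> {}" "ground ?Q \<subseteq> E" using T T_sub by auto
    show "?p x $ i = (if i \<in> ground ?Q then x $ i else 0)" for x i using product_map_restrict_nth[of T T x i] by simp
    fix H assume "H \<in> C"
    then have H: "H \<in> flats P" using C(2) by auto
    have "Inl -` (H \<inter> ground ?Q) = lft H" "Inr -` (H \<inter> ground ?Q) = rgt H" unfolding lft_def rgt_def by auto
    then show "H \<inter> ground ?Q \<in> flats ?Q" unfolding direct_sum_flat_iff using flat_lft[OF H] by simp
  qed
  moreover have "{H. H \<inter> ground ?Q \<in> ?V} = U s" unfolding U_def using d_restrict by simp
  ultimately show ?thesis unfolding diagonal_function_def f_def by simp
qed

text \<open>The index list is built up from its top end, since \<open>foldr\<close> starts there;
  the index \<open>r - s\<close> corresponds to the threshold \<open>s\<close>.\<close>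

lemma foldr_diagonal:
  assumes "s \<le> r"
  shows "foldr (\<lambda>i. divisor (diagonal_function N i \<circ> product_map (induced_map T (\<lambda>t. t)) (induced_map T (\<lambda>t. t))))
    [Suc (r - s)..<Suc r] (bergman_fan P) = fan_of E (W s)"
  using assms
proof (induction s)
  case 0
  then show ?case using bergman_fan_eq[OF loopless_P] nonempty by simp
next
  case (Suc s)
  have l: "[Suc (r - Suc s)..<Suc r] = (r - s) # [Suc (r - s)..<Suc r]"
    using Suc.prems upt_conv_Cons[of "r - s" "Suc r"] by (simp add: Suc_diff_Suc del: upt_Suc)
  have s: "s < r" "s \<le> r" using Suc.prems by simp_all
  have "divisor (diagonal_function N (r - s) \<circ> product_map (induced_map T (\<lambda>t. t)) (induced_map T (\<lambda>t. t)))
      (fan_of E (W s)) = fan_of E (W (Suc s))"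
    unfolding W.simps
  proof (rule divisor_fan_of[OF nonempty])
    show "chain_weight E (R - s) (W s)" "chain_balanced E (W s)" using W_props[OF s(2)] by auto
    show "step_on E (diagonal_function N (r - s) \<circ> product_map (induced_map T (\<lambda>t. t)) (induced_map T (\<lambda>t. t))) (U s) C"
      if "W s C \<noteq> 0" for C
      by (rule diagonal_step_on[OF s(1) _ W_flats[OF that]]) (use W_chain[OF s(2) that] in simp)
  qed
  then show ?case unfolding l foldr.simps o_apply[where f = "divisor _"] Suc.IH[OF s(2)] by simp
qed

theorem fibre_product_fan:
  "tropical_fibre_product M1 M2 N (induced_map T (\<lambda>t. t)) (induced_map T (\<lambda>t. t)) = fan_of E (W r)"
  using foldr_diagonal[of r] unfolding tropical_fibre_product_def by simp

lemma fibre_product_tropical: "tropical_fan (R - r) (fan_of E (W r))"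
  using W_props[of r] tropical_fan_fan_of[OF nonempty] by simp

lemma fibre_product_degree: "fan_degree P (R - r) (fan_of E (W r)) = 1"
  using fan_degree_fan_of[OF loopless_P _ _ _ _ W_flats, of "R - r" "W r"] W_props[of r] r_less nonempty degree_one
  unfolding ground_P by simp

lemma fibre_product_nonneg:
  assumes "\<forall>\<sigma>\<in>fan_cones (fan_of E (W r)). 0 < fan_of E (W r) \<sigma>"
  shows "0 \<le> W r C"
proof (cases "W r C = 0")
  case False
  have C: "proper_chain E C" using W_chain[OF order.refl False] by simp
  have "fan_of E (W r) (chain_cone E C 1) = W r C" by (rule fan_of_cone[OF nonempty C]) simp
  then show ?thesis using assms False unfolding fan_cones_def by (metis (mono_tags) mem_Collect_eq less_imp_le)
qed simp

end

section \<open>The map from the Bergman fan of the amalgam\<close>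

lemma join_support:
  assumes "x \<in> fan_support X" "y \<in> fan_support Y"
  shows "join_vec x y \<in> fan_support (product_fan X Y)"
proof -
  obtain \<sigma> \<tau> where st: "\<sigma> \<in> fan_cones X" "x \<in> \<sigma>" "\<tau> \<in> fan_cones Y" "y \<in> \<tau>"
    using assms unfolding fan_support_def by blast
  define \<rho> where "\<rho> = {join_vec x y |x y. x \<in> \<sigma> \<and> y \<in> \<tau>}"
  have lr: "left_vec (join_vec a b) = a" "right_vec (join_vec a b) = b" for a :: "real ^ 'a" and b :: "real ^ 'b"
    unfolding left_vec_def right_vec_def join_vec_def by (simp_all add: vec_eq_iff)
  have l: "left_vec ` \<rho> = \<sigma>"
  proof (intro subset_antisym subsetI)
    show "a \<in> \<sigma>" if "a \<in> left_vec ` \<rho>" for a using that unfolding \<rho>_def by (auto simp: lr)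
    show "a \<in> left_vec ` \<rho>" if "a \<in> \<sigma>" for a
      using that st(4) unfolding \<rho>_def by (intro image_eqI[of _ _ "join_vec a y"]) (auto simp: lr)
  qed
  have r: "right_vec ` \<rho> = \<tau>"
  proof (intro subset_antisym subsetI)
    show "a \<in> \<tau>" if "a \<in> right_vec ` \<rho>" for a using that unfolding \<rho>_def by (auto simp: lr)
    show "a \<in> right_vec ` \<rho>" if "a \<in> \<tau>" for a
      using that st(2) unfolding \<rho>_def by (intro image_eqI[of _ _ "join_vec x a"]) (auto simp: lr)
  qed
  have "product_fan X Y \<rho> \<noteq> 0"
    unfolding product_fan_def l r using st(1,3) \<rho>_def unfolding fan_cones_def by auto
  moreover have "join_vec x y \<in> \<rho>" using st unfolding \<rho>_def by blast
  ultimately show ?thesis unfolding fan_support_def fan_cones_def by blast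
qed

section \<open>Empty groundsets and a criterion for isomorphism\<close>

lemma loopless_matroid_restriction:
  assumes "loopless_matroid M" "S \<subseteq> ground M"
  shows "loopless_matroid (restriction M S)"
  using ranked_flats.loopless[OF loopless_restriction[OF assms]] unfolding restriction_def by simp

lemma empty_ground:
  assumes M: "loopless_matroid M" and e: "ground M = {}"
  shows "M = Flat_System {} {{}}"
proof -
  interpret ranked_flats "ground M" "flats M" "mrank M" by (rule ranked_flats_mrank[OF M])
  have "flats M = {{}}" using empty_flat flats_ground e by auto
  then show ?thesis using e by (metis flat_system.collapse)
qed

lemma bergman_fan_empty:
  fixes M :: "'n::finite flat_system"
  assumes M: "loopless_matroid M" and e: "ground M = {}"
  shows "bergman_fan M = (\<lambda>\<sigma>. of_bool (\<sigma> = {0}))"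
proof
  fix \<sigma> :: "(real ^ 'n) set"
  have r: "mrank M (ground M) = 0" unfolding e by (rule mrank_empty[OF M])
  have z: "char_vec {} = (0 :: real ^ 'n)" by (simp add: vec_eq_iff)
  have "convex_cone {0 :: real ^ 'n}" unfolding convex_cone_iff by simp
  then have "flag_cone M F s = {0}" for F s
    unfolding flag_cone_def r unfolding e z by (simp add: hull_same)
  moreover have "maximal_flag M (\<lambda>_. {})" unfolding maximal_flag_def r using e by simp
  ultimately show "bergman_fan M \<sigma> = of_bool (\<sigma> = {0})" unfolding bergman_fan_def by auto
qed

lemma fan_cones_point: "fan_cones (\<lambda>\<sigma>. of_bool (\<sigma> = {0})) = {{0}}"
  unfolding fan_cones_def by simp

lemma tropical_fan_point: "tropical_fan 0 (\<lambda>\<sigma>::(real ^ 'n::finite) set. of_bool (\<sigma> = {0}))"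
proof -
  let ?X = "\<lambda>\<sigma>::(real ^ 'n) set. of_bool (\<sigma> = {0}) :: real"
  have "convex_cone {0 :: real ^ 'n}" unfolding convex_cone_iff by simp
  then have "rational_cone {0 :: real ^ 'n}" unfolding rational_cone_def
    by (intro exI[of _ "{0}"]) (simp add: hull_same int_lattice_def)
  moreover have "cones_around ?X \<tau> = {}" for \<tau>
  proof -
    have "\<not> \<tau> facet_of {0}" by (auto simp: facet_of_def aff_dim_empty)
    then show ?thesis unfolding cones_around_def fan_cones_point by auto
  qed
  ultimately show ?thesis unfolding tropical_fan_def fan_cones_point by (auto simp: face_of_refl)
qed

text \<open>The fans match cone by cone, so each serves as its own refinement.\<close>

lemma tropical_isomorphismI:
  assumes X: "tropical_fan k X" and Y: "tropical_fan k Y"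
    and f: "integral_linear f" and g: "integral_linear g"
    and gf: "\<And>x. x \<in> fan_support X \<Longrightarrow> g (f x) = x"
    and cones: "fan_cones Y = (`) f ` fan_cones X" and wts: "\<And>\<sigma>. \<sigma> \<in> fan_cones X \<Longrightarrow> Y (f ` \<sigma>) = X \<sigma>"
  shows "tropical_isomorphism k f X Y"
proof -
  have supp: "fan_support Y = f ` fan_support X" unfolding fan_support_def cones by auto
  have gi: "g ` f ` \<sigma> = \<sigma>" if "\<sigma> \<in> fan_cones X" for \<sigma>
  proof -
    have "g (f x) = x" if "x \<in> \<sigma>" for x using gf that \<open>\<sigma> \<in> fan_cones X\<close> unfolding fan_support_def by blast
    then show ?thesis by (simp add: image_image)
  qed
  have "inj_on ((`) f) (fan_cones X)" by (rule inj_on_inverseI[of _ "(`) g"]) (rule gi)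
  then have bij: "bij_betw ((`) f) (fan_cones X) (fan_cones Y)" unfolding bij_betw_def cones by simp
  have refl: "refinement k X X" "refinement k Y Y" unfolding refinement_def using X Y by auto
  have "tropical_morphism f X Y" unfolding tropical_morphism_def supp using f by simp
  moreover have "tropical_morphism g Y X" unfolding tropical_morphism_def supp using g gf by auto
  moreover have "\<forall>y\<in>fan_support Y. f (g y) = y" unfolding supp using gf by auto
  ultimately show ?thesis unfolding tropical_isomorphism_def using gf bij refl wts by blast
qed

text \<open>The traces of a chain form a chain of flats of the restriction, up to empty and full
  traces; completing it to a flag yields a cone of the target.\<close>

lemma restrict_support:
  fixes M :: "'n::finite flat_system"
  assumes M: "loopless_matroid M" and S: "S \<subseteq> ground M" and x: "x \<in> fan_support (bergman_fan M)"
  shows "induced_map S (\<lambda>t. t) x \<in> fan_support (bergman_fan (restriction M S))"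
proof (cases "S = {}")
  case True
  have "induced_map S (\<lambda>t. t) x = 0" unfolding True induced_map_def by (simp add: vec_eq_iff)
  then show ?thesis
    using bergman_fan_empty[OF loopless_matroid_restriction[OF M S]] True
    unfolding fan_support_def by (simp add: fan_cones_point)
next
  case False
  let ?R = "restriction M S" and ?f = "induced_map S (\<lambda>t. t) :: real ^ 'n \<Rightarrow> real ^ 'n"
  have R: "loopless_matroid ?R" by (rule loopless_matroid_restriction[OF M S])
  interpret R: ranked_flats S "flats ?R" "mrank ?R" using ranked_flats_mrank[OF R] by simp
  have E: "ground M \<noteq> {}" using S False by auto
  obtain C s where C: "proper_chain (ground M) C" "C \<subseteq> flats M" and xC: "x \<in> chain_cone (ground M) C s"
    using x unfolding fan_support_def bergman_cones[OF M E] by blast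
  define D where "D = (\<lambda>F. F \<inter> S) ` C - {{}, S}"
  have fv: "?f (char_vec F) = char_vec (F \<inter> S)" for F
    unfolding induced_map_def by (auto simp: vec_eq_iff)
  have D: "proper_chain S D" unfolding proper_chain_def
  proof (intro conjI ballI)
    show "F \<noteq> {}" "F \<subset> S" if "F \<in> D" for F using that unfolding D_def by auto
    fix F G assume "F \<in> D" "G \<in> D"
    then obtain F' G' where FG: "F' \<in> C" "F = F' \<inter> S" "G' \<in> C" "G = G' \<inter> S" unfolding D_def by blast
    show "F \<subseteq> G \<or> G \<subseteq> F" using proper_chainD(3)[OF C(1) FG(1,3)] FG(2,4) by blast
  qed
  have DR: "D \<subseteq> flats ?R" unfolding D_def restriction_flat_iff using C(2) by auto
  obtain B where B: "D \<subseteq> B" "proper_chain S B" "B \<subseteq> flats ?R" "Suc (card B) = mrank ?R S"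
    using R.flag_extension[OF D DR False] by metis
  have "?f x \<in> chain_line S B"
  proof (rule linear_chain_cone_into[OF _ chain_line_cone _ _ xC])
    show "linear ?f" using integral_linear_induced_map unfolding integral_linear_def by blast
    have "?f (m *\<^sub>R char_vec (ground M)) = m *\<^sub>R char_vec S" for m
      using S unfolding induced_map_def by (auto simp: vec_eq_iff)
    then show "?f (m *\<^sub>R char_vec (ground M)) \<in> chain_line S B" for m using chain_line_ground by metis
    fix F assume F: "F \<in> C"
    consider "F \<inter> S = {}" | "F \<inter> S = S" | "F \<inter> S \<in> D" using F unfolding D_def by blast
    then show "?f (char_vec F) \<in> chain_line S B"
    proof cases
      case 1
      have "char_vec {} = 0 *\<^sub>R char_vec S" by (simp add: vec_eq_iff)
      then show ?thesis unfolding fv 1 using chain_line_ground by metis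
    next
      case 2
      have "char_vec S = 1 *\<^sub>R char_vec S" by simp
      then show ?thesis unfolding fv 2 using chain_line_ground by metis
    next
      case 3
      then show ?thesis unfolding fv using B(1) by (intro chain_line_gen) auto
    qed
  qed
  then obtain t where t: "t \<in> {-1, 1}" "?f x \<in> chain_cone S B t" using chain_line_cases[OF B(2) False] by metis
  have "chain_cone S B t \<in> fan_cones (bergman_fan ?R)"
    using bergman_cones[OF R] False t(1) B(2-4) by (auto intro!: exI[of _ B] exI[of _ t])
  then show ?thesis using t(2) unfolding fan_support_def by blast
qed

abbreviation (input) diagonal_map :: "'a set \<Rightarrow> 'a set \<Rightarrow> real ^ 'a::finite \<Rightarrow> real ^ ('a + 'a)" where
  "diagonal_map A B \<equiv> induced_map (A <+> B) (case_sum (\<lambda>e. e) (\<lambda>e. e))"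

lemma diagonal_map_join:
  "diagonal_map A B x = join_vec (induced_map A (\<lambda>t. t) x) (induced_map B (\<lambda>t. t) x)"
  unfolding induced_map_def join_vec_def by (auto simp: vec_eq_iff split: sum.splits)

theorem amalgam_morphism:
  fixes M1 M2 M :: "'a::finite flat_system"
  assumes "amalgam M1 M2 M"
  shows "tropical_morphism (diagonal_map (ground M1) (ground M2)) (bergman_fan M)
    (product_fan (bergman_fan M1) (bergman_fan M2))"
proof -
  have M: "loopless_matroid M" and g: "ground M = ground M1 \<union> ground M2"
    and res: "restriction M (ground M1) = M1" "restriction M (ground M2) = M2"
    using assms unfolding amalgam_def by auto
  have "diagonal_map (ground M1) (ground M2) x \<in> fan_support (product_fan (bergman_fan M1) (bergman_fan M2))"
    if x: "x \<in> fan_support (bergman_fan M)" for x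
    unfolding diagonal_map_join
    by (rule join_support) (use restrict_support[OF M _ x] res g in \<open>metis Un_upper1 Un_upper2\<close>)+
  then show ?thesis unfolding tropical_morphism_def using integral_linear_induced_map by blast
qed

context amalgam_data
begin

text \<open>The map sends \<open>e_S\<close> to the vector of \<open>split S\<close>, hence the
  cones of \<open>B(M)\<close> bijectively onto those of \<open>B(Q)\<close>, which is the fibre
  product by \<open>W_amalgam\<close>.\<close>

theorem amalgam_isomorphism:
  "tropical_isomorphism (R - r) (diagonal_map (ground M1) (ground M2)) (bergman_fan M) (fan_of E (W r))"
proof -
  let ?i = "diagonal_map (ground M1) (ground M2)"
  \<comment> \<open>On \<open>T\<close> the left copy is read off; on the image both copies carry
    the same value.\<close>
  define g :: "real ^ ('a + 'a) \<Rightarrow> real ^ 'a" where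
    "g = (\<lambda>z. \<chi> a. if a \<in> ground M1 then z $ Inl a else if a \<in> ground M2 then z $ Inr a else 0)"
  have E: "ground Q \<noteq> {}" "ground M \<noteq> {}" using nonempty unfolding ground_M by auto
  have uE: "join E = ground M" unfolding join_def ground_M by auto
  have k: "R - r = mrank M (ground M)" "R - r = mrank Q E" using rank_Q_ground rk_Q[of E] uE by auto
  have X: "fan_of E (W r) = bergman_fan Q" unfolding bergman_fan_eq[OF loopless_Q E(1)] W_amalgam by simp
  have iv: "?i (char_vec S) = char_vec (split S)" for S
    unfolding induced_map_def split_def by (auto simp: vec_eq_iff split: sum.splits)
  have lin: "linear ?i" using integral_linear_induced_map unfolding integral_linear_def by blast
  have dE: "split (ground M) = E" unfolding split_def ground_M by auto
  have ud: "join (split S) = S" if "S \<in> flats M" for S using join_split that M.flats_ground by auto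
  have img: "?i ` chain_cone (ground M) C s = chain_cone E (split ` C) s" for C s
  proof -
    have "?i ` chain_gens (ground M) C s = chain_gens E (split ` C) s"
      unfolding chain_gens_def by (simp add: image_Un image_image iv linear_cmul[OF lin] dE)
    then show ?thesis unfolding chain_cone_def by (simp add: convex_cone_hull_linear_image[OF lin, symmetric])
  qed
  have chain: "proper_chain E (split ` C) \<and> split ` C \<subseteq> flats Q \<and> card (split ` C) = card C"
    if C: "proper_chain (ground M) C" "C \<subseteq> flats M" for C
  proof (intro conjI)
    have inj: "inj_on split (flats M)" by (rule inj_on_inverseI[of _ join]) (rule ud)
    show "card (split ` C) = card C" by (rule card_image[OF inj_on_subset[OF inj C(2)]])
    show "split ` C \<subseteq> flats Q" using C(2) unfolding Q_def by auto
    have F: "split F \<noteq> {} \<and> split F \<subset> E" if "F \<in> C" for F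
    proof -
      have F: "F \<noteq> {}" "F \<subset> ground M" "F \<in> flats M" using proper_chainD(1,2)[OF C(1) that] C(2) that by auto
      have "split F \<noteq> {}" using F ud[OF F(3)] unfolding join_def by auto
      moreover have "split F \<noteq> E" using F(2) ud[OF F(3)] uE by auto
      moreover have "split F \<subseteq> E" unfolding split_def by auto
      ultimately show ?thesis by blast
    qed
    show "proper_chain E (split ` C)" unfolding proper_chain_def ball_simps
    proof (intro conjI ballI)
      show "split F \<noteq> {}" "split F \<subset> E" if "F \<in> C" for F using F[OF that] by blast+
      show "split F \<subseteq> split G \<or> split G \<subseteq> split F" if "F \<in> C" "G \<in> C" for F G
        using proper_chainD(3)[OF C(1) that] split_mono by metis
    qed
  qed
  have chain': "\<exists>B. proper_chain (ground M) B \<and> B \<subseteq> flats M \<and> C = split ` B"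
    if C: "proper_chain E C" "C \<subseteq> flats Q" for C
  proof -
    have du: "join F \<in> flats M \<and> split (join F) = F" if "F \<in> C" for F
    proof -
      have "F \<in> flats Q" using C(2) that by auto
      then obtain S where "S \<in> flats M" "F = split S" unfolding flats_Q by blast
      then show ?thesis using ud by simp
    qed
    have F: "join F \<noteq> {} \<and> join F \<subset> ground M" if "F \<in> C" for F
    proof -
      have F: "F \<noteq> {}" "F \<subset> E" using proper_chainD(1,2)[OF C(1) that] by auto
      have "join F \<noteq> {}" using F(1) du[OF that] unfolding split_def by auto
      moreover have "join F \<noteq> ground M" using F(2) du[OF that] dE by auto
      moreover have "join F \<subseteq> ground M" using du[OF that] M.flats_ground by auto
      ultimately show ?thesis by blast
    qed
    have "proper_chain (ground M) (join ` C)" unfolding proper_chain_def ball_simps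
    proof (intro conjI ballI)
      show "join F \<noteq> {}" "join F \<subset> ground M" if "F \<in> C" for F using F[OF that] by blast+
      show "join F \<subseteq> join G \<or> join G \<subseteq> join F" if "F \<in> C" "G \<in> C" for F G
        using proper_chainD(3)[OF C(1) that] join_mono by metis
    qed
    moreover have "join ` C \<subseteq> flats M" using du by auto
    moreover have "C = split ` join ` C" using du by (simp add: image_image)
    ultimately show ?thesis by blast
  qed
  have cones: "fan_cones (bergman_fan Q) = (`) ?i ` fan_cones (bergman_fan M)"
  proof (intro subset_antisym subsetI)
    fix \<sigma> assume "\<sigma> \<in> fan_cones (bergman_fan Q)"
    then obtain C s where C: "\<sigma> = chain_cone E C s" "s \<in> {-1, 1}" "proper_chain E C" "C \<subseteq> flats Q" "Suc (card C) = mrank Q E"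
      unfolding bergman_cones[OF loopless_Q E(1)] by auto
    obtain B where B: "proper_chain (ground M) B" "B \<subseteq> flats M" "C = split ` B" using chain'[OF C(3,4)] by blast
    have "Suc (card B) = mrank M (ground M)" using chain[OF B(1,2)] B(3) C(5) k by simp
    then have "chain_cone (ground M) B s \<in> fan_cones (bergman_fan M)"
      unfolding bergman_cones[OF M E(2)] using B C(2) by blast
    then show "\<sigma> \<in> (`) ?i ` fan_cones (bergman_fan M)" using img[of B s] C(1) B(3) by blast
  next
    fix \<sigma> assume "\<sigma> \<in> (`) ?i ` fan_cones (bergman_fan M)"
    then obtain C s where C: "\<sigma> = ?i ` chain_cone (ground M) C s" "s \<in> {-1, 1}" "proper_chain (ground M) C" "C \<subseteq> flats M"
      "Suc (card C) = mrank M (ground M)"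
      unfolding bergman_cones[OF M E(2)] by auto
    have "proper_chain E (split ` C)" "split ` C \<subseteq> flats Q" "Suc (card (split ` C)) = mrank Q E"
      using chain[OF C(3,4)] C(5) k by auto
    then show "\<sigma> \<in> fan_cones (bergman_fan Q)"
      unfolding bergman_cones[OF loopless_Q E(1)] ground_Q C(1) img using C(2) by blast
  qed
  show ?thesis unfolding X
  proof (rule tropical_isomorphismI[OF _ _ integral_linear_induced_map _ _ cones])
    show "tropical_fan (R - r) (bergman_fan M)" unfolding k(1) bergman_fan_eq[OF M E(2)]
      by (rule tropical_fan_fan_of[OF E(2) flag_weight_of_props[OF M]])
    show "tropical_fan (R - r) (bergman_fan Q)" using fibre_product_tropical unfolding X .
    show "integral_linear g" unfolding integral_linear_def
    proof
      show "linear g" unfolding g_def by (rule linearI) (simp_all add: vec_eq_iff)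
      show "g ` int_lattice \<subseteq> int_lattice" unfolding g_def by (auto simp: int_lattice_def)
    qed
    show "g (?i x) = x" if x: "x \<in> fan_support (bergman_fan M)" for x
    proof -
      obtain C s where C: "proper_chain (ground M) C" "x \<in> chain_cone (ground M) C s"
        using x unfolding fan_support_def bergman_cones[OF M E(2)] by blast
      have "x $ a = 0" if "a \<notin> ground M" for a
      proof -
        have "x $ a \<in> {0}"
        proof (rule linear_chain_cone_into[OF linear_vec_nth _ _ _ C(2)])
          show "convex_cone {0 :: real}" unfolding convex_cone_iff by simp
          show "char_vec F $ a \<in> {0 :: real}" if "F \<in> C" for F
            using proper_chainD(2)[OF C(1) that] \<open>a \<notin> ground M\<close> by auto
          show "(m *\<^sub>R char_vec (ground M)) $ a \<in> {0 :: real}" for m using that by simp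
        qed
        then show ?thesis by simp
      qed
      then show ?thesis unfolding g_def induced_map_def ground_M by (auto simp: vec_eq_iff)
    qed
    show "bergman_fan Q (?i ` \<sigma>) = bergman_fan M \<sigma>" if "\<sigma> \<in> fan_cones (bergman_fan M)" for \<sigma>
    proof -
      have "bergman_fan Q (?i ` \<sigma>) \<noteq> 0" "bergman_fan M \<sigma> \<noteq> 0"
        using that cones unfolding fan_cones_def by auto
      then show ?thesis unfolding bergman_fan_def by (auto split: if_splits)
    qed
  qed
qed

end

theorem theorem1:
  fixes M1 M2 N :: "'a::finite flat_system"
    and \<pi>1 \<pi>2 :: "real ^ 'a \<Rightarrow> real ^ 'a"
    and \<iota> :: "real ^ 'a \<Rightarrow> real ^ ('a + 'a)"
    and X :: "('a + 'a) wfan"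
    and k :: nat
  assumes "loopless_matroid M1" and "loopless_matroid M2" and "loopless_matroid N"
    and "ground N = ground M1 \<inter> ground M2"
    and "restriction M1 (ground N) = N" and "restriction M2 (ground N) = N"
    and "\<pi>1 = induced_map (ground N) (\<lambda>t. t)"
    and "\<pi>2 = induced_map (ground N) (\<lambda>t. t)"
    and "X = tropical_fibre_product M1 M2 N \<pi>1 \<pi>2"
    and "\<iota> = induced_map (ground M1 <+> ground M2) (case_sum (\<lambda>e. e) (\<lambda>e. e))"
    and "k = mrank M1 (ground M1) + mrank M2 (ground M2) - mrank N (ground N)"
  shows "(tropical_fan k X \<and> fan_degree (direct_sum M1 M2) k X = 1) \<and>
    (\<forall>M. proper_amalgam M1 M2 N M \<longrightarrow>
        tropical_morphism \<iota> (bergman_fan M) (product_fan (bergman_fan M1) (bergman_fan M2)) \<and>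
        tropical_isomorphism k \<iota> (bergman_fan M) X) \<and>
    ((\<forall>\<sigma>\<in>fan_cones X. X \<sigma> > 0) \<longrightarrow> (\<exists>M. proper_amalgam M1 M2 N M)) \<and>
    (\<not> (\<exists>M. proper_amalgam M1 M2 N M) \<longrightarrow> (\<exists>\<sigma>\<in>fan_cones X. X \<sigma> < 0))"
proof -
  note M = assms(1-3)
  have morph: "tropical_morphism \<iota> (bergman_fan M) (product_fan (bergman_fan M1) (bergman_fan M2))"
    if "proper_amalgam M1 M2 N M" for M
    using amalgam_morphism[of M1 M2 M] that unfolding proper_amalgam_def assms(10) by blast
  have "(tropical_fan k X \<and> fan_degree (direct_sum M1 M2) k X = 1) \<and>
    (\<forall>M. proper_amalgam M1 M2 N M \<longrightarrow> tropical_isomorphism k \<iota> (bergman_fan M) X) \<and>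
    ((\<forall>\<sigma>\<in>fan_cones X. X \<sigma> > 0) \<longrightarrow> (\<exists>M. proper_amalgam M1 M2 N M))"
  \<comment> \<open>On the empty groundset all Bergman fans are the origin with weight 1, no divisor
    is taken, \<open>k = 0\<close>, and the cone at which the degree is read is again the
    origin.\<close>
  proof (cases "ground M1 <+> ground M2 = {}")
    case True
    then have e: "ground M1 = {}" "ground M2 = {}" "ground N = {}" using assms(4) by auto
    note r = mrank_empty[OF M(1)] mrank_empty[OF M(2)] mrank_empty[OF M(3)]
    have X: "X = (\<lambda>\<sigma>. of_bool (\<sigma> = {0}))"
      unfolding assms(9) tropical_fibre_product_def e(3) r
      using bergman_fan_empty[OF loopless_direct_sum[OF M(1,2)]] True by simp
    have k: "k = 0" unfolding assms(11) e r by simp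
    have "convex_cone {0 :: real ^ ('a + 'a)}" unfolding convex_cone_iff by simp
    moreover have "char_vec {} = (0 :: real ^ ('a + 'a))" by (simp add: vec_eq_iff)
    ultimately have deg: "fan_degree (direct_sum M1 M2) k X = 1"
      unfolding fan_degree_def k X direct_sum_ground True by (simp add: hull_same)
    have iso: "tropical_isomorphism k \<iota> (bergman_fan M) X" if "proper_amalgam M1 M2 N M" for M
    proof -
      have Mf: "bergman_fan M = (\<lambda>\<sigma>. of_bool (\<sigma> = {0}))"
        using bergman_fan_empty[of M] that e unfolding proper_amalgam_def amalgam_def by simp
      have i0: "\<iota> 0 = 0" unfolding assms(10) induced_map_def by (simp add: vec_eq_iff)
      have i: "integral_linear \<iota>" unfolding assms(10) by (rule integral_linear_induced_map)
      have z: "integral_linear (\<lambda>_ :: real ^ ('a + 'a). 0 :: real ^ 'a)"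
        unfolding integral_linear_def by (auto simp: int_lattice_def intro: linear_zero)
      show ?thesis unfolding Mf k X
        by (rule tropical_isomorphismI[OF tropical_fan_point tropical_fan_point i z])
           (auto simp: fan_cones_point fan_support_def i0)
    qed
    have fl: "M1 = Flat_System {} {{}}" "M2 = Flat_System {} {{}}"
      by (rule empty_ground[OF M(1) e(1)] empty_ground[OF M(2) e(2)])+
    then have "flats M1 = {{}}" by simp
    moreover have "amalgam M1 M2 M1" unfolding amalgam_def using M(1) fl by (simp add: restriction_def)
    ultimately have "proper_amalgam M1 M2 N M1" unfolding proper_amalgam_def by (simp add: r)
    then show ?thesis using deg iso tropical_fan_point unfolding k X by blast
  next
    case False
    interpret fibre_data M1 M2 N by unfold_locales (use assms(1-6) False in simp_all)
    have k: "k = mrank (direct_sum M1 M2) (ground M1 <+> ground M2) - mrank N (ground N)" using R_eq assms(11) by simp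
    have X: "X = fan_of (ground M1 <+> ground M2) (W (mrank N (ground N)))" unfolding assms(7-9) by (rule fibre_product_fan)
    have iso: "tropical_isomorphism k \<iota> (bergman_fan M) X" if "proper_amalgam M1 M2 N M" for M
    proof -
      interpret amalgam_data M1 M2 N M by unfold_locales (rule that)
      show ?thesis unfolding k X assms(10) by (rule amalgam_isomorphism)
    qed
    show ?thesis using fibre_product_tropical fibre_product_degree iso amalgam_exists fibre_product_nonneg
      unfolding k[symmetric] X[symmetric] by blast
  qed
  \<comment> \<open>Cones of weight zero are not in \<open>fan_cones\<close>, so a weight that is
    not positive is negative.\<close>
  moreover have "\<exists>\<sigma>\<in>fan_cones X. X \<sigma> < 0" if "\<not> (\<forall>\<sigma>\<in>fan_cones X. X \<sigma> > 0)"
    using that unfolding fan_cones_def by force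
  ultimately show ?thesis using morph by blast
qed

end
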